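(* Let $P$ be a submonoid of a group $G$. The ideal $D_u^{\mathrm o}$ of $D_u\subset\mathcal T_u(P)$ is the closed linear span of projections of the form $\prod_{\beta\in A}(\dot t_\alpha-\dot t_\beta)$, where $\alpha$ is a neutral word and $A\subset\mathcal W$ is a finite collection of neutral words such that $\{K(\beta):\beta\in A\}$ is a proper foundation set for $K(\alpha)$. Moreover, a map $w\colon P\to B$ into a $\mathrm C^*$-algebra $B$ is a strongly covariant isometric representation of $P$ if and only if it satisfies the relations (T1)--(T4) and the boundary relations, that is, $$\prod_{\beta\in A}(\dot w_\alpha-\dot w_\beta)=0$$ for every neutral word $\alpha$ in $\mathcal W$ and proper foundation set $\{K(\beta):\beta\in A\}$ for $K(\alpha)$, where $A$ is a finite collection of neutral words in $\mathcal W$.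
   Context: $e$ is the identity of $G$. A word is a finite sequence $\alpha=(p_1,p_2,\ldots,p_{2k-1},p_{2k})$ of even length $2k\ge 0$ with entries in $P$; $\mathcal W$ is the set of all words (including the empty word). Put $\dot\alpha:=p_1^{-1}p_2\cdots p_{2k-1}^{-1}p_{2k}\in G$ (equal to $e$ for the empty word); $\alpha$ is neutral if $\dot\alpha=e$. Put $K(\alpha):=P\cap p_{2k}^{-1}p_{2k-1}P\cap p_{2k}^{-1}p_{2k-1}p_{2k-2}^{-1}p_{2k-3}P\cap\cdots\cap p_{2k}^{-1}p_{2k-1}\cdots p_2^{-1}p_1P$ (equal to $P$ for the empty word), and $\mathfrak J:=\{K(\alpha):\alpha\in\mathcal W\}$, the constructible right ideals. For a map $w\colon P\to B$ into a unital $\mathrm C^*$-algebra, $\dot w_\alpha:=w_{p_1}^*w_{p_2}\cdots w_{p_{2k-1}}^*w_{p_{2k}}$ ($=1$ for the empty word). Relations for $w$: (T1) $w_e=1$; (T2) $\dot w_\alpha=0$ if $\alpha$ is neutral and $K(\alpha)=\emptyset$; (T3) $\dot w_\alpha=\dot w_\beta$ if $\alpha,\beta$ are neutral and $K(\alpha)=K(\beta)$; (T4) $\prod_{\beta\in F}(\dot w_\alpha-\dot w_\beta)=0$ if $\alpha$ is neutral and $F$ is a finite set of neutral words with $K(\alpha)=\bigcup_{\beta\in F}K(\beta)$. $\mathcal T_u(P)$ is the universal $\mathrm C^*$-algebra with generators $\{t_p:p\in P\}$ subject to (T1)--(T4), and $D_u:=\overline{\mathrm{span}}\{\dot t_\alpha:\dot\alpha=e\}$.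 Foundation sets: for $S\in\mathfrak J$, a finite collection $\mathcal C\subset\mathfrak J$ is a foundation set for $S$ if $R\subset S$ for all $R\in\mathcal C$ and $pP\cap\bigcup_{R\in\mathcal C}R\neq\emptyset$ for all $p\in S$; it is proper if $S\setminus\bigcup_{R\in\mathcal C}R\neq\emptyset$. $L_p\delta_q=\delta_{pq}$ is the left regular representation of $P$ on $\ell^2(P)$, $\mathcal T_\lambda(P)=\mathrm C^*(L_p:p\in P)$; for neutral $\alpha$, $\dot L_\alpha$ is multiplication by $\mathbb 1_{K(\alpha)}$; $D_r:=\overline{\mathrm{span}}\{\mathbb 1_S:S\in\mathfrak J\}$. The canonical map $\lambda^+\colon\mathcal T_u(P)\to\mathcal T_\lambda(P)$, $t_p\mapsto L_p$, restricts to an isomorphism $D_u\cong D_r$. For finite $F\subseteq G$, $\Delta_F:=\{p\in P:\forall g\in F,\ pP\cap gP=\emptyset\text{ or }pP\cap gP=pP\}$. With finite $F\subseteq G$ directed by inclusion, $D_r^{\mathrm o}:=\{b\in D_r:\lim_F\|b|_{\ell^2(\Delta_F)}\|=0\}$, an ideal of $D_r$; $D_u^{\mathrm o}\subseteq D_u$ is the ideal corresponding to $D_r^{\mathrm o}$ under $\lambda^+|_{D_u}$. An isometric representation $w\colon P\to B$ ($w_p$ isometries, $w_e=1$, $w_pw_q=w_{pq}$) is strongly covariant if the map $\dot L_\alpha\mapsto\dot w_\alpha$ ($\alpha$ neutral) extends to a well-defined $*$-homomorphism $D_r\to B$ that factors through $D_r/D_r^{\mathrm o}$. *)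

theory Defs
  imports
    "HOL-Analysis.Analysis"
    "HOL-Algebra.Module"
    "HOL-Algebra.Coset"
    "HOL-Library.Poly_Mapping"
begin

section \<open>C*-algebras\<close>

text \<open>
  C*-algebras are carrier-based, so that an algebra may depend on the submonoid \<open>P\<close>. A
  *-algebra record extends the \<open>module\<close> record of HOL-Algebra (over the complex numbers), which
  already contains a ring structure.
\<close>

record 'a star_algebra = "(complex, 'a) module" +
  star :: "'a \<Rightarrow> 'a"

record 'a cstar_algebra = "'a star_algebra" +
  cnorm :: "'a \<Rightarrow> real"

definition complex_ring :: "complex ring" where
  "complex_ring = \<lparr>carrier = UNIV, mult = (*), one = 1, zero = 0, add = (+)\<rparr>"

text \<open>The library locale of metric spaces requires symmetry and nonnegativity of the distance
  outside the carrier as well, hence the case distinction.\<close>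

definition cdist :: "('a, 'x) cstar_algebra_scheme \<Rightarrow> 'a \<Rightarrow> 'a \<Rightarrow> real" where
  "cdist A x y = (if x \<in> carrier A \<and> y \<in> carrier A then cnorm A (x \<ominus>\<^bsub>A\<^esub> y) else 0)"

text \<open>The zero algebra is not excluded.\<close>

locale unital_cstar_algebra = ring A + Module.module complex_ring A
  for A :: "('a, 'x) cstar_algebra_scheme" (structure) +
  assumes smult_mult_left:
      "\<lbrakk>x \<in> carrier A; y \<in> carrier A\<rbrakk> \<Longrightarrow> (c \<odot> x) \<otimes> y = c \<odot> (x \<otimes> y)"
    and smult_mult_right:
      "\<lbrakk>x \<in> carrier A; y \<in> carrier A\<rbrakk> \<Longrightarrow> x \<otimes> (c \<odot> y) = c \<odot> (x \<otimes> y)"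
    and star_closed: "x \<in> carrier A \<Longrightarrow> star A x \<in> carrier A"
    and star_star: "x \<in> carrier A \<Longrightarrow> star A (star A x) = x"
    and star_add:
      "\<lbrakk>x \<in> carrier A; y \<in> carrier A\<rbrakk> \<Longrightarrow> star A (x \<oplus> y) = star A x \<oplus> star A y"
    and star_smult: "x \<in> carrier A \<Longrightarrow> star A (c \<odot> x) = cnj c \<odot> star A x"
    and star_mult:
      "\<lbrakk>x \<in> carrier A; y \<in> carrier A\<rbrakk> \<Longrightarrow> star A (x \<otimes> y) = star A y \<otimes> star A x"
    and cnorm_nonneg: "x \<in> carrier A \<Longrightarrow> 0 \<le> cnorm A x"
    and cnorm_eq_0_iff: "x \<in> carrier A \<Longrightarrow> cnorm A x = 0 \<longleftrightarrow> x = \<zero>"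
    and cnorm_triangle:
      "\<lbrakk>x \<in> carrier A; y \<in> carrier A\<rbrakk> \<Longrightarrow> cnorm A (x \<oplus> y) \<le> cnorm A x + cnorm A y"
    and cnorm_smult: "x \<in> carrier A \<Longrightarrow> cnorm A (c \<odot> x) = cmod c * cnorm A x"
    and cnorm_mult:
      "\<lbrakk>x \<in> carrier A; y \<in> carrier A\<rbrakk> \<Longrightarrow> cnorm A (x \<otimes> y) \<le> cnorm A x * cnorm A y"
    and cstar_identity: "x \<in> carrier A \<Longrightarrow> cnorm A (star A x \<otimes> x) = (cnorm A x)\<^sup>2"
    and complete: "Metric_space.mcomplete (carrier A) (cdist A)"

definition closed_span :: "('a, 'x) cstar_algebra_scheme \<Rightarrow> 'a set \<Rightarrow> 'a set" where
  "closed_span A S =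
    Metric_space.mtopology (carrier A) (cdist A) closure_of ((\<lambda>H. submodule H complex_ring A) hull S)"

definition star_hom ::
  "('a, 'x) star_algebra_scheme \<Rightarrow> ('b, 'y) star_algebra_scheme \<Rightarrow> ('a \<Rightarrow> 'b) \<Rightarrow> bool" where
  "star_hom A B \<phi> \<longleftrightarrow>
    \<phi> \<in> carrier A \<rightarrow> carrier B \<and>
    (\<forall>x\<in>carrier A. \<forall>y\<in>carrier A. \<phi> (x \<oplus>\<^bsub>A\<^esub> y) = \<phi> x \<oplus>\<^bsub>B\<^esub> \<phi> y) \<and>
    (\<forall>x\<in>carrier A. \<forall>y\<in>carrier A. \<phi> (x \<otimes>\<^bsub>A\<^esub> y) = \<phi> x \<otimes>\<^bsub>B\<^esub> \<phi> y) \<and>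
    (\<forall>c. \<forall>x\<in>carrier A. \<phi> (c \<odot>\<^bsub>A\<^esub> x) = c \<odot>\<^bsub>B\<^esub> \<phi> x) \<and>
    (\<forall>x\<in>carrier A. \<phi> (star A x) = star B (\<phi> x))"

definition projections :: "('a, 'x) star_algebra_scheme \<Rightarrow> 'a set" where
  "projections A = {q \<in> carrier A. star A q = q \<and> q \<otimes>\<^bsub>A\<^esub> q = q}"


section \<open>Words and constructible right ideals\<close>

text \<open>Words are lists of even length; the recursions below consume two letters at a time, and
  their values on lists of odd length are irrelevant.\<close>

definition words :: "'g set \<Rightarrow> 'g list set" where
  "words P = {\<alpha>. set \<alpha> \<subseteq> P \<and> even (length \<alpha>)}"

fun word_value :: "('g, 'm) monoid_scheme \<Rightarrow> 'g list \<Rightarrow> 'g" where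
  "word_value G (p # q # \<alpha>) = (inv\<^bsub>G\<^esub> p \<otimes>\<^bsub>G\<^esub> q) \<otimes>\<^bsub>G\<^esub> word_value G \<alpha>"
| "word_value G _ = \<one>\<^bsub>G\<^esub>"

definition neutral_words :: "('g, 'm) monoid_scheme \<Rightarrow> 'g set \<Rightarrow> 'g list set" where
  "neutral_words G P = {\<alpha> \<in> words P. word_value G \<alpha> = \<one>\<^bsub>G\<^esub>}"

text \<open>\<open>back_value G [p\<^sub>1, \<dots>, p\<^sub>2\<^sub>k]\<close> is the product
  \<open>p\<^sub>2\<^sub>k\<inverse> p\<^sub>2\<^sub>k\<^sub>-\<^sub>1 \<cdots> p\<^sub>2\<inverse> p\<^sub>1\<close>; the other translates of \<open>P\<close> in the
  definition of \<open>K(\<alpha>)\<close> are those of the suffixes of \<open>\<alpha>\<close>.\<close>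

fun back_value :: "('g, 'm) monoid_scheme \<Rightarrow> 'g list \<Rightarrow> 'g" where
  "back_value G (p # q # \<alpha>) = back_value G \<alpha> \<otimes>\<^bsub>G\<^esub> (inv\<^bsub>G\<^esub> q \<otimes>\<^bsub>G\<^esub> p)"
| "back_value G _ = \<one>\<^bsub>G\<^esub>"

fun K :: "('g, 'm) monoid_scheme \<Rightarrow> 'g set \<Rightarrow> 'g list \<Rightarrow> 'g set" where
  "K G P (p # q # \<alpha>) = K G P \<alpha> \<inter> (back_value G (p # q # \<alpha>) <#\<^bsub>G\<^esub> P)"
| "K G P _ = P"

definition constructible_ideals :: "('g, 'm) monoid_scheme \<Rightarrow> 'g set \<Rightarrow> 'g set set" where
  "constructible_ideals G P = K G P ` words P"

definition foundation_set ::
  "('g, 'm) monoid_scheme \<Rightarrow> 'g set \<Rightarrow> 'g set \<Rightarrow> 'g set set \<Rightarrow> bool" where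
  "foundation_set G P S C \<longleftrightarrow>
    S \<in> constructible_ideals G P \<and> finite C \<and> C \<subseteq> constructible_ideals G P \<and>
    (\<forall>R\<in>C. R \<subseteq> S) \<and> (\<forall>p\<in>S. (p <#\<^bsub>G\<^esub> P) \<inter> \<Union>C \<noteq> {})"

definition proper_foundation_set ::
  "('g, 'm) monoid_scheme \<Rightarrow> 'g set \<Rightarrow> 'g set \<Rightarrow> 'g set set \<Rightarrow> bool" where
  "proper_foundation_set G P S C \<longleftrightarrow> foundation_set G P S C \<and> S - \<Union>C \<noteq> {}"


section \<open>The relations (T1)--(T4) and the boundary relations\<close>

fun word_elem :: "('a, 'x) star_algebra_scheme \<Rightarrow> ('g \<Rightarrow> 'a) \<Rightarrow> 'g list \<Rightarrow> 'a" where
  "word_elem A w (p # q # \<alpha>) = (star A (w p) \<otimes>\<^bsub>A\<^esub> w q) \<otimes>\<^bsub>A\<^esub> word_elem A w \<alpha>"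
| "word_elem A w _ = \<one>\<^bsub>A\<^esub>"

text \<open>The product of the differences \<open>w\<^sub>\<alpha> - w\<^sub>\<beta>\<close>. A finite set of words is presented by a
  distinct list, that is, by an enumeration; everything below quantifies over all enumerations.
  In the presence of (T3) the order is immaterial, because \<open>K(\<alpha>\<beta>) = K(\<beta>\<alpha>)\<close> for neutral words
  and so the elements \<open>w\<^sub>\<alpha>\<close>, \<open>\<alpha>\<close> neutral, commute.\<close>

definition diff_prod ::
  "('a, 'x) star_algebra_scheme \<Rightarrow> ('g \<Rightarrow> 'a) \<Rightarrow> 'g list \<Rightarrow> 'g list list \<Rightarrow> 'a" where
  "diff_prod A w \<alpha> \<beta>s =
    foldr (\<lambda>\<beta> x. (word_elem A w \<alpha> \<ominus>\<^bsub>A\<^esub> word_elem A w \<beta>) \<otimes>\<^bsub>A\<^esub> x) \<beta>s \<one>\<^bsub>A\<^esub>"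

text \<open>
  The elements that have to vanish according to (T1), (T2), (T3) and (T4), respectively.
  In (T4) the set \<open>F\<close> has to be nonempty: for \<open>F = {}\<close> and \<open>K(\<alpha>) = {}\<close> the relation is (T2),
  whereas the empty product would be the unit.
\<close>

definition T1_relators ::
  "('g, 'm) monoid_scheme \<Rightarrow> ('a, 'x) star_algebra_scheme \<Rightarrow> ('g \<Rightarrow> 'a) \<Rightarrow> 'a set" where
  "T1_relators G A w = {w \<one>\<^bsub>G\<^esub> \<ominus>\<^bsub>A\<^esub> \<one>\<^bsub>A\<^esub>}"

definition T2_relators ::
  "('g, 'm) monoid_scheme \<Rightarrow> 'g set \<Rightarrow> ('a, 'x) star_algebra_scheme \<Rightarrow> ('g \<Rightarrow> 'a) \<Rightarrow> 'a set" where
  "T2_relators G P A w = {word_elem A w \<alpha> | \<alpha>. \<alpha> \<in> neutral_words G P \<and> K G P \<alpha> = {}}"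

definition T3_relators ::
  "('g, 'm) monoid_scheme \<Rightarrow> 'g set \<Rightarrow> ('a, 'x) star_algebra_scheme \<Rightarrow> ('g \<Rightarrow> 'a) \<Rightarrow> 'a set" where
  "T3_relators G P A w =
    {word_elem A w \<alpha> \<ominus>\<^bsub>A\<^esub> word_elem A w \<beta> | \<alpha> \<beta>.
      \<alpha> \<in> neutral_words G P \<and> \<beta> \<in> neutral_words G P \<and> K G P \<alpha> = K G P \<beta>}"

definition T4_relators ::
  "('g, 'm) monoid_scheme \<Rightarrow> 'g set \<Rightarrow> ('a, 'x) star_algebra_scheme \<Rightarrow> ('g \<Rightarrow> 'a) \<Rightarrow> 'a set" where
  "T4_relators G P A w =
    {diff_prod A w \<alpha> \<beta>s | \<alpha> \<beta>s.
      \<alpha> \<in> neutral_words G P \<and> distinct \<beta>s \<and> \<beta>s \<noteq> [] \<and> set \<beta>s \<subseteq> neutral_words G P \<and>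
      K G P \<alpha> = (\<Union>\<beta>\<in>set \<beta>s. K G P \<beta>)}"

definition toeplitz_relators ::
  "('g, 'm) monoid_scheme \<Rightarrow> 'g set \<Rightarrow> ('a, 'x) star_algebra_scheme \<Rightarrow> ('g \<Rightarrow> 'a) \<Rightarrow> 'a set" where
  "toeplitz_relators G P A w =
    T1_relators G A w \<union> T2_relators G P A w \<union> T3_relators G P A w \<union> T4_relators G P A w"

definition satisfies_toeplitz_relations ::
  "('g, 'm) monoid_scheme \<Rightarrow> 'g set \<Rightarrow> ('a, 'x) star_algebra_scheme \<Rightarrow> ('g \<Rightarrow> 'a) \<Rightarrow> bool" where
  "satisfies_toeplitz_relations G P A w \<longleftrightarrow> (\<forall>r\<in>toeplitz_relators G P A w. r = \<zero>\<^bsub>A\<^esub>)"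

definition boundary_products ::
  "('g, 'm) monoid_scheme \<Rightarrow> 'g set \<Rightarrow> ('a, 'x) star_algebra_scheme \<Rightarrow> ('g \<Rightarrow> 'a) \<Rightarrow> 'a set" where
  "boundary_products G P A w =
    {diff_prod A w \<alpha> \<beta>s | \<alpha> \<beta>s.
      \<alpha> \<in> neutral_words G P \<and> distinct \<beta>s \<and> set \<beta>s \<subseteq> neutral_words G P \<and>
      proper_foundation_set G P (K G P \<alpha>) (K G P ` set \<beta>s)}"

definition satisfies_boundary_relations ::
  "('g, 'm) monoid_scheme \<Rightarrow> 'g set \<Rightarrow> ('a, 'x) star_algebra_scheme \<Rightarrow> ('g \<Rightarrow> 'a) \<Rightarrow> bool" where
  "satisfies_boundary_relations G P A w \<longleftrightarrow> (\<forall>r\<in>boundary_products G P A w. r = \<zero>\<^bsub>A\<^esub>)"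


section \<open>Universal C*-algebras\<close>

text \<open>
  The universal C*-algebra on generators \<open>P\<close> subject to relations is the Hausdorff completion
  of the free unital complex *-algebra on \<open>P\<close> with respect to the largest C*-seminorm that
  vanishes on the relators. The free *-algebra is the monoid algebra of the free monoid on the
  letters \<open>(p, False)\<close>, standing for \<open>p\<close>, and \<open>(p, True)\<close>, standing for \<open>p\<^sup>*\<close>.
\<close>

datatype 'g star_monomial = Star_Monomial (letters: "('g \<times> bool) list")

instantiation star_monomial :: (type) monoid_add
begin

definition "0 = Star_Monomial []"

definition "m + n = Star_Monomial (letters m @ letters n)"

instance
  by standard (simp_all add: zero_star_monomial_def plus_star_monomial_def)

end

definition monomial_star :: "'g star_monomial \<Rightarrow> 'g star_monomial" where
  "monomial_star m = Star_Monomial (rev (map (\<lambda>(p, b). (p, \<not> b)) (letters m)))"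

type_synonym 'g star_polynomial = "'g star_monomial \<Rightarrow>\<^sub>0 complex"

definition free_star_algebra :: "'g set \<Rightarrow> 'g star_polynomial star_algebra" where
  "free_star_algebra P =
    \<lparr>carrier = {x. \<forall>m\<in>Poly_Mapping.keys x. fst ` set (letters m) \<subseteq> P},
     mult = (*), one = 1, zero = 0, add = (+),
     smult = (\<lambda>c x. Poly_Mapping.single 0 c * x),
     star = (\<lambda>x. Poly_Mapping.map_key monomial_star (Poly_Mapping.map cnj x))\<rparr>"

definition free_generator :: "'g \<Rightarrow> 'g star_polynomial" where
  "free_generator p = Poly_Mapping.single (Star_Monomial [(p, False)]) 1"

definition eval_monomial ::
  "('a, 'x) star_algebra_scheme \<Rightarrow> ('g \<Rightarrow> 'a) \<Rightarrow> 'g star_monomial \<Rightarrow> 'a" where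
  "eval_monomial A w m =
    foldr (\<lambda>(p, b) x. (if b then star A (w p) else w p) \<otimes>\<^bsub>A\<^esub> x) (letters m) \<one>\<^bsub>A\<^esub>"

definition eval_star_polynomial ::
  "('a, 'x) star_algebra_scheme \<Rightarrow> ('g \<Rightarrow> 'a) \<Rightarrow> 'g star_polynomial \<Rightarrow> 'a" where
  "eval_star_polynomial A w x =
    (\<Oplus>\<^bsub>A\<^esub>m\<in>Poly_Mapping.keys x. Poly_Mapping.lookup x m \<odot>\<^bsub>A\<^esub> eval_monomial A w m)"

definition cstar_seminorm :: "('a, 'x) star_algebra_scheme \<Rightarrow> ('a \<Rightarrow> real) \<Rightarrow> bool" where
  "cstar_seminorm F N \<longleftrightarrow>
    (\<forall>x\<in>carrier F. 0 \<le> N x) \<and>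
    (\<forall>x\<in>carrier F. \<forall>y\<in>carrier F. N (x \<oplus>\<^bsub>F\<^esub> y) \<le> N x + N y) \<and>
    (\<forall>c. \<forall>x\<in>carrier F. N (c \<odot>\<^bsub>F\<^esub> x) = cmod c * N x) \<and>
    (\<forall>x\<in>carrier F. \<forall>y\<in>carrier F. N (x \<otimes>\<^bsub>F\<^esub> y) \<le> N x * N y) \<and>
    (\<forall>x\<in>carrier F. N (star F x \<otimes>\<^bsub>F\<^esub> x) = (N x)\<^sup>2)"

text \<open>For the Toeplitz relators the supremum is finite: (T3) gives \<open>N(p\<^sup>*p - 1) = 0\<close> and hence
  \<open>N(p) \<le> 1\<close> for every \<open>p \<in> P\<close>.\<close>

definition universal_seminorm :: "('a, 'x) star_algebra_scheme \<Rightarrow> 'a set \<Rightarrow> 'a \<Rightarrow> real" where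
  "universal_seminorm F R x = (SUP N\<in>{N. cstar_seminorm F N \<and> (\<forall>r\<in>R. N r = 0)}. N x)"

definition seminorm_cauchy ::
  "('a, 'x) star_algebra_scheme \<Rightarrow> ('a \<Rightarrow> real) \<Rightarrow> (nat \<Rightarrow> 'a) \<Rightarrow> bool" where
  "seminorm_cauchy F N X \<longleftrightarrow>
    range X \<subseteq> carrier F \<and> (\<forall>e>0. \<exists>M. \<forall>m\<ge>M. \<forall>n\<ge>M. N (X m \<ominus>\<^bsub>F\<^esub> X n) < e)"

definition cauchy_class ::
  "('a, 'x) star_algebra_scheme \<Rightarrow> ('a \<Rightarrow> real) \<Rightarrow> (nat \<Rightarrow> 'a) \<Rightarrow> (nat \<Rightarrow> 'a) set" where
  "cauchy_class F N X =
    {Y. seminorm_cauchy F N Y \<and> (\<lambda>n. N (X n \<ominus>\<^bsub>F\<^esub> Y n)) \<longlonglongrightarrow> 0}"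

text \<open>The operations on classes are defined as unions over all representatives; by continuity of
  the operations each of these unions is a single class.\<close>

definition hausdorff_completion ::
  "('a, 'x) star_algebra_scheme \<Rightarrow> ('a \<Rightarrow> real) \<Rightarrow> (nat \<Rightarrow> 'a) set cstar_algebra" where
  "hausdorff_completion F N =
    \<lparr>carrier = cauchy_class F N ` {X. seminorm_cauchy F N X},
     mult = (\<lambda>c d. \<Union>X\<in>c. \<Union>Y\<in>d. cauchy_class F N (\<lambda>n. X n \<otimes>\<^bsub>F\<^esub> Y n)),
     one = cauchy_class F N (\<lambda>_. \<one>\<^bsub>F\<^esub>),
     zero = cauchy_class F N (\<lambda>_. \<zero>\<^bsub>F\<^esub>),
     add = (\<lambda>c d. \<Union>X\<in>c. \<Union>Y\<in>d. cauchy_class F N (\<lambda>n. X n \<oplus>\<^bsub>F\<^esub> Y n)),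
     smult = (\<lambda>a c. \<Union>X\<in>c. cauchy_class F N (\<lambda>n. a \<odot>\<^bsub>F\<^esub> X n)),
     star = (\<lambda>c. \<Union>X\<in>c. cauchy_class F N (\<lambda>n. star F (X n))),
     cnorm = (\<lambda>c. lim (\<lambda>n. N ((SOME X. X \<in> c) n)))\<rparr>"

definition toeplitz_seminorm ::
  "('g, 'm) monoid_scheme \<Rightarrow> 'g set \<Rightarrow> 'g star_polynomial \<Rightarrow> real" where
  "toeplitz_seminorm G P =
    universal_seminorm (free_star_algebra P)
      (toeplitz_relators G P (free_star_algebra P) free_generator)"

definition toeplitz_universal ::
  "('g, 'm) monoid_scheme \<Rightarrow> 'g set \<Rightarrow> (nat \<Rightarrow> 'g star_polynomial) set cstar_algebra" where
  "toeplitz_universal G P = hausdorff_completion (free_star_algebra P) (toeplitz_seminorm G P)"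

definition toeplitz_generator ::
  "('g, 'm) monoid_scheme \<Rightarrow> 'g set \<Rightarrow> 'g \<Rightarrow> (nat \<Rightarrow> 'g star_polynomial) set" where
  "toeplitz_generator G P p =
    cauchy_class (free_star_algebra P) (toeplitz_seminorm G P) (\<lambda>_. free_generator p)"

text \<open>The *-homomorphism sending the generator \<open>t\<^sub>p\<close> of \<open>\<T>\<^sub>u(P)\<close> to \<open>w\<^sub>p\<close>, for a map
  \<open>w\<close> into a C*-algebra \<open>A\<close> that satisfies (T1)--(T4): the extension by continuity of the
  evaluation of *-polynomials at \<open>w\<close>.\<close>

definition toeplitz_induced ::
  "('a, 'x) cstar_algebra_scheme \<Rightarrow> ('g \<Rightarrow> 'a) \<Rightarrow> (nat \<Rightarrow> 'g star_polynomial) set \<Rightarrow> 'a" where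
  "toeplitz_induced A w c =
    (THE a. a \<in> carrier A \<and>
      (\<forall>X\<in>c. (\<lambda>n. cnorm A (eval_star_polynomial A w (X n) \<ominus>\<^bsub>A\<^esub> a)) \<longlonglongrightarrow> 0))"

definition D_u :: "('g, 'm) monoid_scheme \<Rightarrow> 'g set \<Rightarrow> (nat \<Rightarrow> 'g star_polynomial) set set" where
  "D_u G P =
    closed_span (toeplitz_universal G P)
      (word_elem (toeplitz_universal G P) (toeplitz_generator G P) ` neutral_words G P)"


section \<open>The left regular representation\<close>

text \<open>\<open>\<ell>\<^sup>2(S)\<close> is realized as the space of square summable functions on the whole type that
  vanish off \<open>S\<close>, so that \<open>\<ell>\<^sup>2(\<Delta>) \<subseteq> \<ell>\<^sup>2(P)\<close> for \<open>\<Delta> \<subseteq> P\<close>.\<close>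

definition ell2 :: "'g set \<Rightarrow> ('g \<Rightarrow> complex) set" where
  "ell2 S = {f. (\<forall>x. x \<notin> S \<longrightarrow> f x = 0) \<and> (\<lambda>x. (cmod (f x))\<^sup>2) summable_on UNIV}"

definition ell2_norm :: "('g \<Rightarrow> complex) \<Rightarrow> real" where
  "ell2_norm f = sqrt (\<Sum>\<^sub>\<infinity>x. (cmod (f x))\<^sup>2)"

definition ell2_inner :: "('g \<Rightarrow> complex) \<Rightarrow> ('g \<Rightarrow> complex) \<Rightarrow> complex" where
  "ell2_inner f g = (\<Sum>\<^sub>\<infinity>x. cnj (f x) * g x)"

text \<open>The norm of the restriction of an operator to the subspace \<open>\<ell>\<^sup>2(S)\<close>.\<close>

definition op_norm_on :: "'g set \<Rightarrow> (('g \<Rightarrow> complex) \<Rightarrow> 'g \<Rightarrow> complex) \<Rightarrow> real" where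
  "op_norm_on S T = (SUP f\<in>{f \<in> ell2 S. ell2_norm f \<le> 1}. ell2_norm (T f))"

definition bounded_op_set :: "'g set \<Rightarrow> (('g \<Rightarrow> complex) \<Rightarrow> 'g \<Rightarrow> complex) set" where
  "bounded_op_set S =
    {T \<in> ell2 S \<rightarrow>\<^sub>E ell2 S.
      (\<forall>f\<in>ell2 S. \<forall>g\<in>ell2 S. T (\<lambda>x. f x + g x) = (\<lambda>x. T f x + T g x)) \<and>
      (\<forall>c. \<forall>f\<in>ell2 S. T (\<lambda>x. c * f x) = (\<lambda>x. c * T f x)) \<and>
      (\<exists>C. \<forall>f\<in>ell2 S. ell2_norm (T f) \<le> C * ell2_norm f)}"

definition bounded_ops :: "'g set \<Rightarrow> (('g \<Rightarrow> complex) \<Rightarrow> 'g \<Rightarrow> complex) cstar_algebra" where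
  "bounded_ops S =
    \<lparr>carrier = bounded_op_set S,
     mult = (\<lambda>T U. compose (ell2 S) T U),
     one = (\<lambda>f\<in>ell2 S. f),
     zero = (\<lambda>f\<in>ell2 S. \<lambda>_. 0),
     add = (\<lambda>T U. \<lambda>f\<in>ell2 S. \<lambda>x. T f x + U f x),
     smult = (\<lambda>c T. \<lambda>f\<in>ell2 S. \<lambda>x. c * T f x),
     star = (\<lambda>T. THE U. U \<in> bounded_op_set S \<and>
       (\<forall>f\<in>ell2 S. \<forall>g\<in>ell2 S. ell2_inner (U f) g = ell2_inner f (T g))),
     cnorm = op_norm_on S\<rparr>"

text \<open>The bounded operator with \<open>L\<^sub>p \<delta>\<^sub>q = \<delta>\<^sub>p\<^sub>q\<close>, written out on all of \<open>\<ell>\<^sup>2(P)\<close>.\<close>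

definition left_regular ::
  "('g, 'm) monoid_scheme \<Rightarrow> 'g set \<Rightarrow> 'g \<Rightarrow> ('g \<Rightarrow> complex) \<Rightarrow> 'g \<Rightarrow> complex" where
  "left_regular G P p =
    (\<lambda>f\<in>ell2 P. \<lambda>x. if x \<in> p <#\<^bsub>G\<^esub> P then f (inv\<^bsub>G\<^esub> p \<otimes>\<^bsub>G\<^esub> x) else 0)"

definition indicator_op :: "'g set \<Rightarrow> 'g set \<Rightarrow> ('g \<Rightarrow> complex) \<Rightarrow> 'g \<Rightarrow> complex" where
  "indicator_op P S = (\<lambda>f\<in>ell2 P. \<lambda>x. if x \<in> S then f x else 0)"

definition D_r ::
  "('g, 'm) monoid_scheme \<Rightarrow> 'g set \<Rightarrow> (('g \<Rightarrow> complex) \<Rightarrow> 'g \<Rightarrow> complex) set" where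
  "D_r G P = closed_span (bounded_ops P) (indicator_op P ` constructible_ideals G P)"

definition \<Delta> :: "('g, 'm) monoid_scheme \<Rightarrow> 'g set \<Rightarrow> 'g set \<Rightarrow> 'g set" where
  "\<Delta> G P F =
    {p \<in> P. \<forall>g\<in>F. (p <#\<^bsub>G\<^esub> P) \<inter> (g <#\<^bsub>G\<^esub> P) = {} \<or> (p <#\<^bsub>G\<^esub> P) \<inter> (g <#\<^bsub>G\<^esub> P) = p <#\<^bsub>G\<^esub> P}"

definition D_r_o ::
  "('g, 'm) monoid_scheme \<Rightarrow> 'g set \<Rightarrow> (('g \<Rightarrow> complex) \<Rightarrow> 'g \<Rightarrow> complex) set" where
  "D_r_o G P =
    {b \<in> D_r G P. ((\<lambda>F. op_norm_on (\<Delta> G P F) b) \<longlongrightarrow> 0) (finite_subsets_at_top (carrier G))}"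

text \<open>The canonical map \<open>\<lambda>\<^sup>+\<close> takes values in \<open>\<T>\<^sub>\<lambda>(P) \<subseteq> B(\<ell>\<^sup>2(P))\<close>; it is regarded as a
  map into the bounded operators.\<close>

definition lambda_plus ::
  "('g, 'm) monoid_scheme \<Rightarrow> 'g set \<Rightarrow> (nat \<Rightarrow> 'g star_polynomial) set
    \<Rightarrow> ('g \<Rightarrow> complex) \<Rightarrow> 'g \<Rightarrow> complex" where
  "lambda_plus G P = toeplitz_induced (bounded_ops P) (left_regular G P)"

definition D_u_o :: "('g, 'm) monoid_scheme \<Rightarrow> 'g set \<Rightarrow> (nat \<Rightarrow> 'g star_polynomial) set set" where
  "D_u_o G P = {d \<in> D_u G P. lambda_plus G P d \<in> D_r_o G P}"


section \<open>Strongly covariant isometric representations\<close>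

definition isometric_representation ::
  "('g, 'm) monoid_scheme \<Rightarrow> 'g set \<Rightarrow> ('a, 'x) star_algebra_scheme \<Rightarrow> ('g \<Rightarrow> 'a) \<Rightarrow> bool" where
  "isometric_representation G P B w \<longleftrightarrow>
    w \<in> P \<rightarrow> carrier B \<and>
    (\<forall>p\<in>P. star B (w p) \<otimes>\<^bsub>B\<^esub> w p = \<one>\<^bsub>B\<^esub>) \<and>
    w \<one>\<^bsub>G\<^esub> = \<one>\<^bsub>B\<^esub> \<and>
    (\<forall>p\<in>P. \<forall>q\<in>P. w p \<otimes>\<^bsub>B\<^esub> w q = w (p \<otimes>\<^bsub>G\<^esub> q))"

text \<open>A homomorphism on \<open>D\<^sub>r\<close> factors through the quotient by the ideal \<open>D\<^sub>r\<^sup>o\<close> if and only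
  if it vanishes on that ideal.\<close>

definition strongly_covariant ::
  "('g, 'm) monoid_scheme \<Rightarrow> 'g set \<Rightarrow> ('a, 'x) star_algebra_scheme \<Rightarrow> ('g \<Rightarrow> 'a) \<Rightarrow> bool" where
  "strongly_covariant G P B w \<longleftrightarrow>
    (\<exists>\<phi>. star_hom (bounded_ops P\<lparr>carrier := D_r G P\<rparr>) B \<phi> \<and>
      (\<forall>\<alpha>\<in>neutral_words G P.
        \<phi> (word_elem (bounded_ops P) (left_regular G P) \<alpha>) = word_elem B w \<alpha>) \<and>
      (\<forall>b\<in>D_r_o G P. \<phi> b = \<zero>\<^bsub>B\<^esub>))"

end

theory Submission
  imports Defs
begin

text \<open>
  Under (T1)--(T4) the elements \<open>w\<^sub>\<alpha>\<close>, \<open>\<alpha>\<close> neutral, are commuting projections that multiply as the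
  indicator functions of the sets \<open>K(\<alpha>)\<close>, and by (T4) the spectral projection of an empty set
  \<open>K(\<mu>) - \<Union>K(\<nu>)\<close> vanishes. Hence a linear combination of the \<open>w\<^sub>\<alpha>\<close> is bounded by the
  supremum norm of the corresponding function on \<open>P\<close>, so that \<open>\<lambda>\<^sup>+\<close> is isometric on \<open>D\<^sub>u\<close>.

  Every \<open>pP\<close> meets every \<open>\<Delta>\<^sub>F\<close>. So if a nonempty set \<open>K(\<mu>) - \<Union>K(\<nu>)\<close> misses some \<open>\<Delta>\<^sub>F\<close>, then
  the sets \<open>K(\<mu>) \<inter> K(\<nu>)\<close> form a proper foundation set for \<open>K(\<mu>)\<close>; conversely \<open>\<Delta>\<^sub>F\<close> misses
  \<open>K(\<alpha>) - \<Union>K(\<beta>)\<close> for every proper foundation set and all large \<open>F\<close>. An element of \<open>D\<^sub>u\<^sup>o\<close> is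
  close to a linear combination of the \<open>t\<^sub>\<alpha>\<close> that is small on some \<open>\<Delta>\<^sub>F\<close>, and the pieces on which
  it is large are multiples of boundary products. For \<open>w\<close> with (T1)--(T4), the homomorphism
  \<open>D\<^sub>r \<rightarrow> B\<close> is the inverse of \<open>\<lambda>\<^sup>+\<close> on \<open>D\<^sub>u\<close> followed by the homomorphism \<open>\<T>\<^sub>u(P) \<rightarrow> B\<close> induced by \<open>w\<close>.
\<close>

section \<open>Algebras with involution and C*-algebras\<close>

text \<open>The estimates on linear combinations rest on no functional calculus. A list of words is
  processed one word at a time, each step splitting the current piece by a commuting projection; the
  only analytic input is that a sum of two orthogonal parts obeys the common norm bound of the
  parts, which follows from the C*-identity alone. The splitting is run twice: with
  \<open>D = P\<close> only pieces over empty sets are discarded, and the canonical map turns out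
  isometric on \<open>D_u\<close>; with \<open>D\<close> one of the sets \<open>\<Delta>\<close> the
  discarded pieces are zero or boundary products.

  The obstacle in passing from the relations to strong covariance is that a map prescribed on
  indicator operators need not extend to \<open>D_r\<close>. Passing through the universal algebra
  removes it: evaluation of polynomials at \<open>w\<close> is contractive for the universal
  seminorm by construction, and the isometry on \<open>D_u\<close> provides the inverse. One locale
  of families satisfying (T1)--(T4) is therefore instantiated with the universal generators, the
  left regular representation and the given map.\<close>

lemma tendsto_zero_le:
  assumes "(g :: nat \<Rightarrow> real) \<longlonglongrightarrow> 0" "\<And>n. 0 \<le> f n" "\<And>n. f n \<le> g n"
  shows "f \<longlonglongrightarrow> 0"
  by (rule tendsto_sandwich[OF _ _ tendsto_const assms(1)]) (simp_all add: assms)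

lemma complex_ring_simps [simp]:
  "carrier complex_ring = UNIV" "\<zero>\<^bsub>complex_ring\<^esub> = 0" "\<one>\<^bsub>complex_ring\<^esub> = 1"
  "x \<oplus>\<^bsub>complex_ring\<^esub> y = x + y" "x \<otimes>\<^bsub>complex_ring\<^esub> y = x * y"
  by (simp_all add: complex_ring_def)

lemma cring_complex_ring: "cring complex_ring"
proof -
  have "\<exists>y. y + x = 0 \<and> x + y = 0" for x :: complex
    by (rule exI[of _ "- x"]) simp
  then show ?thesis
    by (auto intro!: cringI abelian_groupI comm_monoidI simp: algebra_simps)
qed

lemma complex_ring_a_inv [simp]: "\<ominus>\<^bsub>complex_ring\<^esub> x = - x"
proof -
  interpret cring complex_ring by (rule cring_complex_ring)
  have "x \<oplus>\<^bsub>complex_ring\<^esub> (- x) = \<zero>\<^bsub>complex_ring\<^esub>" by simp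
  then show ?thesis using minus_equality[of "- x" x] by simp
qed

text \<open>The algebraic axioms are kept apart from the norm so that the free algebra, which
  carries only seminorms, shares all identities with its completion and with C*-algebras. The module
  structure over \<open>complex_ring\<close> is derived below, so that concrete algebras are checked
  with plain complex scalars.\<close>

locale unital_star_algebra = ring A
  for A :: "('a, 'x) star_algebra_scheme" (structure) +
  assumes scalar_closed [simp, intro]: "x \<in> carrier A \<Longrightarrow> c \<odot> x \<in> carrier A"
    and scalar_add: "x \<in> carrier A \<Longrightarrow> (c + d) \<odot> x = c \<odot> x \<oplus> d \<odot> x"
    and scalar_add_right:
      "\<lbrakk>x \<in> carrier A; y \<in> carrier A\<rbrakk> \<Longrightarrow> c \<odot> (x \<oplus> y) = c \<odot> x \<oplus> c \<odot> y"
    and scalar_scalar: "x \<in> carrier A \<Longrightarrow> c \<odot> (d \<odot> x) = (c * d) \<odot> x"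
    and scalar_one [simp]: "x \<in> carrier A \<Longrightarrow> 1 \<odot> x = x"
    and smult_mult_left:
      "\<lbrakk>x \<in> carrier A; y \<in> carrier A\<rbrakk> \<Longrightarrow> (c \<odot> x) \<otimes> y = c \<odot> (x \<otimes> y)"
    and smult_mult_right:
      "\<lbrakk>x \<in> carrier A; y \<in> carrier A\<rbrakk> \<Longrightarrow> x \<otimes> (c \<odot> y) = c \<odot> (x \<otimes> y)"
    and star_closed [simp]: "x \<in> carrier A \<Longrightarrow> star A x \<in> carrier A"
    and star_star [simp]: "x \<in> carrier A \<Longrightarrow> star A (star A x) = x"
    and star_add:
      "\<lbrakk>x \<in> carrier A; y \<in> carrier A\<rbrakk> \<Longrightarrow> star A (x \<oplus> y) = star A x \<oplus> star A y"
    and star_smult: "x \<in> carrier A \<Longrightarrow> star A (c \<odot> x) = cnj c \<odot> star A x"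
    and star_mult:
      "\<lbrakk>x \<in> carrier A; y \<in> carrier A\<rbrakk> \<Longrightarrow> star A (x \<otimes> y) = star A y \<otimes> star A x"
begin

sublocale M: Module.module complex_ring A
proof -
  show "Module.module complex_ring A"
    by (rule moduleI)
      (simp_all add: cring_complex_ring is_abelian_group scalar_add scalar_add_right scalar_scalar)
qed

lemma scalar_zero [simp]: "x \<in> carrier A \<Longrightarrow> 0 \<odot> x = \<zero>"
  using M.smult_l_null[of x] by simp

lemma scalar_zero_right [simp]: "c \<odot> \<zero> = \<zero>"
  using M.smult_r_null[of c] by simp

lemma scalar_minus_one: "x \<in> carrier A \<Longrightarrow> (- 1) \<odot> x = \<ominus> x"
  using M.smult_l_minus[of 1 x] by simp

lemma scalar_minus: "\<lbrakk>x \<in> carrier A; y \<in> carrier A\<rbrakk> \<Longrightarrow> c \<odot> (x \<ominus> y) = c \<odot> x \<ominus> c \<odot> y"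
  using M.smult_r_minus[of c y] by (simp add: minus_eq scalar_add_right)

lemma minus_scalar: "\<lbrakk>x \<in> carrier A; y \<in> carrier A\<rbrakk> \<Longrightarrow> x \<ominus> y = x \<oplus> (- 1) \<odot> y"
  by (simp add: minus_eq scalar_minus_one)

lemma star_zero [simp]: "star A \<zero> = \<zero>"
  using star_smult[of \<zero> 0] by simp

lemma star_one [simp]: "star A \<one> = \<one>"
proof -
  \<comment> \<open>Distributing the outer star gives back \<open>star A \<one>\<close>; cancelling
    the double star inside the argument gives \<open>\<one>\<close>.\<close>
  have "star A \<one> = star A (star A (star A \<one>) \<otimes> star A \<one>)"
    by (subst star_mult) simp_all
  then show ?thesis by simp
qed

lemma star_minus [simp]:
  "\<lbrakk>x \<in> carrier A; y \<in> carrier A\<rbrakk> \<Longrightarrow> star A (x \<ominus> y) = star A x \<ominus> star A y"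
  by (simp add: minus_scalar star_add star_smult)

lemma minus_self [simp]: "x \<in> carrier A \<Longrightarrow> x \<ominus> x = \<zero>"
  by (simp add: minus_eq r_neg)

lemma minus_zero_right [simp]: "x \<in> carrier A \<Longrightarrow> x \<ominus> \<zero> = x"
  by (simp add: minus_eq)

lemma minus_eq_zero_iff:
  "\<lbrakk>x \<in> carrier A; y \<in> carrier A\<rbrakk> \<Longrightarrow> x \<ominus> y = \<zero> \<longleftrightarrow> x = y"
  by (metis minus_eq minus_minus minus_equality minus_self a_inv_closed)

lemma minus_distrib_left:
  "\<lbrakk>x \<in> carrier A; y \<in> carrier A; z \<in> carrier A\<rbrakk> \<Longrightarrow> (x \<ominus> y) \<otimes> z = x \<otimes> z \<ominus> y \<otimes> z"
  by (simp add: minus_eq l_distr l_minus)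

lemma minus_distrib_right:
  "\<lbrakk>x \<in> carrier A; y \<in> carrier A; z \<in> carrier A\<rbrakk> \<Longrightarrow> z \<otimes> (x \<ominus> y) = z \<otimes> x \<ominus> z \<otimes> y"
  by (simp add: minus_eq r_distr r_minus)

lemma minus_add_minus:
  "\<lbrakk>x \<in> carrier A; y \<in> carrier A; z \<in> carrier A\<rbrakk> \<Longrightarrow> (x \<ominus> y) \<oplus> (y \<ominus> z) = x \<ominus> z"
  by algebra

lemma add_minus_add:
  "\<lbrakk>x \<in> carrier A; y \<in> carrier A; x' \<in> carrier A; y' \<in> carrier A\<rbrakk>
    \<Longrightarrow> (x \<oplus> y) \<ominus> (x' \<oplus> y') = (x \<ominus> x') \<oplus> (y \<ominus> y')"
  by algebra

lemma mult_minus_mult: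
  "\<lbrakk>x \<in> carrier A; y \<in> carrier A; x' \<in> carrier A; y' \<in> carrier A\<rbrakk>
    \<Longrightarrow> x \<otimes> y \<ominus> x' \<otimes> y' = (x \<ominus> x') \<otimes> y \<oplus> x' \<otimes> (y \<ominus> y')"
  by algebra

end

text \<open>Lists with possible repetitions are used instead of coefficient functions: sums become
  concatenations, and inductions can treat one summand at a time.\<close>

definition lincomb :: "('a, 'x) star_algebra_scheme \<Rightarrow> (complex \<times> 'a) list \<Rightarrow> 'a" where
  "lincomb A cs = foldr (\<lambda>(c, x) y. (c \<odot>\<^bsub>A\<^esub> x) \<oplus>\<^bsub>A\<^esub> y) cs \<zero>\<^bsub>A\<^esub>"

lemma lincomb_simps [simp]:
  "lincomb A [] = \<zero>\<^bsub>A\<^esub>"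
  "lincomb A ((c, x) # cs) = (c \<odot>\<^bsub>A\<^esub> x) \<oplus>\<^bsub>A\<^esub> lincomb A cs"
  by (simp_all add: lincomb_def)

context unital_star_algebra begin

lemma lincomb_closed [simp]: "snd ` set cs \<subseteq> carrier A \<Longrightarrow> lincomb A cs \<in> carrier A"
  by (induction cs) auto

lemma lincomb_append:
  "\<lbrakk>snd ` set cs \<subseteq> carrier A; snd ` set ds \<subseteq> carrier A\<rbrakk>
    \<Longrightarrow> lincomb A (cs @ ds) = lincomb A cs \<oplus> lincomb A ds"
  by (induction cs) (auto simp: a_assoc)

lemma scalar_lincomb:
  "snd ` set cs \<subseteq> carrier A
    \<Longrightarrow> a \<odot> lincomb A cs = lincomb A (map (\<lambda>(c, x). (a * c, x)) cs)"
  by (induction cs) (auto simp: scalar_add_right scalar_scalar)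

lemma submodule_lincomb:
  assumes "submodule H complex_ring A" "S \<subseteq> H" "snd ` set cs \<subseteq> S"
  shows "lincomb A cs \<in> H"
  using assms(3)
proof (induction cs)
  case Nil
  then show ?case using M.submoduleE(2)[OF assms(1)] by (metis assms(1) lincomb_simps(1) submodule_def subgroup.one_closed monoid.select_convs(2))
next
  case (Cons d cs)
  then show ?case using M.submoduleE(4,5)[OF assms(1)] assms(2) by (cases d) auto
qed

text \<open>The combinations form a submodule containing \<open>S\<close>, and every submodule
  containing \<open>S\<close> contains them. This replaces the abstract hull in
  \<open>closed_span\<close> by finite sums that can be estimated.\<close>

lemma span_eq_lincomb:
  assumes "S \<subseteq> carrier A"
  shows "(\<lambda>H. submodule H complex_ring A) hull S = {lincomb A cs | cs. snd ` set cs \<subseteq> S}"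
    (is "_ = ?L")
proof
  have "submodule ?L complex_ring A"
  proof (rule M.submoduleI)
    show "?L \<subseteq> carrier A" using assms by (auto intro!: lincomb_closed)
    show "\<zero> \<in> ?L" by (auto intro!: exI[of _ "[]"])
    fix a assume "a \<in> ?L"
    then obtain cs where cs: "a = lincomb A cs" "snd ` set cs \<subseteq> S" by auto
    then have cs': "snd ` set cs \<subseteq> carrier A" using assms by auto
    have *: "c \<odot> a \<in> ?L" for c
      using cs scalar_lincomb[OF cs', of c]
      by (intro CollectI exI[of _ "map (\<lambda>(d, x). (c * d, x)) cs"]) force
    then show "\<And>c. c \<in> carrier complex_ring \<Longrightarrow> c \<odot> a \<in> ?L" by simp
    from *[of "-1"] show "\<ominus> a \<in> ?L"
      using cs' cs by (simp add: scalar_minus_one)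
    fix b assume "b \<in> ?L"
    then obtain ds where ds: "b = lincomb A ds" "snd ` set ds \<subseteq> S" by auto
    then have ds': "snd ` set ds \<subseteq> carrier A" using assms by auto
    have "a \<oplus> b = lincomb A (cs @ ds)" by (simp add: lincomb_append cs' ds' cs ds)
    then show "a \<oplus> b \<in> ?L" using cs ds by (intro CollectI exI[of _ "cs @ ds"]) auto
  qed
  moreover have "S \<subseteq> ?L"
  proof
    fix x assume "x \<in> S"
    then show "x \<in> ?L" using assms by (auto intro!: exI[of _ "[(1, x)]"])
  qed
  ultimately show "(\<lambda>H. submodule H complex_ring A) hull S \<subseteq> ?L"
    by (intro hull_minimal)
  show "?L \<subseteq> (\<lambda>H. submodule H complex_ring A) hull S"
    by (auto simp: hull_def intro!: submodule_lincomb)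
qed

end

text \<open>The same axioms as in \<open>unital_cstar_algebra\<close>, placed on top of
  \<open>unital_star_algebra\<close> so that its lemmas are inherited. The hypothesis of the theorem
  enters through \<open>unital_cstar_algebra_imp_cstar_algebra\<close>.\<close>

locale cstar_algebra = unital_star_algebra A
  for A :: "('a, 'x) cstar_algebra_scheme" (structure) +
  assumes cnorm_nonneg: "x \<in> carrier A \<Longrightarrow> 0 \<le> cnorm A x"
    and cnorm_eq_0_iff: "x \<in> carrier A \<Longrightarrow> cnorm A x = 0 \<longleftrightarrow> x = \<zero>"
    and cnorm_triangle:
      "\<lbrakk>x \<in> carrier A; y \<in> carrier A\<rbrakk> \<Longrightarrow> cnorm A (x \<oplus> y) \<le> cnorm A x + cnorm A y"
    and cnorm_smult: "x \<in> carrier A \<Longrightarrow> cnorm A (c \<odot> x) = cmod c * cnorm A x"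
    and cnorm_mult:
      "\<lbrakk>x \<in> carrier A; y \<in> carrier A\<rbrakk> \<Longrightarrow> cnorm A (x \<otimes> y) \<le> cnorm A x * cnorm A y"
    and cstar_identity: "x \<in> carrier A \<Longrightarrow> cnorm A (star A x \<otimes> x) = (cnorm A x)\<^sup>2"
    and complete: "Metric_space.mcomplete (carrier A) (cdist A)"

text \<open>Completeness is asked for in sequential form with the norm, the form in which it is
  established both for Hausdorff completions and for bounded operators.\<close>

lemma cstar_algebraI:
  assumes A: "unital_star_algebra A"
    and norm_nonneg: "\<And>x. x \<in> carrier A \<Longrightarrow> 0 \<le> cnorm A x"
    and norm_eq_0: "\<And>x. x \<in> carrier A \<Longrightarrow> cnorm A x = 0 \<longleftrightarrow> x = \<zero>\<^bsub>A\<^esub>"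
    and norm_triangle: "\<And>x y. \<lbrakk>x \<in> carrier A; y \<in> carrier A\<rbrakk> \<Longrightarrow> cnorm A (x \<oplus>\<^bsub>A\<^esub> y) \<le> cnorm A x + cnorm A y"
    and norm_smult: "\<And>x c. x \<in> carrier A \<Longrightarrow> cnorm A (c \<odot>\<^bsub>A\<^esub> x) = cmod c * cnorm A x"
    and norm_mult: "\<And>x y. \<lbrakk>x \<in> carrier A; y \<in> carrier A\<rbrakk> \<Longrightarrow> cnorm A (x \<otimes>\<^bsub>A\<^esub> y) \<le> cnorm A x * cnorm A y"
    and norm_cstar: "\<And>x. x \<in> carrier A \<Longrightarrow> cnorm A (star A x \<otimes>\<^bsub>A\<^esub> x) = (cnorm A x)\<^sup>2"
    and lim: "\<And>X. \<lbrakk>\<And>n. X n \<in> carrier A;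
        \<And>e. e > 0 \<Longrightarrow> \<exists>M. \<forall>m\<ge>M. \<forall>n\<ge>M. cnorm A (X m \<ominus>\<^bsub>A\<^esub> X n) < e\<rbrakk>
      \<Longrightarrow> \<exists>a\<in>carrier A. (\<lambda>n. cnorm A (X n \<ominus>\<^bsub>A\<^esub> a)) \<longlonglongrightarrow> 0"
  shows "cstar_algebra A"
proof -
  interpret unital_star_algebra A by fact
  have sym: "cnorm A (x \<ominus>\<^bsub>A\<^esub> y) = cnorm A (y \<ominus>\<^bsub>A\<^esub> x)" if "x \<in> carrier A" "y \<in> carrier A" for x y
  proof -
    have "x \<ominus>\<^bsub>A\<^esub> y = \<ominus>\<^bsub>A\<^esub> (y \<ominus>\<^bsub>A\<^esub> x)" using that by algebra
    also have "\<dots> = (-1) \<odot>\<^bsub>A\<^esub> (y \<ominus>\<^bsub>A\<^esub> x)" using that by (simp add: scalar_minus_one)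
    finally show ?thesis using that by (simp add: norm_smult)
  qed
  interpret Metric_space "carrier A" "cdist A"
  proof
    show "0 \<le> cdist A x y" for x y by (simp add: cdist_def norm_nonneg)
    show "cdist A x y = cdist A y x" for x y by (simp add: cdist_def sym)
    show "cdist A x y = 0 \<longleftrightarrow> x = y" if "x \<in> carrier A" "y \<in> carrier A" for x y
      using that by (simp add: cdist_def norm_eq_0 minus_eq_zero_iff)
    show "cdist A x z \<le> cdist A x y + cdist A y z"
      if "x \<in> carrier A" "y \<in> carrier A" "z \<in> carrier A" for x y z
      using that norm_triangle[of "x \<ominus>\<^bsub>A\<^esub> y" "y \<ominus>\<^bsub>A\<^esub> z"] by (simp add: cdist_def minus_add_minus)
  qed
  have "mcomplete"
    unfolding mcomplete_def
  proof (intro allI impI)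
    fix X assume X: "MCauchy X"
    then have c: "X n \<in> carrier A" for n unfolding MCauchy_def by auto
    have "\<exists>M. \<forall>m\<ge>M. \<forall>n\<ge>M. cnorm A (X m \<ominus>\<^bsub>A\<^esub> X n) < e" if "e > 0" for e
      using X that c unfolding MCauchy_def by (auto simp: cdist_def)
    then obtain a where a: "a \<in> carrier A" "(\<lambda>n. cnorm A (X n \<ominus>\<^bsub>A\<^esub> a)) \<longlonglongrightarrow> 0"
      using lim[of X] c by blast
    have "limitin mtopology X a sequentially"
      unfolding limitin_metric
    proof (intro conjI allI impI)
      fix e :: real assume "e > 0"
      from tendstoD[OF a(2) this]
      show "\<forall>\<^sub>F n in sequentially. X n \<in> carrier A \<and> cdist A (X n) a < e"
        by eventually_elim (use c a in \<open>auto simp: cdist_def\<close>)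
    qed fact
    then show "\<exists>a. limitin mtopology X a sequentially" by blast
  qed
  then show ?thesis
    by unfold_locales (auto intro: norm_nonneg norm_triangle norm_mult simp: norm_eq_0 norm_smult norm_cstar)
qed

lemma unital_cstar_algebra_imp_cstar_algebra:
  assumes "unital_cstar_algebra A"
  shows "cstar_algebra A"
proof -
  interpret unital_cstar_algebra A by fact
  have "ring A" ..
  then interpret A: ring A .
  show ?thesis
    by (unfold_locales)
      (use smult_closed smult_l_distr smult_r_distr smult_assoc1 smult_one in
        \<open>simp_all add: smult_mult_left smult_mult_right star_closed star_star star_add star_smult
          star_mult cnorm_nonneg cnorm_eq_0_iff cnorm_triangle cnorm_smult cnorm_mult
          cstar_identity complete\<close>)
qed

section \<open>Norm, metric and closed spans in a C*-algebra\<close>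

context cstar_algebra begin

lemma cnorm_zero [simp]: "cnorm A \<zero> = 0"
  by (simp add: cnorm_eq_0_iff)

lemma cnorm_minus_sym:
  assumes "x \<in> carrier A" "y \<in> carrier A"
  shows "cnorm A (x \<ominus> y) = cnorm A (y \<ominus> x)"
proof -
  have "x \<ominus> y = \<ominus> (y \<ominus> x)" using assms by algebra
  also have "\<dots> = (-1) \<odot> (y \<ominus> x)" using assms by (simp add: scalar_minus_one)
  finally show ?thesis using assms by (simp add: cnorm_smult)
qed

lemma cnorm_minus_triangle:
  assumes "x \<in> carrier A" "y \<in> carrier A" "z \<in> carrier A"
  shows "cnorm A (x \<ominus> z) \<le> cnorm A (x \<ominus> y) + cnorm A (y \<ominus> z)"
  using cnorm_triangle[of "x \<ominus> y" "y \<ominus> z"] assms by (simp add: minus_add_minus)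

lemma cnorm_le_minus:
  assumes "x \<in> carrier A" "y \<in> carrier A"
  shows "cnorm A x \<le> cnorm A y + cnorm A (x \<ominus> y)"
  using cnorm_minus_triangle[of x y \<zero>] assms by simp

sublocale metric: Metric_space "carrier A" "cdist A"
proof
  show "0 \<le> cdist A x y" for x y by (simp add: cdist_def cnorm_nonneg)
  show "cdist A x y = cdist A y x" for x y by (simp add: cdist_def cnorm_minus_sym)
  show "cdist A x y = 0 \<longleftrightarrow> x = y" if "x \<in> carrier A" "y \<in> carrier A" for x y
    using that by (simp add: cdist_def cnorm_eq_0_iff minus_eq_zero_iff)
  show "cdist A x z \<le> cdist A x y + cdist A y z"
    if "x \<in> carrier A" "y \<in> carrier A" "z \<in> carrier A" for x y z
    using that by (simp add: cdist_def cnorm_minus_triangle)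
qed

lemma complete_sequence:
  assumes "range X \<subseteq> carrier A" "\<And>e. e > 0 \<Longrightarrow> \<exists>M. \<forall>m\<ge>M. \<forall>n\<ge>M. cnorm A (X m \<ominus> X n) < e"
  shows "\<exists>a\<in>carrier A. (\<lambda>n. cnorm A (X n \<ominus> a)) \<longlonglongrightarrow> 0"
proof -
  have "metric.MCauchy X"
    using assms unfolding metric.MCauchy_def by (auto simp: cdist_def subset_iff)
  then obtain a where "limitin metric.mtopology X a sequentially"
    using complete unfolding metric.mcomplete_def by blast
  then have a: "a \<in> carrier A" and lim: "\<And>e. e > 0 \<Longrightarrow> \<forall>\<^sub>F n in sequentially. X n \<in> carrier A \<and> cdist A (X n) a < e"
    unfolding metric.limitin_metric by auto
  have "(\<lambda>n. cnorm A (X n \<ominus> a)) \<longlonglongrightarrow> 0"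
  proof (rule tendstoI)
    fix e :: real assume "e > 0"
    from lim[OF this] show "\<forall>\<^sub>F n in sequentially. dist (cnorm A (X n \<ominus> a)) 0 < e"
      by eventually_elim (use a in \<open>auto simp: cdist_def cnorm_nonneg\<close>)
  qed
  with a show ?thesis by blast
qed

lemma limit_unique:
  assumes "range X \<subseteq> carrier A" "a \<in> carrier A" "b \<in> carrier A"
    "(\<lambda>n. cnorm A (X n \<ominus> a)) \<longlonglongrightarrow> 0" "(\<lambda>n. cnorm A (X n \<ominus> b)) \<longlonglongrightarrow> 0"
  shows "a = b"
proof -
  have "cnorm A (a \<ominus> b) \<le> 0 + 0"
  proof (rule tendsto_lowerbound)
    show "(\<lambda>n. cnorm A (X n \<ominus> a) + cnorm A (X n \<ominus> b)) \<longlonglongrightarrow> 0 + 0"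
      using assms by (intro tendsto_add)
    show "\<forall>\<^sub>F n in sequentially. cnorm A (a \<ominus> b) \<le> cnorm A (X n \<ominus> a) + cnorm A (X n \<ominus> b)"
    proof (rule always_eventually, rule allI)
      fix n show "cnorm A (a \<ominus> b) \<le> cnorm A (X n \<ominus> a) + cnorm A (X n \<ominus> b)"
        using cnorm_minus_triangle[of a "X n" b] cnorm_minus_sym[of a "X n"] assms by auto
    qed
  qed simp
  then show ?thesis
    using cnorm_nonneg[of "a \<ominus> b"] assms by (simp add: cnorm_eq_0_iff minus_eq_zero_iff)
qed

text \<open>On the carrier \<open>cdist\<close> is the norm of the difference, so the topological
  closure becomes approximation by finite combinations. All later work with closed spans goes
  through this form.\<close>

lemma closed_span_iff:
  assumes "S \<subseteq> carrier A"
  shows "x \<in> closed_span A S \<longleftrightarrow> x \<in> carrier A \<and>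
    (\<forall>e>0. \<exists>cs. snd ` set cs \<subseteq> S \<and> cnorm A (x \<ominus> lincomb A cs) < e)"
proof -
  have "\<And>cs. snd ` set cs \<subseteq> S \<Longrightarrow> lincomb A cs \<in> carrier A"
    using assms by (intro lincomb_closed) auto
  then show ?thesis
    unfolding closed_span_def metric.metric_closure_of span_eq_lincomb[OF assms]
    by (auto simp: metric.mball_def cdist_def) metis+
qed

lemma closed_span_approx:
  assumes "S \<subseteq> carrier A" "x \<in> closed_span A S" "e > 0"
  obtains cs where "snd ` set cs \<subseteq> S" "lincomb A cs \<in> carrier A" "cnorm A (x \<ominus> lincomb A cs) < e"
  using assms closed_span_iff[OF assms(1)] lincomb_closed by (metis subset_trans)

lemma closed_span_carrier: "S \<subseteq> carrier A \<Longrightarrow> closed_span A S \<subseteq> carrier A"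
  by (auto simp: closed_span_iff)

lemma lincomb_in_closed_span:
  assumes "S \<subseteq> carrier A" "snd ` set cs \<subseteq> S"
  shows "lincomb A cs \<in> closed_span A S"
proof -
  have "lincomb A cs \<in> carrier A"
    using assms by (intro lincomb_closed) auto
  then show ?thesis using assms by (auto simp: closed_span_iff intro!: exI[of _ cs])
qed

lemma closed_span_base: "S \<subseteq> carrier A \<Longrightarrow> S \<subseteq> closed_span A S"
  using lincomb_in_closed_span[of S "[(1, x)]" for x] by (auto simp: subset_iff)

text \<open>Closedness of the closed span: an approximant within \<open>e / 2\<close> is itself
  within \<open>e / 2\<close> of a finite combination.\<close>

lemma closed_span_mono_closed:
  assumes "S \<subseteq> carrier A" "x \<in> carrier A" "\<And>e. e > 0 \<Longrightarrow> \<exists>y\<in>closed_span A S. cnorm A (x \<ominus> y) < e"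
  shows "x \<in> closed_span A S"
  unfolding closed_span_iff[OF assms(1)]
proof (intro conjI allI impI)
  show "x \<in> carrier A" by fact
  fix e :: real assume "e > 0"
  then obtain y where y: "y \<in> closed_span A S" "cnorm A (x \<ominus> y) < e / 2"
    using assms(3)[of "e/2"] by auto
  obtain cs where cs: "snd ` set cs \<subseteq> S" "lincomb A cs \<in> carrier A" "cnorm A (y \<ominus> lincomb A cs) < e/2"
    using closed_span_approx[OF assms(1) y(1), of "e/2"] \<open>e > 0\<close> by auto
  have "y \<in> carrier A" using closed_span_carrier y assms by auto
  then have "cnorm A (x \<ominus> lincomb A cs) < e"
    using cnorm_minus_triangle[of x y "lincomb A cs"] assms(2) cs y by simp
  then show "\<exists>cs. snd ` set cs \<subseteq> S \<and> cnorm A (x \<ominus> lincomb A cs) < e" using cs by auto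
qed

lemma closed_span_add:
  assumes "S \<subseteq> carrier A" "x \<in> closed_span A S" "y \<in> closed_span A S"
  shows "x \<oplus> y \<in> closed_span A S"
  unfolding closed_span_iff[OF assms(1)]
proof (intro conjI allI impI)
  have xy: "x \<in> carrier A" "y \<in> carrier A" using assms closed_span_carrier by auto
  then show "x \<oplus> y \<in> carrier A" by simp
  fix e :: real assume "e > 0"
  obtain cs where cs: "snd ` set cs \<subseteq> S" "lincomb A cs \<in> carrier A" "cnorm A (x \<ominus> lincomb A cs) < e/2"
    using closed_span_approx[OF assms(1,2), of "e/2"] \<open>e > 0\<close> by auto
  obtain ds where ds: "snd ` set ds \<subseteq> S" "lincomb A ds \<in> carrier A" "cnorm A (y \<ominus> lincomb A ds) < e/2"
    using closed_span_approx[OF assms(1,3), of "e/2"] \<open>e > 0\<close> by auto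
  have "(x \<oplus> y) \<ominus> lincomb A (cs @ ds) = (x \<ominus> lincomb A cs) \<oplus> (y \<ominus> lincomb A ds)"
    using lincomb_append[of cs ds] add_minus_add xy cs ds assms(1)
    by (metis (no_types, lifting) order.trans)
  then have "cnorm A ((x \<oplus> y) \<ominus> lincomb A (cs @ ds)) < e"
    using cnorm_triangle[of "x \<ominus> lincomb A cs" "y \<ominus> lincomb A ds"] xy cs ds by simp
  then show "\<exists>cs. snd ` set cs \<subseteq> S \<and> cnorm A (x \<oplus> y \<ominus> lincomb A cs) < e"
    using cs ds by (intro exI[of _ "cs @ ds"]) auto
qed

lemma closed_span_scalar:
  assumes "S \<subseteq> carrier A" "x \<in> closed_span A S"
  shows "a \<odot> x \<in> closed_span A S"
  unfolding closed_span_iff[OF assms(1)]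
proof (intro conjI allI impI)
  have x: "x \<in> carrier A" using assms closed_span_carrier by auto
  then show "a \<odot> x \<in> carrier A" by simp
  fix e :: real assume "e > 0"
  \<comment> \<open>The added \<open>1\<close> keeps the denominator positive when
    \<open>a = 0\<close>; the same device recurs with \<open>cnorm A u\<close> and
    \<open>cnorm A y\<close> in \<open>closed_span_mult\<close>.\<close>
  then have e: "e / (cmod a + 1) > 0" by (simp add: add_nonneg_pos)
  obtain cs where cs: "snd ` set cs \<subseteq> S" "lincomb A cs \<in> carrier A" "cnorm A (x \<ominus> lincomb A cs) < e/(cmod a + 1)"
    using closed_span_approx[OF assms(1,2) e] by auto
  let ?ds = "map (\<lambda>(c, x). (a * c, x)) cs"
  have "a \<odot> x \<ominus> lincomb A ?ds = a \<odot> (x \<ominus> lincomb A cs)"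
    using scalar_lincomb[of cs a] cs assms(1) x by (simp add: scalar_minus order.trans)
  then have "cnorm A (a \<odot> x \<ominus> lincomb A ?ds) = cmod a * cnorm A (x \<ominus> lincomb A cs)"
    using x cs by (simp add: cnorm_smult)
  also have "\<dots> \<le> (cmod a + 1) * cnorm A (x \<ominus> lincomb A cs)"
    using x cs by (intro mult_right_mono) (auto simp: cnorm_nonneg)
  also have "\<dots> < e"
    using cs(3) by (simp add: pos_less_divide_eq add_nonneg_pos mult.commute)
  finally show "\<exists>cs. snd ` set cs \<subseteq> S \<and> cnorm A (a \<odot> x \<ominus> lincomb A cs) < e"
    using cs by (intro exI[of _ ?ds]) auto
qed

lemma closed_span_minus:
  assumes "S \<subseteq> carrier A" "x \<in> closed_span A S" "y \<in> closed_span A S"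
  shows "x \<ominus> y \<in> closed_span A S"
proof -
  have "x \<in> carrier A" "y \<in> carrier A" using assms closed_span_carrier by auto
  then show ?thesis
    using closed_span_add[OF assms(1,2) closed_span_scalar[OF assms(1,3), of "-1"]]
    by (simp add: minus_scalar)
qed

lemma closed_span_mono:
  assumes "S \<subseteq> closed_span A T" "T \<subseteq> carrier A"
  shows "closed_span A S \<subseteq> closed_span A T"
proof
  have S: "S \<subseteq> carrier A" using assms closed_span_carrier by auto
  have lin: "snd ` set cs \<subseteq> S \<Longrightarrow> lincomb A cs \<in> closed_span A T" for cs
  proof (induction cs)
    case Nil then show ?case using lincomb_in_closed_span[OF assms(2), of "[]"] by simp
  next
    case (Cons d cs) then show ?case using assms
      by (cases d) (auto intro!: closed_span_add closed_span_scalar)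
  qed
  fix x assume "x \<in> closed_span A S"
  then show "x \<in> closed_span A T"
    using lin closed_span_iff[OF S, of x] by (intro closed_span_mono_closed[OF assms(2)]) blast+
qed

text \<open>Bilinear extension from generators, one factor at a time: generator times combination,
  generator times limit, combination times limit, limit times limit. Products of generators are only
  required to lie in the closed span.\<close>

lemma closed_span_mult:
  assumes S: "S \<subseteq> carrier A" and prod: "\<And>x y. \<lbrakk>x \<in> S; y \<in> S\<rbrakk> \<Longrightarrow> x \<otimes> y \<in> closed_span A S"
    and x: "x \<in> closed_span A S" and y: "y \<in> closed_span A S"
  shows "x \<otimes> y \<in> closed_span A S"
proof -
  note C = closed_span_carrier[OF S]
  have 1: "u \<otimes> lincomb A cs \<in> closed_span A S" if "u \<in> S" "snd ` set cs \<subseteq> S" for u cs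
    using that(2)
  proof (induction cs)
    case Nil
    have "u \<in> carrier A" using that S by auto
    then show ?case using lincomb_in_closed_span[OF S, of "[]"] by simp
  next
    case (Cons d cs)
    obtain c v where d: "d = (c, v)" by (cases d)
    have "u \<otimes> lincomb A (d # cs) = c \<odot> (u \<otimes> v) \<oplus> u \<otimes> lincomb A cs"
      using that Cons S lincomb_closed[of cs] by (auto simp: d r_distr smult_mult_right subset_iff image_iff)
    then show ?case using that Cons d by (auto intro!: closed_span_add S closed_span_scalar prod)
  qed
  have 2: "u \<otimes> z \<in> closed_span A S" if u: "u \<in> S" and z: "z \<in> closed_span A S" for u z
  proof (rule closed_span_mono_closed[OF S])
    have uz: "u \<in> carrier A" "z \<in> carrier A" using u z S C by auto
    then show "u \<otimes> z \<in> carrier A" by simp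
    fix e :: real assume "e > 0"
    then have "e / (cnorm A u + 1) > 0" using cnorm_nonneg[OF uz(1)] by simp
    then obtain cs where cs: "snd ` set cs \<subseteq> S" "lincomb A cs \<in> carrier A" "cnorm A (z \<ominus> lincomb A cs) < e / (cnorm A u + 1)"
      by (rule closed_span_approx[OF S z])
    have "cnorm A (u \<otimes> z \<ominus> u \<otimes> lincomb A cs) \<le> cnorm A u * cnorm A (z \<ominus> lincomb A cs)"
      using cnorm_mult[of u "z \<ominus> lincomb A cs"] uz cs by (simp add: minus_distrib_right)
    also have "\<dots> \<le> (cnorm A u + 1) * cnorm A (z \<ominus> lincomb A cs)"
      using uz cs by (intro mult_right_mono) (auto simp: cnorm_nonneg)
    also have "\<dots> < e"
      using cs(3) cnorm_nonneg[OF uz(1)] by (simp add: field_simps)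
    finally show "\<exists>y\<in>closed_span A S. cnorm A (u \<otimes> z \<ominus> y) < e" using 1[OF u cs(1)] by auto
  qed
  have 3: "lincomb A cs \<otimes> y \<in> closed_span A S" if "snd ` set cs \<subseteq> S" for cs
    using that
  proof (induction cs)
    case Nil
    have "y \<in> carrier A" using y C by auto
    then show ?case using lincomb_in_closed_span[OF S, of "[]"] by simp
  next
    case (Cons d cs)
    obtain c v where d: "d = (c, v)" by (cases d)
    have "lincomb A (d # cs) \<otimes> y = c \<odot> (v \<otimes> y) \<oplus> lincomb A cs \<otimes> y"
      using y C Cons S lincomb_closed[of cs] by (auto simp: d l_distr smult_mult_left subset_iff image_iff)
    then show ?case using Cons d by (auto intro!: closed_span_add S closed_span_scalar 2 y)
  qed
  show ?thesis
  proof (rule closed_span_mono_closed[OF S])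
    have uz: "x \<in> carrier A" "y \<in> carrier A" using x y C by auto
    then show "x \<otimes> y \<in> carrier A" by simp
    fix e :: real assume "e > 0"
    then have "e / (cnorm A y + 1) > 0" using cnorm_nonneg[OF uz(2)] by simp
    then obtain cs where cs: "snd ` set cs \<subseteq> S" "lincomb A cs \<in> carrier A" "cnorm A (x \<ominus> lincomb A cs) < e / (cnorm A y + 1)"
      by (rule closed_span_approx[OF S x])
    have "cnorm A (x \<otimes> y \<ominus> lincomb A cs \<otimes> y) \<le> cnorm A (x \<ominus> lincomb A cs) * cnorm A y"
      using cnorm_mult[of "x \<ominus> lincomb A cs" y] uz cs by (simp add: minus_distrib_left)
    also have "\<dots> \<le> cnorm A (x \<ominus> lincomb A cs) * (cnorm A y + 1)"
      using uz cs by (intro mult_left_mono) (auto simp: cnorm_nonneg)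
    also have "\<dots> < e"
      using cs(3) cnorm_nonneg[OF uz(2)] by (simp add: field_simps)
    finally show "\<exists>z\<in>closed_span A S. cnorm A (x \<otimes> y \<ominus> z) < e" using 3[OF cs(1)] by auto
  qed
qed

text \<open>By the C*-identity the square of the norm of \<open>x\<close> is at most the norm of
  \<open>star A x\<close> times that of \<open>x\<close>. Cancelling gives one inequality, and
  exchanging \<open>x\<close> with its adjoint gives the other.\<close>

lemma cnorm_star [simp]:
  assumes "x \<in> carrier A"
  shows "cnorm A (star A x) = cnorm A x"
proof -
  have *: "cnorm A x \<le> cnorm A (star A x)" if x: "x \<in> carrier A" for x
  proof (cases "cnorm A x = 0")
    case True then show ?thesis using x cnorm_nonneg by simp
  next
    case False
    have "cnorm A x * cnorm A x \<le> cnorm A (star A x) * cnorm A x"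
      using cstar_identity[OF x] cnorm_mult[of "star A x" x] x by (simp add: power2_eq_square)
    then show ?thesis using False cnorm_nonneg[OF x] by simp
  qed
  show ?thesis using *[of x] *[of "star A x"] assms by simp
qed

lemma closed_span_star:
  assumes S: "S \<subseteq> carrier A" and st: "\<And>x. x \<in> S \<Longrightarrow> star A x \<in> S" and x: "x \<in> closed_span A S"
  shows "star A x \<in> closed_span A S"
  unfolding closed_span_iff[OF S]
proof (intro conjI allI impI)
  have xc: "x \<in> carrier A" using x S closed_span_carrier by auto
  then show "star A x \<in> carrier A" by simp
  have lin: "star A (lincomb A cs) = lincomb A (map (\<lambda>(c, x). (cnj c, star A x)) cs)"
    if "snd ` set cs \<subseteq> carrier A" for cs
    using that by (induction cs) (auto simp: star_add star_smult)
  fix e :: real assume "e > 0"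
  then obtain cs where cs: "snd ` set cs \<subseteq> S" "lincomb A cs \<in> carrier A" "cnorm A (x \<ominus> lincomb A cs) < e"
    by (rule closed_span_approx[OF S x])
  let ?ds = "map (\<lambda>(c, x). (cnj c, star A x)) cs"
  have "star A x \<ominus> lincomb A ?ds = star A (x \<ominus> lincomb A cs)"
    using lin[of cs] cs S xc by (simp add: order.trans)
  then have "cnorm A (star A x \<ominus> lincomb A ?ds) < e" using xc cs by (simp del: star_minus)
  then show "\<exists>cs. snd ` set cs \<subseteq> S \<and> cnorm A (star A x \<ominus> lincomb A cs) < e"
    using cs st by (intro exI[of _ ?ds]) auto
qed

text \<open>Squaring repeatedly by the C*-identity makes the constant \<open>2\<close> disappear after taking roots.\<close>

lemma cnorm_orthogonal_power:
  assumes "u \<in> carrier A" "v \<in> carrier A" "star A u = u" "star A v = v" "u \<otimes> v = \<zero>"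
    "cnorm A u \<le> r" "cnorm A v \<le> r"
  shows "cnorm A (u \<oplus> v) ^ (2 ^ n) \<le> 2 * r ^ (2 ^ n)"
  using assms
proof (induction n arbitrary: u v r)
  case 0
  then show ?case using cnorm_triangle[of u v] by simp
next
  case (Suc n)
  \<comment> \<open>Self-adjointness turns \<open>u \<otimes> v = \<zero>\<close> into its mirror
    image, so both cross terms of the square vanish and the squares satisfy the hypotheses with
    bound \<open>r ^ 2\<close>.\<close>
  have vu: "v \<otimes> u = \<zero>"
    using star_mult[of u v] Suc.prems by simp
  have r: "0 \<le> r" using cnorm_nonneg Suc.prems order.trans by blast
  have sq: "(u \<oplus> v) \<otimes> (u \<oplus> v) = u \<otimes> u \<oplus> v \<otimes> v"
    using Suc.prems vu by (simp add: l_distr r_distr)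
  have "(cnorm A (u \<oplus> v))\<^sup>2 = cnorm A (u \<otimes> u \<oplus> v \<otimes> v)"
    using cstar_identity[of "u \<oplus> v"] Suc.prems sq by (simp add: star_add)
  moreover have "cnorm A (u \<otimes> u \<oplus> v \<otimes> v) ^ (2 ^ n) \<le> 2 * (r\<^sup>2) ^ (2 ^ n)"
  proof (rule Suc.IH)
    have "u \<otimes> u \<otimes> (v \<otimes> v) = u \<otimes> (u \<otimes> v) \<otimes> v"
      using Suc.prems(1,2) by (simp add: m_assoc)
    then show "u \<otimes> u \<otimes> (v \<otimes> v) = \<zero>" using Suc.prems by simp
    show "cnorm A (u \<otimes> u) \<le> r\<^sup>2"
      using cstar_identity[of u] Suc.prems r by (simp add: power_mono cnorm_nonneg)
    show "cnorm A (v \<otimes> v) \<le> r\<^sup>2"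
      using cstar_identity[of v] Suc.prems r by (simp add: power_mono cnorm_nonneg)
  qed (use Suc.prems in \<open>auto simp: star_mult\<close>)
  ultimately show ?case
    by (metis power_Suc power_mult)
qed

text \<open>If the norm exceeded a positive \<open>r\<close> by the factor \<open>q > 1\<close>, all
  \<open>q ^ (2 ^ n)\<close> would be at most \<open>2\<close>, although powers of \<open>q\<close>
  are unbounded. The case \<open>r = 0\<close> is separate because the ratio divides by
  \<open>r\<close>.\<close>

lemma cnorm_orthogonal:
  assumes "u \<in> carrier A" "v \<in> carrier A" "star A u = u" "star A v = v" "u \<otimes> v = \<zero>"
    "cnorm A u \<le> r" "cnorm A v \<le> r"
  shows "cnorm A (u \<oplus> v) \<le> r"
proof (rule ccontr)
  assume "\<not> ?thesis"
  then have gt: "cnorm A (u \<oplus> v) > r" by simp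
  have r: "0 \<le> r" using cnorm_nonneg assms order.trans by blast
  show False
  proof (cases "r = 0")
    case True
    then show False using cnorm_orthogonal_power[OF assms, of 0] gt by simp
  next
    case False
    define q where "q = cnorm A (u \<oplus> v) / r"
    have q: "q > 1" using gt False r by (simp add: q_def)
    obtain n where "q ^ n > 2" using real_arch_pow[OF q] by blast
    moreover have "q ^ n \<le> q ^ (2 ^ n)" using q by (intro power_increasing) (simp_all add: less_imp_le)
    moreover have "q ^ (2 ^ n) \<le> 2"
      using cnorm_orthogonal_power[OF assms, of n] False r
      by (simp add: q_def power_divide field_simps)
    ultimately show False by simp
  qed
qed

text \<open>Here \<open>u\<close> need not be self-adjoint. For \<open>y = e \<otimes> u\<close> and
  \<open>z = (\<one> \<ominus> e) \<otimes> u\<close> the cross terms of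
  \<open>star A u \<otimes> u\<close> vanish, so it is the sum of
  \<open>star A y \<otimes> y\<close> and \<open>star A z \<otimes> z\<close>. These are
  self-adjoint, and orthogonal because \<open>e\<close> commutes with \<open>u\<close>;
  \<open>cnorm_orthogonal\<close> applies with bound \<open>r ^ 2\<close>.\<close>

lemma cnorm_projection_split:
  assumes "e \<in> carrier A" "u \<in> carrier A" "star A e = e" "e \<otimes> e = e" "e \<otimes> u = u \<otimes> e"
    "cnorm A (e \<otimes> u) \<le> r" "cnorm A ((\<one> \<ominus> e) \<otimes> u) \<le> r"
  shows "cnorm A u \<le> r"
proof -
  define y where "y = e \<otimes> u"
  define z where "z = (\<one> \<ominus> e) \<otimes> u"
  have c [simp]: "y \<in> carrier A" "z \<in> carrier A" using assms by (auto simp: y_def z_def)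
  have z': "z = u \<ominus> e \<otimes> u" using assms by (simp add: z_def minus_distrib_left)
  have u: "u = y \<oplus> z" using assms(1,2) unfolding y_def z' by algebra
  have eu': "e \<otimes> star A u = star A u \<otimes> e"
    by (metis star_mult assms(1,2,3,5))
  have ez: "e \<otimes> z = \<zero>"
    using assms(1,2,4) by (simp add: z' minus_distrib_right flip: m_assoc)
  have ze: "z \<otimes> e = \<zero>"
    using assms(1,2,4) by (simp add: z' minus_distrib_left assms(5) m_assoc)
  have ez': "e \<otimes> star A z = \<zero>" using star_mult[of z e] ze assms(1-4) by simp
  have ze': "star A z \<otimes> e = \<zero>" using star_mult[of e z] ez assms(1-4) by simp
  have sy: "star A y = star A u \<otimes> e" using assms(1-4) by (simp add: y_def star_mult)
  have yz: "star A y \<otimes> z = \<zero>" using assms sy ez by (simp add: m_assoc)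
  have zy: "star A z \<otimes> y = \<zero>" using assms(1,2) ze' by (simp add: y_def flip: m_assoc)
  have yz': "y \<otimes> star A z = \<zero>"
    using assms(1,2) ez' by (simp add: y_def assms(5) m_assoc)
  have r: "0 \<le> r" using cnorm_nonneg assms(1,2,6) order.trans by blast
  have "(cnorm A u)\<^sup>2 = cnorm A (star A y \<otimes> y \<oplus> star A z \<otimes> z)"
  proof -
    have "star A (y \<oplus> z) \<otimes> (y \<oplus> z) = star A y \<otimes> y \<oplus> star A z \<otimes> z"
      using yz zy by (simp add: star_add l_distr r_distr)
    then show ?thesis using cstar_identity[of "y \<oplus> z"] u by simp
  qed
  also have "\<dots> \<le> r\<^sup>2"
  proof (rule cnorm_orthogonal)
    have "star A y \<otimes> y \<otimes> (star A z \<otimes> z) = star A y \<otimes> (y \<otimes> star A z) \<otimes> z"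
      by (simp add: m_assoc)
    then show "star A y \<otimes> y \<otimes> (star A z \<otimes> z) = \<zero>" using yz' by simp
    show "cnorm A (star A y \<otimes> y) \<le> r\<^sup>2" "cnorm A (star A z \<otimes> z) \<le> r\<^sup>2"
      using assms r by (simp_all add: cstar_identity power_mono cnorm_nonneg y_def z_def)
  qed (simp_all add: star_mult)
  finally show ?thesis using r by (simp add: power2_le_iff_abs_le)
qed

lemma cnorm_projection_le_1:
  assumes "e \<in> carrier A" "star A e = e" "e \<otimes> e = e"
  shows "cnorm A e \<le> 1"
proof -
  have "(cnorm A e)\<^sup>2 = cnorm A e" using cstar_identity[OF assms(1)] assms by simp
  then show ?thesis by (auto simp: power2_eq_square)
qed

end


section \<open>Hausdorff completions\<close>

locale cstar_seminormed_algebra = unital_star_algebra F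
  for F :: "('a, 'x) star_algebra_scheme" (structure) +
  fixes N :: "'a \<Rightarrow> real"
  assumes seminorm: "cstar_seminorm F N"
begin

lemma N_nonneg [simp]: "x \<in> carrier F \<Longrightarrow> 0 \<le> N x"
  using seminorm unfolding cstar_seminorm_def by blast

lemma N_triangle: "\<lbrakk>x \<in> carrier F; y \<in> carrier F\<rbrakk> \<Longrightarrow> N (x \<oplus> y) \<le> N x + N y"
  using seminorm unfolding cstar_seminorm_def by blast

lemma N_smult: "x \<in> carrier F \<Longrightarrow> N (c \<odot> x) = cmod c * N x"
  using seminorm unfolding cstar_seminorm_def by blast

lemma N_mult: "\<lbrakk>x \<in> carrier F; y \<in> carrier F\<rbrakk> \<Longrightarrow> N (x \<otimes> y) \<le> N x * N y"
  using seminorm unfolding cstar_seminorm_def by blast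

lemma N_cstar: "x \<in> carrier F \<Longrightarrow> N (star F x \<otimes> x) = (N x)\<^sup>2"
  using seminorm unfolding cstar_seminorm_def by blast

lemma N_zero [simp]: "N \<zero> = 0"
  using N_smult[of \<zero> 0] by simp

lemma N_minus_sym:
  assumes "x \<in> carrier F" "y \<in> carrier F"
  shows "N (x \<ominus> y) = N (y \<ominus> x)"
proof -
  have "x \<ominus> y = \<ominus> (y \<ominus> x)" using assms by algebra
  also have "\<dots> = (-1) \<odot> (y \<ominus> x)" using assms by (simp add: scalar_minus_one)
  finally show ?thesis using assms by (simp add: N_smult)
qed

lemma N_minus_triangle:
  assumes "x \<in> carrier F" "y \<in> carrier F" "z \<in> carrier F"
  shows "N (x \<ominus> z) \<le> N (x \<ominus> y) + N (y \<ominus> z)"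
  using N_triangle[of "x \<ominus> y" "y \<ominus> z"] assms by (simp add: minus_add_minus)

lemma N_diff:
  assumes "x \<in> carrier F" "y \<in> carrier F"
  shows "\<bar>N x - N y\<bar> \<le> N (x \<ominus> y)"
  using N_minus_triangle[of x y \<zero>] N_minus_triangle[of y x \<zero>] N_minus_sym[of x y] assms by simp

lemma N_star [simp]:
  assumes "x \<in> carrier F"
  shows "N (star F x) = N x"
proof -
  have *: "N x \<le> N (star F x)" if x: "x \<in> carrier F" for x
  proof (cases "N x = 0")
    case True then show ?thesis using x N_nonneg by simp
  next
    case False
    have "N x * N x \<le> N (star F x) * N x"
      using N_cstar[OF x] N_mult[of "star F x" x] x by (simp add: power2_eq_square)
    then show ?thesis using False N_nonneg[OF x] by simp
  qed
  show ?thesis using *[of x] *[of "star F x"] assms by simp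
qed

abbreviation "cauchy \<equiv> seminorm_cauchy F N"
abbreviation "cls \<equiv> cauchy_class F N"
abbreviation "C \<equiv> hausdorff_completion F N"

definition null :: "(nat \<Rightarrow> 'a) \<Rightarrow> (nat \<Rightarrow> 'a) \<Rightarrow> bool" where
  "null X Y \<longleftrightarrow> (\<lambda>n. N (X n \<ominus> Y n)) \<longlonglongrightarrow> 0"

lemma cauchy_carrier [simp]: "cauchy X \<Longrightarrow> X n \<in> carrier F"
  unfolding seminorm_cauchy_def by auto

lemma cauchyD: "cauchy X \<Longrightarrow> e > 0 \<Longrightarrow> \<exists>M. \<forall>m\<ge>M. \<forall>n\<ge>M. N (X m \<ominus> X n) < e"
  unfolding seminorm_cauchy_def by auto

lemma cauchyI:
  assumes "\<And>n. X n \<in> carrier F" "\<And>e. e > 0 \<Longrightarrow> \<exists>M. \<forall>m\<ge>M. \<forall>n\<ge>M. N (X m \<ominus> X n) < e"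
  shows "cauchy X"
  using assms unfolding seminorm_cauchy_def by auto

lemma cauchy_bounded:
  assumes "cauchy X"
  obtains b where "b > 0" "\<And>n. N (X n) \<le> b"
proof -
  obtain M where M: "\<forall>m\<ge>M. \<forall>n\<ge>M. N (X m \<ominus> X n) < 1" using cauchyD[OF assms, of 1] by auto
  define b where "b = Max ((\<lambda>n. N (X n)) ` {..M}) + 1"
  have le: "N (X n) \<le> b" for n
  proof (cases "n \<le> M")
    case True
    then have "N (X n) \<le> Max ((\<lambda>n. N (X n)) ` {..M})" by (intro Max_ge) auto
    then show ?thesis by (simp add: b_def)
  next
    case False
    then have "N (X n \<ominus> X M) < 1" using M by simp
    moreover have "N (X M) \<le> Max ((\<lambda>n. N (X n)) ` {..M})" by (intro Max_ge) auto
    moreover have "\<bar>N (X n) - N (X M)\<bar> \<le> N (X n \<ominus> X M)" using assms by (intro N_diff) auto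
    ultimately show ?thesis unfolding b_def by linarith
  qed
  show ?thesis
  proof (rule that[of "b + 1"])
    have "0 \<le> N (X 0)" using assms by simp
    then show "b + 1 > 0" using le[of 0] by linarith
    show "\<And>n. N (X n) \<le> b + 1" using le by (simp add: add_increasing2)
  qed
qed

lemma cauchy_const [simp]: "x \<in> carrier F \<Longrightarrow> cauchy (\<lambda>_. x)"
  by (intro cauchyI) auto

lemma cauchy_add [simp]:
  assumes "cauchy X" "cauchy Y"
  shows "cauchy (\<lambda>n. X n \<oplus> Y n)"
proof (rule cauchyI)
  show "X n \<oplus> Y n \<in> carrier F" for n using assms by simp
  fix e :: real assume e: "e > 0"
  obtain M where M: "\<forall>m\<ge>M. \<forall>n\<ge>M. N (X m \<ominus> X n) < e/2" using cauchyD[OF assms(1), of "e/2"] e by auto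
  obtain L where L: "\<forall>m\<ge>L. \<forall>n\<ge>L. N (Y m \<ominus> Y n) < e/2" using cauchyD[OF assms(2), of "e/2"] e by auto
  show "\<exists>M. \<forall>m\<ge>M. \<forall>n\<ge>M. N (X m \<oplus> Y m \<ominus> (X n \<oplus> Y n)) < e"
  proof (intro exI[of _ "max M L"] allI impI)
    fix m n assume "max M L \<le> m" "max M L \<le> n"
    then have "N (X m \<ominus> X n) < e/2" "N (Y m \<ominus> Y n) < e/2" using M L by auto
    then show "N (X m \<oplus> Y m \<ominus> (X n \<oplus> Y n)) < e"
      using N_triangle[of "X m \<ominus> X n" "Y m \<ominus> Y n"] assms by (simp add: add_minus_add)
  qed
qed

lemma N_scalar_minus:
  "\<lbrakk>x \<in> carrier F; y \<in> carrier F\<rbrakk> \<Longrightarrow> N (c \<odot> x \<ominus> c \<odot> y) = cmod c * N (x \<ominus> y)"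
  using N_smult[of "x \<ominus> y" c] by (simp add: scalar_minus)

lemma N_star_minus:
  "\<lbrakk>x \<in> carrier F; y \<in> carrier F\<rbrakk> \<Longrightarrow> N (star F x \<ominus> star F y) = N (x \<ominus> y)"
  using N_star[of "x \<ominus> y"] by simp

text \<open>Splitting the difference as \<open>(x \<ominus> x') \<otimes> y\<close> plus
  \<open>x' \<otimes> (y \<ominus> y')\<close> shows that only \<open>y\<close> and
  \<open>x'\<close> need bounds. It gives both that products of Cauchy sequences are Cauchy and that
  the product of classes is well defined.\<close>

lemma N_mult_minus:
  assumes "x \<in> carrier F" "y \<in> carrier F" "x' \<in> carrier F" "y' \<in> carrier F" "N y \<le> b" "N x' \<le> b"
  shows "N (x \<otimes> y \<ominus> x' \<otimes> y') \<le> b * (N (x \<ominus> x') + N (y \<ominus> y'))"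
proof -
  have "N (x \<otimes> y \<ominus> x' \<otimes> y') \<le> N ((x \<ominus> x') \<otimes> y) + N (x' \<otimes> (y \<ominus> y'))"
    using assms by (subst mult_minus_mult) (auto intro!: N_triangle)
  also have "\<dots> \<le> N (x \<ominus> x') * N y + N x' * N (y \<ominus> y')"
    using assms by (intro add_mono N_mult) auto
  also have "\<dots> \<le> N (x \<ominus> x') * b + b * N (y \<ominus> y')"
    using assms by (intro add_mono mult_left_mono mult_right_mono) auto
  finally show ?thesis by (simp add: algebra_simps)
qed

lemma cauchy_smult [simp]:
  assumes "cauchy X"
  shows "cauchy (\<lambda>n. c \<odot> X n)"
proof (rule cauchyI)
  show "c \<odot> X n \<in> carrier F" for n using assms by simp
  fix e :: real assume "e > 0"
  then have "e / (cmod c + 1) > 0" by (simp add: add_nonneg_pos)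
  then obtain M where M: "\<forall>m\<ge>M. \<forall>n\<ge>M. N (X m \<ominus> X n) < e / (cmod c + 1)" using cauchyD[OF assms] by blast
  show "\<exists>M. \<forall>m\<ge>M. \<forall>n\<ge>M. N (c \<odot> X m \<ominus> c \<odot> X n) < e"
  proof (intro exI[of _ M] allI impI)
    fix m n assume "M \<le> m" "M \<le> n"
    then have "N (X m \<ominus> X n) < e / (cmod c + 1)" using M by auto
    then have "(cmod c + 1) * N (X m \<ominus> X n) < e" by (simp add: pos_less_divide_eq add_nonneg_pos mult.commute)
    moreover have "cmod c * N (X m \<ominus> X n) \<le> (cmod c + 1) * N (X m \<ominus> X n)"
      using assms by (intro mult_right_mono) auto
    ultimately show "N (c \<odot> X m \<ominus> c \<odot> X n) < e"
      using assms by (simp add: N_scalar_minus)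
  qed
qed

lemma cauchy_star [simp]: "cauchy X \<Longrightarrow> cauchy (\<lambda>n. star F (X n))"
  using cauchyD[of X] by (intro cauchyI) (simp_all add: N_star_minus)

lemma cauchy_mult [simp]:
  assumes "cauchy X" "cauchy Y"
  shows "cauchy (\<lambda>n. X n \<otimes> Y n)"
proof (rule cauchyI)
  show "X n \<otimes> Y n \<in> carrier F" for n using assms by simp
  fix e :: real assume e: "e > 0"
  obtain b1 where b1: "b1 > 0" "\<And>n. N (X n) \<le> b1" using cauchy_bounded[OF assms(1)] by blast
  obtain b2 where b2: "b2 > 0" "\<And>n. N (Y n) \<le> b2" using cauchy_bounded[OF assms(2)] by blast
  define b where "b = max b1 b2"
  have b: "b > 0" "\<And>n. N (X n) \<le> b" "\<And>n. N (Y n) \<le> b"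
    using b1 b2 by (auto simp: b_def le_max_iff_disj)
  \<comment> \<open>Chosen so that the bound \<open>b * (d + d)\<close> from
    \<open>N_mult_minus\<close> equals \<open>e\<close>.\<close>
  define d where "d = e / (2 * b)"
  have d: "d > 0" using e b by (simp add: d_def)
  obtain M where M: "\<forall>m\<ge>M. \<forall>n\<ge>M. N (X m \<ominus> X n) < d" using cauchyD[OF assms(1) d] by auto
  obtain L where L: "\<forall>m\<ge>L. \<forall>n\<ge>L. N (Y m \<ominus> Y n) < d" using cauchyD[OF assms(2) d] by auto
  show "\<exists>M. \<forall>m\<ge>M. \<forall>n\<ge>M. N (X m \<otimes> Y m \<ominus> (X n \<otimes> Y n)) < e"
  proof (intro exI[of _ "max M L"] allI impI)
    fix m n assume "max M L \<le> m" "max M L \<le> n"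
    then have "N (X m \<ominus> X n) + N (Y m \<ominus> Y n) < 2 * d" using M L by (smt (verit) max.boundedE)
    then have "b * (N (X m \<ominus> X n) + N (Y m \<ominus> Y n)) < b * (2 * d)"
      using b by (intro mult_strict_left_mono) auto
    also have "b * (2 * d) = e" using b by (simp add: d_def)
    finally show "N (X m \<otimes> Y m \<ominus> (X n \<otimes> Y n)) < e"
      using N_mult_minus[of "X m" "Y m" "X n" "Y n" b] assms b by simp
  qed
qed

lemma null_refl [simp]: "cauchy X \<Longrightarrow> null X X"
  by (simp add: null_def)

lemma null_sym: "cauchy X \<Longrightarrow> cauchy Y \<Longrightarrow> null X Y \<Longrightarrow> null Y X"
  by (simp add: null_def N_minus_sym)

lemma null_trans:
  assumes "cauchy X" "cauchy Y" "cauchy Z" "null X Y" "null Y Z"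
  shows "null X Z"
  unfolding null_def
proof (rule tendsto_zero_le)
  show "(\<lambda>n. N (X n \<ominus> Y n) + N (Y n \<ominus> Z n)) \<longlonglongrightarrow> 0"
    using tendsto_add[of "\<lambda>n. N (X n \<ominus> Y n)" 0 _ "\<lambda>n. N (Y n \<ominus> Z n)" 0] assms by (simp add: null_def)
qed (use assms in \<open>auto intro!: N_minus_triangle\<close>)

lemma null_add:
  assumes "cauchy X" "cauchy Y" "cauchy X'" "cauchy Y'" "null X X'" "null Y Y'"
  shows "null (\<lambda>n. X n \<oplus> Y n) (\<lambda>n. X' n \<oplus> Y' n)"
  unfolding null_def
proof (rule tendsto_zero_le)
  show "(\<lambda>n. N (X n \<ominus> X' n) + N (Y n \<ominus> Y' n)) \<longlonglongrightarrow> 0"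
    using tendsto_add[of "\<lambda>n. N (X n \<ominus> X' n)" 0 _ "\<lambda>n. N (Y n \<ominus> Y' n)" 0] assms by (simp add: null_def)
qed (use assms in \<open>auto simp: add_minus_add intro!: N_triangle\<close>)

lemma null_mult:
  assumes "cauchy X" "cauchy Y" "cauchy X'" "cauchy Y'" "null X X'" "null Y Y'"
  shows "null (\<lambda>n. X n \<otimes> Y n) (\<lambda>n. X' n \<otimes> Y' n)"
proof -
  obtain b1 where b1: "b1 > 0" "\<And>n. N (X' n) \<le> b1" using cauchy_bounded[OF assms(3)] by blast
  obtain b2 where b2: "b2 > 0" "\<And>n. N (Y n) \<le> b2" using cauchy_bounded[OF assms(2)] by blast
  define b where "b = max b1 b2"
  have b: "\<And>n. N (X' n) \<le> b" "\<And>n. N (Y n) \<le> b"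
    using b1 b2 by (auto simp: b_def le_max_iff_disj)
  show ?thesis
    unfolding null_def
  proof (rule tendsto_zero_le)
    show "(\<lambda>n. b * (N (X n \<ominus> X' n) + N (Y n \<ominus> Y' n))) \<longlonglongrightarrow> 0"
      using tendsto_mult_left[OF tendsto_add[of "\<lambda>n. N (X n \<ominus> X' n)" 0 sequentially "\<lambda>n. N (Y n \<ominus> Y' n)" 0], of b] assms
      by (simp add: null_def)
  qed (use assms b in \<open>auto intro!: N_mult_minus\<close>)
qed

lemma null_smult:
  assumes "cauchy X" "cauchy X'" "null X X'"
  shows "null (\<lambda>n. c \<odot> X n) (\<lambda>n. c \<odot> X' n)"
  using tendsto_mult_left[of "\<lambda>n. N (X n \<ominus> X' n)" 0 _ "cmod c"] assms
  by (simp add: null_def N_scalar_minus)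

lemma null_star:
  assumes "cauchy X" "cauchy X'" "null X X'"
  shows "null (\<lambda>n. star F (X n)) (\<lambda>n. star F (X' n))"
  using assms by (simp add: null_def N_star_minus)

lemma mem_cls: "Y \<in> cls X \<longleftrightarrow> cauchy Y \<and> null X Y"
  by (simp add: cauchy_class_def null_def)

lemma self_mem_cls [simp]: "cauchy X \<Longrightarrow> X \<in> cls X"
  by (simp add: mem_cls)

lemma cls_eq_iff: "cauchy X \<Longrightarrow> cauchy Y \<Longrightarrow> cls X = cls Y \<longleftrightarrow> null X Y"
  by (auto simp: mem_cls set_eq_iff intro: null_sym null_trans)

lemma cls_eqI: "cauchy X \<Longrightarrow> cauchy Y \<Longrightarrow> null X Y \<Longrightarrow> cls X = cls Y"
  by (simp add: cls_eq_iff)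

lemma carrier_C: "carrier C = cls ` {X. cauchy X}"
  by (simp add: hausdorff_completion_def)

lemma cls_carrier [simp]: "cauchy X \<Longrightarrow> cls X \<in> carrier C"
  by (simp add: carrier_C)

lemma carrier_C_cases:
  assumes "c \<in> carrier C"
  obtains X where "cauchy X" "c = cls X"
  using assms by (auto simp: carrier_C)

text \<open>Changing representatives changes the result by a null sequence, so the union in the
  definition is a union of equal sets over a nonempty index set. The same argument evaluates the
  other operations.\<close>

lemma add_C [simp]:
  assumes "cauchy X" "cauchy Y"
  shows "cls X \<oplus>\<^bsub>C\<^esub> cls Y = cls (\<lambda>n. X n \<oplus> Y n)"
proof -
  have "cls (\<lambda>n. X' n \<oplus> Y' n) = cls (\<lambda>n. X n \<oplus> Y n)" if "X' \<in> cls X" "Y' \<in> cls Y" for X' Y'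
    using that assms by (intro cls_eqI null_add cauchy_add) (auto simp: mem_cls null_sym)
  then have "(\<Union>X'\<in>cls X. \<Union>Y'\<in>cls Y. cls (\<lambda>n. X' n \<oplus> Y' n))
      = (\<Union>X'\<in>cls X. \<Union>Y'\<in>cls Y. cls (\<lambda>n. X n \<oplus> Y n))" by simp
  also have "\<dots> = cls (\<lambda>n. X n \<oplus> Y n)" using self_mem_cls assms by blast
  finally show ?thesis by (simp add: hausdorff_completion_def)
qed

lemma mult_C [simp]:
  assumes "cauchy X" "cauchy Y"
  shows "cls X \<otimes>\<^bsub>C\<^esub> cls Y = cls (\<lambda>n. X n \<otimes> Y n)"
proof -
  have "cls (\<lambda>n. X' n \<otimes> Y' n) = cls (\<lambda>n. X n \<otimes> Y n)" if "X' \<in> cls X" "Y' \<in> cls Y" for X' Y'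
    using that assms by (intro cls_eqI null_mult cauchy_mult) (auto simp: mem_cls null_sym)
  then have "(\<Union>X'\<in>cls X. \<Union>Y'\<in>cls Y. cls (\<lambda>n. X' n \<otimes> Y' n))
      = (\<Union>X'\<in>cls X. \<Union>Y'\<in>cls Y. cls (\<lambda>n. X n \<otimes> Y n))" by simp
  also have "\<dots> = cls (\<lambda>n. X n \<otimes> Y n)" using self_mem_cls assms by blast
  finally show ?thesis by (simp add: hausdorff_completion_def)
qed

lemma smult_C [simp]:
  assumes "cauchy X"
  shows "c \<odot>\<^bsub>C\<^esub> cls X = cls (\<lambda>n. c \<odot> X n)"
proof -
  have "cls (\<lambda>n. c \<odot> X' n) = cls (\<lambda>n. c \<odot> X n)" if "X' \<in> cls X" for X'
    using that assms by (intro cls_eqI null_smult cauchy_smult) (auto simp: mem_cls null_sym)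
  then have "(\<Union>X'\<in>cls X. cls (\<lambda>n. c \<odot> X' n)) = (\<Union>X'\<in>cls X. cls (\<lambda>n. c \<odot> X n))" by simp
  also have "\<dots> = cls (\<lambda>n. c \<odot> X n)" using self_mem_cls assms by blast
  finally show ?thesis by (simp add: hausdorff_completion_def)
qed

lemma star_C [simp]:
  assumes "cauchy X"
  shows "star C (cls X) = cls (\<lambda>n. star F (X n))"
proof -
  have "cls (\<lambda>n. star F (X' n)) = cls (\<lambda>n. star F (X n))" if "X' \<in> cls X" for X'
    using that assms by (intro cls_eqI null_star cauchy_star) (auto simp: mem_cls null_sym)
  then have "(\<Union>X'\<in>cls X. cls (\<lambda>n. star F (X' n))) = (\<Union>X'\<in>cls X. cls (\<lambda>n. star F (X n)))" by simp
  also have "\<dots> = cls (\<lambda>n. star F (X n))" using self_mem_cls assms by blast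
  finally show ?thesis by (simp add: hausdorff_completion_def)
qed

lemma one_C: "\<one>\<^bsub>C\<^esub> = cls (\<lambda>_. \<one>)" and zero_C: "\<zero>\<^bsub>C\<^esub> = cls (\<lambda>_. \<zero>)"
  by (simp_all add: hausdorff_completion_def)

lemma N_convergent:
  assumes "cauchy X"
  shows "convergent (\<lambda>n. N (X n))"
proof (rule Cauchy_convergent, rule CauchyI)
  fix e :: real assume "e > 0"
  then obtain M where M: "\<forall>m\<ge>M. \<forall>n\<ge>M. N (X m \<ominus> X n) < e" using cauchyD[OF assms] by blast
  show "\<exists>M. \<forall>m\<ge>M. \<forall>n\<ge>M. norm (N (X m) - N (X n)) < e"
  proof (intro exI[of _ M] allI impI)
    fix m n assume "M \<le> m" "M \<le> n"
    then show "norm (N (X m) - N (X n)) < e"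
      using M N_diff[of "X m" "X n"] assms by (smt (verit) cauchy_carrier real_norm_def)
  qed
qed

text \<open>The norm in the definition uses a representative picked by \<open>SOME\<close>; the
  reverse triangle inequality \<open>N_diff\<close> shows that every representative has the same
  limit.\<close>

lemma cnorm_C:
  assumes "cauchy X"
  shows "(\<lambda>n. N (X n)) \<longlonglongrightarrow> cnorm C (cls X)"
proof -
  define Y where "Y = (SOME Y. Y \<in> cls X)"
  have "Y \<in> cls X" unfolding Y_def by (rule someI[of _ X]) (simp add: assms)
  then have Y: "cauchy Y" "null X Y" by (auto simp: mem_cls)
  have lim: "(\<lambda>n. N (Y n)) \<longlonglongrightarrow> cnorm C (cls X)"
    using N_convergent[OF Y(1)] by (simp add: hausdorff_completion_def Y_def convergent_LIMSEQ_iff)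
  have "(\<lambda>n. N (X n) - N (Y n)) \<longlonglongrightarrow> 0"
  proof (rule Lim_null_comparison)
    show "(\<lambda>n. N (X n \<ominus> Y n)) \<longlonglongrightarrow> 0" using Y by (simp add: null_def)
    show "\<forall>\<^sub>F n in sequentially. norm (N (X n) - N (Y n)) \<le> N (X n \<ominus> Y n)"
      using N_diff assms Y by (intro always_eventually) auto
  qed
  from tendsto_add[OF this lim] show ?thesis by simp
qed

text \<open>Every axiom holds termwise on representatives, since the operations on classes have been
  reduced to termwise operations.\<close>

lemma unital_star_algebra_C: "unital_star_algebra C"
proof -
  have "abelian_group C"
  proof (rule abelian_groupI)
    show "\<zero>\<^bsub>C\<^esub> \<in> carrier C" by (simp add: zero_C)
    fix x assume "x \<in> carrier C"
    then obtain X where X: "cauchy X" "x = cls X" by (rule carrier_C_cases)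
    show "\<zero>\<^bsub>C\<^esub> \<oplus>\<^bsub>C\<^esub> x = x" using X by (simp add: zero_C)
    show "\<exists>y\<in>carrier C. y \<oplus>\<^bsub>C\<^esub> x = \<zero>\<^bsub>C\<^esub>"
    proof (rule bexI[of _ "cls (\<lambda>n. (- 1) \<odot> X n)"])
      show "cls (\<lambda>n. - 1 \<odot> X n) \<oplus>\<^bsub>C\<^esub> x = \<zero>\<^bsub>C\<^esub>"
        unfolding X(2) zero_C add_C[OF cauchy_smult[OF X(1)] X(1)]
        using X by (simp add: scalar_minus_one l_neg)
    qed (use X in simp)
    fix y assume "y \<in> carrier C"
    then obtain Y where Y: "cauchy Y" "y = cls Y" by (rule carrier_C_cases)
    show "x \<oplus>\<^bsub>C\<^esub> y \<in> carrier C" "x \<oplus>\<^bsub>C\<^esub> y = y \<oplus>\<^bsub>C\<^esub> x"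
      using X Y by (simp_all add: a_comm)
    fix z assume "z \<in> carrier C"
    then obtain Z where Z: "cauchy Z" "z = cls Z" by (rule carrier_C_cases)
    show "x \<oplus>\<^bsub>C\<^esub> y \<oplus>\<^bsub>C\<^esub> z = x \<oplus>\<^bsub>C\<^esub> (y \<oplus>\<^bsub>C\<^esub> z)" using X Y Z by (simp add: a_assoc)
  qed
  moreover have "monoid C"
  proof (rule monoidI)
    show "\<one>\<^bsub>C\<^esub> \<in> carrier C" by (simp add: one_C)
    fix x assume "x \<in> carrier C"
    then obtain X where X: "cauchy X" "x = cls X" by (rule carrier_C_cases)
    show "\<one>\<^bsub>C\<^esub> \<otimes>\<^bsub>C\<^esub> x = x" "x \<otimes>\<^bsub>C\<^esub> \<one>\<^bsub>C\<^esub> = x" using X by (simp_all add: one_C)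
    fix y assume "y \<in> carrier C"
    then obtain Y where Y: "cauchy Y" "y = cls Y" by (rule carrier_C_cases)
    show "x \<otimes>\<^bsub>C\<^esub> y \<in> carrier C" using X Y by simp
    fix z assume "z \<in> carrier C"
    then obtain Z where Z: "cauchy Z" "z = cls Z" by (rule carrier_C_cases)
    show "x \<otimes>\<^bsub>C\<^esub> y \<otimes>\<^bsub>C\<^esub> z = x \<otimes>\<^bsub>C\<^esub> (y \<otimes>\<^bsub>C\<^esub> z)" using X Y Z by (simp add: m_assoc)
  qed
  ultimately have "ring C"
  proof (rule ringI)
    fix x y z assume "x \<in> carrier C" "y \<in> carrier C" "z \<in> carrier C"
    then obtain X Y Z where "cauchy X" "x = cls X" "cauchy Y" "y = cls Y" "cauchy Z" "z = cls Z"
      by (meson carrier_C_cases)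
    then show "(x \<oplus>\<^bsub>C\<^esub> y) \<otimes>\<^bsub>C\<^esub> z = x \<otimes>\<^bsub>C\<^esub> z \<oplus>\<^bsub>C\<^esub> y \<otimes>\<^bsub>C\<^esub> z"
      "z \<otimes>\<^bsub>C\<^esub> (x \<oplus>\<^bsub>C\<^esub> y) = z \<otimes>\<^bsub>C\<^esub> x \<oplus>\<^bsub>C\<^esub> z \<otimes>\<^bsub>C\<^esub> y"
      by (simp_all add: l_distr r_distr)
  qed
  then show ?thesis
  proof (rule unital_star_algebra.intro, unfold_locales, goal_cases)
    fix x c d assume "x \<in> carrier C"
    then obtain X where X: "cauchy X" "x = cls X" by (rule carrier_C_cases)
    show "c \<odot>\<^bsub>C\<^esub> x \<in> carrier C" "(c + d) \<odot>\<^bsub>C\<^esub> x = c \<odot>\<^bsub>C\<^esub> x \<oplus>\<^bsub>C\<^esub> d \<odot>\<^bsub>C\<^esub> x"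
      "c \<odot>\<^bsub>C\<^esub> (d \<odot>\<^bsub>C\<^esub> x) = (c * d) \<odot>\<^bsub>C\<^esub> x" "1 \<odot>\<^bsub>C\<^esub> x = x"
      "star C x \<in> carrier C" "star C (star C x) = x" "star C (c \<odot>\<^bsub>C\<^esub> x) = cnj c \<odot>\<^bsub>C\<^esub> star C x"
      using X by (simp_all add: scalar_add scalar_scalar star_smult)
    fix y assume "y \<in> carrier C"
    then obtain Y where Y: "cauchy Y" "y = cls Y" by (rule carrier_C_cases)
    show "c \<odot>\<^bsub>C\<^esub> (x \<oplus>\<^bsub>C\<^esub> y) = c \<odot>\<^bsub>C\<^esub> x \<oplus>\<^bsub>C\<^esub> c \<odot>\<^bsub>C\<^esub> y"
      "(c \<odot>\<^bsub>C\<^esub> x) \<otimes>\<^bsub>C\<^esub> y = c \<odot>\<^bsub>C\<^esub> (x \<otimes>\<^bsub>C\<^esub> y)" "x \<otimes>\<^bsub>C\<^esub> (c \<odot>\<^bsub>C\<^esub> y) = c \<odot>\<^bsub>C\<^esub> (x \<otimes>\<^bsub>C\<^esub> y)"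
      "star C (x \<oplus>\<^bsub>C\<^esub> y) = star C x \<oplus>\<^bsub>C\<^esub> star C y" "star C (x \<otimes>\<^bsub>C\<^esub> y) = star C y \<otimes>\<^bsub>C\<^esub> star C x"
      using X Y by (simp_all add: scalar_add_right smult_mult_left smult_mult_right star_add star_mult)
  qed
qed

sublocale C: unital_star_algebra C by (rule unital_star_algebra_C)

lemma minus_C [simp]:
  assumes "cauchy X" "cauchy Y"
  shows "cls X \<ominus>\<^bsub>C\<^esub> cls Y = cls (\<lambda>n. X n \<ominus> Y n)"
  using assms by (simp add: C.minus_scalar minus_scalar)

lemma cauchy_minus [simp]:
  assumes "cauchy X" "cauchy Y"
  shows "cauchy (\<lambda>n. X n \<ominus> Y n)"
  using cauchy_add[OF assms(1) cauchy_smult[OF assms(2), of "-1"]] assms by (simp add: minus_scalar)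

lemma cnorm_C_const [simp]: "x \<in> carrier F \<Longrightarrow> cnorm C (cls (\<lambda>_. x)) = N x"
  using cnorm_C[of "\<lambda>_. x"] LIMSEQ_unique by (metis cauchy_const tendsto_const)

lemma C_triangle:
  assumes "x \<in> carrier C" "y \<in> carrier C"
  shows "cnorm C (x \<oplus>\<^bsub>C\<^esub> y) \<le> cnorm C x + cnorm C y"
proof -
  obtain X Y where X: "cauchy X" "x = cls X" and Y: "cauchy Y" "y = cls Y"
    using assms by (meson carrier_C_cases)
  have "(\<lambda>n. N (X n \<oplus> Y n)) \<longlonglongrightarrow> cnorm C (x \<oplus>\<^bsub>C\<^esub> y)"
    using cnorm_C[of "\<lambda>n. X n \<oplus> Y n"] X Y by simp
  moreover have "(\<lambda>n. N (X n) + N (Y n)) \<longlonglongrightarrow> cnorm C x + cnorm C y"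
    using cnorm_C X Y by (intro tendsto_add) auto
  ultimately show ?thesis
    using X Y N_triangle by (intro LIMSEQ_le) auto
qed

lemma C_mult:
  assumes "x \<in> carrier C" "y \<in> carrier C"
  shows "cnorm C (x \<otimes>\<^bsub>C\<^esub> y) \<le> cnorm C x * cnorm C y"
proof -
  obtain X Y where X: "cauchy X" "x = cls X" and Y: "cauchy Y" "y = cls Y"
    using assms by (meson carrier_C_cases)
  have "(\<lambda>n. N (X n \<otimes> Y n)) \<longlonglongrightarrow> cnorm C (x \<otimes>\<^bsub>C\<^esub> y)"
    using cnorm_C[of "\<lambda>n. X n \<otimes> Y n"] X Y by simp
  moreover have "(\<lambda>n. N (X n) * N (Y n)) \<longlonglongrightarrow> cnorm C x * cnorm C y"
    using cnorm_C X Y by (intro tendsto_mult) auto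
  ultimately show ?thesis
    using X Y N_mult by (intro LIMSEQ_le) auto
qed

lemma C_norm:
  assumes "x \<in> carrier C"
  shows "0 \<le> cnorm C x" "cnorm C x = 0 \<longleftrightarrow> x = \<zero>\<^bsub>C\<^esub>" "cnorm C (c \<odot>\<^bsub>C\<^esub> x) = cmod c * cnorm C x"
    "cnorm C (star C x \<otimes>\<^bsub>C\<^esub> x) = (cnorm C x)\<^sup>2"
proof -
  obtain X where X: "cauchy X" "x = cls X" using assms by (rule carrier_C_cases)
  note lim = cnorm_C[OF X(1), folded X(2)]
  show "0 \<le> cnorm C x"
    by (rule LIMSEQ_le_const[OF lim]) (use X in auto)
  have "x = \<zero>\<^bsub>C\<^esub> \<longleftrightarrow> (\<lambda>n. N (X n)) \<longlonglongrightarrow> 0"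
    using X by (simp add: zero_C cls_eq_iff null_def)
  then show "cnorm C x = 0 \<longleftrightarrow> x = \<zero>\<^bsub>C\<^esub>" using lim LIMSEQ_unique by metis
  have "(\<lambda>n. N (c \<odot> X n)) \<longlonglongrightarrow> cnorm C (c \<odot>\<^bsub>C\<^esub> x)"
    using cnorm_C[of "\<lambda>n. c \<odot> X n"] X by simp
  moreover have "(\<lambda>n. N (c \<odot> X n)) \<longlonglongrightarrow> cmod c * cnorm C x"
    using tendsto_mult_left[OF lim, of "cmod c"] X by (simp add: N_smult)
  ultimately show "cnorm C (c \<odot>\<^bsub>C\<^esub> x) = cmod c * cnorm C x" by (rule LIMSEQ_unique)
  have "(\<lambda>n. N (star F (X n) \<otimes> X n)) \<longlonglongrightarrow> cnorm C (star C x \<otimes>\<^bsub>C\<^esub> x)"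
    using cnorm_C[of "\<lambda>n. star F (X n) \<otimes> X n"] X by simp
  moreover have "(\<lambda>n. N (star F (X n) \<otimes> X n)) \<longlonglongrightarrow> (cnorm C x)\<^sup>2"
    using tendsto_power[OF lim, of 2] X by (simp add: N_cstar)
  ultimately show "cnorm C (star C x \<otimes>\<^bsub>C\<^esub> x) = (cnorm C x)\<^sup>2" by (rule LIMSEQ_unique)
qed

text \<open>Density of \<open>F\<close> in its completion: the norm of \<open>cls X\<close> minus
  the class of the constant \<open>X n\<close> is the limit over \<open>m\<close> of
  \<open>N (X m \<ominus> X n)\<close>, which the Cauchy condition makes small.\<close>

lemma const_tendsto_cls:
  assumes "cauchy X"
  shows "(\<lambda>n. cnorm C (cls X \<ominus>\<^bsub>C\<^esub> cls (\<lambda>_. X n))) \<longlonglongrightarrow> 0"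
proof (rule tendstoI)
  fix e :: real assume e: "e > 0"
  then obtain M where M: "\<forall>m\<ge>M. \<forall>n\<ge>M. N (X m \<ominus> X n) < e/2" using cauchyD[OF assms, of "e/2"] by auto
  have "cnorm C (cls X \<ominus>\<^bsub>C\<^esub> cls (\<lambda>_. X n)) \<le> e/2" if "n \<ge> M" for n
  proof (rule LIMSEQ_le_const2)
    show "(\<lambda>m. N (X m \<ominus> X n)) \<longlonglongrightarrow> cnorm C (cls X \<ominus>\<^bsub>C\<^esub> cls (\<lambda>_. X n))"
      using cnorm_C[of "\<lambda>m. X m \<ominus> X n"] assms by simp
    show "\<exists>K. \<forall>m\<ge>K. N (X m \<ominus> X n) \<le> e / 2" using M that less_imp_le by blast
  qed
  moreover have "0 \<le> cnorm C (cls X \<ominus>\<^bsub>C\<^esub> cls (\<lambda>_. X n))" for n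
    using assms by (intro C_norm) simp
  ultimately have "\<forall>n\<ge>M. dist (cnorm C (cls X \<ominus>\<^bsub>C\<^esub> cls (\<lambda>_. X n))) 0 < e" using e by force
  then show "\<forall>\<^sub>F n in sequentially. dist (cnorm C (cls X \<ominus>\<^bsub>C\<^esub> cls (\<lambda>_. X n))) 0 < e"
    unfolding eventually_sequentially by blast
qed

lemma C_minus_sym: "\<lbrakk>x \<in> carrier C; y \<in> carrier C\<rbrakk> \<Longrightarrow> cnorm C (x \<ominus>\<^bsub>C\<^esub> y) = cnorm C (y \<ominus>\<^bsub>C\<^esub> x)"
  using C_norm(3)[of "y \<ominus>\<^bsub>C\<^esub> x" "-1"]
  by (simp add: C.scalar_minus_one C.minus_eq C.minus_add C.a_comm)

lemma C_minus_triangle: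
  "\<lbrakk>x \<in> carrier C; y \<in> carrier C; z \<in> carrier C\<rbrakk>
    \<Longrightarrow> cnorm C (x \<ominus>\<^bsub>C\<^esub> z) \<le> cnorm C (x \<ominus>\<^bsub>C\<^esub> y) + cnorm C (y \<ominus>\<^bsub>C\<^esub> z)"
  using C_triangle[of "x \<ominus>\<^bsub>C\<^esub> y" "y \<ominus>\<^bsub>C\<^esub> z"] by (simp add: C.minus_add_minus)

text \<open>For completeness each \<open>c n\<close> is replaced by an element \<open>x n\<close> of
  \<open>F\<close> at distance below \<open>1 / (n + 1)\<close>. The sequence \<open>x\<close> is
  then Cauchy in \<open>F\<close>, and its own class is the limit of \<open>c\<close>.\<close>

lemma cstar_algebra_C: "cstar_algebra C"
proof (rule cstar_algebraI[OF unital_star_algebra_C])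
  fix c assume cc: "\<And>n :: nat. c n \<in> carrier C"
    and c: "\<And>e. e > 0 \<Longrightarrow> \<exists>M. \<forall>m\<ge>M. \<forall>n\<ge>M. cnorm C (c m \<ominus>\<^bsub>C\<^esub> c n) < e"
  have "\<exists>x\<in>carrier F. cnorm C (c n \<ominus>\<^bsub>C\<^esub> cls (\<lambda>_. x)) < inverse (real (Suc n))" for n
  proof -
    obtain X where X: "cauchy X" "c n = cls X" using cc by (rule carrier_C_cases)
    have "\<forall>\<^sub>F m in sequentially. dist (cnorm C (cls X \<ominus>\<^bsub>C\<^esub> cls (\<lambda>_. X m))) 0 < inverse (real (Suc n))"
      by (rule tendstoD[OF const_tendsto_cls[OF X(1)]]) simp
    then obtain m where "dist (cnorm C (cls X \<ominus>\<^bsub>C\<^esub> cls (\<lambda>_. X m))) 0 < inverse (real (Suc n))"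
      using eventually_happens trivial_limit_sequentially by blast
    then show ?thesis using X by (intro bexI[of _ "X m"]) auto
  qed
  then obtain x where x: "\<And>n. x n \<in> carrier F"
      "\<And>n. cnorm C (c n \<ominus>\<^bsub>C\<^esub> cls (\<lambda>_. x n)) < inverse (real (Suc n))" by metis
  have lim: "(\<lambda>n. cnorm C (c n \<ominus>\<^bsub>C\<^esub> cls (\<lambda>_. x n))) \<longlonglongrightarrow> 0"
    by (rule tendsto_zero_le[OF LIMSEQ_inverse_real_of_nat])
      (use x(1) cc less_imp_le[OF x(2)] in \<open>auto intro!: C_norm(1) simp del: of_nat_Suc minus_C\<close>)
  have "cauchy x"
  proof (rule cauchyI)
    fix e :: real assume e: "e > 0"
    obtain K where K: "\<And>n. n \<ge> K \<Longrightarrow> cnorm C (c n \<ominus>\<^bsub>C\<^esub> cls (\<lambda>_. x n)) < e/3"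
      using tendstoD[OF lim, of "e/3"] e C_norm(1) cc x unfolding eventually_sequentially by auto
    obtain L where L: "\<forall>m\<ge>L. \<forall>n\<ge>L. cnorm C (c m \<ominus>\<^bsub>C\<^esub> c n) < e/3"
      using c[of "e/3"] e by auto
    show "\<exists>M. \<forall>m\<ge>M. \<forall>n\<ge>M. N (x m \<ominus> x n) < e"
    proof (intro exI[of _ "max K L"] allI impI)
      fix m n assume mn: "max K L \<le> m" "max K L \<le> n"
      have "N (x m \<ominus> x n) = cnorm C (cls (\<lambda>_. x m) \<ominus>\<^bsub>C\<^esub> cls (\<lambda>_. x n))" using x by simp
      also have "\<dots> \<le> cnorm C (cls (\<lambda>_. x m) \<ominus>\<^bsub>C\<^esub> c m) + cnorm C (c m \<ominus>\<^bsub>C\<^esub> cls (\<lambda>_. x n))"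
        by (rule C_minus_triangle) (use x cc in auto)
      also have "\<dots> \<le> cnorm C (cls (\<lambda>_. x m) \<ominus>\<^bsub>C\<^esub> c m) + (cnorm C (c m \<ominus>\<^bsub>C\<^esub> c n) + cnorm C (c n \<ominus>\<^bsub>C\<^esub> cls (\<lambda>_. x n)))"
        by (intro add_left_mono C_minus_triangle) (use x cc in auto)
      also have "\<dots> < e"
      proof -
        have "cnorm C (c m \<ominus>\<^bsub>C\<^esub> c n) < e/3" using L mn by auto
        moreover have "cnorm C (cls (\<lambda>_. x m) \<ominus>\<^bsub>C\<^esub> c m) < e/3"
          using K[of m] mn C_minus_sym[of "c m" "cls (\<lambda>_. x m)"] cc x by auto
        ultimately show ?thesis using K[of n] mn by auto
      qed
      finally show "N (x m \<ominus> x n) < e" .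
    qed
  qed (rule x)
  have "(\<lambda>n. cnorm C (c n \<ominus>\<^bsub>C\<^esub> cls (\<lambda>_. x n)) + cnorm C (cls x \<ominus>\<^bsub>C\<^esub> cls (\<lambda>_. x n))) \<longlonglongrightarrow> 0"
    using tendsto_add[OF lim const_tendsto_cls[OF \<open>cauchy x\<close>]] by simp
  then have "(\<lambda>n. cnorm C (c n \<ominus>\<^bsub>C\<^esub> cls x)) \<longlonglongrightarrow> 0"
  proof (rule tendsto_zero_le)
    show "0 \<le> cnorm C (c n \<ominus>\<^bsub>C\<^esub> cls x)" for n using cc \<open>cauchy x\<close> by (intro C_norm) simp
    show "cnorm C (c n \<ominus>\<^bsub>C\<^esub> cls x) \<le> cnorm C (c n \<ominus>\<^bsub>C\<^esub> cls (\<lambda>_. x n)) + cnorm C (cls x \<ominus>\<^bsub>C\<^esub> cls (\<lambda>_. x n))" for n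
      using C_minus_triangle[of "c n" "cls (\<lambda>_. x n)" "cls x"] C_minus_sym[of "cls x" "cls (\<lambda>_. x n)"] cc x \<open>cauchy x\<close>
      by (auto simp del: minus_C)
  qed
  then show "\<exists>a\<in>carrier C. (\<lambda>n. cnorm C (c n \<ominus>\<^bsub>C\<^esub> a)) \<longlonglongrightarrow> 0"
    using \<open>cauchy x\<close> by (intro bexI[of _ "cls x"]) auto
qed (auto simp: C_norm C_triangle C_mult)

end

section \<open>Extension of contractive homomorphisms to the completion\<close>

locale contractive_star_hom = cstar_seminormed_algebra F N + B: cstar_algebra B
  for F :: "('a, 'x) star_algebra_scheme" (structure) and N
    and B :: "('b, 'y) cstar_algebra_scheme" and h :: "'a \<Rightarrow> 'b" +
  assumes hom: "star_hom F B h" and contractive: "x \<in> carrier F \<Longrightarrow> cnorm B (h x) \<le> N x"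
begin

lemma h_closed [simp]: "x \<in> carrier F \<Longrightarrow> h x \<in> carrier B"
  using hom by (auto simp: star_hom_def)

lemma h_add: "\<lbrakk>x \<in> carrier F; y \<in> carrier F\<rbrakk> \<Longrightarrow> h (x \<oplus> y) = h x \<oplus>\<^bsub>B\<^esub> h y"
  and h_mult: "\<lbrakk>x \<in> carrier F; y \<in> carrier F\<rbrakk> \<Longrightarrow> h (x \<otimes> y) = h x \<otimes>\<^bsub>B\<^esub> h y"
  and h_smult: "x \<in> carrier F \<Longrightarrow> h (c \<odot> x) = c \<odot>\<^bsub>B\<^esub> h x"
  and h_star: "x \<in> carrier F \<Longrightarrow> h (star F x) = star B (h x)"
  using hom by (auto simp: star_hom_def)

lemma h_minus: "\<lbrakk>x \<in> carrier F; y \<in> carrier F\<rbrakk> \<Longrightarrow> h (x \<ominus> y) = h x \<ominus>\<^bsub>B\<^esub> h y"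
  by (simp add: h_add h_smult minus_scalar B.minus_scalar)

text \<open>Worded as \<open>toeplitz_induced\<close> is, with a general \<open>h\<close> in place
  of polynomial evaluation, so that \<open>ind_eq\<close> can identify the two.\<close>

definition extension :: "(nat \<Rightarrow> 'a) set \<Rightarrow> 'b" where
  "extension c = (THE a. a \<in> carrier B \<and> (\<forall>X\<in>c. (\<lambda>n. cnorm B (h (X n) \<ominus>\<^bsub>B\<^esub> a)) \<longlonglongrightarrow> 0))"

text \<open>Convergence along a single representative suffices: another one differs by a null
  sequence, and \<open>h\<close> is contractive.\<close>

lemma extension_eqI:
  assumes X: "cauchy X" and a: "a \<in> carrier B" "(\<lambda>n. cnorm B (h (X n) \<ominus>\<^bsub>B\<^esub> a)) \<longlonglongrightarrow> 0"
  shows "extension (cls X) = a"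
  unfolding extension_def
proof (rule the_equality)
  show "a \<in> carrier B \<and> (\<forall>Y\<in>cls X. (\<lambda>n. cnorm B (h (Y n) \<ominus>\<^bsub>B\<^esub> a)) \<longlonglongrightarrow> 0)"
  proof (intro conjI ballI)
    fix Y assume "Y \<in> cls X"
    then have Y: "cauchy Y" "null X Y" by (auto simp: mem_cls)
    show "(\<lambda>n. cnorm B (h (Y n) \<ominus>\<^bsub>B\<^esub> a)) \<longlonglongrightarrow> 0"
    proof (rule tendsto_zero_le)
      show "(\<lambda>n. N (Y n \<ominus> X n) + cnorm B (h (X n) \<ominus>\<^bsub>B\<^esub> a)) \<longlonglongrightarrow> 0"
        using tendsto_add[OF null_sym[OF X Y, unfolded null_def] a(2)] by simp
      show "0 \<le> cnorm B (h (Y n) \<ominus>\<^bsub>B\<^esub> a)" for n using Y a by (simp add: B.cnorm_nonneg)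
      show "cnorm B (h (Y n) \<ominus>\<^bsub>B\<^esub> a) \<le> N (Y n \<ominus> X n) + cnorm B (h (X n) \<ominus>\<^bsub>B\<^esub> a)" for n
        using B.cnorm_minus_triangle[of "h (Y n)" "h (X n)" a] contractive[of "Y n \<ominus> X n"] X Y a
        by (simp add: h_minus)
    qed
  qed fact
  fix b assume "b \<in> carrier B \<and> (\<forall>Y\<in>cls X. (\<lambda>n. cnorm B (h (Y n) \<ominus>\<^bsub>B\<^esub> b)) \<longlonglongrightarrow> 0)"
  then show "b = a"
    using X a by (intro B.limit_unique[of "\<lambda>n. h (X n)"]) auto
qed

lemma extension_lim:
  assumes X: "cauchy X"
  shows "extension (cls X) \<in> carrier B"
    "(\<lambda>n. cnorm B (h (X n) \<ominus>\<^bsub>B\<^esub> extension (cls X))) \<longlonglongrightarrow> 0"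
proof -
  have "\<exists>a\<in>carrier B. (\<lambda>n. cnorm B (h (X n) \<ominus>\<^bsub>B\<^esub> a)) \<longlonglongrightarrow> 0"
  proof (rule B.complete_sequence)
    show "range (\<lambda>n. h (X n)) \<subseteq> carrier B" using X by auto
    fix e :: real assume "e > 0"
    then obtain M where M: "\<forall>m\<ge>M. \<forall>n\<ge>M. N (X m \<ominus> X n) < e" using cauchyD[OF X] by blast
    have "cnorm B (h (X m) \<ominus>\<^bsub>B\<^esub> h (X n)) \<le> N (X m \<ominus> X n)" for m n
      using contractive[of "X m \<ominus> X n"] X by (simp add: h_minus)
    with M show "\<exists>M. \<forall>m\<ge>M. \<forall>n\<ge>M. cnorm B (h (X m) \<ominus>\<^bsub>B\<^esub> h (X n)) < e"
      by (meson le_less_trans)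
  qed
  then obtain a where "a \<in> carrier B" "(\<lambda>n. cnorm B (h (X n) \<ominus>\<^bsub>B\<^esub> a)) \<longlonglongrightarrow> 0" by blast
  with extension_eqI[OF X this] show "extension (cls X) \<in> carrier B"
    "(\<lambda>n. cnorm B (h (X n) \<ominus>\<^bsub>B\<^esub> extension (cls X))) \<longlonglongrightarrow> 0" by auto
qed

lemma extension_const: "x \<in> carrier F \<Longrightarrow> extension (cls (\<lambda>_. x)) = h x"
  by (rule extension_eqI) auto

lemma extension_contractive:
  assumes "c \<in> carrier C"
  shows "cnorm B (extension c) \<le> cnorm C c"
proof -
  obtain X where X: "cauchy X" "c = cls X" using assms by (rule carrier_C_cases)
  note l = extension_lim[OF X(1), folded X(2)]
  have "cnorm B (extension c) \<le> cnorm C c + 0"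
  proof (rule LIMSEQ_le_const)
    show "(\<lambda>n. N (X n) + cnorm B (h (X n) \<ominus>\<^bsub>B\<^esub> extension c)) \<longlonglongrightarrow> cnorm C c + 0"
      using cnorm_C X l by (intro tendsto_add) auto
    have "cnorm B (extension c) \<le> N (X n) + cnorm B (h (X n) \<ominus>\<^bsub>B\<^esub> extension c)" for n
      using B.cnorm_le_minus[of "extension c" "h (X n)"] B.cnorm_minus_sym[of "extension c" "h (X n)"]
        contractive[of "X n"] l X by simp
    then show "\<exists>K. \<forall>n\<ge>K. cnorm B (extension c) \<le> N (X n) + cnorm B (h (X n) \<ominus>\<^bsub>B\<^esub> extension c)" by blast
  qed
  then show ?thesis by simp
qed

text \<open>Each clause names the expected limit and verifies convergence along the termwise
  combination of representatives, after which \<open>extension_eqI\<close> identifies the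
  value.\<close>

lemma star_hom_extension: "star_hom C B extension"
  unfolding star_hom_def
proof (intro conjI ballI allI)
  show "extension \<in> carrier C \<rightarrow> carrier B"
    using extension_lim by (auto elim!: carrier_C_cases)
  fix x assume "x \<in> carrier C"
  then obtain X where X: "cauchy X" "x = cls X" by (rule carrier_C_cases)
  note lx = extension_lim[OF X(1), folded X(2)]
  show "extension (c \<odot>\<^bsub>C\<^esub> x) = c \<odot>\<^bsub>B\<^esub> extension x" for c
  proof -
    have "(\<lambda>n. cnorm B (h (c \<odot> X n) \<ominus>\<^bsub>B\<^esub> c \<odot>\<^bsub>B\<^esub> extension x)) \<longlonglongrightarrow> 0"
    proof -
      have "h (c \<odot> X n) \<ominus>\<^bsub>B\<^esub> c \<odot>\<^bsub>B\<^esub> extension x = c \<odot>\<^bsub>B\<^esub> (h (X n) \<ominus>\<^bsub>B\<^esub> extension x)" for n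
        using X lx(1) by (simp add: h_smult B.scalar_minus)
      then show ?thesis
        using tendsto_mult_left[OF lx(2), of "cmod c"] X lx(1) by (simp add: B.cnorm_smult)
    qed
    from extension_eqI[OF cauchy_smult[OF X(1)] _ this] show ?thesis using X lx(1) by simp
  qed
  show "extension (star C x) = star B (extension x)"
  proof -
    have "(\<lambda>n. cnorm B (h (star F (X n)) \<ominus>\<^bsub>B\<^esub> star B (extension x))) \<longlonglongrightarrow> 0"
    proof -
      have "h (star F (X n)) \<ominus>\<^bsub>B\<^esub> star B (extension x) = star B (h (X n) \<ominus>\<^bsub>B\<^esub> extension x)" for n
        using X lx(1) by (simp add: h_star)
      then show ?thesis
        using lx X(1) by (simp only: h_closed B.cnorm_star B.minus_closed cauchy_carrier)
    qed
    from extension_eqI[OF cauchy_star[OF X(1)] _ this] show ?thesis using X lx(1) by simp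
  qed
  fix y assume "y \<in> carrier C"
  then obtain Y where Y: "cauchy Y" "y = cls Y" by (rule carrier_C_cases)
  note ly = extension_lim[OF Y(1), folded Y(2)]
  show "extension (x \<oplus>\<^bsub>C\<^esub> y) = extension x \<oplus>\<^bsub>B\<^esub> extension y"
  proof -
    have "(\<lambda>n. cnorm B (h (X n \<oplus> Y n) \<ominus>\<^bsub>B\<^esub> (extension x \<oplus>\<^bsub>B\<^esub> extension y))) \<longlonglongrightarrow> 0"
    proof (rule tendsto_zero_le)
      show "(\<lambda>n. cnorm B (h (X n) \<ominus>\<^bsub>B\<^esub> extension x) + cnorm B (h (Y n) \<ominus>\<^bsub>B\<^esub> extension y)) \<longlonglongrightarrow> 0"
        using tendsto_add[OF lx(2) ly(2)] by simp
    qed (use X Y lx ly in \<open>auto simp: h_add B.add_minus_add B.cnorm_nonneg intro!: B.cnorm_triangle\<close>)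
    from extension_eqI[OF cauchy_add[OF X(1) Y(1)] _ this] show ?thesis using X Y lx(1) ly(1) by simp
  qed
  show "extension (x \<otimes>\<^bsub>C\<^esub> y) = extension x \<otimes>\<^bsub>B\<^esub> extension y"
  proof -
    \<comment> \<open>In the splitting of the difference of products the first error term is
      multiplied by \<open>h (Y n)\<close>, so these factors have to stay bounded.\<close>
    obtain b where b: "b > 0" "\<And>n. N (Y n) \<le> b" using cauchy_bounded[OF Y(1)] by blast
    have "(\<lambda>n. cnorm B (h (X n \<otimes> Y n) \<ominus>\<^bsub>B\<^esub> (extension x \<otimes>\<^bsub>B\<^esub> extension y))) \<longlonglongrightarrow> 0"
    proof (rule tendsto_zero_le)
      show "(\<lambda>n. cnorm B (h (X n) \<ominus>\<^bsub>B\<^esub> extension x) * b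
          + cnorm B (extension x) * cnorm B (h (Y n) \<ominus>\<^bsub>B\<^esub> extension y)) \<longlonglongrightarrow> 0"
        using tendsto_add[OF tendsto_mult_right[OF lx(2), of b] tendsto_mult_left[OF ly(2), of "cnorm B (extension x)"]]
        by simp
      fix n
      have c: "h (X n) \<in> carrier B" "h (Y n) \<in> carrier B" using X Y by auto
      show "0 \<le> cnorm B (h (X n \<otimes> Y n) \<ominus>\<^bsub>B\<^esub> (extension x \<otimes>\<^bsub>B\<^esub> extension y))"
        using X Y lx ly by (intro B.cnorm_nonneg) auto
      have "h (X n \<otimes> Y n) \<ominus>\<^bsub>B\<^esub> (extension x \<otimes>\<^bsub>B\<^esub> extension y)
        = (h (X n) \<ominus>\<^bsub>B\<^esub> extension x) \<otimes>\<^bsub>B\<^esub> h (Y n) \<oplus>\<^bsub>B\<^esub> extension x \<otimes>\<^bsub>B\<^esub> (h (Y n) \<ominus>\<^bsub>B\<^esub> extension y)"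
        using X Y c lx ly by (simp add: h_mult B.mult_minus_mult)
      then have "cnorm B (h (X n \<otimes> Y n) \<ominus>\<^bsub>B\<^esub> (extension x \<otimes>\<^bsub>B\<^esub> extension y))
        \<le> cnorm B ((h (X n) \<ominus>\<^bsub>B\<^esub> extension x) \<otimes>\<^bsub>B\<^esub> h (Y n)) + cnorm B (extension x \<otimes>\<^bsub>B\<^esub> (h (Y n) \<ominus>\<^bsub>B\<^esub> extension y))"
        using c lx ly B.cnorm_triangle by simp
      also have "\<dots> \<le> cnorm B (h (X n) \<ominus>\<^bsub>B\<^esub> extension x) * cnorm B (h (Y n))
          + cnorm B (extension x) * cnorm B (h (Y n) \<ominus>\<^bsub>B\<^esub> extension y)"
        using c lx ly by (intro add_mono B.cnorm_mult) auto
      also have "\<dots> \<le> cnorm B (h (X n) \<ominus>\<^bsub>B\<^esub> extension x) * b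
          + cnorm B (extension x) * cnorm B (h (Y n) \<ominus>\<^bsub>B\<^esub> extension y)"
        using contractive[of "Y n"] b(2)[of n] Y c lx
        by (intro add_right_mono mult_left_mono) (auto simp: B.cnorm_nonneg)
      finally show "cnorm B (h (X n \<otimes> Y n) \<ominus>\<^bsub>B\<^esub> (extension x \<otimes>\<^bsub>B\<^esub> extension y)) \<le>
        cnorm B (h (X n) \<ominus>\<^bsub>B\<^esub> extension x) * b
          + cnorm B (extension x) * cnorm B (h (Y n) \<ominus>\<^bsub>B\<^esub> extension y)" .
    qed
    from extension_eqI[OF cauchy_mult[OF X(1) Y(1)] _ this] show ?thesis using X Y lx(1) ly(1) by simp
  qed
qed

end


section \<open>The free *-algebra\<close>

lemma inj_monomial_star: "inj monomial_star"
proof (rule inj_on_inverseI[of _ monomial_star])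
  fix m :: "'a star_monomial"
  show "monomial_star (monomial_star m) = m"
    by (cases m) (simp add: monomial_star_def rev_map comp_def case_prod_beta)
qed

lemma monomial_star_invol [simp]: "monomial_star (monomial_star m) = m"
  by (cases m) (simp add: monomial_star_def rev_map comp_def case_prod_beta)

lemma monomial_star_add: "monomial_star (m + n) = monomial_star n + monomial_star m"
  by (simp add: monomial_star_def plus_star_monomial_def)

lemma letters_monomial_star [simp]: "fst ` set (letters (monomial_star m)) = fst ` set (letters m)"
  by (force simp: monomial_star_def)

text \<open>\<open>map_key\<close> pulls coefficients back along an injective map; as
  \<open>monomial_star\<close> is its own inverse, this is also the push-forward of the
  monomials.\<close>

lemma lookup_free_star:
  "Poly_Mapping.lookup (star (free_star_algebra P) x) m = cnj (Poly_Mapping.lookup x (monomial_star m))"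
  by (simp add: free_star_algebra_def map_key.rep_eq[OF inj_monomial_star] Poly_Mapping.map.rep_eq when_def)

lemma free_star_single:
  "star (free_star_algebra P) (Poly_Mapping.single m c) = Poly_Mapping.single (monomial_star m) (cnj c)"
  by (rule poly_mapping_eqI) (auto simp: lookup_free_star lookup_single when_def)

lemma free_star_add:
  "star (free_star_algebra P) (x + y) = star (free_star_algebra P) x + star (free_star_algebra P) y"
  by (rule poly_mapping_eqI) (simp add: lookup_free_star lookup_add)

lemma free_star_algebra_simps [simp]:
  "x \<oplus>\<^bsub>free_star_algebra P\<^esub> y = x + y" "x \<otimes>\<^bsub>free_star_algebra P\<^esub> y = x * y"
  "\<zero>\<^bsub>free_star_algebra P\<^esub> = 0" "\<one>\<^bsub>free_star_algebra P\<^esub> = 1"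
  "c \<odot>\<^bsub>free_star_algebra P\<^esub> x = Poly_Mapping.single 0 c * x"
  by (simp_all add: free_star_algebra_def)

lemma mem_free_star_algebra:
  "x \<in> carrier (free_star_algebra P) \<longleftrightarrow> (\<forall>m\<in>Poly_Mapping.keys x. fst ` set (letters m) \<subseteq> P)"
  by (simp add: free_star_algebra_def)

lemma letters_simps [simp]: "letters 0 = []" "letters (m + n) = letters m @ letters n"
  by (simp_all add: zero_star_monomial_def plus_star_monomial_def)

lemma single_mem_free [simp]:
  "fst ` set (letters m) \<subseteq> P \<Longrightarrow> Poly_Mapping.single m c \<in> carrier (free_star_algebra P)"
  by (simp add: mem_free_star_algebra)

lemma free_add_closed [simp]:
  "\<lbrakk>x \<in> carrier (free_star_algebra P); y \<in> carrier (free_star_algebra P)\<rbrakk>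
    \<Longrightarrow> x + y \<in> carrier (free_star_algebra P)"
  using keys_add[of x y] by (force simp: mem_free_star_algebra)

lemma free_mult_closed [simp]:
  assumes "x \<in> carrier (free_star_algebra P)" "y \<in> carrier (free_star_algebra P)"
  shows "x * y \<in> carrier (free_star_algebra P)"
  unfolding mem_free_star_algebra
proof
  fix m assume "m \<in> Poly_Mapping.keys (x * y)"
  then obtain k l where "m = k + l" "k \<in> Poly_Mapping.keys x" "l \<in> Poly_Mapping.keys y"
    using keys_mult[of x y] by auto
  then show "fst ` set (letters m) \<subseteq> P"
    using assms by (auto simp: mem_free_star_algebra)
qed

lemma free_zero_one_closed [simp]:
  "0 \<in> carrier (free_star_algebra P)" "1 \<in> carrier (free_star_algebra P)"
  by (simp_all add: mem_free_star_algebra)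

lemma poly_mapping_eq_sum_single:
  "x = (\<Sum>m\<in>Poly_Mapping.keys x. Poly_Mapping.single m (Poly_Mapping.lookup x m))"
proof (rule poly_mapping_eqI)
  fix k
  have "Poly_Mapping.lookup (\<Sum>m\<in>Poly_Mapping.keys x. Poly_Mapping.single m (Poly_Mapping.lookup x m)) k
    = (\<Sum>m\<in>Poly_Mapping.keys x. if m = k then Poly_Mapping.lookup x k else 0)"
    unfolding lookup_sum by (intro sum.cong) (auto simp: lookup_single when_def)
  then show "Poly_Mapping.lookup x k
      = Poly_Mapping.lookup (\<Sum>m\<in>Poly_Mapping.keys x. Poly_Mapping.single m (Poly_Mapping.lookup x m)) k"
    by (simp add: in_keys_iff)
qed

text \<open>A polynomial is the finite sum of its terms, so additive statements reduce to scalar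
  multiples of monomials with letters in \<open>P\<close>.\<close>

lemma free_induct [consumes 1, case_names single add]:
  assumes x: "x \<in> carrier (free_star_algebra P)"
    and single: "\<And>m c. fst ` set (letters m) \<subseteq> P \<Longrightarrow> Q (Poly_Mapping.single m c)"
    and add: "\<And>x y. \<lbrakk>x \<in> carrier (free_star_algebra P); y \<in> carrier (free_star_algebra P); Q x; Q y\<rbrakk> \<Longrightarrow> Q (x + y)"
  shows "Q x"
proof -
  \<comment> \<open>Membership of the partial sums is proved along with \<open>Q\<close>, since the
    case \<open>add\<close> presupposes it for both summands.\<close>
  have "(\<Sum>m\<in>S. Poly_Mapping.single m (Poly_Mapping.lookup x m)) \<in> carrier (free_star_algebra P)
      \<and> Q (\<Sum>m\<in>S. Poly_Mapping.single m (Poly_Mapping.lookup x m))"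
    if "finite S" "S \<subseteq> Poly_Mapping.keys x" for S
    using that
  proof (induction S rule: finite_induct)
    case empty
    show ?case using single[of 0 0] by simp
  next
    case (insert m S)
    have "fst ` set (letters m) \<subseteq> P" using insert x by (auto simp: mem_free_star_algebra)
    then show ?case using insert by (auto intro!: add single)
  qed
  from this[of "Poly_Mapping.keys x"] show ?thesis
    using poly_mapping_eq_sum_single[of x] by simp
qed

lemma free_star_mult:
  fixes x :: "'g star_polynomial"
  shows "star (free_star_algebra P) (x * y) = star (free_star_algebra P) y * star (free_star_algebra P) x"
proof -
  \<comment> \<open>The involution is given by the same formula for every \<open>P\<close>, so the
    induction may run over the largest algebra and covers all polynomials.\<close>
  have "x \<in> carrier (free_star_algebra UNIV)" "y \<in> carrier (free_star_algebra UNIV)" for x y :: "'g star_polynomial"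
    by (simp_all add: mem_free_star_algebra)
  note U = this
  show ?thesis
    using U(1)[of x]
  proof (induction x rule: free_induct)
    case (single m c)
    show ?case using U(1)[of y]
      by (induction y rule: free_induct)
        (simp_all add: mult_single free_star_single monomial_star_add mult.commute algebra_simps free_star_add)
  qed (simp add: algebra_simps free_star_add)
qed

lemma free_star_closed [simp]:
  assumes "x \<in> carrier (free_star_algebra P)"
  shows "star (free_star_algebra P) x \<in> carrier (free_star_algebra P)"
  using assms by (induction rule: free_induct) (simp_all add: free_star_single free_star_add)

text \<open>Scalars sit at the empty monomial, which is neutral on both sides. This yields the
  compatibility of scalars with the right factor of a product.\<close>

lemma single_central: "x * Poly_Mapping.single 0 c = Poly_Mapping.single 0 c * (x :: 'g star_polynomial)"
proof -
  have "x \<in> carrier (free_star_algebra UNIV)" by (simp add: mem_free_star_algebra)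
  then show ?thesis
    by (induction x rule: free_induct) (simp_all add: mult_single mult.commute algebra_simps)
qed

lemma unital_star_algebra_free:
  fixes P :: "'g set"
  shows "unital_star_algebra (free_star_algebra P)"
proof -
  have neg: "- x \<in> carrier (free_star_algebra P)" if "x \<in> carrier (free_star_algebra P)" for x :: "'g star_polynomial"
    using that by (simp add: mem_free_star_algebra in_keys_iff)
  have "ring (free_star_algebra P)"
    by (rule ringI[OF abelian_groupI monoidI])
      (auto simp: algebra_simps intro!: bexI[of _ "- x" for x] neg)
  then show ?thesis
  proof (rule unital_star_algebra.intro, unfold_locales, goal_cases)
    fix x y :: "'g star_polynomial" and c d
    show "x \<in> carrier (free_star_algebra P) \<Longrightarrow> c \<odot>\<^bsub>free_star_algebra P\<^esub> x \<in> carrier (free_star_algebra P)"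
      by simp
    show "(c + d) \<odot>\<^bsub>free_star_algebra P\<^esub> x
        = c \<odot>\<^bsub>free_star_algebra P\<^esub> x \<oplus>\<^bsub>free_star_algebra P\<^esub> d \<odot>\<^bsub>free_star_algebra P\<^esub> x"
      by (simp add: single_add distrib_right)
    show "c \<odot>\<^bsub>free_star_algebra P\<^esub> (x \<oplus>\<^bsub>free_star_algebra P\<^esub> y)
        = c \<odot>\<^bsub>free_star_algebra P\<^esub> x \<oplus>\<^bsub>free_star_algebra P\<^esub> c \<odot>\<^bsub>free_star_algebra P\<^esub> y"
      by (simp add: distrib_left)
    show "c \<odot>\<^bsub>free_star_algebra P\<^esub> (d \<odot>\<^bsub>free_star_algebra P\<^esub> x) = (c * d) \<odot>\<^bsub>free_star_algebra P\<^esub> x"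
      by (simp add: mult_single flip: mult.assoc)
    show "1 \<odot>\<^bsub>free_star_algebra P\<^esub> x = x" by simp
    show "(c \<odot>\<^bsub>free_star_algebra P\<^esub> x) \<otimes>\<^bsub>free_star_algebra P\<^esub> y
        = c \<odot>\<^bsub>free_star_algebra P\<^esub> (x \<otimes>\<^bsub>free_star_algebra P\<^esub> y)"
      by (simp add: mult.assoc)
    show "x \<otimes>\<^bsub>free_star_algebra P\<^esub> (c \<odot>\<^bsub>free_star_algebra P\<^esub> y)
        = c \<odot>\<^bsub>free_star_algebra P\<^esub> (x \<otimes>\<^bsub>free_star_algebra P\<^esub> y)"
      by (simp add: single_central flip: mult.assoc)
    show "star (free_star_algebra P) (star (free_star_algebra P) x) = x"
      by (rule poly_mapping_eqI) (simp add: lookup_free_star)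
    show "star (free_star_algebra P) (c \<odot>\<^bsub>free_star_algebra P\<^esub> x)
        = cnj c \<odot>\<^bsub>free_star_algebra P\<^esub> star (free_star_algebra P) x"
      using monomial_star_invol[of 0]
      by (simp add: free_star_mult free_star_single single_central)
        (simp add: monomial_star_def zero_star_monomial_def
          single_central[unfolded zero_star_monomial_def])
  qed (simp_all add: free_star_add free_star_mult)
qed

lemma even_list_induct [consumes 1, case_names Nil Cons]:
  assumes "even (length \<alpha>)" "Q []" "\<And>p q \<alpha>. \<lbrakk>even (length \<alpha>); Q \<alpha>\<rbrakk> \<Longrightarrow> Q (p # q # \<alpha>)"
  shows "Q \<alpha>"
  using assms(1)
proof (induction "length \<alpha>" arbitrary: \<alpha> rule: less_induct)
  case less
  show ?case
  proof (cases \<alpha>)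
    case Nil then show ?thesis using assms(2) by simp
  next
    case (Cons p \<beta>)
    then obtain q \<gamma> where "\<beta> = q # \<gamma>" using less.prems by (cases \<beta>) auto
    then show ?thesis using Cons less by (auto intro!: assms(3))
  qed
qed

lemma diff_prod_simps [simp]:
  "diff_prod A w \<alpha> [] = \<one>\<^bsub>A\<^esub>"
  "diff_prod A w \<alpha> (\<beta> # \<beta>s) = (word_elem A w \<alpha> \<ominus>\<^bsub>A\<^esub> word_elem A w \<beta>) \<otimes>\<^bsub>A\<^esub> diff_prod A w \<alpha> \<beta>s"
  by (simp_all add: diff_prod_def)

section \<open>Evaluation of words and polynomials in an algebra with involution\<close>

context unital_star_algebra begin

lemma word_elem_closed [simp]:
  assumes "w \<in> P \<rightarrow> carrier A" "set \<alpha> \<subseteq> P"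
  shows "word_elem A w \<alpha> \<in> carrier A"
  using assms(2) by (induction \<alpha> rule: induct_list012) (use assms(1) in \<open>auto simp: Pi_iff\<close>)

lemma word_elem_append:
  assumes "w \<in> P \<rightarrow> carrier A" "even (length \<alpha>)" "set \<alpha> \<subseteq> P" "set \<beta> \<subseteq> P"
  shows "word_elem A w (\<alpha> @ \<beta>) = word_elem A w \<alpha> \<otimes> word_elem A w \<beta>"
  using assms(2,3)
proof (induction \<alpha> rule: even_list_induct)
  case Nil
  show ?case using assms by simp
next
  case (Cons p q \<alpha>)
  then have "w p \<in> carrier A" "w q \<in> carrier A" using assms(1) by auto
  then show ?case using Cons assms(1,4) by (simp add: m_assoc)
qed

text \<open>Taking adjoints reverses the order and exchanges starred with unstarred letters.
  Reversing a word of even length does exactly that, since the letters at odd places are the starred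
  ones.\<close>

lemma word_elem_rev:
  assumes "w \<in> P \<rightarrow> carrier A" "even (length \<alpha>)" "set \<alpha> \<subseteq> P"
  shows "word_elem A w (rev \<alpha>) = star A (word_elem A w \<alpha>)"
  using assms(2,3)
proof (induction \<alpha> rule: even_list_induct)
  case Nil
  show ?case using assms by simp
next
  case (Cons p q \<alpha>)
  then have "w p \<in> carrier A" "w q \<in> carrier A" using assms(1) by auto
  then show ?case
    using Cons assms(1) word_elem_append[OF assms(1), of "rev \<alpha>" "[q, p]"]
    by (simp add: star_mult m_assoc)
qed

lemma diff_prod_closed [simp]:
  assumes "w \<in> P \<rightarrow> carrier A" "set \<alpha> \<subseteq> P" "\<And>\<beta>. \<beta> \<in> set \<beta>s \<Longrightarrow> set \<beta> \<subseteq> P"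
  shows "diff_prod A w \<alpha> \<beta>s \<in> carrier A"
  using assms(3) by (induction \<beta>s) (use assms(1,2) in auto)

lemma eval_monomial_closed [simp]:
  assumes "w \<in> P \<rightarrow> carrier A" "fst ` set (letters m) \<subseteq> P"
  shows "eval_monomial A w m \<in> carrier A"
proof -
  have "foldr (\<lambda>(p, b) x. (if b then star A (w p) else w p) \<otimes> x) l \<one> \<in> carrier A"
    if "fst ` set l \<subseteq> P" for l
    using that by (induction l) (use assms(1) in \<open>auto simp: Pi_iff\<close>)
  then show ?thesis using assms by (simp add: eval_monomial_def)
qed

lemma eval_monomial_add:
  assumes "w \<in> P \<rightarrow> carrier A" "fst ` set (letters m) \<subseteq> P" "fst ` set (letters n) \<subseteq> P"
  shows "eval_monomial A w (m + n) = eval_monomial A w m \<otimes> eval_monomial A w n"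
proof -
  let ?f = "\<lambda>l z. foldr (\<lambda>(p, b) x. (if b then star A (w p) else w p) \<otimes> x) l z"
  have c: "?f l \<one> \<in> carrier A" if "fst ` set l \<subseteq> P" for l
    using that by (induction l) (use assms(1) in \<open>auto simp: Pi_iff\<close>)
  have "?f l z = ?f l \<one> \<otimes> z" if "fst ` set l \<subseteq> P" "z \<in> carrier A" for l z
    using that(1)
  proof (induction l)
    case (Cons a l)
    obtain p b where a: "a = (p, b)" by (cases a)
    have "w p \<in> carrier A" using Cons.prems assms(1) a by auto
    then show ?case using Cons that(2) c[of l] by (auto simp: a m_assoc)
  qed (use that in simp)
  from this[of "letters m" "?f (letters n) \<one>"] show ?thesis
    using assms c[of "letters n"] by (simp add: eval_monomial_def)
qed

lemma eval_monomial_star: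
  assumes "w \<in> P \<rightarrow> carrier A" "fst ` set (letters m) \<subseteq> P"
  shows "eval_monomial A w (monomial_star m) = star A (eval_monomial A w m)"
proof -
  have "eval_monomial A w (Star_Monomial (rev (map (\<lambda>(p, b). (p, \<not> b)) l)))
      = star A (eval_monomial A w (Star_Monomial l))" if "fst ` set l \<subseteq> P" for l
    using that
  proof (induction l)
    case Nil
    show ?case by (simp add: eval_monomial_def)
  next
    case (Cons a l)
    obtain p b where a: "a = (p, b)" by (cases a)
    have wp: "w p \<in> carrier A" using Cons.prems assms(1) a by auto
    let ?r = "Star_Monomial (rev (map (\<lambda>(p, b). (p, \<not> b)) l))"
    have 1: "Star_Monomial (rev (map (\<lambda>(p, b). (p, \<not> b)) (a # l))) = ?r + Star_Monomial [(p, \<not> b)]"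
      by (simp add: a plus_star_monomial_def)
    have 2: "Star_Monomial (a # l) = Star_Monomial [(p, b)] + Star_Monomial l"
      by (simp add: a plus_star_monomial_def)
    have r: "fst ` set (letters ?r) \<subseteq> P" using Cons.prems by force
    have p: "fst ` set (letters (Star_Monomial [(p, b')])) \<subseteq> P" for b' using Cons.prems a by auto
    have l: "fst ` set (letters (Star_Monomial l)) \<subseteq> P" using Cons.prems by auto
    have "eval_monomial A w (Star_Monomial [(p, \<not> b)]) = star A (eval_monomial A w (Star_Monomial [(p, b)]))"
      using wp by (simp add: eval_monomial_def)
    then show ?case
      using Cons.IH Cons.prems eval_monomial_closed[OF assms(1) l] eval_monomial_closed[OF assms(1) p]
      unfolding 1 2 eval_monomial_add[OF assms(1) r p] eval_monomial_add[OF assms(1) p l]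
      by (simp add: star_mult)
  qed
  from this[of "letters m"] show ?thesis using assms by (simp add: monomial_star_def)
qed

text \<open>Terms may cancel in a sum of polynomials, so its support need not be the union of the
  two supports. Evaluating everything over one common finite set avoids this problem.\<close>

lemma eval_superset:
  assumes w: "w \<in> P \<rightarrow> carrier A" and S: "finite S" "Poly_Mapping.keys x \<subseteq> S"
    "\<And>m. m \<in> S \<Longrightarrow> fst ` set (letters m) \<subseteq> P"
  shows "eval_star_polynomial A w x = (\<Oplus>m\<in>S. Poly_Mapping.lookup x m \<odot> eval_monomial A w m)"
  unfolding eval_star_polynomial_def
proof (rule add.finprod_mono_neutral_cong_left)
  show "(\<lambda>m. Poly_Mapping.lookup x m \<odot> eval_monomial A w m) \<in> S \<rightarrow> carrier A"
    using eval_monomial_closed[OF w] S(3) by auto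
  show "\<And>m. m \<in> S - Poly_Mapping.keys x \<Longrightarrow> Poly_Mapping.lookup x m \<odot> eval_monomial A w m = \<zero>"
    using eval_monomial_closed[OF w] S(3) by (auto simp: in_keys_iff)
qed (use S in auto)

lemma eval_add:
  assumes w: "w \<in> P \<rightarrow> carrier A" and x: "x \<in> carrier (free_star_algebra P)" and y: "y \<in> carrier (free_star_algebra P)"
  shows "eval_star_polynomial A w (x + y) = eval_star_polynomial A w x \<oplus> eval_star_polynomial A w y"
proof -
  let ?S = "Poly_Mapping.keys x \<union> Poly_Mapping.keys y"
  have S: "\<And>m. m \<in> ?S \<Longrightarrow> fst ` set (letters m) \<subseteq> P" using x y by (auto simp: mem_free_star_algebra)
  have 1: "finite ?S" by simp
  have c: "eval_monomial A w m \<in> carrier A" if "m \<in> ?S" for m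
    using eval_monomial_closed[OF w S[OF that]] .
  have e: "eval_star_polynomial A w z = (\<Oplus>m\<in>?S. Poly_Mapping.lookup z m \<odot> eval_monomial A w m)"
    if "Poly_Mapping.keys z \<subseteq> ?S" for z
    using eval_superset[OF w 1 that S] .
  have "(\<Oplus>m\<in>?S. Poly_Mapping.lookup (x + y) m \<odot> eval_monomial A w m)
      = (\<Oplus>m\<in>?S. Poly_Mapping.lookup x m \<odot> eval_monomial A w m \<oplus> Poly_Mapping.lookup y m \<odot> eval_monomial A w m)"
    by (rule add.finprod_cong') (use c in \<open>auto simp: lookup_add scalar_add\<close>)
  also have "\<dots> = (\<Oplus>m\<in>?S. Poly_Mapping.lookup x m \<odot> eval_monomial A w m)
      \<oplus> (\<Oplus>m\<in>?S. Poly_Mapping.lookup y m \<odot> eval_monomial A w m)"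
    by (rule add.finprod_multf) (use c in auto)
  finally show ?thesis using e[of "x + y"] e[of x] e[of y] keys_add[of x y] by simp
qed

lemma eval_single:
  assumes w: "w \<in> P \<rightarrow> carrier A" and m: "fst ` set (letters m) \<subseteq> P"
  shows "eval_star_polynomial A w (Poly_Mapping.single m c) = c \<odot> eval_monomial A w m"
  using eval_superset[OF w, of "{m}" "Poly_Mapping.single m c"] m eval_monomial_closed[OF w m]
  by (simp add: eval_monomial_closed)

lemma eval_closed [simp]:
  assumes w: "w \<in> P \<rightarrow> carrier A" and x: "x \<in> carrier (free_star_algebra P)"
  shows "eval_star_polynomial A w x \<in> carrier A"
  using x by (induction rule: free_induct) (use w in \<open>auto simp: eval_add eval_single\<close>)

lemma eval_mult:
  assumes w: "w \<in> P \<rightarrow> carrier A" and x: "x \<in> carrier (free_star_algebra P)" and y: "y \<in> carrier (free_star_algebra P)"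
  shows "eval_star_polynomial A w (x * y) = eval_star_polynomial A w x \<otimes> eval_star_polynomial A w y"
  using x
proof (induction x rule: free_induct)
  case (single m c)
  note cm = eval_monomial_closed[OF w single]
  show ?case using y
  proof (induction y rule: free_induct)
    case (single n d)
    have "fst ` set (letters (m + n)) \<subseteq> P" using single \<open>fst ` set (letters m) \<subseteq> P\<close> by auto
    then show ?case using single \<open>fst ` set (letters m) \<subseteq> P\<close> cm eval_monomial_closed[OF w single]
      by (simp add: mult_single eval_single[OF w] eval_monomial_add[OF w] smult_mult_left smult_mult_right scalar_scalar mult.commute)
  next
    case (add y z)
    have "Poly_Mapping.single m c \<in> carrier (free_star_algebra P)" using single by simp
    then show ?case using add eval_closed[OF w]
      by (simp add: distrib_left eval_add[OF w] r_distr)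
  qed
next
  case (add x z)
  then show ?case using eval_closed[OF w] y
    by (simp add: distrib_right eval_add[OF w] l_distr)
qed

lemma eval_star:
  assumes w: "w \<in> P \<rightarrow> carrier A" and x: "x \<in> carrier (free_star_algebra P)"
  shows "eval_star_polynomial A w (star (free_star_algebra P) x) = star A (eval_star_polynomial A w x)"
  using x
proof (induction x rule: free_induct)
  case (single m c)
  then show ?case using eval_monomial_closed[OF w single]
    by (simp add: free_star_single eval_single[OF w] eval_monomial_star[OF w] star_smult)
next
  case (add x y)
  then show ?case using eval_closed[OF w] by (simp add: free_star_add eval_add[OF w] star_add)
qed

lemma eval_one: 
  assumes w: "w \<in> P \<rightarrow> carrier A"
  shows "eval_star_polynomial A w 1 = \<one>"
proof -
  have "eval_star_polynomial A w (Poly_Mapping.single 0 1) = \<one>"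
    using eval_single[OF w, of 0 1] by (simp add: eval_monomial_def)
  then show ?thesis by simp
qed

lemma eval_generator:
  assumes w: "w \<in> P \<rightarrow> carrier A" and p: "p \<in> P"
  shows "eval_star_polynomial A w (free_generator p) = w p"
proof -
  have "w p \<in> carrier A" using w p by auto
  then show ?thesis
    using eval_single[OF w, of "Star_Monomial [(p, False)]" 1] p
    by (simp add: free_generator_def eval_monomial_def)
qed

lemma star_hom_eval:
  assumes w: "w \<in> P \<rightarrow> carrier A"
  shows "star_hom (free_star_algebra P) A (eval_star_polynomial A w)"
  unfolding star_hom_def
proof (intro conjI ballI allI)
  fix c x assume x: "x \<in> carrier (free_star_algebra P)"
  have "eval_star_polynomial A w (Poly_Mapping.single 0 c * x)
      = eval_star_polynomial A w (Poly_Mapping.single 0 c) \<otimes> eval_star_polynomial A w x"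
    using x by (intro eval_mult[OF w]) auto
  moreover have "eval_star_polynomial A w (Poly_Mapping.single 0 c) = c \<odot> \<one>"
    using eval_single[OF w, of 0 c] by (simp add: eval_monomial_def)
  ultimately show "eval_star_polynomial A w (c \<odot>\<^bsub>free_star_algebra P\<^esub> x) = c \<odot> eval_star_polynomial A w x"
    using eval_closed[OF w x] by (simp add: smult_mult_left)
qed (use w in \<open>auto simp: eval_add eval_mult eval_star\<close>)

end

text \<open>Preservation of the unit is required separately because \<open>star_hom\<close> does not
  contain it, while the empty word and the empty difference product evaluate to the unit.\<close>

locale unital_star_hom = A: unital_star_algebra A + B: unital_star_algebra B
  for A :: "('a, 'x) star_algebra_scheme" and B :: "('b, 'y) star_algebra_scheme" and \<phi> +
  assumes hom: "star_hom A B \<phi>" and hom_one [simp]: "\<phi> \<one>\<^bsub>A\<^esub> = \<one>\<^bsub>B\<^esub>"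
begin

lemma hom_closed [simp]: "x \<in> carrier A \<Longrightarrow> \<phi> x \<in> carrier B"
  and hom_add [simp]: "\<lbrakk>x \<in> carrier A; y \<in> carrier A\<rbrakk> \<Longrightarrow> \<phi> (x \<oplus>\<^bsub>A\<^esub> y) = \<phi> x \<oplus>\<^bsub>B\<^esub> \<phi> y"
  and hom_mult [simp]: "\<lbrakk>x \<in> carrier A; y \<in> carrier A\<rbrakk> \<Longrightarrow> \<phi> (x \<otimes>\<^bsub>A\<^esub> y) = \<phi> x \<otimes>\<^bsub>B\<^esub> \<phi> y"
  and hom_smult [simp]: "x \<in> carrier A \<Longrightarrow> \<phi> (c \<odot>\<^bsub>A\<^esub> x) = c \<odot>\<^bsub>B\<^esub> \<phi> x"
  and hom_star [simp]: "x \<in> carrier A \<Longrightarrow> \<phi> (star A x) = star B (\<phi> x)"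
  using hom by (auto simp: star_hom_def)

lemma hom_zero [simp]: "\<phi> \<zero>\<^bsub>A\<^esub> = \<zero>\<^bsub>B\<^esub>"
  using hom_smult[of "\<zero>\<^bsub>A\<^esub>" 0] by simp

lemma hom_minus [simp]:
  "\<lbrakk>x \<in> carrier A; y \<in> carrier A\<rbrakk> \<Longrightarrow> \<phi> (x \<ominus>\<^bsub>A\<^esub> y) = \<phi> x \<ominus>\<^bsub>B\<^esub> \<phi> y"
  by (simp add: A.minus_scalar B.minus_scalar)

lemma hom_lincomb:
  "snd ` set cs \<subseteq> carrier A \<Longrightarrow> \<phi> (lincomb A cs) = lincomb B (map (\<lambda>(c, x). (c, \<phi> x)) cs)"
  by (induction cs) auto

context
  fixes w v P
  assumes w: "w \<in> P \<rightarrow> carrier A" and v: "\<And>p. p \<in> P \<Longrightarrow> \<phi> (w p) = v p"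
begin

lemma hom_word_elem:
  assumes "set \<alpha> \<subseteq> P"
  shows "\<phi> (word_elem A w \<alpha>) = word_elem B v \<alpha>"
  using assms
proof (induction \<alpha> rule: induct_list012)
  case (3 p q \<alpha>)
  then have "w p \<in> carrier A" "w q \<in> carrier A" using w by auto
  then show ?case
    using 3 v A.word_elem_closed[OF w, of \<alpha>] by simp
qed auto

lemma hom_diff_prod:
  assumes "set \<alpha> \<subseteq> P" "\<And>\<beta>. \<beta> \<in> set \<beta>s \<Longrightarrow> set \<beta> \<subseteq> P"
  shows "\<phi> (diff_prod A w \<alpha> \<beta>s) = diff_prod B v \<alpha> \<beta>s"
  using assms(2)
proof (induction \<beta>s)
  case (Cons \<beta> \<beta>s)
  have "word_elem A w \<alpha> \<in> carrier A" "word_elem A w \<beta> \<in> carrier A" "diff_prod A w \<alpha> \<beta>s \<in> carrier A"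
    using w assms(1) Cons.prems by (auto intro!: A.word_elem_closed[OF w] A.diff_prod_closed[OF w])
  then show ?case using Cons assms(1) by (simp add: hom_word_elem)
qed simp

text \<open>Relators are built from generators by operations that \<open>\<phi>\<close> preserves.
  Hence relations pass from the free algebra to the universal one, and polynomial evaluation maps
  abstract relators to relators of the given family.\<close>

lemma hom_toeplitz_relators:
  assumes "\<one>\<^bsub>G\<^esub> \<in> P"
  shows "toeplitz_relators G P B v = \<phi> ` toeplitz_relators G P A w"
proof -
  have N: "set \<alpha> \<subseteq> P" if "\<alpha> \<in> neutral_words G P" for \<alpha>
    using that by (simp add: neutral_words_def words_def)
  have W: "word_elem A w \<alpha> \<in> carrier A" if "\<alpha> \<in> neutral_words G P" for \<alpha>
    using A.word_elem_closed[OF w N[OF that]] .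
  have 1: "T1_relators G B v = \<phi> ` T1_relators G A w"
  proof -
    have "w \<one>\<^bsub>G\<^esub> \<in> carrier A" using w assms by auto
    then show ?thesis using assms v by (simp add: T1_relators_def)
  qed
  have 2: "T2_relators G P B v = \<phi> ` T2_relators G P A w"
    unfolding T2_relators_def using hom_word_elem[OF N] by (auto simp: image_iff) metis+
  have 3: "T3_relators G P B v = \<phi> ` T3_relators G P A w"
  proof -
    have "word_elem B v \<alpha> \<ominus>\<^bsub>B\<^esub> word_elem B v \<beta> = \<phi> (word_elem A w \<alpha> \<ominus>\<^bsub>A\<^esub> word_elem A w \<beta>)"
      if "\<alpha> \<in> neutral_words G P" "\<beta> \<in> neutral_words G P" for \<alpha> \<beta>
      using that W N by (simp add: hom_word_elem)
    then show ?thesis unfolding T3_relators_def by (auto simp: image_iff) metis+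
  qed
  have 4: "T4_relators G P B v = \<phi> ` T4_relators G P A w"
  proof -
    have "diff_prod B v \<alpha> \<beta>s = \<phi> (diff_prod A w \<alpha> \<beta>s)"
      if "\<alpha> \<in> neutral_words G P" "set \<beta>s \<subseteq> neutral_words G P" for \<alpha> \<beta>s
      using that N by (intro hom_diff_prod[symmetric]) auto
    then show ?thesis unfolding T4_relators_def by (auto simp: image_iff) metis+
  qed
  show ?thesis by (simp add: toeplitz_relators_def 1 2 3 4 image_Un)
qed

lemma hom_boundary_products: "boundary_products G P B v = \<phi> ` boundary_products G P A w"
proof -
  have N: "set \<alpha> \<subseteq> P" if "\<alpha> \<in> neutral_words G P" for \<alpha>
    using that by (simp add: neutral_words_def words_def)
  have "diff_prod B v \<alpha> \<beta>s = \<phi> (diff_prod A w \<alpha> \<beta>s)"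
    if "\<alpha> \<in> neutral_words G P" "set \<beta>s \<subseteq> neutral_words G P" for \<alpha> \<beta>s
    using that N by (intro hom_diff_prod[symmetric]) auto
  then show ?thesis unfolding boundary_products_def by (auto simp: image_iff) metis+
qed

end

end


section \<open>The universal C*-algebra\<close>

definition admissible_seminorms :: "('a, 'x) star_algebra_scheme \<Rightarrow> 'a set \<Rightarrow> ('a \<Rightarrow> real) set" where
  "admissible_seminorms F R = {N. cstar_seminorm F N \<and> (\<forall>r\<in>R. N r = 0)}"

text \<open>Each axiom of a C*-seminorm survives a bounded pointwise supremum. The inequalities are
  immediate; the two equations, homogeneity and the C*-identity, need an argument for each
  direction.\<close>

lemma cstar_seminorm_universal:
  assumes "unital_star_algebra F" and R: "R \<subseteq> carrier F"
    and bdd: "\<And>x. x \<in> carrier F \<Longrightarrow> bdd_above ((\<lambda>N. N x) ` admissible_seminorms F R)"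
  shows "cstar_seminorm F (universal_seminorm F R)"
    and "\<And>r. r \<in> R \<Longrightarrow> universal_seminorm F R r = 0"
    and "\<And>N x. \<lbrakk>cstar_seminorm F N; \<forall>r\<in>R. N r = 0; x \<in> carrier F\<rbrakk> \<Longrightarrow> N x \<le> universal_seminorm F R x"
proof -
  interpret unital_star_algebra F by fact
  define S where "S = admissible_seminorms F R"
  have U: "universal_seminorm F R x = (SUP N\<in>S. N x)" for x
    by (simp add: universal_seminorm_def S_def admissible_seminorms_def)
  have S: "cstar_seminormed_algebra F N" if "N \<in> S" for N
    using that by unfold_locales (auto simp: S_def admissible_seminorms_def)
  \<comment> \<open>The zero seminorm makes the index set nonempty and the supremum
    nonnegative.\<close>
  have zero: "(\<lambda>_. 0) \<in> S" by (simp add: S_def admissible_seminorms_def cstar_seminorm_def)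
  have up: "N x \<le> universal_seminorm F R x" if "N \<in> S" "x \<in> carrier F" for N x
    unfolding U using that bdd by (intro cSUP_upper) (auto simp: S_def)
  have least: "universal_seminorm F R x \<le> b" if "\<And>N. N \<in> S \<Longrightarrow> N x \<le> b" for x b
    unfolding U using that zero by (intro cSUP_least) auto
  have nonneg: "0 \<le> universal_seminorm F R x" if "x \<in> carrier F" for x
    using up[OF zero that] by simp
  show "\<And>N x. \<lbrakk>cstar_seminorm F N; \<forall>r\<in>R. N r = 0; x \<in> carrier F\<rbrakk> \<Longrightarrow> N x \<le> universal_seminorm F R x"
    by (rule up) (auto simp: S_def admissible_seminorms_def)
  show "universal_seminorm F R r = 0" if "r \<in> R" for r
  proof (rule antisym)
    show "universal_seminorm F R r \<le> 0"
      by (rule least) (use that in \<open>auto simp: S_def admissible_seminorms_def\<close>)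
  qed (use nonneg that R in auto)
  have smult_le: "universal_seminorm F R (c \<odot>\<^bsub>F\<^esub> x) \<le> cmod c * universal_seminorm F R x"
    if "x \<in> carrier F" for c x
  proof (rule least)
    fix N assume N: "N \<in> S"
    interpret cstar_seminormed_algebra F N by (rule S[OF N])
    show "N (c \<odot>\<^bsub>F\<^esub> x) \<le> cmod c * universal_seminorm F R x"
      using up[OF N that] that by (simp add: N_smult mult_left_mono)
  qed
  show "cstar_seminorm F (universal_seminorm F R)"
    unfolding cstar_seminorm_def
  proof (intro conjI ballI allI)
    fix x assume x: "x \<in> carrier F"
    show "0 \<le> universal_seminorm F R x" by (rule nonneg[OF x])
    show "universal_seminorm F R (c \<odot>\<^bsub>F\<^esub> x) = cmod c * universal_seminorm F R x" for c
    proof (cases "c = 0")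
      case True
      then show ?thesis using smult_le[OF x, of c] nonneg[of "c \<odot>\<^bsub>F\<^esub> x"] x by simp
    next
      case False
      \<comment> \<open>The reverse inequality comes from scaling back with
        \<open>inverse c\<close>.\<close>
      have "universal_seminorm F R (inverse c \<odot>\<^bsub>F\<^esub> (c \<odot>\<^bsub>F\<^esub> x)) \<le> cmod (inverse c) * universal_seminorm F R (c \<odot>\<^bsub>F\<^esub> x)"
        using x by (intro smult_le) simp
      then have "universal_seminorm F R x \<le> universal_seminorm F R (c \<odot>\<^bsub>F\<^esub> x) / cmod c"
        using False x by (simp add: scalar_scalar norm_inverse norm_divide field_simps)
      then have "cmod c * universal_seminorm F R x \<le> universal_seminorm F R (c \<odot>\<^bsub>F\<^esub> x)"
        using False by (simp add: pos_le_divide_eq mult.commute)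
      then show ?thesis using smult_le[OF x, of c] by simp
    qed
    show "universal_seminorm F R (star F x \<otimes>\<^bsub>F\<^esub> x) = (universal_seminorm F R x)\<^sup>2"
    proof (rule antisym)
      show "universal_seminorm F R (star F x \<otimes>\<^bsub>F\<^esub> x) \<le> (universal_seminorm F R x)\<^sup>2"
      proof (rule least)
        fix N assume N: "N \<in> S"
        interpret cstar_seminormed_algebra F N by (rule S[OF N])
        show "N (star F x \<otimes>\<^bsub>F\<^esub> x) \<le> (universal_seminorm F R x)\<^sup>2"
          using up[OF N x] x by (simp add: N_cstar power_mono)
      qed
      \<comment> \<open>Taking square roots first allows comparison member by member: each
        \<open>N x\<close> is the root of its value at \<open>star F x \<otimes> x\<close>.\<close>
      have "universal_seminorm F R x \<le> sqrt (universal_seminorm F R (star F x \<otimes>\<^bsub>F\<^esub> x))"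
      proof (rule least)
        fix N assume N: "N \<in> S"
        interpret cstar_seminormed_algebra F N by (rule S[OF N])
        show "N x \<le> sqrt (universal_seminorm F R (star F x \<otimes>\<^bsub>F\<^esub> x))"
          using up[OF N, of "star F x \<otimes>\<^bsub>F\<^esub> x"] x by (intro real_le_rsqrt) (simp add: N_cstar)
      qed
      then show "(universal_seminorm F R x)\<^sup>2 \<le> universal_seminorm F R (star F x \<otimes>\<^bsub>F\<^esub> x)"
        using nonneg[OF x] nonneg[of "star F x \<otimes>\<^bsub>F\<^esub> x"] x
        by (metis power_mono real_sqrt_pow2 m_closed star_closed)
    qed
    fix y assume y: "y \<in> carrier F"
    show "universal_seminorm F R (x \<oplus>\<^bsub>F\<^esub> y) \<le> universal_seminorm F R x + universal_seminorm F R y"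
    proof (rule least)
      fix N assume N: "N \<in> S"
      interpret cstar_seminormed_algebra F N by (rule S[OF N])
      show "N (x \<oplus>\<^bsub>F\<^esub> y) \<le> universal_seminorm F R x + universal_seminorm F R y"
        using up[OF N x] up[OF N y] N_triangle[OF x y] by simp
    qed
    show "universal_seminorm F R (x \<otimes>\<^bsub>F\<^esub> y) \<le> universal_seminorm F R x * universal_seminorm F R y"
    proof (rule least)
      fix N assume N: "N \<in> S"
      interpret cstar_seminormed_algebra F N by (rule S[OF N])
      have "N x * N y \<le> universal_seminorm F R x * universal_seminorm F R y"
        using up[OF N x] up[OF N y] x y nonneg by (intro mult_mono) auto
      then show "N (x \<otimes>\<^bsub>F\<^esub> y) \<le> universal_seminorm F R x * universal_seminorm F R y"
        using N_mult[OF x y] by simp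
    qed
  qed
qed

section \<open>The submonoid and its universal C*-algebra\<close>

locale group_submonoid = group G for G :: "('g, 'm) monoid_scheme" (structure) +
  fixes P :: "'g set"
  assumes submonoid: "submonoid P G"
begin

lemma P_carrier [simp, intro]: "p \<in> P \<Longrightarrow> p \<in> carrier G"
  and P_mult [simp, intro]: "p \<in> P \<Longrightarrow> q \<in> P \<Longrightarrow> p \<otimes> q \<in> P"
  and P_one [simp, intro]: "\<one> \<in> P"
  using submonoid by (auto simp: submonoid_def)

abbreviation "Fr \<equiv> free_star_algebra P"
abbreviation "Nu \<equiv> toeplitz_seminorm G P"
abbreviation "Tu \<equiv> toeplitz_universal G P"
abbreviation "tu \<equiv> toeplitz_generator G P"
abbreviation "gen \<equiv> (free_generator :: 'g \<Rightarrow> 'g star_polynomial)"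

sublocale Fr: unital_star_algebra Fr by (rule unital_star_algebra_free)

lemma gen_closed: "gen \<in> P \<rightarrow> carrier Fr"
  by (auto simp: free_generator_def)

lemma neutral_words_set: "\<alpha> \<in> neutral_words G P \<Longrightarrow> set \<alpha> \<subseteq> P"
  by (simp add: neutral_words_def words_def)

lemma toeplitz_relators_closed:
  assumes "unital_star_algebra A" "w \<in> P \<rightarrow> carrier A"
  shows "toeplitz_relators G P A w \<subseteq> carrier A"
proof -
  interpret A: unital_star_algebra A by fact
  have "word_elem A w \<alpha> \<in> carrier A" if "\<alpha> \<in> neutral_words G P" for \<alpha>
    using A.word_elem_closed[OF assms(2) neutral_words_set[OF that]] .
  moreover have "diff_prod A w \<alpha> \<beta>s \<in> carrier A"
    if "\<alpha> \<in> neutral_words G P" "set \<beta>s \<subseteq> neutral_words G P" for \<alpha> \<beta>s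
    using that neutral_words_set by (intro A.diff_prod_closed[OF assms(2)]) auto
  moreover have "w \<one> \<in> carrier A" using assms by auto
  ultimately show ?thesis
    by (auto simp: toeplitz_relators_def T1_relators_def T2_relators_def T3_relators_def T4_relators_def)
qed

lemma Nil_neutral [simp]: "[] \<in> neutral_words G P"
  by (simp add: neutral_words_def words_def)

lemma pp_neutral: "p \<in> P \<Longrightarrow> [p, p] \<in> neutral_words G P"
  by (simp add: neutral_words_def words_def)

lemma K_pp: "p \<in> P \<Longrightarrow> K G P [p, p] = P"
  by (auto simp: l_coset_def)

text \<open>The words \<open>[p, p]\<close> and \<open>[]\<close> are neutral with the same ideal
  \<open>P\<close>, so (T3) gives each generator the norm \<open>N 1\<close> after squaring. Since
  \<open>N 1\<close> equals its own square, it is at most \<open>1\<close>, and submultiplicativity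
  extends the bound to all monomials. This uniform bound makes the supremum finite.\<close>

lemma admissible_le:
  assumes N: "N \<in> admissible_seminorms Fr (toeplitz_relators G P Fr gen)"
    and m: "fst ` set (letters m) \<subseteq> P"
  shows "N (Poly_Mapping.single m 1) \<le> 1"
proof -
  interpret cstar_seminormed_algebra Fr N
    using N by unfold_locales (auto simp: admissible_seminorms_def)
  have N1: "N 1 \<le> 1"
  proof -
    have "N (star Fr \<one>\<^bsub>Fr\<^esub> \<otimes>\<^bsub>Fr\<^esub> \<one>\<^bsub>Fr\<^esub>) = (N \<one>\<^bsub>Fr\<^esub>)\<^sup>2"
      by (rule N_cstar) (rule Fr.one_closed)
    then have "(N 1)\<^sup>2 = N 1" by (simp only: Fr.star_one) simp
    then show ?thesis by (auto simp: power2_eq_square)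
  qed
  have gen: "N (gen p) \<le> 1" if "p \<in> P" for p
  proof -
    have gc: "gen p \<in> carrier Fr" using gen_closed that by auto
    have "word_elem Fr gen [p, p] \<ominus>\<^bsub>Fr\<^esub> word_elem Fr gen [] \<in> T3_relators G P Fr gen"
      unfolding T3_relators_def
      by (rule CollectI, intro exI conjI, rule refl) (simp_all only: pp_neutral that Nil_neutral K_pp K.simps(2))
    then have "N (word_elem Fr gen [p, p] \<ominus>\<^bsub>Fr\<^esub> word_elem Fr gen []) = 0"
      using N unfolding admissible_seminorms_def toeplitz_relators_def by blast
    then have "N (star Fr (gen p) * gen p \<ominus>\<^bsub>Fr\<^esub> 1) = 0" by simp
    moreover have "\<bar>N (star Fr (gen p) * gen p) - N 1\<bar> \<le> N (star Fr (gen p) * gen p \<ominus>\<^bsub>Fr\<^esub> 1)"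
      using gc by (intro N_diff) simp_all
    ultimately have "(N (gen p))\<^sup>2 \<le> 1" using N_cstar[OF gc] N1 by simp
    then show ?thesis using power2_le_imp_le[of "N (gen p)" 1] by simp
  qed
  have "N (Poly_Mapping.single (Star_Monomial l) 1) \<le> 1" if "fst ` set l \<subseteq> P" for l
    using that
  proof (induction l)
    case Nil
    then show ?case using N1 by (simp flip: zero_star_monomial_def)
  next
    case (Cons a l)
    obtain p b where a: "a = (p, b)" by (cases a)
    have p: "p \<in> P" using Cons.prems a by auto
    have gc: "gen p \<in> carrier Fr" using gen_closed p by auto
    define x where "x = (Poly_Mapping.single (Star_Monomial [(p, b)]) 1 :: 'g star_polynomial)"
    have x: "x \<in> carrier Fr" using p by (simp add: x_def)
    have "x = (if b then star Fr (gen p) else gen p)"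
      by (auto simp: x_def free_generator_def free_star_single monomial_star_def)
    then have Nx: "N x \<le> 1" using gen[OF p] gc by simp
    have y: "Poly_Mapping.single (Star_Monomial l) 1 \<in> carrier Fr" using Cons.prems by simp
    have "Poly_Mapping.single (Star_Monomial (a # l)) 1 = x * Poly_Mapping.single (Star_Monomial l) 1"
      by (simp add: x_def mult_single plus_star_monomial_def a)
    then have "N (Poly_Mapping.single (Star_Monomial (a # l)) 1) \<le> N x * N (Poly_Mapping.single (Star_Monomial l) 1)"
      using N_mult[OF x y] by simp
    also have "\<dots> \<le> 1 * 1"
      using Nx Cons x y by (intro mult_mono) auto
    finally show ?case by simp
  qed
  from this[of "letters m"] m show ?thesis by simp
qed

lemma admissible_bounded:
  assumes "x \<in> carrier Fr"
  shows "\<exists>b. \<forall>N\<in>admissible_seminorms Fr (toeplitz_relators G P Fr gen). N x \<le> b"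
  using assms
proof (induction rule: free_induct)
  case (single m c)
  have "N (Poly_Mapping.single m c) \<le> cmod c"
    if N: "N \<in> admissible_seminorms Fr (toeplitz_relators G P Fr gen)" for N
  proof -
    interpret cstar_seminormed_algebra Fr N
      using N by unfold_locales (auto simp: admissible_seminorms_def)
    have "Poly_Mapping.single m c = c \<odot>\<^bsub>Fr\<^esub> Poly_Mapping.single m 1" by (simp add: mult_single)
    then show ?thesis
      using N_smult[of "Poly_Mapping.single m 1" c] admissible_le[OF N single] single
      by (simp add: mult_left_le)
  qed
  then show ?case by blast
next
  case (add x y)
  then obtain b c where bc: "\<forall>N\<in>admissible_seminorms Fr (toeplitz_relators G P Fr gen). N x \<le> b"
    "\<forall>N\<in>admissible_seminorms Fr (toeplitz_relators G P Fr gen). N y \<le> c" by blast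
  have "N (x + y) \<le> b + c"
    if N: "N \<in> admissible_seminorms Fr (toeplitz_relators G P Fr gen)" for N
  proof -
    interpret cstar_seminormed_algebra Fr N
      using N by unfold_locales (auto simp: admissible_seminorms_def)
    show ?thesis using N_triangle[of x y] add bc N by force
  qed
  then show ?case by blast
qed

lemma
  shows cstar_seminorm_Nu: "cstar_seminorm Fr Nu"
    and Nu_relator: "r \<in> toeplitz_relators G P Fr gen \<Longrightarrow> Nu r = 0"
    and Nu_upper: "\<lbrakk>cstar_seminorm Fr N; \<forall>r\<in>toeplitz_relators G P Fr gen. N r = 0; x \<in> carrier Fr\<rbrakk> \<Longrightarrow> N x \<le> Nu x"
proof -
  have bdd: "bdd_above ((\<lambda>N. N x) ` admissible_seminorms Fr (toeplitz_relators G P Fr gen))"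
    if "x \<in> carrier Fr" for x
    using admissible_bounded[OF that] by (auto simp: bdd_above_def)
  note * = cstar_seminorm_universal[OF unital_star_algebra_free
      toeplitz_relators_closed[OF unital_star_algebra_free gen_closed] bdd,
      folded toeplitz_seminorm_def]
  show "cstar_seminorm Fr Nu" by (rule *(1))
  show "r \<in> toeplitz_relators G P Fr gen \<Longrightarrow> Nu r = 0" by (rule *(2))
  show "\<lbrakk>cstar_seminorm Fr N; \<forall>r\<in>toeplitz_relators G P Fr gen. N r = 0; x \<in> carrier Fr\<rbrakk> \<Longrightarrow> N x \<le> Nu x"
    by (rule *(3))
qed

sublocale Nu: cstar_seminormed_algebra Fr Nu
  by unfold_locales (rule cstar_seminorm_Nu)

lemma cstar_algebra_Tu: "cstar_algebra Tu"
  unfolding toeplitz_universal_def by (rule Nu.cstar_algebra_C)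

sublocale Tu: cstar_algebra Tu by (rule cstar_algebra_Tu)

definition emb :: "'g star_polynomial \<Rightarrow> (nat \<Rightarrow> 'g star_polynomial) set" where
  "emb x = Nu.cls (\<lambda>_. x)"

lemma unital_star_hom_emb: "unital_star_hom Fr Tu emb"
proof unfold_locales
  show "star_hom Fr Tu emb"
    unfolding star_hom_def toeplitz_universal_def emb_def by (auto simp del: free_star_algebra_simps)
  show "emb \<one>\<^bsub>Fr\<^esub> = \<one>\<^bsub>Tu\<^esub>"
    unfolding toeplitz_universal_def emb_def by (simp add: Nu.one_C)
qed

sublocale emb: unital_star_hom Fr Tu emb by (rule unital_star_hom_emb)

lemma emb_gen: "emb (gen p) = tu p"
  by (simp add: emb_def toeplitz_generator_def)

lemma tu_closed: "tu \<in> P \<rightarrow> carrier Tu"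
proof
  fix p assume "p \<in> P"
  then have "gen p \<in> carrier Fr" using gen_closed by auto
  then show "tu p \<in> carrier Tu" unfolding emb_gen[symmetric] by (rule emb.hom_closed)
qed

text \<open>Relators have universal seminorm zero, so their constant sequences represent the zero
  class.\<close>

lemma tu_relations: "satisfies_toeplitz_relations G P Tu tu"
proof -
  have "emb r = \<zero>\<^bsub>Tu\<^esub>" if r: "r \<in> toeplitz_relators G P Fr gen" for r
  proof -
    have rc: "r \<in> carrier Fr"
      using toeplitz_relators_closed[OF unital_star_algebra_free gen_closed] r by auto
    have "cnorm Tu (emb r) = 0"
      using Nu.cnorm_C_const[OF rc] Nu_relator[OF r] by (simp add: emb_def toeplitz_universal_def)
    then show ?thesis using rc by (simp add: Tu.cnorm_eq_0_iff)
  qed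
  then show ?thesis
    unfolding satisfies_toeplitz_relations_def
    by (subst emb.hom_toeplitz_relators[OF gen_closed emb_gen]) auto
qed

end

text \<open>Instantiated with the left regular representation, with the universal generators and
  with the map of the theorem; every estimate proved here is available for all three.\<close>

locale toeplitz_representation = group_submonoid G P + B: cstar_algebra B
  for G :: "('g, 'm) monoid_scheme" and P and B :: "('b, 'c) cstar_algebra_scheme" (structure)
    and w :: "'g \<Rightarrow> 'b" +
  assumes w_closed: "w \<in> P \<rightarrow> carrier B" and w_relations: "satisfies_toeplitz_relations G P B w"
begin

sublocale ev: unital_star_hom Fr B "eval_star_polynomial B w"
  by unfold_locales (simp_all add: B.star_hom_eval[OF w_closed] B.eval_one[OF w_closed])

lemma eval_gen: "p \<in> P \<Longrightarrow> eval_star_polynomial B w (gen p) = w p"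
  by (rule B.eval_generator[OF w_closed])

sublocale ev: contractive_star_hom Fr Nu B "eval_star_polynomial B w"
proof unfold_locales
  show "star_hom Fr B (eval_star_polynomial B w)" by (rule B.star_hom_eval[OF w_closed])
  have "\<forall>r\<in>toeplitz_relators G P Fr gen. cnorm B (eval_star_polynomial B w r) = 0"
  proof
    fix r assume "r \<in> toeplitz_relators G P Fr gen"
    then have "eval_star_polynomial B w r \<in> toeplitz_relators G P B w"
      using ev.hom_toeplitz_relators[OF gen_closed eval_gen] by auto
    then show "cnorm B (eval_star_polynomial B w r) = 0"
      using w_relations unfolding satisfies_toeplitz_relations_def by (metis B.cnorm_zero)
  qed
  \<comment> \<open>The universal property enters here: the pulled-back norm is a C*-seminorm
    vanishing on the relators, hence one of those over which the supremum \<open>Nu\<close> is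
    taken.\<close>
  moreover have "cstar_seminorm Fr (\<lambda>x. cnorm B (eval_star_polynomial B w x))"
    unfolding cstar_seminorm_def
    by (auto simp del: free_star_algebra_simps
        simp: B.cnorm_nonneg B.cnorm_triangle B.cnorm_smult B.cnorm_mult B.cstar_identity)
  ultimately show "cnorm B (eval_star_polynomial B w x) \<le> Nu x" if "x \<in> carrier Fr" for x
    using Nu_upper[of "\<lambda>x. cnorm B (eval_star_polynomial B w x)"] that by blast
qed

abbreviation "ind \<equiv> toeplitz_induced B w"

lemma ind_eq: "ind = ev.extension"
  unfolding toeplitz_induced_def ev.extension_def by (rule ext) simp

lemma ind_emb: "x \<in> carrier Fr \<Longrightarrow> ind (emb x) = eval_star_polynomial B w x"
  unfolding emb_def ind_eq by (rule ev.extension_const)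

sublocale ind: unital_star_hom Tu B ind
proof unfold_locales
  show "star_hom Tu B ind"
    unfolding toeplitz_universal_def ind_eq by (rule ev.star_hom_extension)
  have "ind \<one>\<^bsub>Tu\<^esub> = ind (emb \<one>\<^bsub>Fr\<^esub>)" by (simp only: emb.hom_one)
  also have "\<dots> = \<one>" by (subst ind_emb) (simp_all add: B.eval_one[OF w_closed])
  finally show "ind \<one>\<^bsub>Tu\<^esub> = \<one>" .
qed

lemma ind_contractive: "c \<in> carrier Tu \<Longrightarrow> cnorm B (ind c) \<le> cnorm Tu c"
  unfolding toeplitz_universal_def ind_eq by (rule ev.extension_contractive)

lemma ind_gen: "p \<in> P \<Longrightarrow> ind (tu p) = w p"
  using ind_emb[of "gen p"] eval_gen[of p] gen_closed by (auto simp: emb_gen)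

lemma ind_word_elem: "set \<alpha> \<subseteq> P \<Longrightarrow> ind (word_elem Tu tu \<alpha>) = word_elem B w \<alpha>"
  by (rule ind.hom_word_elem[OF tu_closed ind_gen])

lemma ind_boundary_products: "boundary_products G P B w = ind ` boundary_products G P Tu tu"
  by (rule ind.hom_boundary_products[OF tu_closed ind_gen])

end


section \<open>Bounded operators on \<open>\<ell>\<^sup>2\<close>\<close>

lemma ell2_finite_le:
  assumes "f \<in> ell2 S" "finite F"
  shows "L2_set (\<lambda>x. cmod (f x)) F \<le> ell2_norm f"
  unfolding L2_set_def ell2_norm_def
  using assms by (intro real_sqrt_le_mono finite_sum_le_infsum) (auto simp: ell2_def)

text \<open>Membership and norm bound are both read off from uniform bounds on finite sets of
  coordinates, where \<open>L2_set\<close> already has its triangle and Cauchy-Schwarz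
  inequalities.\<close>

lemma ell2I:
  assumes "\<And>x. x \<notin> S \<Longrightarrow> f x = 0" "\<And>F. finite F \<Longrightarrow> L2_set (\<lambda>x. cmod (f x)) F \<le> C"
  shows "f \<in> ell2 S" "ell2_norm f \<le> C"
proof -
  have C: "0 \<le> C" using assms(2)[of "{}"] by simp
  have le: "(\<Sum>x\<in>F. (cmod (f x))\<^sup>2) \<le> C\<^sup>2" if "finite F" for F
    using assms(2)[OF that] C by (simp add: L2_set_def sqrt_le_D)
  have s: "(\<lambda>x. (cmod (f x))\<^sup>2) summable_on UNIV"
    by (rule nonneg_bdd_above_summable_on) (use le in \<open>auto simp: bdd_above_def\<close>)
  then show "f \<in> ell2 S" using assms by (simp add: ell2_def)
  have "(\<Sum>\<^sub>\<infinity>x. (cmod (f x))\<^sup>2) \<le> C\<^sup>2"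
    by (rule infsum_le_finite_sums[OF s]) (rule le)
  then show "ell2_norm f \<le> C" unfolding ell2_norm_def using C by (simp add: real_le_lsqrt)
qed

lemma ell2_norm_nonneg [simp]: "0 \<le> ell2_norm f"
  by (simp add: ell2_norm_def infsum_nonneg)

lemma ell2_outside: "f \<in> ell2 S \<Longrightarrow> x \<notin> S \<Longrightarrow> f x = 0"
  by (simp add: ell2_def)

lemma ell2_mono: "S \<subseteq> S' \<Longrightarrow> ell2 S \<subseteq> ell2 S'"
  by (auto simp: ell2_def)

lemma ell2_point_le: "f \<in> ell2 S \<Longrightarrow> cmod (f x) \<le> ell2_norm f"
  using ell2_finite_le[of f S "{x}"] by simp

lemma
  assumes "f \<in> ell2 S" "g \<in> ell2 S"
  shows ell2_add [simp]: "(\<lambda>x. f x + g x) \<in> ell2 S"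
    and ell2_norm_triangle: "ell2_norm (\<lambda>x. f x + g x) \<le> ell2_norm f + ell2_norm g"
proof -
  have "L2_set (\<lambda>x. cmod (f x + g x)) F \<le> ell2_norm f + ell2_norm g" if "finite F" for F
  proof -
    have "L2_set (\<lambda>x. cmod (f x + g x)) F \<le> L2_set (\<lambda>x. cmod (f x) + cmod (g x)) F"
      by (intro L2_set_mono norm_triangle_ineq) auto
    also have "\<dots> \<le> L2_set (\<lambda>x. cmod (f x)) F + L2_set (\<lambda>x. cmod (g x)) F" by (rule L2_set_triangle_ineq)
    also have "\<dots> \<le> ell2_norm f + ell2_norm g"
      using assms that by (intro add_mono ell2_finite_le)
    finally show ?thesis .
  qed
  from ell2I[of S _ "ell2_norm f + ell2_norm g", OF _ this] assms
  show "(\<lambda>x. f x + g x) \<in> ell2 S" "ell2_norm (\<lambda>x. f x + g x) \<le> ell2_norm f + ell2_norm g"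
    by (auto simp: ell2_outside)
qed

lemma ell2_norm_scale: "ell2_norm (\<lambda>x. c * f x) = cmod c * ell2_norm f"
  by (simp add: ell2_norm_def norm_mult power_mult_distrib infsum_cmult_right' real_sqrt_mult)

lemma ell2_scale [simp]: "f \<in> ell2 S \<Longrightarrow> (\<lambda>x. c * f x) \<in> ell2 S"
  by (auto simp: ell2_def norm_mult power_mult_distrib intro!: summable_on_cmult_right)

lemma ell2_zero [simp]: "(\<lambda>_. 0) \<in> ell2 S" "ell2_norm (\<lambda>_. 0) = 0"
  by (simp_all add: ell2_def ell2_norm_def)

lemma ell2_diff [simp]: "f \<in> ell2 S \<Longrightarrow> g \<in> ell2 S \<Longrightarrow> (\<lambda>x. f x - g x) \<in> ell2 S"
  using ell2_add[of f S "\<lambda>x. (-1) * g x"] ell2_scale[of g S "-1"] by simp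

lemma ell2_norm_eq_0: "f \<in> ell2 S \<Longrightarrow> ell2_norm f = 0 \<longleftrightarrow> f = (\<lambda>_. 0)"
  using ell2_point_le[of f S] by fastforce

lemma ell2_dominated:
  assumes "f \<in> ell2 S" "\<And>x. cmod (g x) \<le> C * cmod (f x)" "0 \<le> C"
  shows "g \<in> ell2 S" "ell2_norm g \<le> C * ell2_norm f"
proof -
  have "L2_set (\<lambda>x. cmod (g x)) F \<le> C * ell2_norm f" if "finite F" for F
  proof -
    have "L2_set (\<lambda>x. cmod (g x)) F \<le> L2_set (\<lambda>x. C * cmod (f x)) F"
      using assms by (intro L2_set_mono) auto
    also have "\<dots> = C * L2_set (\<lambda>x. cmod (f x)) F"
      using assms by (simp add: L2_set_right_distrib)
    also have "\<dots> \<le> C * ell2_norm f"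
      using assms that by (intro mult_left_mono ell2_finite_le) auto
    finally show ?thesis .
  qed
  moreover have "g x = 0" if "x \<notin> S" for x
    using assms(2)[of x] ell2_outside[OF assms(1) that] by simp
  ultimately show "g \<in> ell2 S" "ell2_norm g \<le> C * ell2_norm f"
    using ell2I[of S g "C * ell2_norm f"] by auto
qed

definition ket :: "'g \<Rightarrow> 'g \<Rightarrow> complex" where
  "ket x = (\<lambda>y. if y = x then 1 else 0)"

lemma L2_set_ket: "finite F \<Longrightarrow> L2_set (\<lambda>y. cmod (ket x y)) F \<le> 1"
proof -
  assume F: "finite F"
  have "(\<Sum>y\<in>F. (cmod (ket x y))\<^sup>2) = (\<Sum>y\<in>F. if y = x then 1 else 0)"
    by (intro sum.cong) (auto simp: ket_def)
  also have "\<dots> \<le> 1" using F by simp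
  finally show ?thesis by (simp add: L2_set_def)
qed

lemma ket_ell2 [simp]: "x \<in> S \<Longrightarrow> ket x \<in> ell2 S"
  by (rule ell2I(1)[OF _ L2_set_ket]) (auto simp: ket_def)

lemma ket_norm: "ell2_norm (ket x) \<le> 1"
  by (rule ell2I(2)[of UNIV, OF _ L2_set_ket]) auto

lemma ell2_inner_summable:
  assumes "f \<in> ell2 S" "g \<in> ell2 S"
  shows "(\<lambda>x. cmod (cnj (f x) * g x)) summable_on UNIV" "cmod (ell2_inner f g) \<le> ell2_norm f * ell2_norm g"
proof -
  have le: "(\<Sum>x\<in>F. cmod (cnj (f x) * g x)) \<le> ell2_norm f * ell2_norm g" if "finite F" for F
  proof -
    have "(\<Sum>x\<in>F. cmod (cnj (f x) * g x)) = (\<Sum>x\<in>F. \<bar>cmod (f x)\<bar> * \<bar>cmod (g x)\<bar>)"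
      by (simp add: norm_mult)
    also have "\<dots> \<le> L2_set (\<lambda>x. cmod (f x)) F * L2_set (\<lambda>x. cmod (g x)) F"
      by (rule L2_set_mult_ineq)
    also have "\<dots> \<le> ell2_norm f * ell2_norm g"
      using assms that by (intro mult_mono ell2_finite_le) auto
    finally show ?thesis .
  qed
  show s: "(\<lambda>x. cmod (cnj (f x) * g x)) summable_on UNIV"
    by (rule nonneg_bdd_above_summable_on) (use le in \<open>auto simp: bdd_above_def\<close>)
  have "cmod (ell2_inner f g) \<le> (\<Sum>\<^sub>\<infinity>x. cmod (cnj (f x) * g x))"
    unfolding ell2_inner_def by (rule norm_infsum_bound[OF s])
  also have "\<dots> \<le> ell2_norm f * ell2_norm g"
    by (rule infsum_le_finite_sums[OF s le])
  finally show "cmod (ell2_inner f g) \<le> ell2_norm f * ell2_norm g" .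
qed

lemma ell2_inner_add_right:
  assumes "f \<in> ell2 S" "g \<in> ell2 S" "h \<in> ell2 S"
  shows "ell2_inner f (\<lambda>x. g x + h x) = ell2_inner f g + ell2_inner f h"
  unfolding ell2_inner_def distrib_left
  by (rule infsum_add)
    (rule abs_summable_summable[OF ell2_inner_summable(1)[OF assms(1,2)]],
     rule abs_summable_summable[OF ell2_inner_summable(1)[OF assms(1,3)]])

lemma ell2_inner_scale_right: "ell2_inner f (\<lambda>x. c * g x) = c * ell2_inner f g"
  unfolding ell2_inner_def by (simp add: mult.left_commute infsum_cmult_right')

lemma ell2_inner_commute: "ell2_inner g f = cnj (ell2_inner f g)"
  unfolding ell2_inner_def by (simp add: mult.commute flip: infsum_cnj)

lemma ell2_inner_add_left:
  assumes "f \<in> ell2 S" "g \<in> ell2 S" "h \<in> ell2 S"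
  shows "ell2_inner (\<lambda>x. g x + h x) f = ell2_inner g f + ell2_inner h f"
  using ell2_inner_add_right[OF assms] ell2_inner_commute complex_cnj_add by metis

lemma ell2_inner_scale_left: "ell2_inner (\<lambda>x. c * g x) f = cnj c * ell2_inner g f"
  using ell2_inner_scale_right[of f c g] ell2_inner_commute complex_cnj_mult by metis

lemma ell2_inner_diff_right:
  assumes "f \<in> ell2 S" "g \<in> ell2 S" "h \<in> ell2 S"
  shows "ell2_inner f (\<lambda>x. g x - h x) = ell2_inner f g - ell2_inner f h"
  using ell2_inner_add_right[of f S g "\<lambda>x. (-1) * h x"] ell2_inner_scale_right[of f "-1" h] assms
    ell2_scale[of h S "-1"] by simp

lemma ell2_inner_diff_left:
  assumes "f \<in> ell2 S" "g \<in> ell2 S" "h \<in> ell2 S"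
  shows "ell2_inner (\<lambda>x. g x - h x) f = ell2_inner g f - ell2_inner h f"
  using ell2_inner_diff_right[OF assms] ell2_inner_commute complex_cnj_diff by metis

lemma ell2_inner_self:
  assumes "f \<in> ell2 S"
  shows "ell2_inner f f = of_real ((ell2_norm f)\<^sup>2)"
proof -
  have "((\<lambda>x. (cmod (f x))\<^sup>2) has_sum (\<Sum>\<^sub>\<infinity>x. (cmod (f x))\<^sup>2)) UNIV"
    using assms by (intro has_sum_infsum) (simp add: ell2_def)
  then have "((\<lambda>x. complex_of_real ((cmod (f x))\<^sup>2)) has_sum of_real (\<Sum>\<^sub>\<infinity>x. (cmod (f x))\<^sup>2)) UNIV"
    by (rule has_sum_of_real)
  then have "ell2_inner f f = of_real (\<Sum>\<^sub>\<infinity>x. (cmod (f x))\<^sup>2)"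
    unfolding ell2_inner_def by (simp add: complex_norm_square mult.commute infsumI del: of_real_power)
  then show ?thesis by (simp add: ell2_norm_def infsum_nonneg)
qed

lemma ell2_inner_ket_left: "ell2_inner (ket x) g = g x"
proof -
  have "ell2_inner (ket x) g = (\<Sum>\<^sub>\<infinity>y\<in>{x}. g y)"
    unfolding ell2_inner_def ket_def by (rule infsum_cong_neutral) auto
  then show ?thesis by simp
qed

lemma ell2_inner_ket_right: "ell2_inner g (ket x) = cnj (g x)"
  using ell2_inner_commute[of g "ket x"] ell2_inner_ket_left by simp

definition trunc :: "'g set \<Rightarrow> ('g \<Rightarrow> complex) \<Rightarrow> 'g \<Rightarrow> complex" where
  "trunc F f = (\<lambda>x. if x \<in> F then f x else 0)"

lemma trunc_norm:
  assumes "finite F"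
  shows "ell2_norm (trunc F f) \<le> L2_set (\<lambda>x. cmod (f x)) F" "F \<subseteq> S \<Longrightarrow> trunc F f \<in> ell2 S"
proof -
  have "L2_set (\<lambda>x. cmod (trunc F f x)) F' \<le> L2_set (\<lambda>x. cmod (f x)) F" if "finite F'" for F'
  proof -
    have "(\<Sum>x\<in>F'. (cmod (trunc F f x))\<^sup>2) = (\<Sum>x\<in>F' \<inter> F. (cmod (f x))\<^sup>2)"
      using that by (intro sum.mono_neutral_cong_right) (auto simp: trunc_def)
    also have "\<dots> \<le> (\<Sum>x\<in>F. (cmod (f x))\<^sup>2)" using assms by (intro sum_mono2) auto
    finally show ?thesis by (simp add: L2_set_def)
  qed
  note le = this
  show "ell2_norm (trunc F f) \<le> L2_set (\<lambda>x. cmod (f x)) F" by (rule ell2I(2)[of UNIV, OF _ le]) auto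
  show "F \<subseteq> S \<Longrightarrow> trunc F f \<in> ell2 S" by (rule ell2I(1)[OF _ le]) (auto simp: trunc_def)
qed

text \<open>Finitely supported vectors are dense. The set is taken so large that its finite square
  sum misses the total by less than \<open>e ^ 2\<close>.\<close>

lemma trunc_approx:
  assumes f: "f \<in> ell2 S" and e: "e > 0"
  obtains F where "finite F" "F \<subseteq> S" "ell2_norm (\<lambda>x. f x - trunc F f x) \<le> e"
proof -
  define s where "s = (\<Sum>\<^sub>\<infinity>x. (cmod (f x))\<^sup>2)"
  have sm: "(\<lambda>x. (cmod (f x))\<^sup>2) summable_on UNIV" using f by (simp add: ell2_def)
  have "\<exists>F. finite F \<and> (\<Sum>x\<in>F. (cmod (f x))\<^sup>2) > s - e\<^sup>2"
  proof (rule ccontr)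
    assume "\<not> ?thesis"
    then have "s \<le> s - e\<^sup>2" unfolding s_def
      by (intro infsum_le_finite_sums[OF sm]) (auto simp: not_less)
    then show False using e by simp
  qed
  then obtain F where F: "finite F" "(\<Sum>x\<in>F. (cmod (f x))\<^sup>2) > s - e\<^sup>2" by blast
  \<comment> \<open>Since \<open>f\<close> vanishes off \<open>S\<close>, the finite set may be cut
    down to a subset of \<open>S\<close>, which keeps the truncation in
    \<open>ell2 S\<close>.\<close>
  have "(\<Sum>x\<in>F \<inter> S. (cmod (f x))\<^sup>2) = (\<Sum>x\<in>F. (cmod (f x))\<^sup>2)"
    using F f by (intro sum.mono_neutral_left) (auto simp: ell2_outside)
  then have FS: "(\<Sum>x\<in>F \<inter> S. (cmod (f x))\<^sup>2) > s - e\<^sup>2" using F by simp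
  have "ell2_norm (\<lambda>x. f x - trunc (F \<inter> S) f x) \<le> e"
  proof (rule ell2I(2)[of S])
    fix F' :: "'a set" assume F': "finite F'"
    have "(\<Sum>x\<in>F'. (cmod (f x - trunc (F \<inter> S) f x))\<^sup>2) = (\<Sum>x\<in>F' - (F \<inter> S). (cmod (f x))\<^sup>2)"
      using F' by (intro sum.mono_neutral_cong_right) (auto simp: trunc_def)
    also have "\<dots> = (\<Sum>x\<in>F' \<union> (F \<inter> S). (cmod (f x))\<^sup>2) - (\<Sum>x\<in>F \<inter> S. (cmod (f x))\<^sup>2)"
      using F F' sum.union_disjoint[of "F' - (F \<inter> S)" "F \<inter> S" "\<lambda>x. (cmod (f x))\<^sup>2"]
      by (simp add: Un_Diff_cancel2 Diff_disjoint Int_commute[of "F' - _"])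
    also have "(\<Sum>x\<in>F' \<union> (F \<inter> S). (cmod (f x))\<^sup>2) \<le> s"
      unfolding s_def using F F' by (intro finite_sum_le_infsum[OF sm]) auto
    finally have "(\<Sum>x\<in>F'. (cmod (f x - trunc (F \<inter> S) f x))\<^sup>2) \<le> e\<^sup>2" using FS by simp
    then show "L2_set (\<lambda>x. cmod (f x - trunc (F \<inter> S) f x)) F' \<le> e"
      unfolding L2_set_def using e by (intro real_le_lsqrt) auto
  qed (use f in \<open>auto simp: trunc_def ell2_outside\<close>)
  then show ?thesis using that[of "F \<inter> S"] F by auto
qed

section \<open>Bounded operators and their restricted norms\<close>

lemma
  assumes "T \<in> bounded_op_set S"
  shows bounded_op_closed: "f \<in> ell2 S \<Longrightarrow> T f \<in> ell2 S"
    and bounded_op_ext: "f \<notin> ell2 S \<Longrightarrow> T f = undefined"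
    and bounded_op_add: "\<lbrakk>f \<in> ell2 S; g \<in> ell2 S\<rbrakk> \<Longrightarrow> T (\<lambda>x. f x + g x) = (\<lambda>x. T f x + T g x)"
    and bounded_op_scale: "f \<in> ell2 S \<Longrightarrow> T (\<lambda>x. c * f x) = (\<lambda>x. c * T f x)"
    and bounded_op_bound: "\<exists>C\<ge>0. \<forall>f\<in>ell2 S. ell2_norm (T f) \<le> C * ell2_norm f"
proof -
  show "f \<in> ell2 S \<Longrightarrow> T f \<in> ell2 S" "f \<notin> ell2 S \<Longrightarrow> T f = undefined"
    "\<lbrakk>f \<in> ell2 S; g \<in> ell2 S\<rbrakk> \<Longrightarrow> T (\<lambda>x. f x + g x) = (\<lambda>x. T f x + T g x)"
    "f \<in> ell2 S \<Longrightarrow> T (\<lambda>x. c * f x) = (\<lambda>x. c * T f x)"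
    using assms by (auto simp: bounded_op_set_def PiE_def extensional_def)
  obtain C where C: "\<forall>f\<in>ell2 S. ell2_norm (T f) \<le> C * ell2_norm f"
    using assms by (auto simp: bounded_op_set_def)
  have "\<forall>f\<in>ell2 S. ell2_norm (T f) \<le> \<bar>C\<bar> * ell2_norm f"
    using C by (meson abs_ge_self ell2_norm_nonneg mult_right_mono order.trans)
  then show "\<exists>C\<ge>0. \<forall>f\<in>ell2 S. ell2_norm (T f) \<le> C * ell2_norm f"
    by (intro exI[of _ "\<bar>C\<bar>"]) auto
qed

lemma bounded_opI:
  assumes "\<And>f. f \<in> ell2 S \<Longrightarrow> T f \<in> ell2 S" "\<And>f. f \<notin> ell2 S \<Longrightarrow> T f = undefined"
    "\<And>f g. \<lbrakk>f \<in> ell2 S; g \<in> ell2 S\<rbrakk> \<Longrightarrow> T (\<lambda>x. f x + g x) = (\<lambda>x. T f x + T g x)"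
    "\<And>c f. f \<in> ell2 S \<Longrightarrow> T (\<lambda>x. c * f x) = (\<lambda>x. c * T f x)"
    "\<And>f. f \<in> ell2 S \<Longrightarrow> ell2_norm (T f) \<le> C * ell2_norm f"
  shows "T \<in> bounded_op_set S"
  using assms by (auto simp: bounded_op_set_def PiE_def extensional_def intro!: exI[of _ C])

lemma bounded_op_zero: "T \<in> bounded_op_set S \<Longrightarrow> T (\<lambda>_. 0) = (\<lambda>_. 0)"
  using bounded_op_scale[of T S "\<lambda>_. 0" 0] by simp

lemma bounded_op_diff:
  assumes "T \<in> bounded_op_set S" "f \<in> ell2 S" "g \<in> ell2 S"
  shows "T (\<lambda>x. f x - g x) = (\<lambda>x. T f x - T g x)"
  using bounded_op_add[OF assms(1,2), of "\<lambda>x. (-1) * g x"] bounded_op_scale[OF assms(1,3), of "-1"]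
    ell2_scale[OF assms(3), of "-1"] by simp

lemma op_norm_on_bdd:
  assumes "T \<in> bounded_op_set S" "S' \<subseteq> S"
  shows "bdd_above ((\<lambda>f. ell2_norm (T f)) ` {f \<in> ell2 S'. ell2_norm f \<le> 1})"
proof -
  obtain C where C: "C \<ge> 0" "\<forall>f\<in>ell2 S. ell2_norm (T f) \<le> C * ell2_norm f"
    using bounded_op_bound[OF assms(1)] by blast
  have "ell2_norm (T f) \<le> C" if "f \<in> ell2 S'" "ell2_norm f \<le> 1" for f
  proof -
    have "ell2_norm (T f) \<le> C * ell2_norm f" using C(2) that(1) ell2_mono[OF assms(2)] by blast
    also have "\<dots> \<le> C * 1" using C(1) that(2) by (intro mult_left_mono)
    finally show ?thesis by simp
  qed
  then show ?thesis by (auto simp: bdd_above_def)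
qed

lemma op_norm_on_nonneg:
  assumes "T \<in> bounded_op_set S" "S' \<subseteq> S"
  shows "0 \<le> op_norm_on S' T"
proof -
  have "ell2_norm (T (\<lambda>_. 0)) \<le> op_norm_on S' T"
    unfolding op_norm_on_def by (rule cSUP_upper[OF _ op_norm_on_bdd[OF assms]]) simp
  then show ?thesis using ell2_norm_nonneg order.trans by blast
qed

lemma op_norm_on_upper:
  assumes T: "T \<in> bounded_op_set S" and S: "S' \<subseteq> S" and f: "f \<in> ell2 S'"
  shows "ell2_norm (T f) \<le> op_norm_on S' T * ell2_norm f"
proof (cases "ell2_norm f = 0")
  case True
  then have "f = (\<lambda>_. 0)" using ell2_norm_eq_0[OF f] by simp
  then show ?thesis using bounded_op_zero[OF T] by simp
next
  case False
  define r where "r = ell2_norm f"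
  have r: "r > 0" using False by (simp add: r_def less_le)
  have f': "f \<in> ell2 S" using f ell2_mono[OF S] by auto
  have "ell2_norm (T (\<lambda>x. of_real (inverse r) * f x)) \<le> op_norm_on S' T"
    unfolding op_norm_on_def
    by (rule cSUP_upper[OF _ op_norm_on_bdd[OF T S]])
      (use f r in \<open>simp add: ell2_norm_scale norm_inverse r_def[symmetric] del: of_real_inverse\<close>)
  then have "inverse r * ell2_norm (T f) \<le> op_norm_on S' T"
    using r by (simp add: bounded_op_scale[OF T f'] ell2_norm_scale del: of_real_inverse)
  then show ?thesis using r by (simp add: r_def[symmetric] field_simps)
qed

lemma op_norm_on_least:
  assumes "\<And>f. f \<in> ell2 S' \<Longrightarrow> ell2_norm (T f) \<le> C * ell2_norm f" "0 \<le> C"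
  shows "op_norm_on S' T \<le> C"
  unfolding op_norm_on_def
proof (rule cSUP_least)
  show "{f \<in> ell2 S'. ell2_norm f \<le> 1} \<noteq> {}"
    by (auto intro!: exI[of _ "\<lambda>_. 0"])
  fix f assume "f \<in> {f \<in> ell2 S'. ell2_norm f \<le> 1}"
  then show "ell2_norm (T f) \<le> C"
    using assms(1)[of f] mult_left_mono[of "ell2_norm f" 1 C] assms(2) by auto
qed

text \<open>Testing on the basis vector at \<open>p\<close> bounds every matrix entry of column
  \<open>p\<close>. For multiplication operators the diagonal entry is the value of the function at
  \<open>p\<close>, so norm bounds turn into pointwise ones.\<close>

lemma op_norm_on_point:
  assumes "T \<in> bounded_op_set S" "S' \<subseteq> S" "p \<in> S'"
  shows "cmod (T (ket p) x) \<le> op_norm_on S' T"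
proof -
  have k: "ket p \<in> ell2 S'" "ket p \<in> ell2 S" using assms by auto
  have "cmod (T (ket p) x) \<le> ell2_norm (T (ket p))"
    using ell2_point_le[OF bounded_op_closed[OF assms(1) k(2)]] .
  also have "\<dots> \<le> op_norm_on S' T * ell2_norm (ket p)"
    using assms k by (intro op_norm_on_upper)
  also have "\<dots> \<le> op_norm_on S' T * 1"
    using op_norm_on_nonneg[OF assms(1,2)] ket_norm by (intro mult_left_mono) auto
  finally show ?thesis by simp
qed

lemma bounded_ops_simps [simp]:
  "carrier (bounded_ops S) = bounded_op_set S"
  "T \<otimes>\<^bsub>bounded_ops S\<^esub> U = compose (ell2 S) T U"
  "\<one>\<^bsub>bounded_ops S\<^esub> = (\<lambda>f\<in>ell2 S. f)"
  "\<zero>\<^bsub>bounded_ops S\<^esub> = (\<lambda>f\<in>ell2 S. \<lambda>_. 0)"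
  "T \<oplus>\<^bsub>bounded_ops S\<^esub> U = (\<lambda>f\<in>ell2 S. \<lambda>x. T f x + U f x)"
  "c \<odot>\<^bsub>bounded_ops S\<^esub> T = (\<lambda>f\<in>ell2 S. \<lambda>x. c * T f x)"
  "cnorm (bounded_ops S) = op_norm_on S"
  by (simp_all add: bounded_ops_def)

lemma bounded_op_eqI:
  assumes "T \<in> bounded_op_set S" "U \<in> bounded_op_set S" "\<And>f x. f \<in> ell2 S \<Longrightarrow> T f x = U f x"
  shows "T = U"
proof
  fix f show "T f = U f"
    by (cases "f \<in> ell2 S") (use assms bounded_op_ext[of _ S f] in auto)
qed

lemma bounded_op_bound':
  "T \<in> bounded_op_set S \<Longrightarrow> f \<in> ell2 S \<Longrightarrow> ell2_norm (T f) \<le> op_norm_on S T * ell2_norm f"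
  by (rule op_norm_on_upper) auto

lemma bounded_op_plus [simp]:
  assumes "T \<in> bounded_op_set S" "U \<in> bounded_op_set S"
  shows "(\<lambda>f\<in>ell2 S. \<lambda>x. T f x + U f x) \<in> bounded_op_set S"
proof (rule bounded_opI[where C = "op_norm_on S T + op_norm_on S U"])
  fix f assume f: "f \<in> ell2 S"
  have "ell2_norm (\<lambda>x. T f x + U f x) \<le> ell2_norm (T f) + ell2_norm (U f)"
    by (rule ell2_norm_triangle[OF bounded_op_closed[OF assms(1) f] bounded_op_closed[OF assms(2) f]])
  then show "ell2_norm ((\<lambda>f\<in>ell2 S. \<lambda>x. T f x + U f x) f) \<le> (op_norm_on S T + op_norm_on S U) * ell2_norm f"
    using bounded_op_bound'[OF assms(1) f] bounded_op_bound'[OF assms(2) f] f by (simp add: distrib_right)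
qed (use assms in \<open>auto simp: bounded_op_closed bounded_op_add[OF assms(1)] bounded_op_add[OF assms(2)]
    bounded_op_scale[OF assms(1)] bounded_op_scale[OF assms(2)] algebra_simps\<close>)

lemma bounded_op_smult [simp]:
  assumes "T \<in> bounded_op_set S"
  shows "(\<lambda>f\<in>ell2 S. \<lambda>x. c * T f x) \<in> bounded_op_set S"
proof (rule bounded_opI[where C = "cmod c * op_norm_on S T"])
  fix f assume f: "f \<in> ell2 S"
  then show "ell2_norm ((\<lambda>f\<in>ell2 S. \<lambda>x. c * T f x) f) \<le> cmod c * op_norm_on S T * ell2_norm f"
    using bounded_op_bound'[OF assms(1) f] by (simp add: ell2_norm_scale mult.assoc mult_left_mono)
qed (use assms in \<open>auto simp: bounded_op_closed bounded_op_add[OF assms] bounded_op_scale[OF assms] algebra_simps\<close>)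

lemma bounded_op_compose [simp]:
  assumes "T \<in> bounded_op_set S" "U \<in> bounded_op_set S"
  shows "compose (ell2 S) T U \<in> bounded_op_set S"
proof (rule bounded_opI[where C = "op_norm_on S T * op_norm_on S U"])
  fix f assume f: "f \<in> ell2 S"
  have "ell2_norm (T (U f)) \<le> op_norm_on S T * ell2_norm (U f)"
    by (rule bounded_op_bound'[OF assms(1) bounded_op_closed[OF assms(2) f]])
  also have "\<dots> \<le> op_norm_on S T * (op_norm_on S U * ell2_norm f)"
    by (rule mult_left_mono[OF bounded_op_bound'[OF assms(2) f] op_norm_on_nonneg[OF assms(1)]]) simp
  finally show "ell2_norm (compose (ell2 S) T U f) \<le> op_norm_on S T * op_norm_on S U * ell2_norm f"
    using f by (simp add: compose_def mult.assoc)
qed (use assms in \<open>auto simp: compose_def bounded_op_closed bounded_op_add[OF assms(1)] bounded_op_add[OF assms(2)]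
    bounded_op_scale[OF assms(1)] bounded_op_scale[OF assms(2)]\<close>)

lemma bounded_op_one [simp]: "(\<lambda>f\<in>ell2 S. f) \<in> bounded_op_set S"
  by (rule bounded_opI[where C = 1]) auto

lemma bounded_op_null [simp]: "(\<lambda>f\<in>ell2 S. \<lambda>_. 0) \<in> bounded_op_set S"
  by (rule bounded_opI[where C = 0]) auto

lemma ring_bounded_ops: "ring (bounded_ops S)"
proof (rule ringI)
  show "abelian_group (bounded_ops S)"
  proof (rule abelian_groupI)
    fix T assume "T \<in> carrier (bounded_ops S)"
    then have T: "T \<in> bounded_op_set S" by simp
    show "\<exists>U\<in>carrier (bounded_ops S). U \<oplus>\<^bsub>bounded_ops S\<^esub> T = \<zero>\<^bsub>bounded_ops S\<^esub>"
      by (rule bexI[of _ "\<lambda>f\<in>ell2 S. \<lambda>x. (-1) * T f x"])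
        (use T bounded_op_smult[OF T, of "-1"] in \<open>auto simp: fun_eq_iff\<close>)
  qed (auto simp: fun_eq_iff algebra_simps bounded_op_ext)
  show "monoid (bounded_ops S)"
    by (rule monoidI) (auto simp: fun_eq_iff compose_def bounded_op_compose[unfolded compose_def] bounded_op_closed bounded_op_ext)
  fix T U V assume "T \<in> carrier (bounded_ops S)" "U \<in> carrier (bounded_ops S)" "V \<in> carrier (bounded_ops S)"
  then show "(T \<oplus>\<^bsub>bounded_ops S\<^esub> U) \<otimes>\<^bsub>bounded_ops S\<^esub> V
      = T \<otimes>\<^bsub>bounded_ops S\<^esub> V \<oplus>\<^bsub>bounded_ops S\<^esub> U \<otimes>\<^bsub>bounded_ops S\<^esub> V"
    "V \<otimes>\<^bsub>bounded_ops S\<^esub> (T \<oplus>\<^bsub>bounded_ops S\<^esub> U)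
      = V \<otimes>\<^bsub>bounded_ops S\<^esub> T \<oplus>\<^bsub>bounded_ops S\<^esub> V \<otimes>\<^bsub>bounded_ops S\<^esub> U"
    by (auto simp: fun_eq_iff compose_def bounded_op_closed bounded_op_add[of V])
qed

section \<open>Adjoints of bounded operators\<close>

lemma bounded_op_trunc_inner:
  assumes T: "T \<in> bounded_op_set S" and f: "f \<in> ell2 S" and F: "finite F" "F \<subseteq> S"
  shows "ell2_inner (T (trunc F g)) f = (\<Sum>x\<in>F. cnj (g x) * ell2_inner (T (ket x)) f)"
  using F
proof (induction F rule: finite_induct)
  case empty
  have "trunc {} g = (\<lambda>_. 0)" by (auto simp: trunc_def)
  then show ?case using bounded_op_zero[OF T] by (simp add: ell2_inner_def)
next
  case (insert y F)
  have "trunc (insert y F) g = (\<lambda>x. trunc F g x + g y * ket y x)"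
    using insert.hyps by (auto simp: trunc_def ket_def)
  moreover have "trunc F g \<in> ell2 S" using insert by (intro trunc_norm) auto
  moreover have "ket y \<in> ell2 S" using insert by auto
  ultimately have "T (trunc (insert y F) g) = (\<lambda>x. T (trunc F g) x + g y * T (ket y) x)"
    and c: "T (trunc F g) \<in> ell2 S" "T (ket y) \<in> ell2 S"
    using T by (auto simp: bounded_op_add[OF T] bounded_op_scale[OF T] bounded_op_closed)
  then show ?case
    using ell2_inner_add_left[OF f c(1) ell2_scale[OF c(2), of "g y"]] insert
    by (simp add: ell2_inner_scale_left)
qed

text \<open>Pairing with basis vectors forces the coordinate of \<open>U f\<close> at
  \<open>x\<close> to be the inner product of \<open>T (ket x)\<close> with \<open>f\<close>; the
  work is to show that this defines a bounded operator and that the identity extends beyond finitely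
  supported vectors.\<close>

lemma adjoint_exists:
  assumes T: "T \<in> bounded_op_set S"
  shows "\<exists>U\<in>bounded_op_set S. \<forall>f\<in>ell2 S. \<forall>g\<in>ell2 S. ell2_inner (U f) g = ell2_inner f (T g)"
proof -
  define U where "U = (\<lambda>f\<in>ell2 S. \<lambda>x. if x \<in> S then ell2_inner (T (ket x)) f else 0)"
  define N where "N = op_norm_on S T"
  have N: "0 \<le> N" unfolding N_def using T by (rule op_norm_on_nonneg) simp
  have Uf: "U f \<in> ell2 S" "ell2_norm (U f) \<le> N * ell2_norm f" if f: "f \<in> ell2 S" for f
  proof -
    have "L2_set (\<lambda>x. cmod (U f x)) F \<le> N * ell2_norm f" if "finite F" for F
    proof -
      define E where "E = F \<inter> S"
      have E: "finite E" "E \<subseteq> S" using that by (auto simp: E_def)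
      have "(\<Sum>x\<in>F. (cmod (U f x))\<^sup>2) = (\<Sum>x\<in>E. (cmod (U f x))\<^sup>2)"
        unfolding E_def using that f by (intro sum.mono_neutral_right) (auto simp: U_def)
      then have L: "L2_set (\<lambda>x. cmod (U f x)) F = L2_set (\<lambda>x. cmod (U f x)) E"
        by (simp add: L2_set_def)
      \<comment> \<open>Pairing \<open>f\<close> with \<open>T\<close> applied to the truncation of
        \<open>U f\<close> itself produces \<open>l ^ 2\<close> on one side and at most
        \<open>N * l * ell2_norm f\<close> on the other; cancelling one \<open>l\<close> gives the
        bound.\<close>
      define l where "l = L2_set (\<lambda>x. cmod (U f x)) E"
      have l: "0 \<le> l" by (simp add: l_def)
      have "complex_of_real (l\<^sup>2) = (\<Sum>x\<in>E. of_real ((cmod (U f x))\<^sup>2))"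
        by (simp add: l_def L2_set_def sum_nonneg)
      also have "\<dots> = (\<Sum>x\<in>E. cnj (U f x) * ell2_inner (T (ket x)) f)"
        using E f by (intro sum.cong) (auto simp: U_def complex_norm_square mult.commute simp del: of_real_power)
      also have "\<dots> = ell2_inner (T (trunc E (U f))) f"
        by (rule bounded_op_trunc_inner[OF T f E, symmetric])
      finally have "l\<^sup>2 = cmod (ell2_inner (T (trunc E (U f))) f)"
        by (metis norm_of_real abs_of_nonneg zero_le_power2)
      also have "\<dots> \<le> ell2_norm (T (trunc E (U f))) * ell2_norm f"
        by (rule ell2_inner_summable(2)[OF bounded_op_closed[OF T trunc_norm(2)[OF E]] f])
      also have "\<dots> \<le> (N * ell2_norm (trunc E (U f))) * ell2_norm f"
        unfolding N_def by (rule mult_right_mono[OF bounded_op_bound'[OF T trunc_norm(2)[OF E]]]) simp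
      also have "\<dots> \<le> (N * l) * ell2_norm f"
        unfolding l_def using E N by (intro mult_right_mono mult_left_mono trunc_norm) auto
      finally have "l * l \<le> l * (N * ell2_norm f)" by (simp add: power2_eq_square algebra_simps)
      then have "l \<le> N * ell2_norm f"
        using l N by (cases "l = 0") (auto simp: mult_le_cancel_left)
      then show ?thesis by (simp add: L l_def)
    qed
    from ell2I[OF _ this, of S] show "U f \<in> ell2 S" "ell2_norm (U f) \<le> N * ell2_norm f"
      using f by (auto simp: U_def)
  qed
  have U: "U \<in> bounded_op_set S"
  proof (rule bounded_opI[OF Uf(1) _ _ _ Uf(2)])
    show "\<And>f g. \<lbrakk>f \<in> ell2 S; g \<in> ell2 S\<rbrakk> \<Longrightarrow> U (\<lambda>x. f x + g x) = (\<lambda>x. U f x + U g x)"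
    proof
      fix f g x assume fg: "f \<in> ell2 S" "g \<in> ell2 S"
      show "U (\<lambda>x. f x + g x) x = U f x + U g x"
        using fg T ell2_inner_add_right[of "T (ket x)" S f g]
        by (auto simp: U_def bounded_op_closed)
    qed
  qed (auto simp: U_def ell2_inner_scale_right)
  have "ell2_inner (U f) g = ell2_inner f (T g)" if f: "f \<in> ell2 S" and g: "g \<in> ell2 S" for f g
  proof -
    define r where "r = cmod (ell2_inner g (U f) - ell2_inner (T g) f)"
    \<comment> \<open>The identity is exact for the truncation of \<open>g\<close>. The remainder
      has norm at most \<open>e\<close> and enters two pairings, each bounded with the constant
      \<open>N\<close>, whence the factor \<open>2\<close>.\<close>
    have "r \<le> 2 * N * ell2_norm f * e" if e: "e > 0" for e
    proof -
      obtain F where F: "finite F" "F \<subseteq> S" "ell2_norm (\<lambda>x. g x - trunc F g x) \<le> e"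
        using trunc_approx[OF g e] by blast
      have t: "trunc F g \<in> ell2 S" using F by (intro trunc_norm) auto
      let ?h = "\<lambda>x. g x - trunc F g x"
      have h: "?h \<in> ell2 S" using g t by simp
      have "ell2_inner (T (trunc F g)) f = (\<Sum>x\<in>F. cnj (g x) * U f x)"
        unfolding bounded_op_trunc_inner[OF T f F(1,2)] using F f by (intro sum.cong) (auto simp: U_def)
      also have "\<dots> = (\<Sum>\<^sub>\<infinity>x\<in>F. cnj (g x) * U f x)" using F by simp
      also have "\<dots> = ell2_inner (trunc F g) (U f)"
        unfolding ell2_inner_def by (rule infsum_cong_neutral) (auto simp: trunc_def)
      finally have eq: "ell2_inner (T (trunc F g)) f = ell2_inner (trunc F g) (U f)" .
      have "ell2_inner g (U f) - ell2_inner (T g) f = ell2_inner ?h (U f) - ell2_inner (T ?h) f"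
        using ell2_inner_diff_left[OF Uf(1)[OF f] g t] ell2_inner_diff_left[OF f, of "T g" "T (trunc F g)"]
          bounded_op_diff[OF T g t] T g t eq by (simp add: bounded_op_closed)
      then have "r \<le> cmod (ell2_inner ?h (U f)) + cmod (ell2_inner (T ?h) f)"
        unfolding r_def by (metis norm_triangle_ineq4)
      also have "\<dots> \<le> ell2_norm ?h * ell2_norm (U f) + ell2_norm (T ?h) * ell2_norm f"
        by (intro add_mono ell2_inner_summable(2)[OF h Uf(1)[OF f]] ell2_inner_summable(2)[OF bounded_op_closed[OF T h] f])
      also have "\<dots> \<le> ell2_norm ?h * (N * ell2_norm f) + (N * ell2_norm ?h) * ell2_norm f"
        using h f Uf(2)[OF f] T bounded_op_bound'[OF T h] unfolding N_def
        by (intro add_mono mult_left_mono mult_right_mono) auto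
      also have "\<dots> = 2 * N * ell2_norm f * ell2_norm ?h" by (simp add: algebra_simps)
      also have "\<dots> \<le> 2 * N * ell2_norm f * e" using F N by (intro mult_left_mono) auto
      finally show ?thesis .
    qed
    moreover have "((\<lambda>e. 2 * N * ell2_norm f * e) \<longlongrightarrow> 2 * N * ell2_norm f * 0) (at_right 0)"
      by (intro tendsto_intros)
    ultimately have "r \<le> 0"
      by (intro tendsto_lowerbound[of _ _ "at_right 0"])
        (auto simp: eventually_at_right_less intro: eventually_mono[OF eventually_at_right_less])
    then have "ell2_inner g (U f) = ell2_inner (T g) f" by (simp add: r_def)
    then show ?thesis using ell2_inner_commute by metis
  qed
  then show ?thesis using U by blast
qed

lemma adjoint_unique:
  assumes "U \<in> bounded_op_set S" "V \<in> bounded_op_set S"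
    "\<And>f g. f \<in> ell2 S \<Longrightarrow> g \<in> ell2 S \<Longrightarrow> ell2_inner (U f) g = ell2_inner (V f) g"
  shows "U = V"
proof (rule bounded_op_eqI[OF assms(1,2)])
  fix f x assume f: "f \<in> ell2 S"
  show "U f x = V f x"
  proof (cases "x \<in> S")
    case True
    then show ?thesis using assms(3)[OF f, of "ket x"] by (simp add: ell2_inner_ket_right)
  next
    case False
    then show ?thesis using f assms by (metis bounded_op_closed ell2_outside)
  qed
qed

lemma star_bounded_ops_eqI:
  assumes "T \<in> bounded_op_set S" "U \<in> bounded_op_set S"
    "\<And>f g. f \<in> ell2 S \<Longrightarrow> g \<in> ell2 S \<Longrightarrow> ell2_inner (U f) g = ell2_inner f (T g)"
  shows "star (bounded_ops S) T = U"
proof -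
  have "(THE U. U \<in> bounded_op_set S \<and> (\<forall>f\<in>ell2 S. \<forall>g\<in>ell2 S. ell2_inner (U f) g = ell2_inner f (T g))) = U"
  proof (rule the_equality)
    show "U \<in> bounded_op_set S \<and> (\<forall>f\<in>ell2 S. \<forall>g\<in>ell2 S. ell2_inner (U f) g = ell2_inner f (T g))"
      using assms by blast
    fix V assume "V \<in> bounded_op_set S \<and> (\<forall>f\<in>ell2 S. \<forall>g\<in>ell2 S. ell2_inner (V f) g = ell2_inner f (T g))"
    then show "V = U" by (intro adjoint_unique[OF _ assms(2)]) (simp_all add: assms(3))
  qed
  then show ?thesis by (simp add: bounded_ops_def)
qed

lemma
  assumes "T \<in> bounded_op_set S"
  shows star_bounded_ops_closed [simp]: "star (bounded_ops S) T \<in> bounded_op_set S"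
    and star_bounded_ops_inner: "\<lbrakk>f \<in> ell2 S; g \<in> ell2 S\<rbrakk> \<Longrightarrow> ell2_inner (star (bounded_ops S) T f) g = ell2_inner f (T g)"
proof -
  obtain U where U: "U \<in> bounded_op_set S" "\<forall>f\<in>ell2 S. \<forall>g\<in>ell2 S. ell2_inner (U f) g = ell2_inner f (T g)"
    using adjoint_exists[OF assms] by blast
  then have "star (bounded_ops S) T = U" by (intro star_bounded_ops_eqI[OF assms]) auto
  with U show "star (bounded_ops S) T \<in> bounded_op_set S"
    "\<lbrakk>f \<in> ell2 S; g \<in> ell2 S\<rbrakk> \<Longrightarrow> ell2_inner (star (bounded_ops S) T f) g = ell2_inner f (T g)" by auto
qed

lemma unital_star_algebra_bounded_ops: "unital_star_algebra (bounded_ops S)"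
proof -
  interpret ring "bounded_ops S" by (rule ring_bounded_ops)
  have inner': "ell2_inner (T f) g = ell2_inner f (star (bounded_ops S) T g)"
    if "T \<in> bounded_op_set S" "f \<in> ell2 S" "g \<in> ell2 S" for T f g
    using star_bounded_ops_inner[OF that(1,3,2)] ell2_inner_commute by metis
  show ?thesis
  proof (unfold_locales, goal_cases)
    case (7 T U c)
    then show ?case
      by (auto simp: fun_eq_iff compose_def bounded_op_closed bounded_op_scale[of T])
  next
    case (8 T)
    then show ?case by simp
  next
    case (9 T)
    then show ?case by (intro star_bounded_ops_eqI inner') auto
  next
    case (10 T U)
    then show ?case
    proof (intro star_bounded_ops_eqI)
      fix f g assume fg: "f \<in> ell2 S" "g \<in> ell2 S"
      have "T \<in> bounded_op_set S" "U \<in> bounded_op_set S" using 10 by auto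
      note TU = this star_bounded_ops_closed[OF this(1)] star_bounded_ops_closed[OF this(2)]
      show "ell2_inner ((star (bounded_ops S) T \<oplus>\<^bsub>bounded_ops S\<^esub> star (bounded_ops S) U) f) g
          = ell2_inner f ((T \<oplus>\<^bsub>bounded_ops S\<^esub> U) g)"
        using fg TU ell2_inner_add_left[OF fg(2), of "star (bounded_ops S) T f" "star (bounded_ops S) U f"]
          ell2_inner_add_right[OF fg(1), of "T g" "U g"]
        by (simp add: bounded_op_closed star_bounded_ops_inner)
    qed auto
  next
    case (11 T c)
    then show ?case
      by (intro star_bounded_ops_eqI)
        (auto simp: ell2_inner_scale_left ell2_inner_scale_right star_bounded_ops_inner)
  next
    case (12 T U)
    then show ?case
      by (intro star_bounded_ops_eqI)
        (auto simp: compose_def bounded_op_compose[unfolded compose_def] star_bounded_ops_inner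
          bounded_op_closed)
  qed (auto simp: fun_eq_iff compose_def bounded_op_closed bounded_op_ext algebra_simps)
qed

section \<open>The operator norm and completeness\<close>

lemma op_norm_eq_0:
  assumes T: "T \<in> bounded_op_set S" and z: "op_norm_on S T = 0"
  shows "T = (\<lambda>f\<in>ell2 S. \<lambda>_. 0)"
proof (rule bounded_op_eqI[OF T bounded_op_null])
  fix f x assume f: "f \<in> ell2 S"
  have "ell2_norm (T f) \<le> 0" using bounded_op_bound'[OF T f] z by simp
  then have "ell2_norm (T f) = 0" using ell2_norm_nonneg[of "T f"] by linarith
  then have "T f = (\<lambda>_. 0)" using ell2_norm_eq_0[OF bounded_op_closed[OF T f]] by simp
  then show "T f x = (\<lambda>f\<in>ell2 S. \<lambda>_. 0) f x" using f by simp
qed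

lemma op_norm_smult_le:
  assumes T: "T \<in> bounded_op_set S" and S: "S' \<subseteq> S"
  shows "op_norm_on S' (c \<odot>\<^bsub>bounded_ops S\<^esub> T) \<le> cmod c * op_norm_on S' T"
proof (rule op_norm_on_least)
  fix f assume f: "f \<in> ell2 S'"
  then have "f \<in> ell2 S" using ell2_mono[OF S] by auto
  then show "ell2_norm ((c \<odot>\<^bsub>bounded_ops S\<^esub> T) f) \<le> cmod c * op_norm_on S' T * ell2_norm f"
    using op_norm_on_upper[OF T S f] by (simp add: ell2_norm_scale mult.assoc mult_left_mono)
qed (use op_norm_on_nonneg[OF T S] in auto)

lemma op_norm_triangle:
  assumes T: "T \<in> bounded_op_set S" and U: "U \<in> bounded_op_set S" and S: "S' \<subseteq> S"
  shows "op_norm_on S' (T \<oplus>\<^bsub>bounded_ops S\<^esub> U) \<le> op_norm_on S' T + op_norm_on S' U"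
proof (rule op_norm_on_least)
  fix f assume f: "f \<in> ell2 S'"
  then have f': "f \<in> ell2 S" using ell2_mono[OF S] by auto
  have "ell2_norm (\<lambda>x. T f x + U f x) \<le> ell2_norm (T f) + ell2_norm (U f)"
    by (rule ell2_norm_triangle[OF bounded_op_closed[OF T f'] bounded_op_closed[OF U f']])
  then show "ell2_norm ((T \<oplus>\<^bsub>bounded_ops S\<^esub> U) f) \<le> (op_norm_on S' T + op_norm_on S' U) * ell2_norm f"
    using op_norm_on_upper[OF T S f] op_norm_on_upper[OF U S f] f' by (simp add: distrib_right)
qed (use op_norm_on_nonneg[OF T S] op_norm_on_nonneg[OF U S] in auto)

lemma op_norm_compose:
  assumes T: "T \<in> bounded_op_set S" and U: "U \<in> bounded_op_set S"
  shows "op_norm_on S (compose (ell2 S) T U) \<le> op_norm_on S T * op_norm_on S U"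
proof (rule op_norm_on_least)
  fix f assume f: "f \<in> ell2 S"
  have "ell2_norm (T (U f)) \<le> op_norm_on S T * ell2_norm (U f)"
    by (rule bounded_op_bound'[OF T bounded_op_closed[OF U f]])
  also have "\<dots> \<le> op_norm_on S T * (op_norm_on S U * ell2_norm f)"
    by (rule mult_left_mono[OF bounded_op_bound'[OF U f] op_norm_on_nonneg[OF T]]) simp
  finally show "ell2_norm (compose (ell2 S) T U f) \<le> op_norm_on S T * op_norm_on S U * ell2_norm f"
    using f by (simp add: compose_def mult.assoc)
qed (use op_norm_on_nonneg[OF T] op_norm_on_nonneg[OF U] in auto)

text \<open>With \<open>U\<close> the adjoint, the squared norm of \<open>U f\<close> is the inner
  product of \<open>f\<close> with \<open>T (U f)\<close>; Cauchy-Schwarz and cancelling one factor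
  finish the estimate. The C*-identity \<open>op_norm_cstar\<close> uses the same idea with
  \<open>T f\<close>.\<close>

lemma op_norm_star_le:
  assumes T: "T \<in> bounded_op_set S"
  shows "op_norm_on S (star (bounded_ops S) T) \<le> op_norm_on S T"
proof (rule op_norm_on_least)
  let ?U = "star (bounded_ops S) T"
  have U: "?U \<in> bounded_op_set S" using T by simp
  have n: "0 \<le> op_norm_on S T" by (rule op_norm_on_nonneg[OF T]) simp
  fix f assume f: "f \<in> ell2 S"
  have Uf: "?U f \<in> ell2 S" by (rule bounded_op_closed[OF U f])
  define a where "a = ell2_norm (?U f)"
  have "complex_of_real (a\<^sup>2) = ell2_inner f (T (?U f))"
    using ell2_inner_self[OF Uf] star_bounded_ops_inner[OF T f Uf] by (simp add: a_def)
  then have "a\<^sup>2 = cmod (ell2_inner f (T (?U f)))" by (metis norm_of_real abs_of_nonneg zero_le_power2)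
  also have "\<dots> \<le> ell2_norm f * ell2_norm (T (?U f))"
    by (rule ell2_inner_summable(2)[OF f bounded_op_closed[OF T Uf]])
  also have "\<dots> \<le> ell2_norm f * (op_norm_on S T * a)"
    unfolding a_def by (intro mult_left_mono bounded_op_bound'[OF T Uf]) simp
  finally have "a * a \<le> a * (op_norm_on S T * ell2_norm f)" by (simp add: power2_eq_square algebra_simps)
  moreover have "0 \<le> a" by (simp add: a_def)
  ultimately show "ell2_norm (?U f) \<le> op_norm_on S T * ell2_norm f"
    unfolding a_def[symmetric] using n by (cases "a = 0") (auto simp: mult_le_cancel_left)
qed (rule op_norm_on_nonneg[OF T], simp)

lemma op_norm_cstar:
  assumes T: "T \<in> bounded_op_set S"
  shows "op_norm_on S (compose (ell2 S) (star (bounded_ops S) T) T) = (op_norm_on S T)\<^sup>2"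
proof (rule antisym)
  let ?U = "star (bounded_ops S) T"
  let ?V = "compose (ell2 S) ?U T"
  have U: "?U \<in> bounded_op_set S" using T by simp
  have V: "?V \<in> bounded_op_set S" using T U by simp
  have n: "0 \<le> op_norm_on S T" "0 \<le> op_norm_on S ?V" by (rule op_norm_on_nonneg[OF T] op_norm_on_nonneg[OF V], simp)+
  have "op_norm_on S ?V \<le> op_norm_on S ?U * op_norm_on S T" by (rule op_norm_compose[OF U T])
  also have "\<dots> \<le> op_norm_on S T * op_norm_on S T" by (intro mult_right_mono op_norm_star_le T n)
  finally show "op_norm_on S ?V \<le> (op_norm_on S T)\<^sup>2" by (simp add: power2_eq_square)
  have "op_norm_on S T \<le> sqrt (op_norm_on S ?V)"
  proof (rule op_norm_on_least)
    fix f assume f: "f \<in> ell2 S"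
    have Tf: "T f \<in> ell2 S" by (rule bounded_op_closed[OF T f])
    have "complex_of_real ((ell2_norm (T f))\<^sup>2) = ell2_inner (?V f) f"
      using ell2_inner_self[OF Tf] star_bounded_ops_inner[OF T Tf f] f by (simp add: compose_def)
    then have "(ell2_norm (T f))\<^sup>2 = cmod (ell2_inner (?V f) f)" by (metis norm_of_real abs_of_nonneg zero_le_power2)
    also have "\<dots> \<le> ell2_norm (?V f) * ell2_norm f"
      by (rule ell2_inner_summable(2)[OF bounded_op_closed[OF V f] f])
    also have "\<dots> \<le> (op_norm_on S ?V * ell2_norm f) * ell2_norm f"
      by (intro mult_right_mono bounded_op_bound'[OF V f]) simp
    also have "\<dots> = (sqrt (op_norm_on S ?V) * ell2_norm f)\<^sup>2"
      using n by (simp add: power2_eq_square algebra_simps)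
    finally show "ell2_norm (T f) \<le> sqrt (op_norm_on S ?V) * ell2_norm f"
      by (rule power2_le_imp_le) (use n in simp)
  qed (use n in simp)
  then have "(op_norm_on S T)\<^sup>2 \<le> (sqrt (op_norm_on S ?V))\<^sup>2" using n by (intro power_mono)
  then show "(op_norm_on S T)\<^sup>2 \<le> op_norm_on S ?V" using n by simp
qed

lemma bounded_ops_minus:
  assumes "T \<in> bounded_op_set S" "U \<in> bounded_op_set S"
  shows "T \<ominus>\<^bsub>bounded_ops S\<^esub> U = (\<lambda>f\<in>ell2 S. \<lambda>x. T f x - U f x)"
proof -
  interpret unital_star_algebra "bounded_ops S" by (rule unital_star_algebra_bounded_ops)
  show ?thesis using minus_scalar[of T U] assms by (simp add: fun_eq_iff)
qed

text \<open>The limit operator is constructed coordinatewise; norm convergence follows because the bound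
  on a finite set of coordinates survives the limit.\<close>

lemma bounded_ops_complete:
  assumes T: "\<And>n. T n \<in> bounded_op_set S"
    and cau: "\<And>e. e > 0 \<Longrightarrow> \<exists>M. \<forall>m\<ge>M. \<forall>n\<ge>M. op_norm_on S (T m \<ominus>\<^bsub>bounded_ops S\<^esub> T n) < e"
  shows "\<exists>U\<in>bounded_op_set S. (\<lambda>n. op_norm_on S (T n \<ominus>\<^bsub>bounded_ops S\<^esub> U)) \<longlonglongrightarrow> 0"
proof -
  interpret unital_star_algebra "bounded_ops S" by (rule unital_star_algebra_bounded_ops)
  have D: "T m \<ominus>\<^bsub>bounded_ops S\<^esub> T n \<in> bounded_op_set S" for m n
    using minus_closed[of "T m" "T n"] T by simp
  have diff: "ell2_norm (\<lambda>x. T m f x - T n f x) \<le> op_norm_on S (T m \<ominus>\<^bsub>bounded_ops S\<^esub> T n) * ell2_norm f"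
    if "f \<in> ell2 S" for m n f
    using bounded_op_bound'[OF D that] that by (simp add: bounded_ops_minus[OF T T])
  define U where "U = (\<lambda>f\<in>ell2 S. \<lambda>x. lim (\<lambda>n. T n f x))"
  have lim: "(\<lambda>n. T n f x) \<longlonglongrightarrow> U f x" if f: "f \<in> ell2 S" for f x
  proof -
    have "Cauchy (\<lambda>n. T n f x)"
    proof (rule CauchyI)
      fix e :: real assume e: "e > 0"
      have p: "ell2_norm f + 1 > 0" by (simp add: add_nonneg_pos)
      then obtain M where M: "\<forall>m\<ge>M. \<forall>n\<ge>M. op_norm_on S (T m \<ominus>\<^bsub>bounded_ops S\<^esub> T n) < e / (ell2_norm f + 1)"
        using cau[of "e / (ell2_norm f + 1)"] e by auto
      show "\<exists>M. \<forall>m\<ge>M. \<forall>n\<ge>M. norm (T m f x - T n f x) < e"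
      proof (intro exI[of _ M] allI impI)
        fix m n assume mn: "M \<le> m" "M \<le> n"
        have "norm (T m f x - T n f x) \<le> ell2_norm (\<lambda>x. T m f x - T n f x)"
          using ell2_point_le[OF ell2_diff[OF bounded_op_closed[OF T f] bounded_op_closed[OF T f]]] .
        also have "\<dots> \<le> op_norm_on S (T m \<ominus>\<^bsub>bounded_ops S\<^esub> T n) * ell2_norm f" by (rule diff[OF f])
        also have "\<dots> \<le> op_norm_on S (T m \<ominus>\<^bsub>bounded_ops S\<^esub> T n) * (ell2_norm f + 1)"
          by (intro mult_left_mono op_norm_on_nonneg[OF D]) auto
        also have "\<dots> < e" using M mn p by (simp add: pos_less_divide_eq)
        finally show "norm (T m f x - T n f x) < e" .
      qed
    qed
    then show ?thesis using f by (simp add: U_def Cauchy_convergent_iff convergent_LIMSEQ_iff)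
  qed
  \<comment> \<open>The difference is shown to be square summable before \<open>U f\<close> is known
    to be; the bound survives the limit over \<open>m\<close> because each finite sum of squares
    depends continuously on finitely many coordinates.\<close>
  have conv: "(\<lambda>x. T n f x - U f x) \<in> ell2 S \<and> ell2_norm (\<lambda>x. T n f x - U f x) \<le> e * ell2_norm f"
    if f: "f \<in> ell2 S" and M: "\<forall>m\<ge>M. \<forall>n\<ge>M. op_norm_on S (T m \<ominus>\<^bsub>bounded_ops S\<^esub> T n) < e" and n: "n \<ge> M" for f M n e
  proof -
    have "L2_set (\<lambda>x. cmod (T n f x - U f x)) F \<le> e * ell2_norm f" if F: "finite F" for F
    proof (rule LIMSEQ_le_const2)
      show "(\<lambda>m. L2_set (\<lambda>x. cmod (T n f x - T m f x)) F) \<longlonglongrightarrow> L2_set (\<lambda>x. cmod (T n f x - U f x)) F"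
        unfolding L2_set_def by (intro tendsto_intros lim f)
      show "\<exists>N. \<forall>m\<ge>N. L2_set (\<lambda>x. cmod (T n f x - T m f x)) F \<le> e * ell2_norm f"
      proof (intro exI[of _ M] allI impI)
        fix m assume m: "M \<le> m"
        have "L2_set (\<lambda>x. cmod (T n f x - T m f x)) F \<le> ell2_norm (\<lambda>x. T n f x - T m f x)"
          using ell2_finite_le[OF ell2_diff[OF bounded_op_closed[OF T f] bounded_op_closed[OF T f]] F] .
        also have "\<dots> \<le> op_norm_on S (T n \<ominus>\<^bsub>bounded_ops S\<^esub> T m) * ell2_norm f" by (rule diff[OF f])
        also have "\<dots> \<le> e * ell2_norm f" using M m n by (intro mult_right_mono) (auto simp: less_imp_le)
        finally show "L2_set (\<lambda>x. cmod (T n f x - T m f x)) F \<le> e * ell2_norm f" .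
      qed
    qed
    moreover have "T n f x - U f x = 0" if "x \<notin> S" for x
    proof -
      have z: "T m f x = 0" for m using ell2_outside[OF bounded_op_closed[OF T f] that] .
      then have "(\<lambda>n. T n f x) \<longlonglongrightarrow> 0" by simp
      then have "U f x = 0" by (rule LIMSEQ_unique[OF lim[OF f]])
      then show ?thesis using z by simp
    qed
    ultimately show ?thesis using ell2I[of S "\<lambda>x. T n f x - U f x" "e * ell2_norm f"] by blast
  qed
  obtain M where M: "\<forall>m\<ge>M. \<forall>n\<ge>M. op_norm_on S (T m \<ominus>\<^bsub>bounded_ops S\<^esub> T n) < 1" using cau[of 1] by auto
  have Uf: "U f \<in> ell2 S \<and> ell2_norm (U f) \<le> (op_norm_on S (T M) + 1) * ell2_norm f" if f: "f \<in> ell2 S" for f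
  proof -
    have TM: "T M f \<in> ell2 S" by (rule bounded_op_closed[OF T f])
    have c: "(\<lambda>x. T M f x - U f x) \<in> ell2 S" "ell2_norm (\<lambda>x. T M f x - U f x) \<le> 1 * ell2_norm f"
      using conv[OF f M] by auto
    \<comment> \<open>\<open>U f\<close> is recovered from one approximant and the square summable
      difference, which also gives the operator bound with the slack \<open>1\<close> used to choose
      \<open>M\<close>.\<close>
    have eq: "U f = (\<lambda>x. T M f x + (-1) * (T M f x - U f x))" by (simp add: fun_eq_iff)
    have "U f \<in> ell2 S" using ell2_add[OF TM ell2_scale[OF c(1), of "-1"]] eq by simp
    moreover have "ell2_norm (U f) \<le> ell2_norm (T M f) + ell2_norm (\<lambda>x. (-1) * (T M f x - U f x))"
      by (subst eq) (rule ell2_norm_triangle[OF TM ell2_scale[OF c(1)]])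
    ultimately show ?thesis
      using bounded_op_bound'[OF T f, of M] c(2) ell2_norm_scale[of "-1" "\<lambda>x. T M f x - U f x"]
      by (simp add: distrib_right)
  qed
  have U: "U \<in> bounded_op_set S"
  proof (rule bounded_opI[where C = "op_norm_on S (T M) + 1"])
    show "U (\<lambda>x. f x + g x) = (\<lambda>x. U f x + U g x)" if fg: "f \<in> ell2 S" "g \<in> ell2 S" for f g
    proof
      fix x
      have "(\<lambda>n. T n (\<lambda>x. f x + g x) x) \<longlonglongrightarrow> U f x + U g x"
        using tendsto_add[OF lim[OF fg(1), of x] lim[OF fg(2), of x]] by (simp add: bounded_op_add[OF T fg])
      then show "U (\<lambda>x. f x + g x) x = U f x + U g x"
        using lim[OF ell2_add[OF fg], of x] LIMSEQ_unique by blast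
    qed
    show "U (\<lambda>x. c * f x) = (\<lambda>x. c * U f x)" if f: "f \<in> ell2 S" for c f
    proof
      fix x
      have "(\<lambda>n. T n (\<lambda>x. c * f x) x) \<longlonglongrightarrow> c * U f x"
        using tendsto_mult_left[OF lim[OF f, of x]] by (simp add: bounded_op_scale[OF T f])
      then show "U (\<lambda>x. c * f x) x = c * U f x"
        using lim[OF ell2_scale[OF f], of c x] LIMSEQ_unique by blast
    qed
  qed (use Uf in \<open>auto simp: U_def\<close>)
  have DU: "T n \<ominus>\<^bsub>bounded_ops S\<^esub> U \<in> bounded_op_set S" for n
    using minus_closed[of "T n" U] T U by simp
  have "(\<lambda>n. op_norm_on S (T n \<ominus>\<^bsub>bounded_ops S\<^esub> U)) \<longlonglongrightarrow> 0"
  proof (rule LIMSEQ_I)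
    fix r :: real assume r: "r > 0"
    then obtain M where M: "\<forall>m\<ge>M. \<forall>n\<ge>M. op_norm_on S (T m \<ominus>\<^bsub>bounded_ops S\<^esub> T n) < r/2" using cau[of "r/2"] by auto
    have "op_norm_on S (T n \<ominus>\<^bsub>bounded_ops S\<^esub> U) \<le> r/2" if n: "n \<ge> M" for n
      using conv[OF _ M n] r by (intro op_norm_on_least) (auto simp: bounded_ops_minus[OF T U])
    moreover have "0 \<le> op_norm_on S (T n \<ominus>\<^bsub>bounded_ops S\<^esub> U)" for n by (rule op_norm_on_nonneg[OF DU]) simp
    ultimately have "\<forall>n\<ge>M. norm (op_norm_on S (T n \<ominus>\<^bsub>bounded_ops S\<^esub> U) - 0) < r" using r by fastforce
    then show "\<exists>M. \<forall>n\<ge>M. norm (op_norm_on S (T n \<ominus>\<^bsub>bounded_ops S\<^esub> U) - 0) < r" by blast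
  qed
  then show ?thesis using U by blast
qed

lemma op_norm_smult:
  assumes T: "T \<in> bounded_op_set S"
  shows "op_norm_on S (c \<odot>\<^bsub>bounded_ops S\<^esub> T) = cmod c * op_norm_on S T"
proof (rule antisym)
  interpret unital_star_algebra "bounded_ops S" by (rule unital_star_algebra_bounded_ops)
  show le: "op_norm_on S (c \<odot>\<^bsub>bounded_ops S\<^esub> T) \<le> cmod c * op_norm_on S T"
    by (rule op_norm_smult_le[OF T]) simp
  have cT: "c \<odot>\<^bsub>bounded_ops S\<^esub> T \<in> bounded_op_set S" using scalar_closed[of T c] T by (simp del: bounded_ops_simps(6))
  show "cmod c * op_norm_on S T \<le> op_norm_on S (c \<odot>\<^bsub>bounded_ops S\<^esub> T)"
  proof (cases "c = 0")
    case True
    then show ?thesis using op_norm_on_nonneg[OF cT] by simp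
  next
    case False
    have "op_norm_on S (inverse c \<odot>\<^bsub>bounded_ops S\<^esub> (c \<odot>\<^bsub>bounded_ops S\<^esub> T))
        \<le> cmod (inverse c) * op_norm_on S (c \<odot>\<^bsub>bounded_ops S\<^esub> T)"
      by (rule op_norm_smult_le[OF cT]) simp
    moreover have "inverse c \<odot>\<^bsub>bounded_ops S\<^esub> (c \<odot>\<^bsub>bounded_ops S\<^esub> T) = T"
      using scalar_scalar[of T "inverse c" c] scalar_one[of T] T False by (simp del: bounded_ops_simps(6))
    ultimately have "op_norm_on S T \<le> op_norm_on S (c \<odot>\<^bsub>bounded_ops S\<^esub> T) / cmod c"
      by (simp add: norm_inverse norm_divide divide_inverse mult.commute del: bounded_ops_simps(6))
    then show ?thesis using False by (simp add: pos_le_divide_eq mult.commute del: bounded_ops_simps(6))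
  qed
qed

lemma cstar_algebra_bounded_ops: "cstar_algebra (bounded_ops S)"
proof -
  interpret unital_star_algebra "bounded_ops S" by (rule unital_star_algebra_bounded_ops)
  have norm: "x \<in> carrier (bounded_ops S) \<Longrightarrow> 0 \<le> cnorm (bounded_ops S) x"
    "x \<in> carrier (bounded_ops S) \<Longrightarrow> cnorm (bounded_ops S) x = 0 \<longleftrightarrow> x = \<zero>\<^bsub>bounded_ops S\<^esub>"
    "\<lbrakk>x \<in> carrier (bounded_ops S); y \<in> carrier (bounded_ops S)\<rbrakk>
      \<Longrightarrow> cnorm (bounded_ops S) (x \<oplus>\<^bsub>bounded_ops S\<^esub> y) \<le> cnorm (bounded_ops S) x + cnorm (bounded_ops S) y"
    "x \<in> carrier (bounded_ops S) \<Longrightarrow> cnorm (bounded_ops S) (c \<odot>\<^bsub>bounded_ops S\<^esub> x) = cmod c * cnorm (bounded_ops S) x"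
    "\<lbrakk>x \<in> carrier (bounded_ops S); y \<in> carrier (bounded_ops S)\<rbrakk>
      \<Longrightarrow> cnorm (bounded_ops S) (x \<otimes>\<^bsub>bounded_ops S\<^esub> y) \<le> cnorm (bounded_ops S) x * cnorm (bounded_ops S) y"
    "x \<in> carrier (bounded_ops S) \<Longrightarrow> cnorm (bounded_ops S) (star (bounded_ops S) x \<otimes>\<^bsub>bounded_ops S\<^esub> x) = (cnorm (bounded_ops S) x)\<^sup>2"
    for x y c
  proof -
    show "x \<in> carrier (bounded_ops S) \<Longrightarrow> 0 \<le> cnorm (bounded_ops S) x"
      using op_norm_on_nonneg[of x S S] by simp
    have "op_norm_on S (\<lambda>f\<in>ell2 S. \<lambda>_. 0) = 0"
      using op_norm_smult[OF bounded_op_one, of S 0] by simp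
    then show "x \<in> carrier (bounded_ops S) \<Longrightarrow> cnorm (bounded_ops S) x = 0 \<longleftrightarrow> x = \<zero>\<^bsub>bounded_ops S\<^esub>"
      using op_norm_eq_0[of x S] by auto
    show "\<lbrakk>x \<in> carrier (bounded_ops S); y \<in> carrier (bounded_ops S)\<rbrakk>
      \<Longrightarrow> cnorm (bounded_ops S) (x \<oplus>\<^bsub>bounded_ops S\<^esub> y) \<le> cnorm (bounded_ops S) x + cnorm (bounded_ops S) y"
      using op_norm_triangle[of x S y S] by simp
    show "x \<in> carrier (bounded_ops S) \<Longrightarrow> cnorm (bounded_ops S) (c \<odot>\<^bsub>bounded_ops S\<^esub> x) = cmod c * cnorm (bounded_ops S) x"
      using op_norm_smult[of x S c] by simp
    show "\<lbrakk>x \<in> carrier (bounded_ops S); y \<in> carrier (bounded_ops S)\<rbrakk>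
      \<Longrightarrow> cnorm (bounded_ops S) (x \<otimes>\<^bsub>bounded_ops S\<^esub> y) \<le> cnorm (bounded_ops S) x * cnorm (bounded_ops S) y"
      using op_norm_compose[of x S y] by simp
    show "x \<in> carrier (bounded_ops S) \<Longrightarrow> cnorm (bounded_ops S) (star (bounded_ops S) x \<otimes>\<^bsub>bounded_ops S\<^esub> x) = (cnorm (bounded_ops S) x)\<^sup>2"
      using op_norm_cstar[of x S] by simp
  qed
  show ?thesis
  proof (rule cstar_algebraI[OF unital_star_algebra_bounded_ops norm])
    fix X :: "nat \<Rightarrow> ('a \<Rightarrow> complex) \<Rightarrow> 'a \<Rightarrow> complex"
    assume "\<And>n. X n \<in> carrier (bounded_ops S)"
      "\<And>e. e > 0 \<Longrightarrow> \<exists>M. \<forall>m\<ge>M. \<forall>n\<ge>M. cnorm (bounded_ops S) (X m \<ominus>\<^bsub>bounded_ops S\<^esub> X n) < e"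
    then show "\<exists>a\<in>carrier (bounded_ops S). (\<lambda>n. cnorm (bounded_ops S) (X n \<ominus>\<^bsub>bounded_ops S\<^esub> a)) \<longlonglongrightarrow> 0"
      using bounded_ops_complete[of X S] by simp
  qed
qed


section \<open>Words and the left regular representation\<close>

context group_submonoid begin

abbreviation "wv \<equiv> word_value G"

lemma wordsD: "\<alpha> \<in> words P \<Longrightarrow> set \<alpha> \<subseteq> P" "\<alpha> \<in> words P \<Longrightarrow> even (length \<alpha>)"
  by (auto simp: words_def)

lemma words_induct [consumes 1, case_names Nil Cons]:
  assumes "\<alpha> \<in> words P" "Q []" "\<And>p q \<alpha>. \<lbrakk>p \<in> P; q \<in> P; \<alpha> \<in> words P; Q \<alpha>\<rbrakk> \<Longrightarrow> Q (p # q # \<alpha>)"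
  shows "Q \<alpha>"
proof -
  have "even (length \<alpha>)" "set \<alpha> \<subseteq> P" using assms(1) by (auto simp: words_def)
  then show ?thesis
    by (induction rule: even_list_induct) (auto intro!: assms(2,3) simp: words_def)
qed

lemma words_append [simp]: "\<lbrakk>\<alpha> \<in> words P; \<beta> \<in> words P\<rbrakk> \<Longrightarrow> \<alpha> @ \<beta> \<in> words P"
  and words_rev [simp]: "\<alpha> \<in> words P \<Longrightarrow> rev \<alpha> \<in> words P"
  and words_Nil [simp]: "[] \<in> words P"
  and words_Cons [simp]: "p # q # \<alpha> \<in> words P \<longleftrightarrow> p \<in> P \<and> q \<in> P \<and> \<alpha> \<in> words P"
  by (auto simp: words_def)

lemma wv_closed [simp]: "\<alpha> \<in> words P \<Longrightarrow> wv \<alpha> \<in> carrier G"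
  by (induction rule: words_induct) auto

lemma wv_append: "\<lbrakk>\<alpha> \<in> words P; \<beta> \<in> words P\<rbrakk> \<Longrightarrow> wv (\<alpha> @ \<beta>) = wv \<alpha> \<otimes> wv \<beta>"
  by (induction rule: words_induct) (auto simp: m_assoc)

lemma wv_rev: "\<alpha> \<in> words P \<Longrightarrow> wv (rev \<alpha>) = inv (wv \<alpha>)"
proof (induction rule: words_induct)
  case (Cons p q \<alpha>)
  then show ?case by (simp add: wv_append inv_mult_group m_assoc)
qed simp

lemma back_value_eq: "\<alpha> \<in> words P \<Longrightarrow> back_value G \<alpha> = inv (wv \<alpha>)"
  by (induction rule: words_induct) (auto simp: inv_mult_group m_assoc)

lemma mem_l_coset: "g \<in> carrier G \<Longrightarrow> x \<in> g <# P \<longleftrightarrow> x \<in> carrier G \<and> inv g \<otimes> x \<in> P"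
  by (force simp: l_coset_def m_assoc[symmetric])

lemma self_mem_l_coset [simp]: "p \<in> P \<Longrightarrow> p \<in> p <# P"
  by (simp add: mem_l_coset)

lemma K_subset: "K G P \<alpha> \<subseteq> P"
  by (induction \<alpha> rule: induct_list012) auto

lemma K_carrier [simp]: "x \<in> K G P \<alpha> \<Longrightarrow> x \<in> carrier G"
  using K_subset by blast

text \<open>\<open>back_value\<close> is the inverse of the word value, so lying in its translate of
  \<open>P\<close> means being moved into \<open>P\<close> by the word. Thus
  \<open>K(\<alpha>)\<close> is the domain of a partial translation: the points of \<open>P\<close>
  that all suffixes of even length move back into \<open>P\<close>.\<close>

lemma K_Cons_iff:
  assumes "p # q # \<alpha> \<in> words P"
  shows "x \<in> K G P (p # q # \<alpha>) \<longleftrightarrow> x \<in> K G P \<alpha> \<and> wv (p # q # \<alpha>) \<otimes> x \<in> P"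
proof -
  have "back_value G (p # q # \<alpha>) = inv (wv (p # q # \<alpha>))"
    by (rule back_value_eq[OF assms])
  moreover have "wv (p # q # \<alpha>) \<in> carrier G" by (rule wv_closed[OF assms])
  ultimately show ?thesis
    by (auto simp: mem_l_coset simp del: word_value.simps back_value.simps)
qed

lemma K_value: "\<alpha> \<in> words P \<Longrightarrow> x \<in> K G P \<alpha> \<Longrightarrow> wv \<alpha> \<otimes> x \<in> P"
  by (induction rule: words_induct) (use K_Cons_iff in auto)

text \<open>Concatenation composes partial translations: a point has to survive
  \<open>\<beta>\<close>, and its image has to survive \<open>\<alpha>\<close>. For
  \<open>\<alpha> = []\<close> the second condition is already \<open>K_value\<close>.\<close>

lemma K_append:
  assumes \<alpha>: "\<alpha> \<in> words P" and \<beta>: "\<beta> \<in> words P"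
  shows "x \<in> K G P (\<alpha> @ \<beta>) \<longleftrightarrow> x \<in> K G P \<beta> \<and> wv \<beta> \<otimes> x \<in> K G P \<alpha>"
  using \<alpha>
proof (induction rule: words_induct)
  case Nil
  then show ?case using K_value[OF \<beta>] by auto
next
  case (Cons p q \<alpha>)
  have w: "p # q # \<alpha> \<in> words P" "p # q # (\<alpha> @ \<beta>) \<in> words P" using Cons \<beta> by auto
  have "wv (p # q # (\<alpha> @ \<beta>)) = wv (p # q # \<alpha>) \<otimes> wv \<beta>"
    using wv_append[OF w(1) \<beta>] by simp
  then have "wv (p # q # (\<alpha> @ \<beta>)) \<otimes> x = wv (p # q # \<alpha>) \<otimes> (wv \<beta> \<otimes> x)" if "x \<in> carrier G"
    using that m_assoc[OF wv_closed[OF w(1)] wv_closed[OF \<beta>] that] by simp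
  then show ?case
    using Cons.IH K_Cons_iff[OF w(1), of "wv \<beta> \<otimes> x"] K_Cons_iff[OF w(2), of x]
    by (metis append_Cons K_carrier)
qed

text \<open>The reversed word is the inverse partial translation, so its domain is the range of the
  original one.\<close>

lemma K_rev:
  assumes \<alpha>: "\<alpha> \<in> words P"
  shows "x \<in> K G P (rev \<alpha>) \<longleftrightarrow> x \<in> carrier G \<and> inv (wv \<alpha>) \<otimes> x \<in> K G P \<alpha>"
  using \<alpha>
proof (induction arbitrary: x rule: words_induct)
  case Nil
  have "\<one> \<otimes> x \<in> P \<Longrightarrow> x \<in> carrier G \<Longrightarrow> x \<in> P" by simp
  then show ?case by auto
next
  case (Cons p q \<alpha>)
  have w: "p # q # \<alpha> \<in> words P" "[q, p] \<in> words P" using Cons by auto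
  have pq: "p \<in> carrier G" "q \<in> carrier G" "wv \<alpha> \<in> carrier G" using Cons by auto
  show ?case
  proof (cases "x \<in> carrier G")
    case x: True
    define y where "y = inv (wv \<alpha>) \<otimes> (inv q \<otimes> p \<otimes> x)"
    have y: "inv (wv (p # q # \<alpha>)) \<otimes> x = y"
      using pq x by (simp add: y_def inv_mult_group m_assoc)
    have yc: "y \<in> carrier G" using pq x by (simp add: y_def)
    have v1: "wv \<alpha> \<otimes> y = inv q \<otimes> p \<otimes> x"
      using pq x by (simp add: y_def m_assoc[symmetric])
    have v2: "wv (p # q # \<alpha>) \<otimes> y = x"
      using wv_closed[OF w(1)] x by (simp add: y[symmetric] m_assoc[symmetric] del: word_value.simps)
    have "x \<in> K G P (rev (p # q # \<alpha>)) \<longleftrightarrow> x \<in> K G P [q, p] \<and> wv [q, p] \<otimes> x \<in> K G P (rev \<alpha>)"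
      using K_append[of "rev \<alpha>" "[q, p]" x] Cons w by simp
    also have "\<dots> \<longleftrightarrow> (x \<in> P \<and> inv q \<otimes> p \<otimes> x \<in> P) \<and> y \<in> K G P \<alpha>"
      using Cons.IH[of "inv q \<otimes> p \<otimes> x"] K_Cons_iff[OF w(2), of x] pq x by (simp add: y_def del: K.simps(1))
    \<comment> \<open>The intermediate condition is redundant:
      \<open>inv q \<otimes> p \<otimes> x\<close> is the image of \<open>y\<close> under
      \<open>\<alpha>\<close>, which \<open>K_value\<close> puts into \<open>P\<close>.\<close>
    also have "\<dots> \<longleftrightarrow> y \<in> K G P \<alpha> \<and> x \<in> P"
      using K_value[OF Cons(3), of y] v1 by auto
    also have "\<dots> \<longleftrightarrow> y \<in> K G P (p # q # \<alpha>)"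
      using K_Cons_iff[OF w(1), of y] v2 by (simp del: word_value.simps K.simps)
    finally show ?thesis using y x by (simp del: word_value.simps K.simps)
  qed (use K_carrier in blast)
qed

lemma neutral_wordsD:
  "\<alpha> \<in> neutral_words G P \<Longrightarrow> \<alpha> \<in> words P" "\<alpha> \<in> neutral_words G P \<Longrightarrow> wv \<alpha> = \<one>"
  by (auto simp: neutral_words_def)

lemma neutral_append [simp]:
  "\<lbrakk>\<alpha> \<in> neutral_words G P; \<beta> \<in> neutral_words G P\<rbrakk> \<Longrightarrow> \<alpha> @ \<beta> \<in> neutral_words G P"
  by (simp add: neutral_words_def wv_append)

lemma neutral_rev [simp]: "\<alpha> \<in> neutral_words G P \<Longrightarrow> rev \<alpha> \<in> neutral_words G P"
  by (simp add: neutral_words_def wv_rev)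

lemma K_neutral_append:
  "\<lbrakk>\<alpha> \<in> neutral_words G P; \<beta> \<in> neutral_words G P\<rbrakk> \<Longrightarrow> K G P (\<alpha> @ \<beta>) = K G P \<alpha> \<inter> K G P \<beta>"
  using K_append neutral_wordsD by (auto simp del: K.simps)

lemma K_neutral_rev: "\<alpha> \<in> neutral_words G P \<Longrightarrow> K G P (rev \<alpha>) = K G P \<alpha>"
  using K_rev neutral_wordsD by (auto simp del: K.simps)

text \<open>A partial translation followed by its inverse is the identity on its domain. Hence
  neutral words already produce every constructible ideal.\<close>

lemma rev_append_neutral:
  assumes "\<alpha> \<in> words P"
  shows "rev \<alpha> @ \<alpha> \<in> neutral_words G P" "K G P (rev \<alpha> @ \<alpha>) = K G P \<alpha>"
proof -
  show "rev \<alpha> @ \<alpha> \<in> neutral_words G P" using assms by (simp add: neutral_words_def wv_append wv_rev)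
  have "wv \<alpha> \<otimes> x \<in> K G P (rev \<alpha>)" if "x \<in> K G P \<alpha>" for x
    using that assms by (simp add: K_rev m_assoc[symmetric])
  then show "K G P (rev \<alpha> @ \<alpha>) = K G P \<alpha>" using K_append[of "rev \<alpha>" \<alpha>] assms by auto
qed

lemma constructible_ideals_eq: "constructible_ideals G P = K G P ` neutral_words G P"
proof
  show "constructible_ideals G P \<subseteq> K G P ` neutral_words G P"
  proof
    fix S assume "S \<in> constructible_ideals G P"
    then obtain \<alpha> where "\<alpha> \<in> words P" "S = K G P \<alpha>" by (auto simp: constructible_ideals_def)
    with rev_append_neutral[OF this(1)] show "S \<in> K G P ` neutral_words G P" by blast
  qed
qed (auto simp: constructible_ideals_def neutral_words_def)

lemma l_coset_mult: "g \<in> carrier G \<Longrightarrow> x \<in> g <# P \<Longrightarrow> y \<in> P \<Longrightarrow> x \<otimes> y \<in> g <# P"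
  by (auto simp: mem_l_coset m_assoc[symmetric])

lemma l_coset_subset: "g \<in> carrier G \<Longrightarrow> r \<in> g <# P \<Longrightarrow> r <# P \<subseteq> g <# P"
  using l_coset_mult by (auto simp: l_coset_def)

lemma K_right_ideal: "\<alpha> \<in> words P \<Longrightarrow> x \<in> K G P \<alpha> \<Longrightarrow> y \<in> P \<Longrightarrow> x \<otimes> y \<in> K G P \<alpha>"
proof (induction rule: words_induct)
  case (Cons p q \<alpha>)
  then have w: "p # q # \<alpha> \<in> words P" by simp
  have "wv (p # q # \<alpha>) \<otimes> x \<in> P" "x \<in> K G P \<alpha>" using K_Cons_iff[OF w] Cons by auto
  moreover have "wv (p # q # \<alpha>) \<otimes> (x \<otimes> y) = wv (p # q # \<alpha>) \<otimes> x \<otimes> y"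
    by (rule m_assoc[OF wv_closed[OF w] K_carrier[OF Cons.prems(1)] P_carrier[OF Cons.prems(2)], symmetric])
  ultimately show ?case using K_Cons_iff[OF w] Cons P_mult by metis
qed auto

text \<open>The translating elements are the back values of the suffixes. Their finite number is
  what allows a finite \<open>F\<close> in \<open>\<Delta>\<close> to decide membership in a
  constructible ideal.\<close>

lemma K_finite_intersection:
  assumes "\<alpha> \<in> words P"
  shows "\<exists>F. finite F \<and> F \<subseteq> carrier G \<and> K G P \<alpha> = P \<inter> (\<Inter>g\<in>F. g <# P)"
  using assms
proof (induction rule: words_induct)
  case Nil
  show ?case by (auto intro!: exI[of _ "{}"])
next
  case (Cons p q \<alpha>)
  then obtain F where F: "finite F" "F \<subseteq> carrier G" "K G P \<alpha> = P \<inter> (\<Inter>g\<in>F. g <# P)" by blast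
  let ?b = "back_value G (p # q # \<alpha>)"
  have "p # q # \<alpha> \<in> words P" using Cons by simp
  then have "?b \<in> carrier G" using back_value_eq wv_closed inv_closed by metis
  then show ?case using F by (intro exI[of _ "insert ?b F"]) auto
qed

section \<open>The sets \<open>\<Delta>\<close> and foundation sets\<close>

lemma Delta_carrier: "\<Delta> G P F \<subseteq> P"
  by (auto simp: \<Delta>_def)

lemma Delta_antimono: "F \<subseteq> F' \<Longrightarrow> \<Delta> G P F' \<subseteq> \<Delta> G P F"
  by (auto simp: \<Delta>_def)

text \<open>For a new \<open>g\<close>, either \<open>qP\<close> already avoids \<open>gP\<close>,
  or \<open>q\<close> is moved to a point \<open>r\<close> of both. In the second case
  \<open>rP\<close> lies inside \<open>gP\<close>, and it inherits the alternatives for the earlier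
  elements of \<open>F\<close> because it lies inside \<open>qP\<close>.\<close>

lemma Delta_meets:
  assumes "finite F" "F \<subseteq> carrier G" "p \<in> P"
  shows "\<exists>q\<in>p <# P. q \<in> \<Delta> G P F"
  using assms(1,2)
proof (induction rule: finite_induct)
  case empty
  show ?case using assms by (auto simp: \<Delta>_def)
next
  case (insert g F)
  then obtain q where q: "q \<in> p <# P" "q \<in> \<Delta> G P F" by auto
  have qP: "q \<in> P" using q by (auto simp: \<Delta>_def)
  show ?case
  proof (cases "(q <# P) \<inter> (g <# P) = {}")
    case True
    then show ?thesis using q by (auto simp: \<Delta>_def)
  next
    case False
    then obtain r where r: "r \<in> q <# P" "r \<in> g <# P" by auto
    have rq: "r <# P \<subseteq> q <# P" by (rule l_coset_subset) (use r qP in auto)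
    have rg: "r <# P \<subseteq> g <# P" by (rule l_coset_subset) (use r insert in auto)
    have rp: "r \<in> p <# P" using l_coset_subset[OF _ q(1)] assms r(1) by auto
    have rP: "r \<in> P" using r(1) qP by (auto simp: l_coset_def)
    have "r \<in> \<Delta> G P (insert g F)" unfolding \<Delta>_def
    proof (intro CollectI conjI ballI rP)
      fix h assume "h \<in> insert g F"
      then consider "h = g" | "(q <# P) \<inter> (h <# P) = {}" | "(q <# P) \<inter> (h <# P) = q <# P"
        using q(2) by (auto simp: \<Delta>_def)
      then show "(r <# P) \<inter> (h <# P) = {} \<or> (r <# P) \<inter> (h <# P) = r <# P"
        by cases (use rq rg in blast)+
    qed
    then show ?thesis using rp by blast
  qed
qed

text \<open>If \<open>pP\<close> meets \<open>K(\<beta>)\<close>, it meets every \<open>gP\<close> in the intersection defining \<open>K(\<beta>)\<close>; for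
  \<open>p \<in> \<Delta>\<^sub>F\<close> and \<open>F\<close> large it is then contained in all of them.\<close>

lemma foundation_set_Delta:
  assumes "foundation_set G P S C"
  shows "\<exists>F. finite F \<and> F \<subseteq> carrier G \<and> S \<inter> \<Delta> G P F \<subseteq> \<Union>C"
proof -
  have "\<exists>F. finite F \<and> F \<subseteq> carrier G \<and> R = P \<inter> (\<Inter>g\<in>F. g <# P)" if "R \<in> C" for R
    using that assms K_finite_intersection by (force simp: foundation_set_def constructible_ideals_def)
  then obtain H where H: "\<And>R. R \<in> C \<Longrightarrow> finite (H R) \<and> H R \<subseteq> carrier G \<and> R = P \<inter> (\<Inter>g\<in>H R. g <# P)" by metis
  let ?F = "\<Union>(H ` C)"
  have "S \<inter> \<Delta> G P ?F \<subseteq> \<Union>C"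
  proof
    fix p assume p: "p \<in> S \<inter> \<Delta> G P ?F"
    then obtain R where R: "R \<in> C" "(p <# P) \<inter> R \<noteq> {}" using assms by (force simp: foundation_set_def)
    have "p \<in> g <# P" if g: "g \<in> H R" for g
    proof -
      have "(p <# P) \<inter> (g <# P) \<noteq> {}" using H[OF R(1)] g R(2) by blast
      then have "(p <# P) \<inter> (g <# P) = p <# P" using p g R(1) by (auto simp: \<Delta>_def)
      then show ?thesis using p self_mem_l_coset[of p] by (auto simp: \<Delta>_def)
    qed
    then have "p \<in> R" using H[OF R(1)] p Delta_carrier by blast
    then show "p \<in> \<Union>C" using R by blast
  qed
  moreover have "finite ?F" "?F \<subseteq> carrier G" using H assms by (auto simp: foundation_set_def)
  ultimately show ?thesis by blast
qed

section \<open>The left regular representation and multiplication operators\<close>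

abbreviation "BO \<equiv> bounded_ops P"
abbreviation "Lr \<equiv> left_regular G P"

sublocale BO: cstar_algebra BO by (rule cstar_algebra_bounded_ops)

definition left_regular_adjoint :: "'g \<Rightarrow> ('g \<Rightarrow> complex) \<Rightarrow> 'g \<Rightarrow> complex" where
  "left_regular_adjoint p = (\<lambda>f\<in>ell2 P. \<lambda>x. if x \<in> P then f (p \<otimes> x) else 0)"

text \<open>An injective substitution cannot increase finite square sums. It is applied to
  \<open>x \<mapsto> inv p \<otimes> x\<close> on \<open>p <# P\<close> for the translation operator
  and to \<open>x \<mapsto> p \<otimes> x\<close> on \<open>P\<close> for its adjoint.\<close>

lemma ell2_reindex:
  assumes f: "f \<in> ell2 P" and S: "S \<subseteq> P" and inj: "inj_on \<phi> S"
  shows "(\<lambda>x. if x \<in> S then f (\<phi> x) else 0) \<in> ell2 P"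
    "ell2_norm (\<lambda>x. if x \<in> S then f (\<phi> x) else 0) \<le> ell2_norm f"
proof -
  let ?g = "\<lambda>x. if x \<in> S then f (\<phi> x) else 0"
  have "L2_set (\<lambda>x. cmod (?g x)) F \<le> ell2_norm f" if F: "finite F" for F
  proof -
    have "(\<Sum>x\<in>F. (cmod (?g x))\<^sup>2) = (\<Sum>x\<in>F \<inter> S. (cmod (f (\<phi> x)))\<^sup>2)"
      using F by (intro sum.mono_neutral_cong_right) auto
    also have "\<dots> = (\<Sum>y\<in>\<phi> ` (F \<inter> S). (cmod (f y))\<^sup>2)"
      using inj by (subst sum.reindex) (auto intro: inj_on_subset)
    finally have "L2_set (\<lambda>x. cmod (?g x)) F = L2_set (\<lambda>y. cmod (f y)) (\<phi> ` (F \<inter> S))"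
      by (simp add: L2_set_def)
    also have "\<dots> \<le> ell2_norm f" using F by (intro ell2_finite_le[OF f]) auto
    finally show ?thesis .
  qed
  moreover have "?g x = 0" if "x \<notin> P" for x using that S by auto
  ultimately show "?g \<in> ell2 P" "ell2_norm ?g \<le> ell2_norm f"
    using ell2I[of P ?g "ell2_norm f"] by blast+
qed

lemma left_regular_closed:
  assumes p: "p \<in> P"
  shows "Lr p \<in> bounded_op_set P"
proof (rule bounded_opI[where C = 1])
  have S: "p <# P \<subseteq> P" using p by (auto simp: l_coset_def)
  have inj: "inj_on (\<lambda>x. inv p \<otimes> x) (p <# P)"
    using p by (auto simp: inj_on_def mem_l_coset)
  fix f assume f: "f \<in> ell2 P"
  then show "Lr p f \<in> ell2 P" "ell2_norm (Lr p f) \<le> 1 * ell2_norm f"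
    using ell2_reindex[OF f S inj] by (simp_all add: left_regular_def)
qed (auto simp: left_regular_def fun_eq_iff)

lemma left_regular_adjoint_closed:
  assumes p: "p \<in> P"
  shows "left_regular_adjoint p \<in> bounded_op_set P"
proof (rule bounded_opI[where C = 1])
  have inj: "inj_on (\<lambda>x. p \<otimes> x) P"
    using p by (auto simp: inj_on_def)
  fix f assume f: "f \<in> ell2 P"
  then show "left_regular_adjoint p f \<in> ell2 P" "ell2_norm (left_regular_adjoint p f) \<le> 1 * ell2_norm f"
    using ell2_reindex[OF f order.refl inj] by (simp_all add: left_regular_adjoint_def)
qed (auto simp: left_regular_adjoint_def fun_eq_iff)

lemma star_left_regular:
  assumes p: "p \<in> P"
  shows "star BO (Lr p) = left_regular_adjoint p"
proof (rule star_bounded_ops_eqI[OF left_regular_closed[OF p] left_regular_adjoint_closed[OF p]])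
  fix f g assume f: "f \<in> ell2 P" and g: "g \<in> ell2 P"
  have inj: "inj_on (\<lambda>x. p \<otimes> x) P"
    using p by (auto simp: inj_on_def)
  have "ell2_inner (left_regular_adjoint p f) g = (\<Sum>\<^sub>\<infinity>x\<in>P. cnj (f (p \<otimes> x)) * g x)"
    unfolding ell2_inner_def by (rule infsum_cong_neutral) (use f in \<open>auto simp: left_regular_adjoint_def\<close>)
  also have "\<dots> = (\<Sum>\<^sub>\<infinity>x\<in>P. (\<lambda>y. cnj (f y) * g (inv p \<otimes> y)) (p \<otimes> x))"
    by (rule infsum_cong) (use p in \<open>simp add: m_assoc[symmetric]\<close>)
  also have "\<dots> = (\<Sum>\<^sub>\<infinity>y\<in>(\<lambda>x. p \<otimes> x) ` P. cnj (f y) * g (inv p \<otimes> y))"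
    using infsum_reindex[OF inj, of "\<lambda>y. cnj (f y) * g (inv p \<otimes> y)"] by (simp add: o_def)
  also have "\<dots> = ell2_inner f (Lr p g)"
    unfolding ell2_inner_def
    by (rule infsum_cong_neutral) (use g in \<open>auto simp: left_regular_def l_coset_def\<close>)
  finally show "ell2_inner (left_regular_adjoint p f) g = ell2_inner f (Lr p g)" .
qed

lemma Lr_closed: "Lr \<in> P \<rightarrow> carrier BO"
  using left_regular_closed by simp

text \<open>The operator of a word implements its partial translation: it carries the basis vector
  at \<open>y \<in> K(\<alpha>)\<close> to the one at \<open>wv \<alpha> \<otimes> y\<close> and
  kills the others. All words are treated because suffixes of neutral words need not be
  neutral.\<close>

lemma word_elem_left_regular:
  assumes "\<alpha> \<in> words P" "f \<in> ell2 P"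
  shows "word_elem BO Lr \<alpha> f
    = (\<lambda>x. if x \<in> carrier G \<and> inv (wv \<alpha>) \<otimes> x \<in> K G P \<alpha> then f (inv (wv \<alpha>) \<otimes> x) else 0)"
  using assms(1)
proof (induction rule: words_induct)
  case Nil
  have "x \<notin> P \<Longrightarrow> f x = 0" for x using assms(2) by (simp add: ell2_outside)
  then show ?case using assms(2) by (auto simp: fun_eq_iff)
next
  case (Cons p q \<alpha>)
  have w: "p # q # \<alpha> \<in> words P" using Cons by simp
  have pq: "p \<in> carrier G" "q \<in> carrier G" "wv \<alpha> \<in> carrier G" using Cons by auto
  let ?W = "word_elem BO Lr \<alpha>"
  have "?W \<in> carrier BO" using BO.word_elem_closed[OF Lr_closed] wordsD(1)[OF Cons(3)] .
  then have W: "?W f \<in> ell2 P" using assms(2) bounded_op_closed by simp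
  have L: "Lr q (?W f) \<in> ell2 P" using bounded_op_closed[OF left_regular_closed[OF Cons(2)] W] .
  show ?case
  proof
    fix x
    have "word_elem BO Lr (p # q # \<alpha>) f x = left_regular_adjoint p (Lr q (?W f)) x"
      using Cons W assms(2) by (simp add: compose_def star_left_regular)
    also have "\<dots> = (if x \<in> P \<and> p \<otimes> x \<in> q <# P then ?W f (inv q \<otimes> (p \<otimes> x)) else 0)"
      using L W by (auto simp: left_regular_adjoint_def left_regular_def)
    also have "\<dots> = (if x \<in> carrier G \<and> inv (wv (p # q # \<alpha>)) \<otimes> x \<in> K G P (p # q # \<alpha>)
        then f (inv (wv (p # q # \<alpha>)) \<otimes> x) else 0)"
    proof (cases "x \<in> carrier G")
      case x: True
      define y where "y = inv (wv \<alpha>) \<otimes> (inv q \<otimes> (p \<otimes> x))"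
      have y: "inv (wv (p # q # \<alpha>)) \<otimes> x = y"
        using pq x by (simp add: y_def inv_mult_group m_assoc)
      have v1: "wv \<alpha> \<otimes> y = inv q \<otimes> (p \<otimes> x)"
        using pq x by (simp add: y_def m_assoc[symmetric])
      have v2: "wv (p # q # \<alpha>) \<otimes> y = x"
        using wv_closed[OF w] x by (simp add: y[symmetric] m_assoc[symmetric] del: word_value.simps)
      have c: "inv q \<otimes> (p \<otimes> x) \<in> carrier G" using pq x by simp
      have "p \<otimes> x \<in> q <# P \<longleftrightarrow> inv q \<otimes> (p \<otimes> x) \<in> P" using pq x by (simp add: mem_l_coset)
      moreover have "y \<in> K G P (p # q # \<alpha>) \<longleftrightarrow> y \<in> K G P \<alpha> \<and> x \<in> P"
        using K_Cons_iff[OF w, of y] v2 by (simp del: word_value.simps K.simps)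
      moreover have "y \<in> K G P \<alpha> \<Longrightarrow> inv q \<otimes> (p \<otimes> x) \<in> P"
        using K_value[OF Cons(3), of y] v1 by auto
      ultimately show ?thesis using x c Cons.IH y
        by (auto simp add: y_def[symmetric] simp del: word_value.simps K.simps)
    qed auto
    finally show "word_elem BO Lr (p # q # \<alpha>) f x
      = (if x \<in> carrier G \<and> inv (wv (p # q # \<alpha>)) \<otimes> x \<in> K G P (p # q # \<alpha>)
        then f (inv (wv (p # q # \<alpha>)) \<otimes> x) else 0)" .
  qed
qed

text \<open>A diagonal operator; it is used only with bounded \<open>h\<close>, but the boundedness
  is left to separate lemmas so that identities can be computed on symbols.\<close>

definition mult_op :: "('g \<Rightarrow> complex) \<Rightarrow> ('g \<Rightarrow> complex) \<Rightarrow> 'g \<Rightarrow> complex" where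
  "mult_op h = (\<lambda>f\<in>ell2 P. \<lambda>x. h x * f x)"

lemma mult_op_closed:
  assumes "\<And>x. cmod (h x) \<le> C" "0 \<le> C"
  shows "mult_op h \<in> bounded_op_set P"
proof (rule bounded_opI[where C = C])
  fix f assume f: "f \<in> ell2 P"
  have "cmod (h x * f x) \<le> C * cmod (f x)" for x using assms by (simp add: norm_mult mult_right_mono)
  from ell2_dominated[OF f this assms(2)]
  show "mult_op h f \<in> ell2 P" "ell2_norm (mult_op h f) \<le> C * ell2_norm f"
    using f by (simp_all add: mult_op_def)
qed (auto simp: mult_op_def algebra_simps)

lemma indicator_op_eq_mult_op: "indicator_op P S = mult_op (\<lambda>x. if x \<in> S then 1 else 0)"
  by (auto simp: indicator_op_def mult_op_def fun_eq_iff)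

lemma word_elem_neutral:
  assumes "\<alpha> \<in> neutral_words G P"
  shows "word_elem BO Lr \<alpha> = indicator_op P (K G P \<alpha>)"
proof
  fix f
  have w: "\<alpha> \<in> words P" "wv \<alpha> = \<one>" using neutral_wordsD[OF assms] by auto
  have c: "word_elem BO Lr \<alpha> \<in> bounded_op_set P"
    using BO.word_elem_closed[OF Lr_closed wordsD(1)[OF w(1)]] by simp
  show "word_elem BO Lr \<alpha> f = indicator_op P (K G P \<alpha>) f"
  proof (cases "f \<in> ell2 P")
    case True
    then show ?thesis using word_elem_left_regular[OF w(1) True] w(2)
      by (auto simp: indicator_op_def fun_eq_iff)
  next
    case False
    then show ?thesis using bounded_op_ext[OF c] by (simp add: indicator_op_def)
  qed
qed

lemma D_r_eq: "D_r G P = closed_span BO (word_elem BO Lr ` neutral_words G P)"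
  by (simp add: D_r_def constructible_ideals_eq image_image word_elem_neutral cong: image_cong)

lemma mult_op_diff:
  assumes "mult_op h \<in> bounded_op_set P" "mult_op k \<in> bounded_op_set P"
  shows "mult_op h \<ominus>\<^bsub>BO\<^esub> mult_op k = mult_op (\<lambda>x. h x - k x)"
  using assms by (auto simp: bounded_ops_minus mult_op_def fun_eq_iff algebra_simps)

lemma mult_op_compose:
  assumes "mult_op k \<in> bounded_op_set P"
  shows "mult_op h \<otimes>\<^bsub>BO\<^esub> mult_op k = mult_op (\<lambda>x. h x * k x)"
  using bounded_op_closed[OF assms] by (auto simp: compose_def mult_op_def fun_eq_iff algebra_simps)

lemma mult_op_one: "\<one>\<^bsub>BO\<^esub> = mult_op (\<lambda>_. 1)" and mult_op_zero: "\<zero>\<^bsub>BO\<^esub> = mult_op (\<lambda>_. 0)"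
  by (auto simp: mult_op_def fun_eq_iff)

definition diff_symbol :: "'g list \<Rightarrow> 'g list list \<Rightarrow> 'g \<Rightarrow> complex" where
  "diff_symbol \<alpha> \<beta>s x = (\<Prod>\<beta>\<leftarrow>\<beta>s. (if x \<in> K G P \<alpha> then 1 else 0) - (if x \<in> K G P \<beta> then 1 else 0))"

text \<open>At every point one factor is \<open>0\<close>: inside \<open>K(\<alpha>)\<close> the
  factor of a set containing the point, outside it any factor at all, since both indicators vanish
  there. The criterion serves (T4) globally and foundation sets on \<open>\<Delta>\<close>.\<close>

lemma diff_symbol_eq_0:
  assumes "x \<in> K G P \<alpha> \<Longrightarrow> \<exists>\<beta>\<in>set \<beta>s. x \<in> K G P \<beta>" "\<And>\<beta>. \<beta> \<in> set \<beta>s \<Longrightarrow> K G P \<beta> \<subseteq> K G P \<alpha>" "\<beta>s \<noteq> []"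
  shows "diff_symbol \<alpha> \<beta>s x = 0"
proof -
  have "\<exists>\<beta>\<in>set \<beta>s. (x \<in> K G P \<alpha>) = (x \<in> K G P \<beta>)"
  proof (cases "x \<in> K G P \<alpha>")
    case True
    then show ?thesis using assms(1) by auto
  next
    case False
    obtain \<beta> where "\<beta> \<in> set \<beta>s" using assms(3) by (cases \<beta>s) auto
    then show ?thesis using assms(2) False by blast
  qed
  then have "0 \<in> set (map (\<lambda>\<beta>. (if x \<in> K G P \<alpha> then 1 else 0) - (if x \<in> K G P \<beta> then 1 else 0 :: complex)) \<beta>s)"
    by force
  then show ?thesis unfolding diff_symbol_def by (metis prod_list_zero_iff)
qed

lemma diff_prod_left_regular:
  assumes "\<alpha> \<in> neutral_words G P" "set \<beta>s \<subseteq> neutral_words G P"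
  shows "diff_prod BO Lr \<alpha> \<beta>s = mult_op (diff_symbol \<alpha> \<beta>s)"
  using assms(2)
proof (induction \<beta>s)
  case Nil
  show ?case using mult_op_one by (simp add: diff_symbol_def)
next
  case (Cons \<beta> \<beta>s)
  have \<beta>: "\<beta> \<in> neutral_words G P" using Cons.prems by simp
  have i: "mult_op (\<lambda>x. if x \<in> S then 1 else 0) \<in> bounded_op_set P" for S
    by (rule mult_op_closed[of _ 1]) auto
  have "diff_prod BO Lr \<alpha> \<beta>s \<in> carrier BO"
    using Cons.prems assms(1) neutral_words_set by (intro BO.diff_prod_closed[OF Lr_closed]) auto
  then have d: "mult_op (diff_symbol \<alpha> \<beta>s) \<in> bounded_op_set P" using Cons by simp
  show ?case
    using Cons \<beta> assms(1)
    by (simp add: word_elem_neutral indicator_op_eq_mult_op mult_op_diff[OF i i] mult_op_compose[OF d]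
        del: bounded_ops_simps(2)) (simp add: diff_symbol_def[abs_def])
qed

lemma left_regular_relations: "satisfies_toeplitz_relations G P BO Lr"
  unfolding satisfies_toeplitz_relations_def toeplitz_relators_def
proof
  fix r assume "r \<in> T1_relators G BO Lr \<union> T2_relators G P BO Lr \<union> T3_relators G P BO Lr \<union> T4_relators G P BO Lr"
  then consider "r \<in> T1_relators G BO Lr" | "r \<in> T2_relators G P BO Lr"
    | "r \<in> T3_relators G P BO Lr" | "r \<in> T4_relators G P BO Lr" by blast
  then show "r = \<zero>\<^bsub>BO\<^esub>"
  proof cases
    case 1
    have "Lr \<one> = \<one>\<^bsub>BO\<^esub>"
    proof (rule bounded_op_eqI[OF left_regular_closed])
      fix f x assume f: "f \<in> ell2 P"
      show "Lr \<one> f x = \<one>\<^bsub>BO\<^esub> f x"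
        using f ell2_outside[OF f, of x] by (cases "x \<in> P") (auto simp: left_regular_def mem_l_coset l_coset_def)
    qed auto
    then show ?thesis using 1 BO.minus_self[OF BO.one_closed] by (simp add: T1_relators_def)
  next
    case 2
    then show ?thesis by (auto simp: T2_relators_def word_elem_neutral indicator_op_def fun_eq_iff)
  next
    case 3
    then obtain \<alpha> \<beta> where ab: "\<alpha> \<in> neutral_words G P" "\<beta> \<in> neutral_words G P" "K G P \<alpha> = K G P \<beta>"
      "r = word_elem BO Lr \<alpha> \<ominus>\<^bsub>BO\<^esub> word_elem BO Lr \<beta>" by (auto simp: T3_relators_def)
    have "word_elem BO Lr \<beta> \<in> carrier BO"
      using BO.word_elem_closed[OF Lr_closed neutral_words_set[OF ab(2)]] .
    then show ?thesis using ab BO.minus_self by (simp add: word_elem_neutral)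
  next
    case 4
    then obtain \<alpha> \<beta>s where ab: "\<alpha> \<in> neutral_words G P" "set \<beta>s \<subseteq> neutral_words G P" "\<beta>s \<noteq> []"
      "K G P \<alpha> = (\<Union>\<beta>\<in>set \<beta>s. K G P \<beta>)" "r = diff_prod BO Lr \<alpha> \<beta>s" by (auto simp: T4_relators_def)
    have "diff_symbol \<alpha> \<beta>s x = 0" for x
      by (rule diff_symbol_eq_0) (use ab in auto)
    then have "diff_symbol \<alpha> \<beta>s = (\<lambda>_. 0)" by (simp add: fun_eq_iff)
    then show ?thesis using ab diff_prod_left_regular mult_op_zero by simp
  qed
qed

sublocale Lr: toeplitz_representation G P BO Lr
  by unfold_locales (rule Lr_closed, rule left_regular_relations)

lemma lambda_plus_eq: "lambda_plus G P = Lr.ind"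
  by (simp add: lambda_plus_def)

text \<open>Coefficients are attached to words instead of operators, so that the same list can be
  evaluated as a function on \<open>P\<close> and, through \<open>lin\<close>, in each of the
  algebras.\<close>

definition symbol :: "(complex \<times> 'g list) list \<Rightarrow> 'g \<Rightarrow> complex" where
  "symbol cs x = (\<Sum>(c, \<alpha>)\<leftarrow>cs. if x \<in> K G P \<alpha> then c else 0)"

lemma symbol_simps [simp]:
  "symbol [] x = 0" "symbol ((c, \<alpha>) # cs) x = (if x \<in> K G P \<alpha> then c else 0) + symbol cs x"
  by (simp_all add: symbol_def)

lemma lincomb_left_regular:
  assumes "snd ` set cs \<subseteq> neutral_words G P"
  shows "lincomb BO (map (\<lambda>(c, \<alpha>). (c, word_elem BO Lr \<alpha>)) cs) = mult_op (symbol cs)"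
  using assms
proof (induction cs)
  case Nil
  then show ?case by (simp add: mult_op_def fun_eq_iff)
next
  case (Cons d cs)
  obtain c \<alpha> where d: "d = (c, \<alpha>)" by (cases d)
  show ?case using Cons
    by (auto simp: d word_elem_neutral indicator_op_def mult_op_def fun_eq_iff algebra_simps)
qed

lemma symbol_bounded: "\<exists>C\<ge>0. \<forall>x. cmod (symbol cs x) \<le> C"
proof (induction cs)
  case (Cons d cs)
  obtain c \<alpha> where d: "d = (c, \<alpha>)" by (cases d)
  obtain C where C: "C \<ge> 0" "\<forall>x. cmod (symbol cs x) \<le> C" using Cons by blast
  have "cmod (symbol (d # cs) x) \<le> cmod c + C" for x
  proof -
    have "cmod (symbol (d # cs) x) \<le> cmod (if x \<in> K G P \<alpha> then c else 0) + cmod (symbol cs x)"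
      unfolding d symbol_simps by (rule norm_triangle_ineq)
    also have "\<dots> \<le> cmod c + C" using C by (intro add_mono) auto
    finally show ?thesis .
  qed
  then show ?case using C by (intro exI[of _ "cmod c + C"]) auto
qed (auto intro: exI[of _ 0])

lemma mult_op_symbol_closed [simp]: "mult_op (symbol cs) \<in> bounded_op_set P"
  using symbol_bounded[of cs] mult_op_closed by blast

end


section \<open>Spectral projections\<close>

context toeplitz_representation begin

section \<open>Commuting projections of neutral words\<close>

abbreviation "E \<equiv> word_elem B w"

lemma E_closed [simp]: "\<alpha> \<in> neutral_words G P \<Longrightarrow> E \<alpha> \<in> carrier B"
  using B.word_elem_closed[OF w_closed neutral_words_set] .

lemma relation_T2: "\<alpha> \<in> neutral_words G P \<Longrightarrow> K G P \<alpha> = {} \<Longrightarrow> E \<alpha> = \<zero>"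
  using w_relations unfolding satisfies_toeplitz_relations_def toeplitz_relators_def T2_relators_def by blast

lemma relation_T3:
  assumes "\<alpha> \<in> neutral_words G P" "\<beta> \<in> neutral_words G P" "K G P \<alpha> = K G P \<beta>"
  shows "E \<alpha> = E \<beta>"
proof -
  have "E \<alpha> \<ominus> E \<beta> = \<zero>"
    using w_relations assms
    unfolding satisfies_toeplitz_relations_def toeplitz_relators_def T3_relators_def by blast
  then show ?thesis using assms by (simp add: B.minus_eq_zero_iff)
qed

lemma relation_T4:
  assumes "\<alpha> \<in> neutral_words G P" "distinct \<beta>s" "\<beta>s \<noteq> []" "set \<beta>s \<subseteq> neutral_words G P"
    "K G P \<alpha> = (\<Union>\<beta>\<in>set \<beta>s. K G P \<beta>)"
  shows "diff_prod B w \<alpha> \<beta>s = \<zero>"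
  using w_relations assms
  unfolding satisfies_toeplitz_relations_def toeplitz_relators_def T4_relators_def by blast

lemma E_append:
  "\<lbrakk>\<alpha> \<in> neutral_words G P; \<beta> \<in> neutral_words G P\<rbrakk> \<Longrightarrow> E (\<alpha> @ \<beta>) = E \<alpha> \<otimes> E \<beta>"
  by (rule B.word_elem_append[OF w_closed]) (auto simp: neutral_words_def words_def)

text \<open>Reversal leaves \<open>K\<close> of a neutral word unchanged, so (T3) makes
  \<open>E \<alpha>\<close> self-adjoint. Idempotence and commutation follow in the same way from
  concatenation, which intersects the ideals.\<close>

lemma E_star [simp]:
  assumes "\<alpha> \<in> neutral_words G P"
  shows "star B (E \<alpha>) = E \<alpha>"
proof -
  have "star B (E \<alpha>) = E (rev \<alpha>)"
    using B.word_elem_rev[OF w_closed] assms by (auto simp: neutral_words_def words_def)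
  also have "\<dots> = E \<alpha>" using assms by (intro relation_T3) (auto simp: K_neutral_rev)
  finally show ?thesis .
qed

lemma E_le:
  assumes "\<alpha> \<in> neutral_words G P" "\<beta> \<in> neutral_words G P" "K G P \<alpha> \<subseteq> K G P \<beta>"
  shows "E \<alpha> \<otimes> E \<beta> = E \<alpha>"
  using assms relation_T3[of "\<alpha> @ \<beta>" \<alpha>] by (simp add: E_append K_neutral_append inf_absorb1)

lemma E_idem [simp]: "\<alpha> \<in> neutral_words G P \<Longrightarrow> E \<alpha> \<otimes> E \<alpha> = E \<alpha>"
  by (rule E_le) auto

lemma E_commute:
  assumes "\<alpha> \<in> neutral_words G P" "\<beta> \<in> neutral_words G P"
  shows "E \<alpha> \<otimes> E \<beta> = E \<beta> \<otimes> E \<alpha>"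
  using assms relation_T3[of "\<alpha> @ \<beta>" "\<beta> @ \<alpha>"] by (simp add: E_append K_neutral_append Int_commute)

text \<open>The joint spectral projection of \<open>K(\<mu>) - \<Union>K(\<nu>)\<close>.\<close>

definition cut :: "'g list \<Rightarrow> 'g list list \<Rightarrow> 'b" where
  "cut \<mu> \<nu>s = foldr (\<lambda>\<nu> x. (\<one> \<ominus> E \<nu>) \<otimes> x) \<nu>s (E \<mu>)"

lemma cut_simps [simp]:
  "cut \<mu> [] = E \<mu>" "cut \<mu> (\<nu> # \<nu>s) = (\<one> \<ominus> E \<nu>) \<otimes> cut \<mu> \<nu>s"
  by (simp_all add: cut_def)

lemma cut_closed [simp]:
  "\<lbrakk>\<mu> \<in> neutral_words G P; set \<nu>s \<subseteq> neutral_words G P\<rbrakk> \<Longrightarrow> cut \<mu> \<nu>s \<in> carrier B"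
  by (induction \<nu>s) auto

lemma co_mult:
  "\<lbrakk>\<nu> \<in> neutral_words G P; x \<in> carrier B\<rbrakk> \<Longrightarrow> (\<one> \<ominus> E \<nu>) \<otimes> x = x \<ominus> E \<nu> \<otimes> x"
  by (simp add: B.minus_distrib_left)

lemma mult_co:
  "\<lbrakk>\<nu> \<in> neutral_words G P; x \<in> carrier B\<rbrakk> \<Longrightarrow> x \<otimes> (\<one> \<ominus> E \<nu>) = x \<ominus> x \<otimes> E \<nu>"
  by (simp add: B.minus_distrib_right)

lemma cut_commute:
  assumes "\<mu> \<in> neutral_words G P" "set \<nu>s \<subseteq> neutral_words G P" "\<beta> \<in> neutral_words G P"
  shows "E \<beta> \<otimes> cut \<mu> \<nu>s = cut \<mu> \<nu>s \<otimes> E \<beta>"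
  using assms(2)
proof (induction \<nu>s)
  case Nil
  show ?case using assms by (simp add: E_commute)
next
  case (Cons \<nu> \<nu>s)
  let ?c = "cut \<mu> \<nu>s"
  have c: "?c \<in> carrier B" "E \<nu> \<in> carrier B" "E \<beta> \<in> carrier B" using Cons assms by auto
  have "E \<beta> \<otimes> (E \<nu> \<otimes> ?c) = E \<nu> \<otimes> (E \<beta> \<otimes> ?c)"
    using c Cons.prems assms(3) E_commute[of \<beta> \<nu>] by (simp flip: B.m_assoc)
  also have "\<dots> = E \<nu> \<otimes> ?c \<otimes> E \<beta>" using Cons c by (simp add: B.m_assoc)
  finally have *: "E \<beta> \<otimes> (E \<nu> \<otimes> ?c) = E \<nu> \<otimes> ?c \<otimes> E \<beta>" .
  show ?case
    using c Cons * by (simp add: co_mult B.minus_distrib_right B.minus_distrib_left)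
qed

lemma co_cut_commute:
  assumes "\<mu> \<in> neutral_words G P" "set \<nu>s \<subseteq> neutral_words G P" "\<nu> \<in> neutral_words G P"
  shows "(\<one> \<ominus> E \<nu>) \<otimes> cut \<mu> \<nu>s = cut \<mu> \<nu>s \<otimes> (\<one> \<ominus> E \<nu>)"
  using assms by (simp add: co_mult mult_co cut_commute)

lemma co_idem: "\<nu> \<in> neutral_words G P \<Longrightarrow> (\<one> \<ominus> E \<nu>) \<otimes> (\<one> \<ominus> E \<nu>) = \<one> \<ominus> E \<nu>"
  by (simp add: co_mult mult_co B.minus_distrib_right)

lemma co_E: "\<nu> \<in> neutral_words G P \<Longrightarrow> E \<nu> \<otimes> (\<one> \<ominus> E \<nu>) = \<zero>"
  by (simp add: mult_co)

lemma cut_projection: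
  assumes "\<mu> \<in> neutral_words G P" "set \<nu>s \<subseteq> neutral_words G P"
  shows "star B (cut \<mu> \<nu>s) = cut \<mu> \<nu>s \<and> cut \<mu> \<nu>s \<otimes> cut \<mu> \<nu>s = cut \<mu> \<nu>s"
  using assms(2)
proof (induction \<nu>s)
  case (Cons \<nu> \<nu>s)
  let ?c = "cut \<mu> \<nu>s" and ?q = "\<one> \<ominus> E \<nu>"
  have n: "\<nu> \<in> neutral_words G P" "set \<nu>s \<subseteq> neutral_words G P" using Cons.prems by auto
  have c: "?c \<in> carrier B" "?q \<in> carrier B" using n assms by auto
  have com: "?q \<otimes> ?c = ?c \<otimes> ?q" using co_cut_commute n assms by simp
  have "?q \<otimes> ?c \<otimes> (?q \<otimes> ?c) = ?q \<otimes> (?q \<otimes> ?c) \<otimes> ?c"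
    using c com by (metis B.m_assoc B.m_closed)
  also have "\<dots> = ?q \<otimes> ?q \<otimes> (?c \<otimes> ?c)" using c by (simp add: B.m_assoc)
  also have "\<dots> = ?q \<otimes> ?c" using n Cons.IH co_idem by simp
  finally show ?case using Cons.IH n c com by (simp add: B.star_mult)
qed (use assms in auto)

text \<open>Appending to \<open>\<mu>\<close> intersects the piece with \<open>K(\<alpha>)\<close>,
  while prepending to the excluded list removes \<open>K(\<alpha>)\<close>. These are the two halves
  of a splitting step.\<close>

lemma cut_include:
  assumes "\<mu> \<in> neutral_words G P" "set \<nu>s \<subseteq> neutral_words G P" "\<alpha> \<in> neutral_words G P"
  shows "cut (\<mu> @ \<alpha>) \<nu>s = E \<alpha> \<otimes> cut \<mu> \<nu>s"
  using assms(2)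
proof (induction \<nu>s)
  case Nil
  show ?case using assms by (simp add: E_append E_commute)
next
  case (Cons \<nu> \<nu>s)
  let ?c = "cut \<mu> \<nu>s" and ?q = "\<one> \<ominus> E \<nu>"
  have c: "?c \<in> carrier B" "?q \<in> carrier B" "E \<alpha> \<in> carrier B" using Cons assms by auto
  have "?q \<otimes> E \<alpha> = E \<alpha> \<otimes> ?q" using Cons.prems assms(3) by (simp add: co_mult mult_co E_commute)
  then show ?case using Cons c by (simp flip: B.m_assoc)
qed

lemma E_cut:
  assumes "\<mu> \<in> neutral_words G P" "set \<nu>s \<subseteq> neutral_words G P"
  shows "E \<mu> \<otimes> cut \<mu> \<nu>s = cut \<mu> \<nu>s"
  using assms(2)
proof (induction \<nu>s)
  case (Cons \<nu> \<nu>s)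
  let ?c = "cut \<mu> \<nu>s" and ?q = "\<one> \<ominus> E \<nu>"
  have c: "?c \<in> carrier B" "?q \<in> carrier B" "E \<mu> \<in> carrier B" using Cons assms by auto
  have "E \<mu> \<otimes> ?q = ?q \<otimes> E \<mu>" using Cons.prems assms(1) by (simp add: co_mult mult_co E_commute)
  then have "E \<mu> \<otimes> (?q \<otimes> ?c) = ?q \<otimes> (E \<mu> \<otimes> ?c)"
    using c by (simp flip: B.m_assoc)
  then show ?case using Cons by simp
qed (use assms in simp)

lemma cut_exclude_absorb:
  assumes "\<mu> \<in> neutral_words G P" "set \<nu>s \<subseteq> neutral_words G P" "\<nu> \<in> set \<nu>s"
  shows "(\<one> \<ominus> E \<nu>) \<otimes> cut \<mu> \<nu>s = cut \<mu> \<nu>s"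
  using assms(2,3)
proof (induction \<nu>s)
  case (Cons \<xi> \<nu>s)
  let ?c = "cut \<mu> \<nu>s" and ?q = "\<one> \<ominus> E \<nu>" and ?r = "\<one> \<ominus> E \<xi>"
  have n: "\<nu> \<in> neutral_words G P" "\<xi> \<in> neutral_words G P" using Cons.prems by auto
  have c: "?c \<in> carrier B" "?q \<in> carrier B" "?r \<in> carrier B" using Cons assms n by auto
  show ?case
  proof (cases "\<nu> = \<xi>")
    case True
    then show ?thesis using co_idem[OF n(1)] c by (simp flip: B.m_assoc)
  next
    case False
    have "?q \<otimes> ?r = ?r \<otimes> ?q"
    proof -
      have "?q \<otimes> ?r = \<one> \<ominus> E \<nu> \<ominus> (E \<xi> \<ominus> E \<nu> \<otimes> E \<xi>)" using n by (simp add: co_mult mult_co)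
      also have "\<dots> = \<one> \<ominus> E \<xi> \<ominus> (E \<nu> \<ominus> E \<xi> \<otimes> E \<nu>)"
        using n E_commute[OF n] by (simp add: B.minus_eq B.minus_add B.a_ac)
      also have "\<dots> = ?r \<otimes> ?q" using n by (simp add: co_mult mult_co)
      finally show ?thesis .
    qed
    then have "?q \<otimes> (?r \<otimes> ?c) = ?r \<otimes> (?q \<otimes> ?c)"
      using c by (simp flip: B.m_assoc)
    then show ?thesis using Cons False by simp
  qed
qed simp

text \<open>The splitting may exclude one word repeatedly, whereas (T4) and the boundary relations
  are indexed by distinct lists; idempotence of the factors bridges the gap.\<close>

lemma cut_remdups:
  assumes "\<mu> \<in> neutral_words G P" "set \<nu>s \<subseteq> neutral_words G P"
  shows "cut \<mu> (remdups \<nu>s) = cut \<mu> \<nu>s"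
  using assms(2) by (induction \<nu>s) (auto simp: cut_exclude_absorb[OF assms(1)])

lemma diff_prod_eq_cut:
  assumes "\<mu> \<in> neutral_words G P" "set \<nu>s \<subseteq> neutral_words G P" "\<nu>s \<noteq> []"
  shows "diff_prod B w \<mu> (map (\<lambda>\<nu>. \<mu> @ \<nu>) \<nu>s) = cut \<mu> \<nu>s"
  using assms(3,2)
proof (induction \<nu>s rule: list_nonempty_induct)
  case (single \<nu>)
  then show ?case using assms(1) by (simp add: E_append co_mult E_commute)
next
  case (cons \<nu> \<nu>s)
  have n: "\<nu> \<in> neutral_words G P" "set \<nu>s \<subseteq> neutral_words G P" using cons.prems by auto
  let ?c = "cut \<mu> \<nu>s"
  have c: "?c \<in> carrier B" "E \<nu> \<in> carrier B" "E \<mu> \<in> carrier B" using n assms by auto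
  have "(E \<mu> \<ominus> E (\<mu> @ \<nu>)) \<otimes> ?c = E \<mu> \<otimes> ?c \<ominus> E \<nu> \<otimes> (E \<mu> \<otimes> ?c)"
    using c n assms(1) by (simp add: E_append B.minus_distrib_left E_commute[of \<mu> \<nu>] B.m_assoc)
  then show ?case using cons.IH n c E_cut[OF assms(1) n(2)] by (simp add: co_mult)
qed

text \<open>The inclusion says that \<open>K(\<mu>)\<close> is the union of the ideals of the words
  \<open>\<mu> @ \<nu>\<close>, so the difference product vanishes by (T4). With no excluded word
  the ideal itself is empty and (T2) applies.\<close>

lemma cut_eq_zero:
  assumes "\<mu> \<in> neutral_words G P" "set \<nu>s \<subseteq> neutral_words G P" "K G P \<mu> \<subseteq> (\<Union>\<nu>\<in>set \<nu>s. K G P \<nu>)"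
  shows "cut \<mu> \<nu>s = \<zero>"
proof (cases "\<nu>s = []")
  case True
  then show ?thesis using assms relation_T2 by simp
next
  case False
  have "diff_prod B w \<mu> (map (\<lambda>\<nu>. \<mu> @ \<nu>) (remdups \<nu>s)) = \<zero>"
  proof (rule relation_T4[OF assms(1)])
    show "distinct (map (\<lambda>\<nu>. \<mu> @ \<nu>) (remdups \<nu>s))" by (simp add: distinct_map inj_on_def)
    show "K G P \<mu> = (\<Union>\<beta>\<in>set (map (\<lambda>\<nu>. \<mu> @ \<nu>) (remdups \<nu>s)). K G P \<beta>)"
      using assms by (auto simp: K_neutral_append subset_iff)
  qed (use assms False in auto)
  then show ?thesis
    using assms False diff_prod_eq_cut[of \<mu> "remdups \<nu>s"] cut_remdups by simp
qed

text \<open>A point of \<open>K(\<mu>)\<close> has a right multiple in some \<open>K(\<nu>)\<close>;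
  the multiple stays in the right ideal \<open>K(\<mu>)\<close>, hence belongs to the ideal of
  \<open>\<mu> @ \<nu>\<close>.\<close>

lemma cut_boundary:
  assumes "\<mu> \<in> neutral_words G P" "set \<nu>s \<subseteq> neutral_words G P" "K G P \<mu> - (\<Union>\<nu>\<in>set \<nu>s. K G P \<nu>) \<noteq> {}"
    "\<And>p. p \<in> K G P \<mu> \<Longrightarrow> \<exists>q\<in>p <#\<^bsub>G\<^esub> P. \<exists>\<nu>\<in>set \<nu>s. q \<in> K G P \<nu>"
  shows "cut \<mu> \<nu>s \<in> boundary_products G P B w"
proof -
  let ?\<beta>s = "map (\<lambda>\<nu>. \<mu> @ \<nu>) (remdups \<nu>s)"
  \<comment> \<open>The nonempty difference supplies a point of \<open>K(\<mu>)\<close>, for which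
    the last hypothesis yields a word in the list.\<close>
  have "\<nu>s \<noteq> []" using assms(3,4) by force
  then have eq: "cut \<mu> \<nu>s = diff_prod B w \<mu> ?\<beta>s"
    using assms diff_prod_eq_cut[of \<mu> "remdups \<nu>s"] cut_remdups by simp
  have \<mu>: "\<mu> \<in> words P" using assms(1) by (simp add: neutral_words_def)
  have "proper_foundation_set G P (K G P \<mu>) (K G P ` set ?\<beta>s)"
    unfolding proper_foundation_set_def foundation_set_def
  proof (intro conjI ballI)
    show "K G P \<mu> \<in> constructible_ideals G P" using assms(1) by (simp add: constructible_ideals_eq)
    show "K G P ` set ?\<beta>s \<subseteq> constructible_ideals G P"
      using assms by (auto simp: constructible_ideals_eq)
    show "\<And>R. R \<in> K G P ` set ?\<beta>s \<Longrightarrow> R \<subseteq> K G P \<mu>"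
      using assms by (auto simp: K_neutral_append subset_iff)
    show "K G P \<mu> - \<Union> (K G P ` set ?\<beta>s) \<noteq> {}"
      using assms by (auto simp: K_neutral_append subset_iff)
    fix p assume p: "p \<in> K G P \<mu>"
    then obtain q \<nu> where q: "q \<in> p <#\<^bsub>G\<^esub> P" "\<nu> \<in> set \<nu>s" "q \<in> K G P \<nu>" using assms(4) by blast
    have "q \<in> K G P \<mu>" using q(1) K_right_ideal[OF \<mu> p] by (auto simp: l_coset_def)
    then have "q \<in> K G P (\<mu> @ \<nu>)" using q assms by (auto simp: K_neutral_append)
    then show "(p <#\<^bsub>G\<^esub> P) \<inter> \<Union> (K G P ` set ?\<beta>s) \<noteq> {}" using q by auto
  qed auto
  moreover have "distinct ?\<beta>s" by (simp add: distinct_map inj_on_def)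
  moreover have "set ?\<beta>s \<subseteq> neutral_words G P" using assms by auto
  ultimately show ?thesis unfolding eq boundary_products_def using assms(1) by blast
qed

section \<open>Norms of linear combinations of the projections\<close>

definition lin :: "(complex \<times> 'g list) list \<Rightarrow> 'b" where
  "lin cs = lincomb B (map (\<lambda>(c, \<alpha>). (c, E \<alpha>)) cs)"

lemma lin_simps [simp]:
  "lin [] = \<zero>" "lin ((c, \<alpha>) # cs) = c \<odot> E \<alpha> \<oplus> lin cs"
  by (simp_all add: lin_def)

lemma lin_closed [simp]: "snd ` set cs \<subseteq> neutral_words G P \<Longrightarrow> lin cs \<in> carrier B"
  by (induction cs) auto

text \<open>Splitting successively by \<open>E \<alpha>\<close> and \<open>1 - E \<alpha>\<close> diagonalizes \<open>lin cs\<close>. The pieces of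
  \<open>P\<close> that avoid \<open>D\<close> go to the span of \<open>Z\<close>, the others are controlled by the values on \<open>D\<close>.\<close>

lemma lin_split:
  assumes Z: "Z \<subseteq> carrier B"
    and Z_cut: "\<And>\<mu> \<nu>s. \<lbrakk>\<mu> \<in> neutral_words G P; set \<nu>s \<subseteq> neutral_words G P;
        D \<inter> (K G P \<mu> - (\<Union>\<nu>\<in>set \<nu>s. K G P \<nu>)) = {}\<rbrakk> \<Longrightarrow> cut \<mu> \<nu>s \<in> Z"
    and r: "0 \<le> r"
    and "snd ` set cs \<subseteq> neutral_words G P" "\<mu> \<in> neutral_words G P" "set \<nu>s \<subseteq> neutral_words G P"
    and "\<And>p. p \<in> D \<Longrightarrow> p \<in> K G P \<mu> \<Longrightarrow> (\<And>\<nu>. \<nu> \<in> set \<nu>s \<Longrightarrow> p \<notin> K G P \<nu>) \<Longrightarrow> cmod (c + symbol cs p) \<le> r"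
  shows "\<exists>u ds. u \<in> carrier B \<and> snd ` set ds \<subseteq> Z
    \<and> cut \<mu> \<nu>s \<otimes> (c \<odot> \<one> \<oplus> lin cs) = u \<oplus> lincomb B ds
    \<and> cut \<mu> \<nu>s \<otimes> u = u \<and> (\<forall>\<beta>\<in>neutral_words G P. E \<beta> \<otimes> u = u \<otimes> E \<beta>) \<and> cnorm B u \<le> r"
  using assms(4-)
\<comment> \<open>\<open>c\<close> collects the coefficients already known to be active on the
  current piece; when the list is used up, only this constant remains. The two clauses on
  multiplication by \<open>u\<close> are carried along because the gluing of the halves needs
  them.\<close>
proof (induction cs arbitrary: \<mu> \<nu>s c)
  case Nil
  let ?C = "cut \<mu> \<nu>s"
  have C: "?C \<in> carrier B" using Nil by simp
  have eq: "?C \<otimes> (c \<odot> \<one> \<oplus> lin []) = c \<odot> ?C" using C by (simp add: B.smult_mult_right)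
  show ?case
  \<comment> \<open>A piece with a small constant goes into \<open>u\<close>, where a projection
    times \<open>c\<close> has norm at most \<open>cmod c\<close>. A piece with a large constant
    contains no point of \<open>D\<close>, so its cut belongs to \<open>Z\<close> and becomes a
    summand of \<open>ds\<close>.\<close>
  proof (cases "cmod c \<le> r")
    case True
    have "cnorm B ?C \<le> 1" using C cut_projection Nil by (intro B.cnorm_projection_le_1) auto
    then have "cnorm B (c \<odot> ?C) \<le> cmod c"
      using C by (simp add: B.cnorm_smult mult_left_le)
    then have "cnorm B (c \<odot> ?C) \<le> r" using True by simp
    moreover have "?C \<otimes> (c \<odot> ?C) = c \<odot> ?C"
      using C cut_projection[of \<mu> \<nu>s] Nil by (simp add: B.smult_mult_right)
    moreover have "\<forall>\<beta>\<in>neutral_words G P. E \<beta> \<otimes> (c \<odot> ?C) = c \<odot> ?C \<otimes> E \<beta>"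
      using C cut_commute[of \<mu> \<nu>s] Nil by (simp add: B.smult_mult_right B.smult_mult_left)
    ultimately show ?thesis unfolding eq using C
      by (intro exI[of _ "c \<odot> ?C"] exI[of _ "[]"]) auto
  next
    case False
    have "D \<inter> (K G P \<mu> - (\<Union>\<nu>\<in>set \<nu>s. K G P \<nu>)) = {}" using Nil.prems(4) False by force
    then have "?C \<in> Z" using Z_cut Nil by blast
    then show ?thesis unfolding eq using C r Nil
      by (intro exI[of _ "\<zero>"] exI[of _ "[(c, ?C)]"]) auto
  qed
next
  case (Cons d' cs)
  obtain d \<alpha> where d': "d' = (d, \<alpha>)" by (cases d')
  have n: "\<mu> \<in> neutral_words G P" "set \<nu>s \<subseteq> neutral_words G P" "\<alpha> \<in> neutral_words G P"
    "snd ` set cs \<subseteq> neutral_words G P" using Cons.prems d' by auto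
  let ?C = "cut \<mu> \<nu>s" and ?e = "E \<alpha>" and ?q = "\<one> \<ominus> E \<alpha>"
  have C [simp]: "?C \<in> carrier B" "?e \<in> carrier B" "lin cs \<in> carrier B" using n by auto
  have C1: "cut (\<mu> @ \<alpha>) \<nu>s = ?e \<otimes> ?C" using cut_include n by simp
  have C2: "cut \<mu> (\<alpha> # \<nu>s) = ?q \<otimes> ?C" by simp
  have CC: "?C \<otimes> ?C = ?C" using cut_projection n by simp
  have eC: "?e \<otimes> ?C = ?C \<otimes> ?e" using cut_commute n by simp
  have qC: "?q \<otimes> ?C = ?C \<otimes> ?q" using co_cut_commute n by simp
  \<comment> \<open>On \<open>K(\<alpha>)\<close> the coefficient \<open>d\<close> joins the
    constant; on the complement, treated after it, the constant remains \<open>c\<close>.\<close>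
  have "\<exists>u ds. u \<in> carrier B \<and> snd ` set ds \<subseteq> Z
    \<and> cut (\<mu> @ \<alpha>) \<nu>s \<otimes> ((c + d) \<odot> \<one> \<oplus> lin cs) = u \<oplus> lincomb B ds
    \<and> cut (\<mu> @ \<alpha>) \<nu>s \<otimes> u = u \<and> (\<forall>\<beta>\<in>neutral_words G P. E \<beta> \<otimes> u = u \<otimes> E \<beta>) \<and> cnorm B u \<le> r"
  proof (rule Cons.IH)
    fix p assume "p \<in> D" "p \<in> K G P (\<mu> @ \<alpha>)" "\<And>\<nu>. \<nu> \<in> set \<nu>s \<Longrightarrow> p \<notin> K G P \<nu>"
    then show "cmod (c + d + symbol cs p) \<le> r"
      using Cons.prems(4)[of p] n by (simp add: K_neutral_append d' add.assoc)
  qed (use n in auto)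
  then obtain u1 ds1 where u1: "u1 \<in> carrier B" "snd ` set ds1 \<subseteq> Z"
    "?e \<otimes> ?C \<otimes> ((c + d) \<odot> \<one> \<oplus> lin cs) = u1 \<oplus> lincomb B ds1"
    "?e \<otimes> ?C \<otimes> u1 = u1" "\<forall>\<beta>\<in>neutral_words G P. E \<beta> \<otimes> u1 = u1 \<otimes> E \<beta>" "cnorm B u1 \<le> r"
    unfolding C1 by blast
  have "\<exists>u ds. u \<in> carrier B \<and> snd ` set ds \<subseteq> Z
    \<and> cut \<mu> (\<alpha> # \<nu>s) \<otimes> (c \<odot> \<one> \<oplus> lin cs) = u \<oplus> lincomb B ds
    \<and> cut \<mu> (\<alpha> # \<nu>s) \<otimes> u = u \<and> (\<forall>\<beta>\<in>neutral_words G P. E \<beta> \<otimes> u = u \<otimes> E \<beta>) \<and> cnorm B u \<le> r"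
  proof (rule Cons.IH)
    fix p assume "p \<in> D" "p \<in> K G P \<mu>" "\<And>\<nu>. \<nu> \<in> set (\<alpha> # \<nu>s) \<Longrightarrow> p \<notin> K G P \<nu>"
    then show "cmod (c + symbol cs p) \<le> r"
      using Cons.prems(4)[of p] by (simp add: d')
  qed (use n in auto)
  then obtain u2 ds2 where u2: "u2 \<in> carrier B" "snd ` set ds2 \<subseteq> Z"
    "?q \<otimes> ?C \<otimes> (c \<odot> \<one> \<oplus> lin cs) = u2 \<oplus> lincomb B ds2"
    "?q \<otimes> ?C \<otimes> u2 = u2" "\<forall>\<beta>\<in>neutral_words G P. E \<beta> \<otimes> u2 = u2 \<otimes> E \<beta>" "cnorm B u2 \<le> r"
    unfolding C2 by blast
  have qc [simp]: "?q \<in> carrier B" by simp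
  \<comment> \<open>Each half lies under its own projection: \<open>u1\<close> under
    \<open>?e\<close> and \<open>u2\<close> under \<open>?q\<close>. This is read off from the
    clause that each is fixed by its cut.\<close>
  have eu1: "?e \<otimes> u1 = u1"
  proof -
    have "?e \<otimes> u1 = ?e \<otimes> ?e \<otimes> ?C \<otimes> u1"
      using u1(1) by (subst u1(4)[symmetric]) (simp add: B.m_assoc)
    then show ?thesis using n u1(4) by simp
  qed
  have qu2: "?q \<otimes> u2 = u2"
  proof -
    have "?q \<otimes> u2 = ?q \<otimes> ?q \<otimes> ?C \<otimes> u2"
      using u2(1) by (subst u2(4)[symmetric]) (simp add: B.m_assoc)
    then show ?thesis using co_idem n(3) u2(4) by simp
  qed
  have eu2: "?e \<otimes> u2 = \<zero>"
  proof -
    have "?e \<otimes> u2 = ?e \<otimes> ?q \<otimes> u2"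
      using u2(1) by (subst qu2[symmetric]) (simp add: B.m_assoc)
    then show ?thesis using co_E n(3) u2(1) by simp
  qed
  have Cu1: "?C \<otimes> u1 = u1"
  proof -
    have "?C \<otimes> u1 = ?C \<otimes> (?C \<otimes> ?e \<otimes> u1)" using u1(4) eC by simp
    also have "\<dots> = ?C \<otimes> ?C \<otimes> ?e \<otimes> u1" using u1(1) by (simp add: B.m_assoc)
    also have "\<dots> = u1" using u1(4) eC CC by simp
    finally show ?thesis .
  qed
  have Cu2: "?C \<otimes> u2 = u2"
  proof -
    have "?C \<otimes> u2 = ?C \<otimes> (?C \<otimes> ?q \<otimes> u2)" using u2(4) qC by simp
    also have "\<dots> = ?C \<otimes> ?C \<otimes> ?q \<otimes> u2" using u2(1) by (simp add: B.m_assoc)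
    also have "\<dots> = u2" using u2(4) qC CC by simp
    finally show ?thesis .
  qed
  have ds: "lincomb B ds1 \<in> carrier B" "lincomb B ds2 \<in> carrier B"
    "lincomb B (ds1 @ ds2) = lincomb B ds1 \<oplus> lincomb B ds2"
    using u1(2) u2(2) Z by (auto intro!: B.lincomb_closed B.lincomb_append)
  let ?u = "u1 \<oplus> u2"
  \<comment> \<open>The triangle inequality would double the bound at every split. Orthogonality of
    the halves keeps it at \<open>r\<close>.\<close>
  have norm: "cnorm B ?u \<le> r"
  proof (rule B.cnorm_projection_split[of ?e])
    show "?e \<otimes> ?u = ?u \<otimes> ?e"
      using u1(1,5) u2(1,5) n(3) by (simp add: B.r_distr B.l_distr)
    have "?e \<otimes> ?u = u1" using u1(1) u2(1) eu1 eu2 by (simp add: B.r_distr)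
    then show "cnorm B (?e \<otimes> ?u) \<le> r" using u1(6) by simp
    have "?q \<otimes> u1 = \<zero>" using u1(1) n(3) eu1 by (simp add: co_mult)
    then have "?q \<otimes> ?u = u2" using u1(1) u2(1) qu2 by (simp add: B.r_distr)
    then show "cnorm B (?q \<otimes> ?u) \<le> r" using u2(6) by simp
  qed (use u1(1) u2(1) n(3) in auto)
  have eq: "?C \<otimes> (c \<odot> \<one> \<oplus> lin (d' # cs)) = ?u \<oplus> lincomb B (ds1 @ ds2)"
  proof -
    let ?X = "c \<odot> \<one> \<oplus> lin cs"
    have X: "?X \<in> carrier B" by simp
    have X': "(c + d) \<odot> \<one> \<oplus> lin cs = ?X \<oplus> d \<odot> \<one>"
      by (simp add: B.scalar_add B.a_ac)
    have X'': "c \<odot> \<one> \<oplus> lin (d' # cs) = ?X \<oplus> d \<odot> ?e"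
      by (simp add: d' B.a_ac)
    have 1: "?e \<otimes> ?C \<otimes> (?X \<oplus> d \<odot> \<one>) = ?e \<otimes> ?C \<otimes> ?X \<oplus> d \<odot> (?e \<otimes> ?C)"
      using X by (simp add: B.r_distr B.smult_mult_right)
    have 2: "?q \<otimes> ?C \<otimes> ?X = ?C \<otimes> ?X \<ominus> ?e \<otimes> ?C \<otimes> ?X"
      using X n(3) by (simp add: co_mult B.m_assoc B.minus_distrib_left)
    have 3: "?C \<otimes> (?X \<oplus> d \<odot> ?e) = ?C \<otimes> ?X \<oplus> d \<odot> (?e \<otimes> ?C)"
      using X by (simp add: B.r_distr B.smult_mult_right eC)
    have "?u \<oplus> lincomb B (ds1 @ ds2) = (u1 \<oplus> lincomb B ds1) \<oplus> (u2 \<oplus> lincomb B ds2)"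
      using u1(1) u2(1) ds by (simp add: B.a_ac)
    also have "\<dots> = (?e \<otimes> ?C \<otimes> ?X \<oplus> d \<odot> (?e \<otimes> ?C)) \<oplus> (?C \<otimes> ?X \<ominus> ?e \<otimes> ?C \<otimes> ?X)"
      using u1(3) u2(3) 1 2 X' by simp
    also have "\<dots> = ?C \<otimes> ?X \<oplus> d \<odot> (?e \<otimes> ?C)"
    proof -
      have "(x \<oplus> y) \<oplus> (z \<ominus> x) = z \<oplus> y"
        if c: "x \<in> carrier B" "y \<in> carrier B" "z \<in> carrier B" for x y z
      proof -
        have "(x \<oplus> y) \<oplus> (z \<ominus> x) = (z \<oplus> y) \<oplus> (x \<oplus> \<ominus> x)"
          using c by (simp add: B.minus_eq B.a_ac)
        then show ?thesis using c by (simp add: B.r_neg)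
      qed
      then show ?thesis using X by simp
    qed
    finally show ?thesis using 3 X'' by simp
  qed
  show ?case
  proof (intro exI conjI)
    show "?u \<in> carrier B" using u1(1) u2(1) by simp
    show "snd ` set (ds1 @ ds2) \<subseteq> Z" using u1(2) u2(2) by auto
    show "?C \<otimes> (c \<odot> \<one> \<oplus> lin (d' # cs)) = ?u \<oplus> lincomb B (ds1 @ ds2)" by (rule eq)
    show "?C \<otimes> ?u = ?u" using u1(1) u2(1) Cu1 Cu2 by (simp add: B.r_distr)
    show "\<forall>\<beta>\<in>neutral_words G P. E \<beta> \<otimes> ?u = ?u \<otimes> E \<beta>"
      using u1(1,5) u2(1,5) by (simp add: B.r_distr B.l_distr)
    show "cnorm B ?u \<le> r" by (rule norm)
  qed
qed

text \<open>The splitting starts from the whole of \<open>P\<close>: the cut with empty words is the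
  unit, and the accumulated constant is \<open>0\<close>.\<close>

lemma lin_decompose:
  assumes Z: "Z \<subseteq> carrier B"
    and Z_cut: "\<And>\<mu> \<nu>s. \<lbrakk>\<mu> \<in> neutral_words G P; set \<nu>s \<subseteq> neutral_words G P;
        D \<inter> (K G P \<mu> - (\<Union>\<nu>\<in>set \<nu>s. K G P \<nu>)) = {}\<rbrakk> \<Longrightarrow> cut \<mu> \<nu>s \<in> Z"
    and r: "0 \<le> r" and cs: "snd ` set cs \<subseteq> neutral_words G P"
    and le: "\<And>p. p \<in> D \<Longrightarrow> cmod (symbol cs p) \<le> r"
  obtains u ds where "u \<in> carrier B" "snd ` set ds \<subseteq> Z" "lin cs = u \<oplus> lincomb B ds" "cnorm B u \<le> r"
proof -
  have "\<exists>u ds. u \<in> carrier B \<and> snd ` set ds \<subseteq> Z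
    \<and> cut [] [] \<otimes> (0 \<odot> \<one> \<oplus> lin cs) = u \<oplus> lincomb B ds
    \<and> cut [] [] \<otimes> u = u \<and> (\<forall>\<beta>\<in>neutral_words G P. E \<beta> \<otimes> u = u \<otimes> E \<beta>) \<and> cnorm B u \<le> r"
    by (rule lin_split[where D = D, OF Z Z_cut r cs]) (simp_all add: le)
  moreover have "cut [] [] \<otimes> (0 \<odot> \<one> \<oplus> lin cs) = lin cs" using cs by simp
  ultimately show ?thesis using that by metis
qed

text \<open>With \<open>D = P\<close> a discarded piece is empty, as every ideal lies in
  \<open>P\<close>; its cut is zero by (T2) or (T4), so nothing but the part of norm at most
  \<open>r\<close> remains.\<close>

lemma cnorm_lin_le:
  assumes "snd ` set cs \<subseteq> neutral_words G P" "0 \<le> r" "\<And>p. p \<in> P \<Longrightarrow> cmod (symbol cs p) \<le> r"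
  shows "cnorm B (lin cs) \<le> r"
proof -
  have "cut \<mu> \<nu>s \<in> {\<zero>}" if "\<mu> \<in> neutral_words G P" "set \<nu>s \<subseteq> neutral_words G P"
    "P \<inter> (K G P \<mu> - (\<Union>\<nu>\<in>set \<nu>s. K G P \<nu>)) = {}" for \<mu> \<nu>s
    using cut_eq_zero[of \<mu> \<nu>s] that K_subset by blast
  then obtain u ds where u: "u \<in> carrier B" "snd ` set ds \<subseteq> {\<zero>}"
    "lin cs = u \<oplus> lincomb B ds" "cnorm B u \<le> r"
    using lin_decompose[of "{\<zero>}" P r cs] assms by (metis B.zero_closed empty_subsetI insert_subset)
  have "lincomb B ds = \<zero>" using u(2) by (induction ds) auto
  then have "lin cs = u" using u assms(1) by simp
  then show ?thesis using u by simp
qed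

lemma boundary_products_closed: "boundary_products G P B w \<subseteq> carrier B"
  using neutral_words_set by (auto simp: boundary_products_def intro!: B.diff_prod_closed[OF w_closed])

text \<open>A nonempty piece that misses \<open>\<Delta>\<close> has a boundary product as its cut:
  every \<open>pP\<close> contains a point of \<open>\<Delta>\<close>, which inside
  \<open>K(\<mu>)\<close> must then lie in an excluded ideal.\<close>

lemma lin_near_boundary:
  assumes cs: "snd ` set cs \<subseteq> neutral_words G P" and r: "0 \<le> r" and F: "finite F" "F \<subseteq> carrier G"
    and le: "\<And>p. p \<in> \<Delta> G P F \<Longrightarrow> cmod (symbol cs p) \<le> r"
  shows "\<exists>z\<in>closed_span B (boundary_products G P B w). cnorm B (lin cs \<ominus> z) \<le> r"
proof -
  \<comment> \<open>Zero is added for the empty pieces, whose covers are foundation sets but not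
    proper ones.\<close>
  let ?Z = "insert \<zero> (boundary_products G P B w)"
  have Zc: "?Z \<subseteq> carrier B" using boundary_products_closed by auto
  have Z: "cut \<mu> \<nu>s \<in> ?Z" if n: "\<mu> \<in> neutral_words G P" "set \<nu>s \<subseteq> neutral_words G P"
    and D: "\<Delta> G P F \<inter> (K G P \<mu> - (\<Union>\<nu>\<in>set \<nu>s. K G P \<nu>)) = {}" for \<mu> \<nu>s
  proof (cases "K G P \<mu> \<subseteq> (\<Union>\<nu>\<in>set \<nu>s. K G P \<nu>)")
    case True
    then show ?thesis using cut_eq_zero n by simp
  next
    case False
    have "cut \<mu> \<nu>s \<in> boundary_products G P B w"
    proof (rule cut_boundary[OF n])
      fix p assume p: "p \<in> K G P \<mu>"
      then have "p \<in> P" using K_subset by blast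
      then obtain q where q: "q \<in> p <#\<^bsub>G\<^esub> P" "q \<in> \<Delta> G P F" using Delta_meets[OF F] by blast
      then have "q \<in> K G P \<mu>"
        using K_right_ideal[of \<mu> p] p n(1) by (auto simp: l_coset_def neutral_words_def)
      then show "\<exists>q\<in>p <#\<^bsub>G\<^esub> P. \<exists>\<nu>\<in>set \<nu>s. q \<in> K G P \<nu>" using q D by blast
    qed (use False in blast)
    then show ?thesis by simp
  qed
  from lin_decompose[OF Zc Z r cs le]
  obtain u ds where u: "u \<in> carrier B" "snd ` set ds \<subseteq> ?Z"
    "lin cs = u \<oplus> lincomb B ds" "cnorm B u \<le> r" by blast
  have "?Z \<subseteq> closed_span B (boundary_products G P B w)"
    using B.closed_span_base[OF boundary_products_closed]
      B.lincomb_in_closed_span[OF boundary_products_closed, of "[]"] by auto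
  then have "closed_span B ?Z \<subseteq> closed_span B (boundary_products G P B w)"
    by (rule B.closed_span_mono[OF _ boundary_products_closed])
  then have "lincomb B ds \<in> closed_span B (boundary_products G P B w)"
    using B.lincomb_in_closed_span[OF Zc u(2)] by blast
  moreover have dc: "lincomb B ds \<in> carrier B" using u(2) Zc by (intro B.lincomb_closed) auto
  have "lin cs \<ominus> lincomb B ds = u"
    unfolding u(3) using u(1) dc by (simp add: B.minus_eq B.a_assoc B.r_neg)
  ultimately show ?thesis using u(4) by force
qed

text \<open>Members of a foundation set lie inside \<open>K(\<alpha>)\<close>, so by (T3) each
  \<open>\<beta>\<close> may be replaced by \<open>\<alpha> @ \<beta>\<close>; the product is then a
  cut, hence a projection.\<close>

lemma boundary_products_projections: "boundary_products G P B w \<subseteq> projections B"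
proof
  fix x assume "x \<in> boundary_products G P B w"
  then obtain \<alpha> \<beta>s where ab: "x = diff_prod B w \<alpha> \<beta>s" "\<alpha> \<in> neutral_words G P" "set \<beta>s \<subseteq> neutral_words G P"
    "proper_foundation_set G P (K G P \<alpha>) (K G P ` set \<beta>s)" by (auto simp: boundary_products_def)
  have "\<beta>s \<noteq> []" using ab(4) by (auto simp: proper_foundation_set_def foundation_set_def)
  have "E \<beta> = E (\<alpha> @ \<beta>)" if "\<beta> \<in> set \<beta>s" for \<beta>
  proof (rule relation_T3)
    have "K G P \<beta> \<subseteq> K G P \<alpha>" using ab(4) that by (auto simp: proper_foundation_set_def foundation_set_def)
    moreover have "\<beta> \<in> neutral_words G P" using that ab(3) by auto
    ultimately show "K G P \<beta> = K G P (\<alpha> @ \<beta>)" using K_neutral_append[OF ab(2), of \<beta>] by auto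
  qed (use that ab in auto)
  then have "diff_prod B w \<alpha> \<beta>s = diff_prod B w \<alpha> (map (\<lambda>\<beta>. \<alpha> @ \<beta>) \<beta>s)"
    by (induction \<beta>s) auto
  then have "x = cut \<alpha> \<beta>s" using diff_prod_eq_cut ab \<open>\<beta>s \<noteq> []\<close> by simp
  then show "x \<in> projections B" using cut_projection ab by (simp add: projections_def)
qed

end


section \<open>Strong covariance\<close>

context group_submonoid begin

sublocale T: toeplitz_representation G P Tu tu
  by unfold_locales (rule tu_closed, rule tu_relations)

end

section \<open>The closed span of the projections, and isometry of \<open>w\<close>\<close>

context toeplitz_representation begin

abbreviation "DB \<equiv> closed_span B (E ` neutral_words G P)"

lemma E_image: "E ` neutral_words G P \<subseteq> carrier B"
  by auto

lemma lincomb_eq_lin: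
  assumes "snd ` set ds \<subseteq> E ` neutral_words G P"
  shows "\<exists>cs. snd ` set cs \<subseteq> neutral_words G P \<and> lincomb B ds = lin cs"
  using assms
proof (induction ds)
  case Nil
  show ?case by (intro exI[of _ "[]"]) simp
next
  case (Cons d ds)
  obtain c x where d: "d = (c, x)" by (cases d)
  obtain cs where cs: "snd ` set cs \<subseteq> neutral_words G P" "lincomb B ds = lin cs" using Cons by auto
  obtain \<alpha> where \<alpha>: "\<alpha> \<in> neutral_words G P" "x = E \<alpha>" using Cons.prems d by auto
  show ?case using cs \<alpha> d by (intro exI[of _ "(c, \<alpha>) # cs"]) auto
qed

lemma lin_in_DB:
  assumes "snd ` set cs \<subseteq> neutral_words G P"
  shows "lin cs \<in> DB"
  unfolding lin_def using assms by (intro B.lincomb_in_closed_span E_image) force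

lemma DB_approx:
  assumes "d \<in> DB" "e > 0"
  obtains cs where "snd ` set cs \<subseteq> neutral_words G P" "cnorm B (d \<ominus> lin cs) < e"
  using B.closed_span_approx[OF E_image assms] lincomb_eq_lin by metis

lemma E_in_DB: "\<alpha> \<in> neutral_words G P \<Longrightarrow> E \<alpha> \<in> DB"
  using B.closed_span_base[OF E_image] by auto

lemma one_in_DB: "\<one> \<in> DB"
  using E_in_DB[OF Nil_neutral] by simp

lemma DB_mult: "\<lbrakk>x \<in> DB; y \<in> DB\<rbrakk> \<Longrightarrow> x \<otimes> y \<in> DB"
  by (rule B.closed_span_mult[OF E_image]) (auto simp: E_in_DB simp flip: E_append)

lemma DB_star: "x \<in> DB \<Longrightarrow> star B x \<in> DB"
  by (rule B.closed_span_star[OF E_image]) auto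

lemma DB_carrier: "DB \<subseteq> carrier B"
  by (rule B.closed_span_carrier[OF E_image])

lemma diff_prod_in_DB:
  assumes "\<alpha> \<in> neutral_words G P" "set \<beta>s \<subseteq> neutral_words G P"
  shows "diff_prod B w \<alpha> \<beta>s \<in> DB"
  using assms(2)
  by (induction \<beta>s) (auto intro!: one_in_DB DB_mult B.closed_span_minus[OF E_image] E_in_DB assms(1))

lemma boundary_products_in_DB: "boundary_products G P B w \<subseteq> DB"
  by (auto simp: boundary_products_def intro!: diff_prod_in_DB)

lemma ind_lin:
  assumes "snd ` set cs \<subseteq> neutral_words G P"
  shows "ind (T.lin cs) = lin cs"
  using assms by (induction cs) (auto simp: ind_word_elem[OF neutral_words_set])

text \<open>The induced map sends boundary products to boundary products of \<open>w\<close>, which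
  vanish; contractivity carries this over to the closed span.\<close>

lemma ind_boundary_vanish:
  assumes bd: "satisfies_boundary_relations G P B w"
    and d: "d \<in> closed_span Tu (boundary_products G P Tu tu)"
  shows "ind d = \<zero>"
proof -
  note bc = T.boundary_products_closed
  have dc: "d \<in> carrier Tu" using d Tu.closed_span_carrier[OF bc] by auto
  have lin0: "ind (lincomb Tu ds) = \<zero>" if "snd ` set ds \<subseteq> boundary_products G P Tu tu" for ds
    using that
  proof (induction ds)
    case (Cons x ds)
    obtain c y where x: "x = (c, y)" by (cases x)
    have y: "y \<in> boundary_products G P Tu tu" "y \<in> carrier Tu" using Cons.prems x bc by auto
    then have "ind y \<in> boundary_products G P B w" using ind_boundary_products by auto
    then have "ind y = \<zero>" using bd by (simp add: satisfies_boundary_relations_def)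
    moreover have "lincomb Tu ds \<in> carrier Tu" using Cons.prems bc by (intro Tu.lincomb_closed) auto
    ultimately show ?case using Cons x y by simp
  qed simp
  have "cnorm B (ind d) \<le> e" if e: "e > 0" for e
  proof -
    obtain ds where ds: "snd ` set ds \<subseteq> boundary_products G P Tu tu" "lincomb Tu ds \<in> carrier Tu"
      "cnorm Tu (d \<ominus>\<^bsub>Tu\<^esub> lincomb Tu ds) < e"
      by (rule Tu.closed_span_approx[OF bc d e])
    have "ind (d \<ominus>\<^bsub>Tu\<^esub> lincomb Tu ds) = ind d" using dc ds lin0 by simp
    then show ?thesis using ind_contractive[of "d \<ominus>\<^bsub>Tu\<^esub> lincomb Tu ds"] dc ds by simp
  qed
  then have "cnorm B (ind d) \<le> 0" by (rule field_le_epsilon[of _ 0, simplified])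
  then show ?thesis using B.cnorm_nonneg[of "ind d"] dc by (simp add: B.cnorm_eq_0_iff)
qed

text \<open>The relations mention products of generators only inside words, so isometry and
  multiplicativity have to be extracted from neutral words whose ideal is all of \<open>P\<close>
  and whose elements are therefore the unit by (T3).\<close>

lemma isometric: "isometric_representation G P B w"
proof -
  have one: "w \<one>\<^bsub>G\<^esub> = \<one>"
  proof -
    have "w \<one>\<^bsub>G\<^esub> \<ominus> \<one> = \<zero>"
      using w_relations by (simp add: satisfies_toeplitz_relations_def toeplitz_relators_def T1_relators_def)
    moreover have "w \<one>\<^bsub>G\<^esub> \<in> carrier B" using w_closed by auto
    ultimately show ?thesis by (simp add: B.minus_eq_zero_iff)
  qed
  have wc: "w p \<in> carrier B" if "p \<in> P" for p using w_closed that by auto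
  have iso: "star B (w p) \<otimes> w p = \<one>" if p: "p \<in> P" for p
  proof -
    have "E [p, p] = E []" by (rule relation_T3) (use pp_neutral[OF p] K_pp[OF p] in auto)
    then show ?thesis using wc[OF p] by simp
  qed
  have mult: "w p \<otimes> w q = w (p \<otimes>\<^bsub>G\<^esub> q)" if p: "p \<in> P" and q: "q \<in> P" for p q
  proof -
    \<comment> \<open>The unit of \<open>G\<close> pads \<open>q\<close> to a pair. The word then
      reads as the adjoint of \<open>w ?r\<close> times \<open>w p \<otimes> w q\<close>, because
      the adjoint of \<open>w\<close> at the unit is the unit by (T1).\<close>
    let ?r = "p \<otimes>\<^bsub>G\<^esub> q" and ?\<alpha> = "[p \<otimes>\<^bsub>G\<^esub> q, p, \<one>\<^bsub>G\<^esub>, q]"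
    have r: "?r \<in> P" using p q by simp
    have g: "p \<in> carrier G" "q \<in> carrier G" using p q by auto
    have "wv ?\<alpha> = \<one>\<^bsub>G\<^esub>" using g by (simp add: inv_mult_group m_assoc)
    then have n: "?\<alpha> \<in> neutral_words G P" using p q by (simp add: neutral_words_def)
    have w1: "[\<one>\<^bsub>G\<^esub>, q] \<in> words P" and w2: "[p \<otimes>\<^bsub>G\<^esub> q, p, \<one>\<^bsub>G\<^esub>, q] \<in> words P" using p q by auto
    have "K G P ?\<alpha> = P"
    proof
      show "P \<subseteq> K G P ?\<alpha>"
      proof
        fix x assume x: "x \<in> P"
        have "x \<in> K G P [\<one>\<^bsub>G\<^esub>, q]" using K_Cons_iff[OF w1, of x] x q by simp
        moreover have "wv ?\<alpha> \<otimes>\<^bsub>G\<^esub> x \<in> P" using \<open>wv ?\<alpha> = \<one>\<^bsub>G\<^esub>\<close> x by simp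
        ultimately show "x \<in> K G P ?\<alpha>" using K_Cons_iff[OF w2, of x] by simp
      qed
    qed (rule K_subset)
    then have "E ?\<alpha> = E []" using n by (intro relation_T3) auto
    then have u: "star B (w ?r) \<otimes> (w p \<otimes> w q) = \<one>"
      using wc[OF p] wc[OF q] wc[OF r] one by (simp add: B.m_assoc)
    let ?v = "w p \<otimes> w q"
    have vc: "?v \<in> carrier B" using wc p q by simp
    have u': "star B ?v \<otimes> w ?r = \<one>"
    proof -
      have "star B ?v \<otimes> w ?r = star B (star B (w ?r) \<otimes> ?v)"
        using B.star_mult[of "star B (w ?r)" ?v] wc[OF r] vc by simp
      then show ?thesis using u by simp
    qed
    have vv: "star B ?v \<otimes> ?v = \<one>"
    proof -
      have "star B ?v \<otimes> ?v = star B (w q) \<otimes> (star B (w p) \<otimes> w p) \<otimes> w q"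
        using wc[OF p] wc[OF q] by (simp add: B.star_mult B.m_assoc)
      then show ?thesis using iso[OF p] iso[OF q] wc[OF q] by simp
    qed
    \<comment> \<open>two isometries \<open>u\<close>, \<open>v\<close> with \<open>u\<^sup>*v = 1\<close> coincide, as \<open>(v - u)\<^sup>*(v - u) = 0\<close>\<close>
    have "star B (?v \<ominus> w ?r) \<otimes> (?v \<ominus> w ?r) = \<zero>"
    proof -
      have "star B (?v \<ominus> w ?r) = star B ?v \<ominus> star B (w ?r)"
        by (rule B.star_minus[OF vc wc[OF r]])
      then have "star B (?v \<ominus> w ?r) \<otimes> (?v \<ominus> w ?r)
          = (star B ?v \<otimes> ?v \<ominus> star B (w ?r) \<otimes> ?v)
            \<ominus> (star B ?v \<otimes> w ?r \<ominus> star B (w ?r) \<otimes> w ?r)"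
        using vc wc[OF r] by (simp only: B.minus_distrib_left B.minus_distrib_right B.star_closed B.minus_closed)
      then show ?thesis unfolding u u' vv iso[OF r] by simp
    qed
    then have "(cnorm B (?v \<ominus> w ?r))\<^sup>2 = 0"
      using B.cstar_identity[of "?v \<ominus> w ?r"] vc wc[OF r] by (metis B.cnorm_zero B.minus_closed)
    then show ?thesis using vc wc[OF r] by (simp add: B.cnorm_eq_0_iff B.minus_eq_zero_iff)
  qed
  show ?thesis unfolding isometric_representation_def using w_closed iso one mult by blast
qed

end

section \<open>The canonical map between \<open>D_u\<close> and \<open>D_r\<close>\<close>

context group_submonoid begin

lemma D_u_eq: "D_u G P = T.DB"
  by (simp add: D_u_def)

lemma D_r_eq': "D_r G P = Lr.DB"
  by (rule D_r_eq)

abbreviation "lam \<equiv> Lr.ind"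

lemma Lr_lin: "snd ` set cs \<subseteq> neutral_words G P \<Longrightarrow> Lr.lin cs = mult_op (symbol cs)"
  using lincomb_left_regular by (simp add: Lr.lin_def)

lemma lam_lin: "snd ` set cs \<subseteq> neutral_words G P \<Longrightarrow> lam (T.lin cs) = mult_op (symbol cs)"
  using Lr.ind_lin[of cs] Lr_lin[of cs] by simp

lemma mult_op_ket: "p \<in> P \<Longrightarrow> mult_op h (ket p) p = h p"
  by (simp add: mult_op_def) (simp add: ket_def)

lemma lam_closed [simp]: "d \<in> carrier Tu \<Longrightarrow> lam d \<in> bounded_op_set P"
  using Lr.ind.hom_closed by simp

text \<open>The values of the symbol are diagonal entries of the image, so they are bounded by its
  operator norm; \<open>cnorm_lin_le\<close> turns this bound into one for the universal
  norm.\<close>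

lemma lam_lin_isometric:
  assumes "snd ` set cs \<subseteq> neutral_words G P"
  shows "cnorm Tu (T.lin cs) \<le> cnorm BO (lam (T.lin cs))"
proof (rule T.cnorm_lin_le[OF assms])
  show "0 \<le> cnorm BO (lam (T.lin cs))" using assms by (intro BO.cnorm_nonneg) simp
  fix p assume p: "p \<in> P"
  show "cmod (symbol cs p) \<le> cnorm BO (lam (T.lin cs))"
    using op_norm_on_point[OF mult_op_symbol_closed order.refl p, of cs p] mult_op_ket[OF p, of "symbol cs"]
    by (simp add: lam_lin[OF assms])
qed

text \<open>Extension by density; the error \<open>e / 2\<close> enters twice, once for
  \<open>d\<close> and once for its image. The opposite inequality is the contractivity of
  \<open>lam\<close>.\<close>

lemma lam_isometric:
  assumes d: "d \<in> D_u G P"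
  shows "cnorm Tu d \<le> cnorm BO (lam d)"
proof (rule field_le_epsilon)
  fix e :: real assume "e > 0"
  then obtain cs where cs: "snd ` set cs \<subseteq> neutral_words G P" "cnorm Tu (d \<ominus>\<^bsub>Tu\<^esub> T.lin cs) < e/2"
    using T.DB_approx[OF d[unfolded D_u_eq], of "e/2"] by auto
  have dc: "d \<in> carrier Tu" "T.lin cs \<in> carrier Tu" using d T.DB_carrier cs by (auto simp: D_u_eq)
  have lc: "lam d \<in> carrier BO" "lam (T.lin cs) \<in> carrier BO" using dc by simp_all
  have "cnorm BO (lam (T.lin cs) \<ominus>\<^bsub>BO\<^esub> lam d) \<le> cnorm Tu (T.lin cs \<ominus>\<^bsub>Tu\<^esub> d)"
    using Lr.ind_contractive[of "T.lin cs \<ominus>\<^bsub>Tu\<^esub> d"] dc by (simp del: bounded_ops_simps)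
  moreover have "cnorm Tu d \<le> cnorm Tu (T.lin cs) + cnorm Tu (d \<ominus>\<^bsub>Tu\<^esub> T.lin cs)"
    by (rule Tu.cnorm_le_minus[OF dc])
  moreover have "cnorm BO (lam (T.lin cs)) \<le> cnorm BO (lam d) + cnorm BO (lam (T.lin cs) \<ominus>\<^bsub>BO\<^esub> lam d)"
    by (rule BO.cnorm_le_minus[OF lc(2,1)])
  ultimately show "cnorm Tu d \<le> cnorm BO (lam d) + e"
    using lam_lin_isometric[OF cs(1)] cs(2) Tu.cnorm_minus_sym[OF dc] by simp
qed

lemma lam_D_u:
  assumes d: "d \<in> D_u G P"
  shows "lam d \<in> D_r G P"
  unfolding D_r_eq'
proof (rule BO.closed_span_mono_closed[OF Lr.E_image])
  have dc: "d \<in> carrier Tu" using d T.DB_carrier by (auto simp: D_u_eq)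
  then show "lam d \<in> carrier BO" by simp
  fix e :: real assume "e > 0"
  then obtain cs where cs: "snd ` set cs \<subseteq> neutral_words G P" "cnorm Tu (d \<ominus>\<^bsub>Tu\<^esub> T.lin cs) < e"
    by (rule T.DB_approx[OF d[unfolded D_u_eq]])
  have "cnorm BO (lam d \<ominus>\<^bsub>BO\<^esub> Lr.lin cs) \<le> cnorm Tu (d \<ominus>\<^bsub>Tu\<^esub> T.lin cs)"
    using Lr.ind_contractive[of "d \<ominus>\<^bsub>Tu\<^esub> T.lin cs"] dc cs(1) by (simp add: Lr.ind_lin del: bounded_ops_simps)
  then show "\<exists>y\<in>Lr.DB. cnorm BO (lam d \<ominus>\<^bsub>BO\<^esub> y) < e"
    using Lr.lin_in_DB[OF cs(1)] cs(2) by (intro bexI[of _ "Lr.lin cs"]) simp_all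
qed

lemma D_u_carrier: "D_u G P \<subseteq> carrier Tu"
  using T.DB_carrier by (simp add: D_u_eq)

lemma D_u_minus: "\<lbrakk>x \<in> D_u G P; y \<in> D_u G P\<rbrakk> \<Longrightarrow> x \<ominus>\<^bsub>Tu\<^esub> y \<in> D_u G P"
  unfolding D_u_eq by (rule Tu.closed_span_minus[OF T.E_image])

lemma lam_inj: "inj_on lam (D_u G P)"
proof (rule inj_onI)
  fix x y assume x: "x \<in> D_u G P" and y: "y \<in> D_u G P" and eq: "lam x = lam y"
  have c: "x \<in> carrier Tu" "y \<in> carrier Tu" using x y D_u_carrier by auto
  have "lam (x \<ominus>\<^bsub>Tu\<^esub> y) = \<zero>\<^bsub>BO\<^esub>"
    using c eq BO.minus_self[OF Lr.ind.hom_closed[OF c(2)]] by (simp del: bounded_ops_simps)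
  then have "cnorm Tu (x \<ominus>\<^bsub>Tu\<^esub> y) \<le> 0" using lam_isometric[OF D_u_minus[OF x y]] BO.cnorm_zero by metis
  moreover have "0 \<le> cnorm Tu (x \<ominus>\<^bsub>Tu\<^esub> y)" using c by (intro Tu.cnorm_nonneg) simp
  ultimately have "cnorm Tu (x \<ominus>\<^bsub>Tu\<^esub> y) = 0" by simp
  then show "x = y" using c by (simp add: Tu.cnorm_eq_0_iff Tu.minus_eq_zero_iff)
qed

text \<open>Approximating combinations in \<open>D_r\<close> lift with the same coefficients. By the
  isometry the lifts are Cauchy, and their limit in the complete universal algebra is mapped to
  \<open>b\<close> by contractivity.\<close>

lemma lam_surj:
  assumes b: "b \<in> D_r G P"
  shows "\<exists>d\<in>D_u G P. lam d = b"
proof -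
  have bc: "b \<in> carrier BO" using b Lr.DB_carrier by (auto simp: D_r_eq')
  have "\<exists>cs. snd ` set cs \<subseteq> neutral_words G P \<and> cnorm BO (b \<ominus>\<^bsub>BO\<^esub> Lr.lin cs) < inverse (real (Suc n))" for n
    using Lr.DB_approx[OF b[unfolded D_r_eq'], of "inverse (real (Suc n))"] by (metis inverse_positive_iff_positive of_nat_0_less_iff zero_less_Suc)
  then obtain cs where cs: "\<And>n. snd ` set (cs n) \<subseteq> neutral_words G P"
    "\<And>n. cnorm BO (b \<ominus>\<^bsub>BO\<^esub> Lr.lin (cs n)) < inverse (real (Suc n))" by metis
  define X where "X n = T.lin (cs n)" for n
  have X: "X n \<in> D_u G P" "X n \<in> carrier Tu" "lam (X n) = Lr.lin (cs n)" for n
    using T.lin_in_DB[OF cs(1)] cs(1) Lr.ind_lin[OF cs(1)] by (auto simp: X_def D_u_eq)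
  have Lc: "Lr.lin (cs n) \<in> carrier BO" for n using cs(1) by (rule Lr.lin_closed)
  have lim: "(\<lambda>n. cnorm BO (b \<ominus>\<^bsub>BO\<^esub> Lr.lin (cs n))) \<longlonglongrightarrow> 0"
    by (rule tendsto_zero_le[OF LIMSEQ_inverse_real_of_nat])
      (rule BO.cnorm_nonneg[OF BO.minus_closed[OF bc Lc]], rule less_imp_le[OF cs(2)])
  have "\<exists>a\<in>carrier Tu. (\<lambda>n. cnorm Tu (X n \<ominus>\<^bsub>Tu\<^esub> a)) \<longlonglongrightarrow> 0"
  proof (rule Tu.complete_sequence)
    show "range X \<subseteq> carrier Tu" using X by auto
    fix e :: real assume "e > 0"
    then have "\<forall>\<^sub>F n in sequentially. cnorm BO (b \<ominus>\<^bsub>BO\<^esub> Lr.lin (cs n)) < e/2"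
      by (intro order_tendstoD(2)[OF lim]) simp
    then obtain M where M: "\<And>n. n \<ge> M \<Longrightarrow> cnorm BO (b \<ominus>\<^bsub>BO\<^esub> Lr.lin (cs n)) < e/2"
      unfolding eventually_sequentially by blast
    show "\<exists>M. \<forall>m\<ge>M. \<forall>n\<ge>M. cnorm Tu (X m \<ominus>\<^bsub>Tu\<^esub> X n) < e"
    proof (intro exI[of _ M] allI impI)
      fix m n assume mn: "M \<le> m" "M \<le> n"
      have "cnorm Tu (X m \<ominus>\<^bsub>Tu\<^esub> X n) \<le> cnorm BO (lam (X m \<ominus>\<^bsub>Tu\<^esub> X n))"
        by (rule lam_isometric[OF D_u_minus[OF X(1) X(1)]])
      also have "lam (X m \<ominus>\<^bsub>Tu\<^esub> X n) = Lr.lin (cs m) \<ominus>\<^bsub>BO\<^esub> Lr.lin (cs n)"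
        using X by (simp del: bounded_ops_simps)
      also have "cnorm BO (Lr.lin (cs m) \<ominus>\<^bsub>BO\<^esub> Lr.lin (cs n))
          \<le> cnorm BO (Lr.lin (cs m) \<ominus>\<^bsub>BO\<^esub> b) + cnorm BO (b \<ominus>\<^bsub>BO\<^esub> Lr.lin (cs n))"
        by (rule BO.cnorm_minus_triangle[OF Lc bc Lc])
      also have "\<dots> < e" using M[OF mn(1)] M[OF mn(2)] BO.cnorm_minus_sym[OF bc Lc, of m] by simp
      finally show "cnorm Tu (X m \<ominus>\<^bsub>Tu\<^esub> X n) < e" .
    qed
  qed
  then obtain d where d: "d \<in> carrier Tu" "(\<lambda>n. cnorm Tu (X n \<ominus>\<^bsub>Tu\<^esub> d)) \<longlonglongrightarrow> 0" by blast
  have "d \<in> D_u G P"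
    unfolding D_u_eq
  proof (rule Tu.closed_span_mono_closed[OF T.E_image d(1)])
    fix e :: real assume "e > 0"
    from tendstoD[OF d(2) this] obtain n where "dist (cnorm Tu (X n \<ominus>\<^bsub>Tu\<^esub> d)) 0 < e"
      using eventually_happens trivial_limit_sequentially by blast
    then have "cnorm Tu (d \<ominus>\<^bsub>Tu\<^esub> X n) < e"
      using Tu.cnorm_minus_sym[OF d(1) X(2)[of n]] by simp
    then show "\<exists>y\<in>T.DB. cnorm Tu (d \<ominus>\<^bsub>Tu\<^esub> y) < e" using X(1)[of n] by (auto simp: D_u_eq)
  qed
  moreover have "lam d = b"
  proof (rule BO.limit_unique)
    show "range (\<lambda>n. Lr.lin (cs n)) \<subseteq> carrier BO" using Lc by blast
    show "lam d \<in> carrier BO" using d(1) by (rule Lr.ind.hom_closed)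
    show "b \<in> carrier BO" by (rule bc)
    show "(\<lambda>n. cnorm BO (Lr.lin (cs n) \<ominus>\<^bsub>BO\<^esub> b)) \<longlonglongrightarrow> 0"
      using lim BO.cnorm_minus_sym[OF bc Lc] by simp
    show "(\<lambda>n. cnorm BO (Lr.lin (cs n) \<ominus>\<^bsub>BO\<^esub> lam d)) \<longlonglongrightarrow> 0"
    proof (rule tendsto_zero_le[OF d(2)])
      fix n
      have eq: "Lr.lin (cs n) \<ominus>\<^bsub>BO\<^esub> lam d = lam (X n \<ominus>\<^bsub>Tu\<^esub> d)"
        using X(2,3) d(1) by (simp del: bounded_ops_simps)
      have c: "X n \<ominus>\<^bsub>Tu\<^esub> d \<in> carrier Tu" using X(2) d(1) by simp
      show "0 \<le> cnorm BO (Lr.lin (cs n) \<ominus>\<^bsub>BO\<^esub> lam d)"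
        unfolding eq by (rule BO.cnorm_nonneg[OF Lr.ind.hom_closed[OF c]])
      show "cnorm BO (Lr.lin (cs n) \<ominus>\<^bsub>BO\<^esub> lam d) \<le> cnorm Tu (X n \<ominus>\<^bsub>Tu\<^esub> d)"
        unfolding eq by (rule Lr.ind_contractive[OF c])
    qed
  qed
  ultimately show ?thesis by blast
qed

section \<open>Restriction to the sets \<open>\<Delta>\<close> and the two ideals\<close>

definition vanishes_on_Delta :: "'g set \<Rightarrow> (('g \<Rightarrow> complex) \<Rightarrow> 'g \<Rightarrow> complex) \<Rightarrow> bool" where
  "vanishes_on_Delta F T \<longleftrightarrow> (\<forall>f\<in>ell2 (\<Delta> G P F). T f = (\<lambda>_. 0))"

lemma vanishes_antimono: "F \<subseteq> F' \<Longrightarrow> vanishes_on_Delta F T \<Longrightarrow> vanishes_on_Delta F' T"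
  using ell2_mono[OF Delta_antimono] unfolding vanishes_on_Delta_def by blast

lemma ell2_Delta: "f \<in> ell2 (\<Delta> G P F) \<Longrightarrow> f \<in> ell2 P"
  using ell2_mono[OF Delta_carrier] by blast

lemma boundary_vanishes:
  assumes "b \<in> boundary_products G P BO Lr"
  shows "\<exists>F. finite F \<and> F \<subseteq> carrier G \<and> vanishes_on_Delta F b"
proof -
  obtain \<alpha> \<beta>s where ab: "b = diff_prod BO Lr \<alpha> \<beta>s" "\<alpha> \<in> neutral_words G P" "set \<beta>s \<subseteq> neutral_words G P"
    "proper_foundation_set G P (K G P \<alpha>) (K G P ` set \<beta>s)" using assms by (auto simp: boundary_products_def)
  have fs: "foundation_set G P (K G P \<alpha>) (K G P ` set \<beta>s)" using ab(4) by (simp add: proper_foundation_set_def)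
  obtain F where F: "finite F" "F \<subseteq> carrier G" "K G P \<alpha> \<inter> \<Delta> G P F \<subseteq> \<Union>(K G P ` set \<beta>s)"
    using foundation_set_Delta[OF fs] by blast
  have ne: "\<beta>s \<noteq> []" using ab(4) by (auto simp: proper_foundation_set_def foundation_set_def)
  have "diff_symbol \<alpha> \<beta>s x = 0" if "x \<in> \<Delta> G P F" for x
    by (rule diff_symbol_eq_0) (use that F fs ne in \<open>auto simp: foundation_set_def\<close>)
  then have "vanishes_on_Delta F b"
    unfolding vanishes_on_Delta_def ab(1) diff_prod_left_regular[OF ab(2,3)]
    using ell2_Delta ell2_outside by (fastforce simp: mult_op_def)
  then show ?thesis using F by blast
qed

text \<open>A finite combination of boundary products restricts to zero exactly, not only up to a
  small norm: the sets \<open>F\<close> of the summands are united, and vanishing persists because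
  \<open>\<Delta>\<close> shrinks as \<open>F\<close> grows.\<close>

lemma lincomb_vanishes:
  assumes "snd ` set ds \<subseteq> boundary_products G P BO Lr"
  shows "\<exists>F. finite F \<and> F \<subseteq> carrier G \<and> vanishes_on_Delta F (lincomb BO ds)"
  using assms
proof (induction ds)
  case Nil
  show ?case by (rule exI[of _ "{}"]) (auto simp: vanishes_on_Delta_def ell2_Delta)
next
  case (Cons d ds)
  obtain c b where d: "d = (c, b)" by (cases d)
  obtain F where F: "finite F" "F \<subseteq> carrier G" "vanishes_on_Delta F (lincomb BO ds)" using Cons by auto
  obtain H where H: "finite H" "H \<subseteq> carrier G" "vanishes_on_Delta H b" using boundary_vanishes[of b] Cons.prems d by auto
  have "vanishes_on_Delta (F \<union> H) (lincomb BO ds)" "vanishes_on_Delta (F \<union> H) b"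
    using vanishes_antimono F(3) H(3) by blast+
  then have "vanishes_on_Delta (F \<union> H) (lincomb BO (d # ds))"
    using d by (auto simp: vanishes_on_Delta_def ell2_Delta)
  then show ?case using F H by (intro exI[of _ "F \<union> H"]) auto
qed

text \<open>For every larger \<open>F'\<close> the operator \<open>z\<close> still vanishes on the
  smaller subspace, where \<open>b\<close> therefore agrees with the difference of \<open>b\<close>
  and \<open>z\<close>. This bounds all later members of the net at once.\<close>

lemma D_r_oI:
  assumes b: "b \<in> D_r G P"
    and ap: "\<And>e. e > 0 \<Longrightarrow> \<exists>z F. z \<in> carrier BO \<and> finite F \<and> F \<subseteq> carrier G \<and> vanishes_on_Delta F z
      \<and> cnorm BO (b \<ominus>\<^bsub>BO\<^esub> z) \<le> e"
  shows "b \<in> D_r_o G P"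
proof -
  have bc: "b \<in> bounded_op_set P" using b Lr.DB_carrier by (auto simp: D_r_eq')
  have "((\<lambda>F. op_norm_on (\<Delta> G P F) b) \<longlongrightarrow> 0) (finite_subsets_at_top (carrier G))"
  proof (rule tendstoI)
    fix e :: real assume e: "e > 0"
    obtain z F where z: "z \<in> bounded_op_set P" "finite F" "F \<subseteq> carrier G" "vanishes_on_Delta F z"
      "op_norm_on P (b \<ominus>\<^bsub>BO\<^esub> z) \<le> e/2" using ap[of "e/2"] e by auto
    have "dist (op_norm_on (\<Delta> G P F') b) 0 < e" if F': "F \<subseteq> F'" for F'
    proof -
      have "op_norm_on (\<Delta> G P F') b \<le> e/2"
      proof (rule op_norm_on_least)
        fix f assume f: "f \<in> ell2 (\<Delta> G P F')"
        then have fP: "f \<in> ell2 P" by (rule ell2_Delta)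
        have "z f = (\<lambda>_. 0)" using vanishes_antimono[OF F' z(4)] f by (simp add: vanishes_on_Delta_def)
        then have "b f = (b \<ominus>\<^bsub>BO\<^esub> z) f" using fP by (simp add: bounded_ops_minus[OF bc z(1)])
        moreover have "b \<ominus>\<^bsub>BO\<^esub> z \<in> bounded_op_set P" using BO.minus_closed[of b z] bc z(1) by simp
        ultimately have "ell2_norm (b f) \<le> op_norm_on P (b \<ominus>\<^bsub>BO\<^esub> z) * ell2_norm f"
          using bounded_op_bound'[OF _ fP] by simp
        also have "\<dots> \<le> e/2 * ell2_norm f" using z(5) by (intro mult_right_mono) auto
        finally show "ell2_norm (b f) \<le> e/2 * ell2_norm f" .
      qed (use e in simp)
      moreover have "0 \<le> op_norm_on (\<Delta> G P F') b" by (rule op_norm_on_nonneg[OF bc Delta_carrier])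
      ultimately show ?thesis using e by simp
    qed
    then show "\<forall>\<^sub>F F in finite_subsets_at_top (carrier G). dist (op_norm_on (\<Delta> G P F) b) 0 < e"
      unfolding eventually_finite_subsets_at_top using z(2,3) by blast
  qed
  then show ?thesis using b by (simp add: D_r_o_def)
qed

lemma boundary_products_D_r_o: "boundary_products G P BO Lr \<subseteq> D_r_o G P"
proof
  fix b assume b: "b \<in> boundary_products G P BO Lr"
  then have bD: "b \<in> D_r G P" using Lr.boundary_products_in_DB by (auto simp: D_r_eq')
  have bc: "b \<in> carrier BO" using b Lr.boundary_products_closed by blast
  obtain F where F: "finite F" "F \<subseteq> carrier G" "vanishes_on_Delta F b" using boundary_vanishes[OF b] by blast
  show "b \<in> D_r_o G P"
  proof (rule D_r_oI[OF bD])
    fix e :: real assume "e > 0"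
    have "cnorm BO (b \<ominus>\<^bsub>BO\<^esub> b) = 0" using BO.minus_self[OF bc] BO.cnorm_zero by metis
    then show "\<exists>z F. z \<in> carrier BO \<and> finite F \<and> F \<subseteq> carrier G \<and> vanishes_on_Delta F z \<and> cnorm BO (b \<ominus>\<^bsub>BO\<^esub> z) \<le> e"
      using F bc \<open>e > 0\<close> by (intro exI[of _ b] exI[of _ F]) simp
  qed
qed

text \<open>One \<open>F\<close> making the restriction of \<open>lam d\<close> small is combined
  with a finite combination close to \<open>d\<close>; its symbol is then small on
  \<open>\<Delta>\<close>, and \<open>lin_near_boundary\<close> supplies the approximant.\<close>

lemma D_u_o_subset: "D_u_o G P \<subseteq> closed_span Tu (boundary_products G P Tu tu)"
proof
  fix d assume "d \<in> D_u_o G P"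
  then have d: "d \<in> D_u G P" and o: "lam d \<in> D_r_o G P"
    by (auto simp: D_u_o_def lambda_plus_eq)
  have dc: "d \<in> carrier Tu" using d D_u_carrier by auto
  show "d \<in> closed_span Tu (boundary_products G P Tu tu)"
  proof (rule Tu.closed_span_mono_closed[OF T.boundary_products_closed dc])
    fix e :: real assume e: "e > 0"
    have "\<forall>\<^sub>F F in finite_subsets_at_top (carrier G). dist (op_norm_on (\<Delta> G P F) (lam d)) 0 < e/3"
      using o e by (intro tendstoD) (auto simp: D_r_o_def)
    then obtain F where F: "finite F" "F \<subseteq> carrier G" "op_norm_on (\<Delta> G P F) (lam d) < e/3"
      unfolding eventually_finite_subsets_at_top by force
    obtain cs where cs: "snd ` set cs \<subseteq> neutral_words G P" "cnorm Tu (d \<ominus>\<^bsub>Tu\<^esub> T.lin cs) < e/3"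
      using T.DB_approx[OF d[unfolded D_u_eq], of "e/3"] e by auto
    have lc: "T.lin cs \<in> carrier Tu" using cs(1) by simp
    have diff: "op_norm_on P (lam d \<ominus>\<^bsub>BO\<^esub> lam (T.lin cs)) < e/3"
      using Lr.ind_contractive[of "d \<ominus>\<^bsub>Tu\<^esub> T.lin cs"] dc lc cs(2) by simp
    \<comment> \<open>One third comes from the restricted norm of \<open>lam d\<close>, one from
      replacing \<open>d\<close> by the combination. The remaining third is the distance from
      \<open>d\<close> to the combination in the final triangle inequality.\<close>
    have "cmod (symbol cs p) \<le> 2 * e / 3" if p: "p \<in> \<Delta> G P F" for p
    proof -
      have pP: "p \<in> P" using p Delta_carrier by blast
      have kp: "ket p \<in> ell2 P" using pP by simp
      have dB: "lam d \<ominus>\<^bsub>BO\<^esub> lam (T.lin cs) \<in> bounded_op_set P"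
        using BO.minus_closed[of "lam d" "lam (T.lin cs)"] dc lc by simp
      have "symbol cs p = lam d (ket p) p - (lam d \<ominus>\<^bsub>BO\<^esub> lam (T.lin cs)) (ket p) p"
        using kp lam_lin[OF cs(1)] mult_op_ket[OF pP] dc lc by (simp add: bounded_ops_minus)
      then have "cmod (symbol cs p) \<le> cmod (lam d (ket p) p) + cmod ((lam d \<ominus>\<^bsub>BO\<^esub> lam (T.lin cs)) (ket p) p)"
        by (metis norm_triangle_ineq4)
      also have "\<dots> \<le> op_norm_on (\<Delta> G P F) (lam d) + op_norm_on P (lam d \<ominus>\<^bsub>BO\<^esub> lam (T.lin cs))"
        by (intro add_mono op_norm_on_point[OF lam_closed[OF dc] Delta_carrier p] op_norm_on_point[OF dB order.refl pP])
      finally show ?thesis using F(3) diff by simp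
    qed
    then obtain z where z: "z \<in> closed_span Tu (boundary_products G P Tu tu)" "cnorm Tu (T.lin cs \<ominus>\<^bsub>Tu\<^esub> z) \<le> 2 * e / 3"
      using T.lin_near_boundary[OF cs(1) _ F(1,2), of "2 * e / 3"] e by auto
    have zc: "z \<in> carrier Tu" using z(1) Tu.closed_span_carrier[OF T.boundary_products_closed] by auto
    have "cnorm Tu (d \<ominus>\<^bsub>Tu\<^esub> z) < e"
      using Tu.cnorm_minus_triangle[OF dc lc zc] cs(2) z(2) by simp
    then show "\<exists>y\<in>closed_span Tu (boundary_products G P Tu tu). cnorm Tu (d \<ominus>\<^bsub>Tu\<^esub> y) < e" using z(1) by blast
  qed
qed

text \<open>The images of approximating combinations are combinations of boundary products of the
  left regular representation. They vanish on some \<open>\<Delta>\<close>, as \<open>D_r_oI\<close>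
  requires of its approximants.\<close>

lemma closed_span_subset_D_u_o: "closed_span Tu (boundary_products G P Tu tu) \<subseteq> D_u_o G P"
proof
  note bc = T.boundary_products_closed
  fix d assume d: "d \<in> closed_span Tu (boundary_products G P Tu tu)"
  then have du: "d \<in> D_u G P"
    unfolding D_u_eq using Tu.closed_span_mono[OF T.boundary_products_in_DB T.E_image] by blast
  then have dc: "d \<in> carrier Tu" using D_u_carrier by auto
  have "lam d \<in> D_r_o G P"
  proof (rule D_r_oI[OF lam_D_u[OF du]])
    fix e :: real assume "e > 0"
    then obtain ds where ds: "snd ` set ds \<subseteq> boundary_products G P Tu tu" "lincomb Tu ds \<in> carrier Tu"
      "cnorm Tu (d \<ominus>\<^bsub>Tu\<^esub> lincomb Tu ds) < e"
      by (rule Tu.closed_span_approx[OF bc d])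
    let ?ds = "map (\<lambda>(c, x). (c, lam x)) ds"
    have eq: "lam (lincomb Tu ds) = lincomb BO ?ds"
      using ds(1) bc by (intro Lr.ind.hom_lincomb) auto
    have bd: "lam x \<in> boundary_products G P BO Lr" if "x \<in> boundary_products G P Tu tu" for x
      unfolding Lr.ind_boundary_products using that by (rule imageI)
    have im: "snd ` set ?ds = lam ` (snd ` set ds)"
      unfolding set_map image_image by (rule image_cong[OF refl]) (simp only: split_beta snd_conv)
    have "snd ` set ?ds \<subseteq> boundary_products G P BO Lr"
      unfolding im by (rule image_subsetI, rule bd, rule subsetD[OF ds(1)])
    from lincomb_vanishes[OF this]
    obtain F where F: "finite F" "F \<subseteq> carrier G" "vanishes_on_Delta F (lincomb BO ?ds)"
      by (elim exE conjE)
    have "cnorm BO (lam d \<ominus>\<^bsub>BO\<^esub> lincomb BO ?ds) \<le> cnorm Tu (d \<ominus>\<^bsub>Tu\<^esub> lincomb Tu ds)"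
      using Lr.ind_contractive[of "d \<ominus>\<^bsub>Tu\<^esub> lincomb Tu ds"] dc ds(2) eq by (simp del: bounded_ops_simps)
    then have "cnorm BO (lam d \<ominus>\<^bsub>BO\<^esub> lincomb BO ?ds) \<le> e" using ds(3) by linarith
    moreover have "lincomb BO ?ds \<in> carrier BO" using Lr.ind.hom_closed[OF ds(2)] eq by simp
    ultimately show "\<exists>z F. z \<in> carrier BO \<and> finite F \<and> F \<subseteq> carrier G \<and> vanishes_on_Delta F z
      \<and> cnorm BO (lam d \<ominus>\<^bsub>BO\<^esub> z) \<le> e" using F by blast
  qed
  then show "d \<in> D_u_o G P" using du by (simp add: D_u_o_def lambda_plus_eq)
qed

lemma D_u_o_eq: "D_u_o G P = closed_span Tu (boundary_products G P Tu tu)"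
  using D_u_o_subset closed_span_subset_D_u_o by blast

end

section \<open>Strong covariance and the relations\<close>

context toeplitz_representation begin

lemma strongly_covariantI:
  assumes bd: "satisfies_boundary_relations G P B w"
  shows "strongly_covariant G P B w"
proof -
  define \<psi> where "\<psi> = inv_into (D_u G P) Lr.ind"
  have \<psi>: "\<psi> b \<in> D_u G P" "Lr.ind (\<psi> b) = b" if "b \<in> D_r G P" for b
  proof -
    have "b \<in> Lr.ind ` D_u G P" using lam_surj[OF that] by blast
    then show "\<psi> b \<in> D_u G P" "Lr.ind (\<psi> b) = b" unfolding \<psi>_def by (rule inv_into_into, rule f_inv_into_f)
  qed
  \<comment> \<open>By injectivity the value of \<open>\<psi>\<close> is determined by any preimage
    in \<open>D_u\<close>, so each homomorphism property reduces to closure of \<open>D_u\<close>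
    and the same property of \<open>Lr.ind\<close>.\<close>
  have \<psi>_eq: "\<psi> b = d" if "d \<in> D_u G P" "Lr.ind d = b" for d b
    unfolding \<psi>_def using that lam_inj by (metis inv_into_f_f)
  have \<psi>c: "\<psi> b \<in> carrier Tu" if "b \<in> D_r G P" for b using \<psi>(1)[OF that] D_u_carrier by blast
  have D: "D_u G P = T.DB" by (rule D_u_eq)
  have \<psi>_add: "\<psi> (x \<oplus>\<^bsub>BO\<^esub> y) = \<psi> x \<oplus>\<^bsub>Tu\<^esub> \<psi> y" if "x \<in> D_r G P" "y \<in> D_r G P" for x y
  proof (rule \<psi>_eq)
    show "\<psi> x \<oplus>\<^bsub>Tu\<^esub> \<psi> y \<in> D_u G P"
      using \<psi>(1)[OF that(1)] \<psi>(1)[OF that(2)] unfolding D by (rule Tu.closed_span_add[OF T.E_image])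
    show "Lr.ind (\<psi> x \<oplus>\<^bsub>Tu\<^esub> \<psi> y) = x \<oplus>\<^bsub>BO\<^esub> y"
      using that \<psi>(2) \<psi>c by (simp del: bounded_ops_simps)
  qed
  have \<psi>_mult: "\<psi> (x \<otimes>\<^bsub>BO\<^esub> y) = \<psi> x \<otimes>\<^bsub>Tu\<^esub> \<psi> y" if "x \<in> D_r G P" "y \<in> D_r G P" for x y
  proof (rule \<psi>_eq)
    show "\<psi> x \<otimes>\<^bsub>Tu\<^esub> \<psi> y \<in> D_u G P"
      using \<psi>(1)[OF that(1)] \<psi>(1)[OF that(2)] unfolding D by (rule T.DB_mult)
    show "Lr.ind (\<psi> x \<otimes>\<^bsub>Tu\<^esub> \<psi> y) = x \<otimes>\<^bsub>BO\<^esub> y"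
      using that \<psi>(2) \<psi>c by (simp del: bounded_ops_simps)
  qed
  have \<psi>_smult: "\<psi> (c \<odot>\<^bsub>BO\<^esub> x) = c \<odot>\<^bsub>Tu\<^esub> \<psi> x" if "x \<in> D_r G P" for x c
  proof (rule \<psi>_eq)
    show "c \<odot>\<^bsub>Tu\<^esub> \<psi> x \<in> D_u G P"
      using \<psi>(1)[OF that(1)] unfolding D by (rule Tu.closed_span_scalar[OF T.E_image])
    show "Lr.ind (c \<odot>\<^bsub>Tu\<^esub> \<psi> x) = c \<odot>\<^bsub>BO\<^esub> x"
      using that \<psi>(2) \<psi>c by (simp del: bounded_ops_simps)
  qed
  have \<psi>_star: "\<psi> (star BO x) = star Tu (\<psi> x)" if "x \<in> D_r G P" for x
  proof (rule \<psi>_eq)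
    show "star Tu (\<psi> x) \<in> D_u G P"
      using \<psi>(1)[OF that(1)] unfolding D by (rule T.DB_star)
    show "Lr.ind (star Tu (\<psi> x)) = star BO x"
      using that \<psi>(2) \<psi>c by (simp del: bounded_ops_simps)
  qed
  let ?\<phi> = "\<lambda>b. ind (\<psi> b)"
  have "star_hom (bounded_ops P\<lparr>carrier := D_r G P\<rparr>) B ?\<phi>"
    unfolding star_hom_def
    using \<psi>_add \<psi>_mult \<psi>_smult \<psi>_star \<psi>c by (simp del: bounded_ops_simps)
  moreover have "?\<phi> (word_elem BO Lr \<alpha>) = E \<alpha>" if \<alpha>: "\<alpha> \<in> neutral_words G P" for \<alpha>
  proof -
    have "\<psi> (word_elem BO Lr \<alpha>) = word_elem Tu tu \<alpha>"
      using T.E_in_DB[OF \<alpha>] Lr.ind_word_elem[OF neutral_words_set[OF \<alpha>]] by (intro \<psi>_eq) (simp_all add: D)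
    then show ?thesis using ind_word_elem[OF neutral_words_set[OF \<alpha>]] by simp
  qed
  moreover have "?\<phi> b = \<zero>" if b: "b \<in> D_r_o G P" for b
  proof -
    have bD: "b \<in> D_r G P" using b by (simp add: D_r_o_def)
    \<comment> \<open>\<open>D_u_o\<close> is defined as a preimage, so \<open>\<psi>\<close> maps
      \<open>D_r_o\<close> into it. There the description by boundary products lets
      \<open>ind_boundary_vanish\<close> take effect.\<close>
    have "\<psi> b \<in> D_u_o G P" using \<psi>[OF bD] b by (simp add: D_u_o_def lambda_plus_eq)
    then show ?thesis using ind_boundary_vanish[OF bd] by (simp add: D_u_o_eq)
  qed
  ultimately show ?thesis unfolding strongly_covariant_def by blast
qed

end

context group_submonoid begin

text \<open>The homomorphism on \<open>D_r\<close> sends difference products of the left regular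
  representation to those of \<open>w\<close>. So (T2)--(T4) are transported from the former, and
  the boundary relations hold because boundary products there lie in the ideal that is sent to zero.
  Only finite algebraic expressions occur, so no continuity of the homomorphism enters.\<close>

lemma strongly_covariant_imp_relations:
  fixes w :: "'g \<Rightarrow> 'b" and B :: "('b, 'c) cstar_algebra_scheme"
  assumes "cstar_algebra B" and w: "w \<in> P \<rightarrow> carrier B"
    and iso: "isometric_representation G P B w" and cov: "strongly_covariant G P B w"
  shows "satisfies_toeplitz_relations G P B w" "satisfies_boundary_relations G P B w"
proof -
  interpret B: cstar_algebra B by fact
  obtain \<phi> where hom: "star_hom (bounded_ops P\<lparr>carrier := D_r G P\<rparr>) B \<phi>"
    and word: "\<And>\<alpha>. \<alpha> \<in> neutral_words G P \<Longrightarrow> \<phi> (word_elem BO Lr \<alpha>) = word_elem B w \<alpha>"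
    and van: "\<And>b. b \<in> D_r_o G P \<Longrightarrow> \<phi> b = \<zero>\<^bsub>B\<^esub>"
    using cov unfolding strongly_covariant_def by blast
  have D: "D_r G P = Lr.DB" by (rule D_r_eq')
  have \<phi>c: "\<phi> x \<in> carrier B" if "x \<in> D_r G P" for x
    using hom that by (auto simp: star_hom_def)
  have add: "\<phi> (x \<oplus>\<^bsub>BO\<^esub> y) = \<phi> x \<oplus>\<^bsub>B\<^esub> \<phi> y" and mult: "\<phi> (x \<otimes>\<^bsub>BO\<^esub> y) = \<phi> x \<otimes>\<^bsub>B\<^esub> \<phi> y"
    if "x \<in> D_r G P" "y \<in> D_r G P" for x y
    using hom that by (simp_all add: star_hom_def del: bounded_ops_simps)
  have smult: "\<phi> (c \<odot>\<^bsub>BO\<^esub> x) = c \<odot>\<^bsub>B\<^esub> \<phi> x" if "x \<in> D_r G P" for x c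
    using hom that by (simp add: star_hom_def del: bounded_ops_simps)
  have D_carrier: "D_r G P \<subseteq> carrier BO" unfolding D by (rule Lr.DB_carrier)
  have Ew: "word_elem BO Lr \<alpha> \<in> D_r G P" if "\<alpha> \<in> neutral_words G P" for \<alpha>
    unfolding D by (rule Lr.E_in_DB[OF that])
  have minus: "\<phi> (x \<ominus>\<^bsub>BO\<^esub> y) = \<phi> x \<ominus>\<^bsub>B\<^esub> \<phi> y" if "x \<in> D_r G P" "y \<in> D_r G P" for x y
  proof -
    have c: "x \<in> carrier BO" "y \<in> carrier BO" using that D_carrier by auto
    have "(-1) \<odot>\<^bsub>BO\<^esub> y \<in> D_r G P" using that(2) unfolding D by (rule BO.closed_span_scalar[OF Lr.E_image])
    then show ?thesis
      unfolding BO.minus_scalar[OF c] using that add smult \<phi>c by (simp add: B.minus_scalar del: bounded_ops_simps)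
  qed
  \<comment> \<open>Unitality is not part of \<open>star_hom\<close>; it comes from the empty word,
    and \<open>\<one> \<ominus> \<one>\<close> then yields the value at zero.\<close>
  have one: "\<phi> \<one>\<^bsub>BO\<^esub> = \<one>\<^bsub>B\<^esub>" using word[OF Nil_neutral] by (simp del: bounded_ops_simps)
  have zero: "\<phi> \<zero>\<^bsub>BO\<^esub> = \<zero>\<^bsub>B\<^esub>"
  proof -
    have o: "\<one>\<^bsub>BO\<^esub> \<in> D_r G P" unfolding D by (rule Lr.one_in_DB)
    have "\<zero>\<^bsub>BO\<^esub> = \<one>\<^bsub>BO\<^esub> \<ominus>\<^bsub>BO\<^esub> \<one>\<^bsub>BO\<^esub>" using BO.minus_self[OF BO.one_closed] by simp
    then show ?thesis using minus[OF o o] one by simp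
  qed
  have diff: "\<phi> (diff_prod BO Lr \<alpha> \<beta>s) = diff_prod B w \<alpha> \<beta>s"
    if \<alpha>: "\<alpha> \<in> neutral_words G P" and \<beta>s: "set \<beta>s \<subseteq> neutral_words G P" for \<alpha> \<beta>s
    using \<beta>s
  proof (induction \<beta>s)
    case Nil
    then show ?case using one by (simp del: bounded_ops_simps)
  next
    case (Cons \<beta> \<beta>s)
    have \<beta>: "\<beta> \<in> neutral_words G P" "set \<beta>s \<subseteq> neutral_words G P" using Cons.prems by auto
    have "word_elem BO Lr \<alpha> \<ominus>\<^bsub>BO\<^esub> word_elem BO Lr \<beta> \<in> D_r G P"
      using Ew[OF \<alpha>] Ew[OF \<beta>(1)] unfolding D by (rule BO.closed_span_minus[OF Lr.E_image])
    moreover have "diff_prod BO Lr \<alpha> \<beta>s \<in> D_r G P" unfolding D by (rule Lr.diff_prod_in_DB[OF \<alpha> \<beta>(2)])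
    ultimately show ?case
      using Cons.IH[OF \<beta>(2)] by (simp add: mult minus Ew \<alpha> \<beta>(1) word del: bounded_ops_simps)
  qed
  have Lrel: "r = \<zero>\<^bsub>BO\<^esub>" if "r \<in> toeplitz_relators G P BO Lr" for r
    using left_regular_relations that by (simp add: satisfies_toeplitz_relations_def)
  show "satisfies_toeplitz_relations G P B w"
    unfolding satisfies_toeplitz_relations_def toeplitz_relators_def
  proof
    fix r assume "r \<in> T1_relators G B w \<union> T2_relators G P B w \<union> T3_relators G P B w \<union> T4_relators G P B w"
    then consider "r \<in> T1_relators G B w" | "r \<in> T2_relators G P B w"
      | "r \<in> T3_relators G P B w" | "r \<in> T4_relators G P B w" by blast
    then show "r = \<zero>\<^bsub>B\<^esub>"
    proof cases
      \<comment> \<open>(T1) concerns \<open>w\<close> at the unit itself, not the element of a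
        neutral word, so it is taken from the isometric representation.\<close>
      case 1
      then show ?thesis using iso by (simp add: T1_relators_def isometric_representation_def)
    next
      case 2
      then obtain \<alpha> where a: "\<alpha> \<in> neutral_words G P" "K G P \<alpha> = {}" "r = word_elem B w \<alpha>"
        by (auto simp: T2_relators_def)
      then show ?thesis using Lr.relation_T2[OF a(1,2)] word[OF a(1)] zero by simp
    next
      case 3
      then obtain \<alpha> \<beta> where a: "\<alpha> \<in> neutral_words G P" "\<beta> \<in> neutral_words G P" "K G P \<alpha> = K G P \<beta>"
        "r = word_elem B w \<alpha> \<ominus>\<^bsub>B\<^esub> word_elem B w \<beta>" by (auto simp: T3_relators_def)
      have "word_elem B w \<alpha> = word_elem B w \<beta>" using Lr.relation_T3[OF a(1-3)] word a(1,2) by metis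
      moreover have "word_elem B w \<beta> \<in> carrier B" using B.word_elem_closed[OF w neutral_words_set[OF a(2)]] .
      ultimately show ?thesis using a(4) by simp
    next
      case 4
      then obtain \<alpha> \<beta>s where a: "\<alpha> \<in> neutral_words G P" "distinct \<beta>s" "\<beta>s \<noteq> []" "set \<beta>s \<subseteq> neutral_words G P"
        "K G P \<alpha> = (\<Union>\<beta>\<in>set \<beta>s. K G P \<beta>)" "r = diff_prod B w \<alpha> \<beta>s"
        by (auto simp: T4_relators_def)
      then show ?thesis using Lr.relation_T4[OF a(1-5)] diff[OF a(1,4)] zero by simp
    qed
  qed
  show "satisfies_boundary_relations G P B w"
    unfolding satisfies_boundary_relations_def
  proof
    fix r assume "r \<in> boundary_products G P B w"
    then obtain \<alpha> \<beta>s where a: "\<alpha> \<in> neutral_words G P" "distinct \<beta>s" "set \<beta>s \<subseteq> neutral_words G P"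
      "proper_foundation_set G P (K G P \<alpha>) (K G P ` set \<beta>s)" "r = diff_prod B w \<alpha> \<beta>s"
      by (auto simp: boundary_products_def)
    then have "diff_prod BO Lr \<alpha> \<beta>s \<in> boundary_products G P BO Lr" unfolding boundary_products_def by blast
    then show "r = \<zero>\<^bsub>B\<^esub>" using van boundary_products_D_r_o diff[OF a(1,3)] a(5) by auto
  qed
qed

end

theorem corollary6p6:
  fixes G :: "('g, 'm) monoid_scheme" and P :: "'g set"
    and B :: "('b, 'c) cstar_algebra_scheme" and w :: "'g \<Rightarrow> 'b"
  assumes "group G" and "submonoid P G"
  shows "boundary_products G P (toeplitz_universal G P) (toeplitz_generator G P)
        \<subseteq> projections (toeplitz_universal G P) \<and>
      D_u_o G P = closed_span (toeplitz_universal G P)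
        (boundary_products G P (toeplitz_universal G P) (toeplitz_generator G P)) \<and>
      (unital_cstar_algebra B \<and> w \<in> P \<rightarrow> carrier B \<longrightarrow>
        (isometric_representation G P B w \<and> strongly_covariant G P B w \<longleftrightarrow>
         satisfies_toeplitz_relations G P B w \<and> satisfies_boundary_relations G P B w))"
proof -
  interpret group_submonoid G P
    using assms by (simp add: group_submonoid_def group_submonoid_axioms_def)
  have "isometric_representation G P B w \<and> strongly_covariant G P B w \<longleftrightarrow>
         satisfies_toeplitz_relations G P B w \<and> satisfies_boundary_relations G P B w"
    if B: "unital_cstar_algebra B" and w: "w \<in> P \<rightarrow> carrier B"
  proof
    have B': "cstar_algebra B" by (rule unital_cstar_algebra_imp_cstar_algebra[OF B])
    show "satisfies_toeplitz_relations G P B w \<and> satisfies_boundary_relations G P B w"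
      if "isometric_representation G P B w \<and> strongly_covariant G P B w"
      using strongly_covariant_imp_relations[OF B' w] that by blast
    assume rel: "satisfies_toeplitz_relations G P B w \<and> satisfies_boundary_relations G P B w"
    interpret B: cstar_algebra B by (rule B')
    interpret rep: toeplitz_representation G P B w
      by unfold_locales (use w rel in auto)
    show "isometric_representation G P B w \<and> strongly_covariant G P B w"
      using rep.isometric rep.strongly_covariantI rel by blast
  qed
  then show ?thesis
    using T.boundary_products_projections D_u_o_eq by blast
qed

end
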